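(* Let $d \in \mathbb{N}$ and let $s > 1/2$ be real. There is a constant $C>0$ (not depending on $f$) such that for every $f\in H^s_{\mathrm{mix}}(D)$, $$\sum_{\mathbf{k}\in\mathbb{N}_0^d}|\langle f,\eta_{\mathbf{k}}\rangle_{\varrho}|^2\prod_{\ell=1}^d\left(1+|k_\ell|^2\right)^s\le C\,\|f\|^2_{H^s_{\mathrm{mix}}(D)}<\infty .$$
   Context: Notation: $\mathbb{N}$ is the set of positive integers, $\mathbb{N}_0=\mathbb{N}\cup\{0\}$, $[d]=\{1,\dots,d\}$, $D=[-1,1]^d$. $L_2(D)$ is the space of square-integrable functions with respect to Lebesgue measure on $D$. $L_2(\varrho_D)$ is the space of square-integrable functions on $D$ with respect to the Chebyshev probability measure $$d\varrho_D(\mathbf{x})=\prod_{\ell=1}^d\left(\pi\sqrt{1-x_\ell^2}\right)^{-1}d\mathbf{x},$$ and $\langle f,g\rangle_\varrho$ denotes its inner product. Chebyshev polynomials: the $L_2(\varrho_D)$-normalized Chebyshev polynomials of the first kind are $T_k(x)=\sqrt{2}^{\min\{1,k\}}\cos(k\arccos(x))$, $k\in\mathbb{N}_0$, $x \in [-1,1]$, and $\eta_{\mathbf{k}}(\mathbf{x})=\prod_{\ell=1}^d T_{k_\ell}(x_\ell)$ for $\mathbf{k}=(k_\ell)_{\ell=1}^d\in\mathbb{N}_0^d$. Sobolev spaces of dominating mixed smoothness on $D$: for an integer $m\in\mathbb{N}_0$, $H^m_{\mathrm{mix}}(D)$ is the space of all $f\in L_2(D)$ with $$\|f\|_{H^m_{\mathrm{mix}}(D)}=\|f\|_{L_2(D)}+\sum_{\alpha}\|\partial^\alpha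 f\|_{L_2(D)}<\infty,$$ the sum being over all $\alpha\in\mathbb{N}_0^d$ with $0\le\max_{i\in[d]}\alpha_i\le m$ (weak derivatives). For fractional (non-integer) $s>0$, $H^s_{\mathrm{mix}}(D)$ is the space of all $f \in L_2(D)$ with $$\|f\|_{H^s_{\mathrm{mix}}(D)}=\|f\|_{L_2(D)}+\sum_{e\subset[d]}\mathcal{R}^M_e(f)<\infty,$$ where $M\ge s$ is a fixed integer and $$\mathcal{R}^M_e(f)^2=\sum_{\mathbf{j}\in\mathbb{N}_0^d(e)}2^{2s|\mathbf{j}|_1}\sup_{|h_\ell|\le 2^{-j_\ell}}\|\Delta^{M,e}_{\mathbf{h}}f\|_{L_2(D)}^2 .$$ Here $\mathbb{N}_0^d(e)=\{\mathbf{j}\in\mathbb{N}_0^d : j_\ell=0 \text{ for all } \ell\notin e\}$, $|\mathbf{j}|_1=j_1+\dots+j_d$, $\Delta^{M,e}_{\mathbf{h}}=\prod_{\ell\in e}\Delta^M_{h_\ell,\ell}$, and $\Delta^M_{h_\ell,\ell}$ is the $M$th-order forward difference in the $\ell$th coordinate direction with step size $h_\ell$; the $L_2(D)$ norm of a difference is taken over those points $\mathbf{x}\in D$ for which all points at which $f$ is evaluated in the difference lie in $D$. *)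

theory Defs
  imports "HOL-Analysis.Analysis"
begin

(* Dimension d is CARD('d) and the coordinate set [d] is the index type 'd.  Elements of L2(D) are
   represented by complex-valued functions on all of real^'d; only their values on D (and in fact
   only their class modulo null sets) enter the notions below. *)

definition ennsqrt :: "ennreal \<Rightarrow> ennreal" where
  "ennsqrt x = (if x = \<infinity> then \<infinity> else ennreal (sqrt (enn2real x)))"

definition L2_norm :: "'a measure \<Rightarrow> ('a \<Rightarrow> complex) \<Rightarrow> ennreal" where
  "L2_norm M f = ennsqrt (\<integral>\<^sup>+ x. ennreal ((cmod (f x))\<^sup>2) \<partial>M)"

definition L2_space :: "'a measure \<Rightarrow> ('a \<Rightarrow> complex) set" where
  "L2_space M = {f. f \<in> borel_measurable M \<and> L2_norm M f < \<infinity>}"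

definition L2_inner :: "'a measure \<Rightarrow> ('a \<Rightarrow> complex) \<Rightarrow> ('a \<Rightarrow> complex) \<Rightarrow> complex" where
  "L2_inner M f g = (LINT x|M. f x * cnj (g x))"

definition cube :: "(real^'d) set" where
  "cube = {x. \<forall>l. x $ l \<in> {-1..1}}"

(* The density formula takes the junk value 0 where some coordinate is -1 or 1, a null set. *)
definition cheb_measure :: "(real^'d) measure" where
  "cheb_measure = density (lebesgue_on cube)
     (\<lambda>x. ennreal (\<Prod>l\<in>UNIV. inverse (pi * sqrt (1 - (x $ l)\<^sup>2))))"

definition cheb_T :: "nat \<Rightarrow> real \<Rightarrow> real" where
  "cheb_T k x = sqrt 2 ^ min 1 k * cos (real k * arccos x)"

definition cheb_eta :: "nat^'d \<Rightarrow> real^'d \<Rightarrow> complex" where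
  "cheb_eta k x = complex_of_real (\<Prod>l\<in>UNIV. cheb_T (k $ l) (x $ l))"

definition partial_deriv :: "'d \<Rightarrow> (real^'d \<Rightarrow> real) \<Rightarrow> real^'d \<Rightarrow> real" where
  "partial_deriv l \<phi> x = deriv (\<lambda>t. \<phi> (x + t *\<^sub>R axis l 1)) 0"

(* Requiring every iterated partial derivative to be Frechet differentiable (hence continuous)
   is the same as C^infinity. *)
definition smooth :: "(real^'d \<Rightarrow> real) \<Rightarrow> bool" where
  "smooth \<phi> \<longleftrightarrow> (\<forall>ls. foldr partial_deriv ls \<phi> differentiable_on UNIV)"

definition test_functions :: "(real^'d \<Rightarrow> real) set" where
  "test_functions = {\<phi>. smooth \<phi> \<and> closure {x. \<phi> x \<noteq> 0} \<subseteq> interior cube}"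

(* A list ls in which every coordinate l occurs exactly \<alpha>_l times represents the classical
   derivative of order \<alpha>; on smooth functions the order of the list is immaterial. *)
definition has_weak_deriv ::
    "(real^'d \<Rightarrow> complex) \<Rightarrow> nat^'d \<Rightarrow> (real^'d \<Rightarrow> complex) \<Rightarrow> bool" where
  "has_weak_deriv f \<alpha> g \<longleftrightarrow>
     (\<forall>K. compact K \<and> K \<subseteq> interior cube \<longrightarrow> integrable (lebesgue_on K) g) \<and>
     (\<forall>\<phi>\<in>test_functions. \<forall>ls. (\<forall>l. count_list ls l = \<alpha> $ l) \<longrightarrow>
        (LINT x|lebesgue_on cube. foldr partial_deriv ls \<phi> x *\<^sub>R f x) =
        (- 1) ^ (\<Sum>l\<in>UNIV. \<alpha> $ l) * (LINT x|lebesgue_on cube. \<phi> x *\<^sub>R g x))"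

(* Weak derivatives are unique up to null sets, so the choice does not matter. *)
definition weak_deriv_norm :: "nat^'d \<Rightarrow> (real^'d \<Rightarrow> complex) \<Rightarrow> ennreal" where
  "weak_deriv_norm \<alpha> f =
     (if \<exists>g. has_weak_deriv f \<alpha> g
      then L2_norm (lebesgue_on cube) (SOME g. has_weak_deriv f \<alpha> g) else \<infinity>)"

definition fwd_diff :: "'d \<Rightarrow> real \<Rightarrow> (real^'d \<Rightarrow> complex) \<Rightarrow> real^'d \<Rightarrow> complex" where
  "fwd_diff l t f x = f (x + t *\<^sub>R axis l 1) - f x"

definition mixed_diff ::
    "nat \<Rightarrow> 'd set \<Rightarrow> real^'d \<Rightarrow> (real^'d \<Rightarrow> complex) \<Rightarrow> real^'d \<Rightarrow> complex" where
  "mixed_diff M e h f = Finite_Set.fold (\<lambda>l. fwd_diff l (h $ l) ^^ M) f e"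

(* The operators commute, so the fold is a genuine product of operators over e. *)
lemma fwd_diff_commute:
  "fwd_diff l t (fwd_diff l' t' f) = fwd_diff l' t' (fwd_diff l t f)"
  unfolding fwd_diff_def by (rule ext) (simp add: add.assoc add.commute add.left_commute)

lemma comp_fun_commute_fwd_diff:
  "comp_fun_commute (\<lambda>l. fwd_diff l (h $ l) ^^ M)"
proof
  fix l l' :: 'a
  have 1: "fwd_diff l t ((fwd_diff l' t' ^^ n) f) = (fwd_diff l' t' ^^ n) (fwd_diff l t f)"
    for t t' n f
    by (induction n) (simp_all add: fwd_diff_commute[of l])
  have 2: "(fwd_diff l t ^^ m) ((fwd_diff l' t' ^^ n) f) = (fwd_diff l' t' ^^ n) ((fwd_diff l t ^^ m) f)"
    for t t' m n f
    by (induction m) (simp_all add: 1)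
  show "fwd_diff l' (h $ l') ^^ M \<circ> fwd_diff l (h $ l) ^^ M =
        fwd_diff l (h $ l) ^^ M \<circ> fwd_diff l' (h $ l') ^^ M"
    by (rule ext) (simp only: o_apply 2)
qed

(* Those points of D at which the mixed difference only evaluates f inside D. *)
definition diff_domain :: "nat \<Rightarrow> 'd set \<Rightarrow> real^'d \<Rightarrow> (real^'d) set" where
  "diff_domain M e h =
     {x \<in> cube. \<forall>m :: nat^'d. (\<forall>l\<in>e. m $ l \<le> M) \<longrightarrow>
        x + (\<Sum>l\<in>e. (real (m $ l) * h $ l) *\<^sub>R axis l 1) \<in> cube}"

definition R_seminorm :: "real \<Rightarrow> nat \<Rightarrow> 'd set \<Rightarrow> (real^'d \<Rightarrow> complex) \<Rightarrow> ennreal" where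
  "R_seminorm s M e f = ennsqrt
     (\<Sum>\<^sub>\<infinity> j \<in> {j :: nat^'d. \<forall>l. l \<notin> e \<longrightarrow> j $ l = 0}.
        ennreal (2 powr (2 * s * real (\<Sum>l\<in>UNIV. j $ l))) *
        (SUP h \<in> {h :: real^'d. \<forall>l. \<bar>h $ l\<bar> \<le> 2 powr (- real (j $ l))}.
           (L2_norm (lebesgue_on (diff_domain M e h)) (mixed_diff M e h f))\<^sup>2))"

definition Hmix_norm_integer :: "nat \<Rightarrow> (real^'d \<Rightarrow> complex) \<Rightarrow> ennreal" where
  "Hmix_norm_integer m f =
     L2_norm (lebesgue_on cube) f + (\<Sum>\<alpha> | \<forall>l. \<alpha> $ l \<le> m. weak_deriv_norm \<alpha> f)"

definition Hmix_norm_fractional :: "real \<Rightarrow> nat \<Rightarrow> (real^'d \<Rightarrow> complex) \<Rightarrow> ennreal" where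
  "Hmix_norm_fractional s M f =
     L2_norm (lebesgue_on cube) f + (\<Sum>e\<in>UNIV. R_seminorm s M e f)"

(* M, the order of the differences, only enters for non-integer s. *)
definition Hmix_norm :: "real \<Rightarrow> nat \<Rightarrow> (real^'d \<Rightarrow> complex) \<Rightarrow> ennreal" where
  "Hmix_norm s M f =
     (if s \<in> \<int> then Hmix_norm_integer (nat \<lfloor>s\<rfloor>) f else Hmix_norm_fractional s M f)"

definition Hmix :: "real \<Rightarrow> nat \<Rightarrow> (real^'d \<Rightarrow> complex) set" where
  "Hmix s M = {f \<in> L2_space (lebesgue_on cube). Hmix_norm s M f < \<infinity>}"

end

theory Submission
  imports Defs "HOL-Computational_Algebra.Polynomial" "HOL-Library.Discrete_Functions"
begin

text \<open>In each variable the function is written as a sum of integral operators: smooth kernels at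
  the dyadic scales \<open>2 ^ - j\<close> applied to averaged differences (fractional \<open>s\<close>), or a Sobolev
  representation through weak derivatives (integer \<open>s\<close>). Pairing a kernel with \<open>T\<^sub>k\<close> and the
  Chebyshev weight is a Bessel family with a bound that decays geometrically in the distance of \<open>j\<close>
  to \<open>log k\<close>, since the derivatives of the \<open>T\<^sub>k\<close> are again orthogonal for the weights
  \<open>(1 - x\<^sup>2) powr (p - 1/2)\<close>. Such bounds tensorise, which gives the estimate on the cube.\<close>

text \<open>The obstacle is the singularity of the Chebyshev density at the faces of the cube: L2(D)
  does not embed into L2 of the Chebyshev measure, so square integrability of a building block does
  not control its Chebyshev coefficients. A smooth building block of scale 2^-i is bounded, however,
  and in the frequency block k ~ 2^j with j <= i this costs only a factor 2^(i-j); the weight 2^(-2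
  s i) pays for it exactly because s > 1/2. For j > i, M integrations by parts gain 2^(-2 M (j-i)),
  without boundary terms since every step multiplies the weight by 1 - x^2; this needs s < M.
  Differences must not leave the cube: they are taken to the right on the left half and to the left
  on the right half of each coordinate, glued by a partition of unity. Since f is only a class in
  L2, the sum F of all building blocks is compared with f by testing against boxes, and the
  estimates are made for the bounded Borel function F.\<close>

lemmas lint_cong = Bochner_Integration.integral_cong
 and lint_bound = Bochner_Integration.integrable_bound
 and lint_sum = Bochner_Integration.integral_sum

section \<open>Chebyshev polynomials and their derivatives\<close>

text \<open>Taken as a \<open>poly\<close> and not as \<open>cos (n * arccos x)\<close>: derivatives
  of every order then exist on the whole line, also at the end points where \<open>arccos\<close> is
  not differentiable, and an identity may be checked on any infinite set.\<close>

fun cheb_poly :: "nat => real poly" where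
 "cheb_poly 0 = 1"
| "cheb_poly (Suc 0) = [:0, 1:]"
| "cheb_poly (Suc (Suc n)) = [:0, 2:] * cheb_poly (Suc n) - cheb_poly n"

lemma poly_cheb_poly_cos: "poly (cheb_poly n) (cos t) = cos (real n * t)"
proof (induction n rule: cheb_poly.induct)
 case (3 n)
 have "cos (real (Suc (Suc n)) * t) + cos (real n * t) = 2 * (cos t * cos (real (Suc n) * t))"
  using cos_times_cos[of "real (Suc n) * t" t] by (simp add: algebra_simps)
 with 3 show ?case by simp
qed auto

text \<open>The p-th derivative of the normalised T_k. For 1 <= p <= k it is a multiple of the
  Gegenbauer polynomial of degree k - p and parameter p, the source of the second family of
  orthogonality relations.\<close>

definition chebD :: "nat => nat => real => real" where
 "chebD k p x = poly ((pderiv ^^ p) (smult (sqrt 2 ^ min 1 k) (cheb_poly k))) x"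

lemma chebD_deriv: "(chebD k p has_real_derivative chebD k (Suc p) x) (at x)"
 unfolding chebD_def by (simp add: poly_DERIV)

lemma continuous_chebD: "continuous_on A (chebD k p)"
 unfolding chebD_def by (intro continuous_intros)

lemma chebD_measurable [measurable]: "chebD k p \<in> borel_measurable borel"
 by (intro borel_measurable_continuous_onI continuous_chebD)

lemma chebD_cos: "chebD k 0 (cos t) = sqrt 2 ^ min 1 k * cos (real k * t)"
 by (simp add: chebD_def poly_cheb_poly_cos)

lemma chebD_eq_cheb_T: "\<bar>x\<bar> \<le> 1 ==> chebD k 0 x = cheb_T k x"
 using chebD_cos[of k "arccos x"] by (simp add: cheb_T_def cos_arccos)

text \<open>The chain rule for T_k(cos t). The factor sin t is kept on the left, so that nothing is
  divided by zero where cos t = 1 or cos t = -1.\<close>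

lemma chebD_1_cos: "chebD k (Suc 0) (cos t) * sin t = sqrt 2 ^ min 1 k * real k * sin (real k * t)"
proof -
 have "((\<lambda>t. chebD k 0 (cos t)) has_real_derivative (chebD k (Suc 0) (cos t) * (- sin t))) (at t)"
  by (rule DERIV_chain2[OF chebD_deriv]) (auto intro!: derivative_eq_intros)
 moreover have "((\<lambda>t. chebD k 0 (cos t)) has_real_derivative
   (- (sqrt 2 ^ min 1 k * real k * sin (real k * t)))) (at t)"
  unfolding chebD_cos by (auto intro!: derivative_eq_intros)
 ultimately show ?thesis using DERIV_unique by fastforce
qed

text \<open>Differentiating \<open>chebD_1_cos\<close> once more gives Chebyshev's equation at the
  points cos t. The left side is a polynomial in x with infinitely many zeros, hence it vanishes for
  all real x.\<close>

lemma chebD_ode_0: "(1 - x\<^sup>2) * chebD k 2 x - x * chebD k 1 x + (real k)^2 * chebD k 0 x = 0"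
proof -
 define P where "P = (smult (sqrt 2 ^ min 1 k) (cheb_poly k))"
 define Q where "Q = [:1,0,-1:] * pderiv (pderiv P) - [:0,1:] * pderiv P + smult ((real k)^2) P"
 have Qeq: "poly Q x = (1 - x\<^sup>2) * chebD k 2 x - x * chebD k 1 x + (real k)^2 * chebD k 0 x" for x
  by (simp add: Q_def P_def chebD_def power2_eq_square eval_nat_numeral algebra_simps)
 have zero: "poly Q (cos t) = 0" if "0 < t" "t < pi" for t
 proof -
  have "((\<lambda>t. chebD k (Suc 0) (cos t) * sin t) has_real_derivative
    (chebD k (Suc (Suc 0)) (cos t) * (- sin t) * sin t + chebD k (Suc 0) (cos t) * cos t)) (at t)"
   by (auto intro!: derivative_eq_intros DERIV_chain2[OF chebD_deriv])
  moreover have "((\<lambda>t. chebD k (Suc 0) (cos t) * sin t) has_real_derivative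
    (sqrt 2 ^ min 1 k * (real k)^2 * cos (real k * t))) (at t)"
   unfolding chebD_1_cos by (auto intro!: derivative_eq_intros simp: power2_eq_square)
  ultimately have "chebD k (Suc (Suc 0)) (cos t) * (- sin t) * sin t + chebD k (Suc 0) (cos t) * cos t
    = (real k)^2 * chebD k 0 (cos t)"
   using DERIV_unique unfolding chebD_cos by fastforce
  moreover have "1 - (cos t)^2 = sin t * sin t" using sin_squared_eq[of t] by (simp add: power2_eq_square)
  moreover have "chebD k 2 = chebD k (Suc (Suc 0))" by (simp add: eval_nat_numeral)
  ultimately show ?thesis unfolding Qeq by (simp add: mult.commute)
 qed
 have "Q = 0"
 proof (rule ccontr)
  assume "Q \<noteq> 0"
  then have fin: "finite {x. poly Q x = 0}" by (rule poly_roots_finite)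
  have "{-1<..<1} \<subseteq> {x. poly Q x = 0}"
  proof
   fix x :: real assume "x \<in> {-1<..<1}"
   then have "0 < arccos x" "arccos x < pi" "cos (arccos x) = x"
    using arccos_lt_bounded[of x] by (auto intro: cos_arccos)
   with zero[of "arccos x"] show "x \<in> {x. poly Q x = 0}" by simp
  qed
  then have "finite {-1<..<(1::real)}" using fin finite_subset by blast
  then show False using infinite_Ioo[of "-1" "1::real"] by simp
 qed
 with Qeq[of x] show ?thesis by simp
qed

text \<open>Differentiate the equation once per induction step: the coefficient 2 p + 1 grows by 2,
  and (k^2 - p^2) - (2 p + 1) = k^2 - (p + 1)^2.\<close>

lemma chebD_ode:
 "(1 - x\<^sup>2) * chebD k (Suc (Suc p)) x - (2 * real p + 1) * x * chebD k (Suc p) x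
  + ((real k)^2 - (real p)^2) * chebD k p x = 0"
proof (induction p arbitrary: x)
 case 0
 then show ?case using chebD_ode_0[of x k] by (simp add: eval_nat_numeral)
next
 case (Suc p)
 have "((\<lambda>x. (1 - x\<^sup>2) * chebD k (Suc (Suc p)) x - (2 * real p + 1) * x * chebD k (Suc p) x
  + ((real k)^2 - (real p)^2) * chebD k p x) has_real_derivative
  ((- 2 * x) * chebD k (Suc (Suc p)) x + (1 - x\<^sup>2) * chebD k (Suc (Suc (Suc p))) x
   - ((2 * real p + 1) * chebD k (Suc p) x + (2 * real p + 1) * x * chebD k (Suc (Suc p)) x)
   + ((real k)^2 - (real p)^2) * chebD k (Suc p) x)) (at x)"
  by (auto intro!: derivative_eq_intros chebD_deriv)
 then have "(- 2 * x) * chebD k (Suc (Suc p)) x + (1 - x\<^sup>2) * chebD k (Suc (Suc (Suc p))) x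
   - ((2 * real p + 1) * chebD k (Suc p) x + (2 * real p + 1) * x * chebD k (Suc (Suc p)) x)
   + ((real k)^2 - (real p)^2) * chebD k (Suc p) x = 0"
  unfolding Suc.IH using DERIV_const DERIV_unique by blast
 then show ?case by (simp add: algebra_simps power2_eq_square)
qed

section \<open>Gegenbauer weights and integration by parts\<close>

text \<open>\<open>wt 0\<close> is the Chebyshev density and \<open>wt p\<close> the weight
  belonging to p-th derivatives. Cutting off to 0 for \<open>1 \<le> \<bar>x\<bar>\<close> lets
  every integral run over the whole line.\<close>

definition wt :: "nat => real => real" where
 "wt p x = (if \<bar>x\<bar> < 1 then (1 - x\<^sup>2) powr (real p - 1/2) / pi else 0)"

lemma wt_measurable [measurable]: "wt p \<in> borel_measurable borel"
 unfolding wt_def by measurable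

lemma wt_nonneg: "0 \<le> wt p x"
 by (simp add: wt_def)

lemma wt_uminus: "wt p (- x) = wt p x"
 by (simp add: wt_def)

lemma wt_eq_0: "1 \<le> \<bar>x\<bar> ==> wt p x = 0"
 by (simp add: wt_def)

lemma one_minus_sq_pos: "\<bar>x\<bar> < 1 ==> 0 < 1 - (x::real)^2"
 by (simp add: abs_square_less_1)

lemma wt_0: "\<bar>x\<bar> < 1 ==> wt 0 x = inverse (pi * sqrt (1 - x\<^sup>2))"
 using one_minus_sq_pos[of x] by (simp add: wt_def powr_minus powr_half_sqrt field_simps)

lemma wt_Suc: "wt (Suc p) x = (1 - x\<^sup>2) * wt p x"
proof (cases "\<bar>x\<bar> < 1")
 case True
 have "(1 - x\<^sup>2) powr (1 + (real p - 1/2)) = (1 - x\<^sup>2) * (1 - x\<^sup>2) powr (real p - 1/2)"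
  using one_minus_sq_pos[OF True] by (simp only: powr_add) simp
 moreover have "1 + (real p - 1/2) = real (Suc p) - 1/2" by simp
 ultimately show ?thesis using True by (simp add: wt_def)
qed (simp add: wt_def)

lemma wt_1: "\<bar>x\<bar> \<le> 1 ==> wt (Suc 0) x = sqrt (1 - x\<^sup>2) / pi"
 using one_minus_sq_pos[of x]
 by (cases "\<bar>x\<bar> = 1") (auto simp: wt_def powr_half_sqrt abs_square_eq_1)

lemma wt_Suc_le: "wt (Suc p) x \<le> 1"
proof (cases "\<bar>x\<bar> < 1")
 case True
 have "(1 - x\<^sup>2) powr (real (Suc p) - 1/2) \<le> 1"
  using one_minus_sq_pos[OF True] by (intro powr_le1) auto
 moreover have "1 \<le> pi" using pi_gt3 by simp
 ultimately have "(1 - x\<^sup>2) powr (real (Suc p) - 1/2) / pi \<le> 1"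
  by (simp add: divide_le_eq)
 with True show ?thesis by (simp add: wt_def)
qed (simp add: wt_def)

lemma wt_Suc_deriv:
 assumes "\<bar>x\<bar> < 1"
 shows "(wt (Suc p) has_real_derivative (- (2 * real p + 1) * x * wt p x)) (at x)"
proof -
 have pos: "0 < 1 - x\<^sup>2" by (rule one_minus_sq_pos) fact
 have "((\<lambda>x. (1 - x\<^sup>2) powr (real (Suc p) - 1/2) / pi) has_real_derivative
   ((real (Suc p) - 1/2) * (1 - x\<^sup>2) powr (real (Suc p) - 1/2 - 1) * (- 2 * x) / pi)) (at x)"
  using pos by (auto intro!: derivative_eq_intros)
 also have "(real (Suc p) - 1/2) * (1 - x\<^sup>2) powr (real (Suc p) - 1/2 - 1) * (- 2 * x) / pi =
   - (2 * real p + 1) * x * wt p x"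
  using assms by (simp add: wt_def field_simps)
 finally show ?thesis
  by (rule has_field_derivative_transform_within_open[of _ _ _ "{-1<..<1}"])
   (use assms in \<open>simp_all add: wt_def abs_less_iff\<close>)
qed

text \<open>The exponent p + 1/2 is positive, so the power tends to 0 at the end points, which is
  the value \<open>wt\<close> takes there.\<close>

lemma continuous_wt_Suc: "continuous_on {-1..1} (wt (Suc p))"
proof -
 have "continuous_on {-1..1} (\<lambda>x::real. (1 - x\<^sup>2) powr (real (Suc p) - 1/2) / pi)"
  by (intro continuous_intros continuous_on_powr') (auto simp: abs_square_le_1 abs_le_iff)
 then show ?thesis
  by (rule continuous_on_cong[THEN iffD1, rotated -1, OF _ refl])
   (auto simp: wt_def abs_le_iff not_less abs_square_eq_1 intro!: powr_zero_eq_one)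
qed

text \<open>Sturm-Liouville form of \<open>chebD_ode\<close>: it exhibits
  \<open>wt p x * chebD k p x\<close> as the derivative of a multiple of the same expression of
  order p + 1. As \<open>wt (Suc p)\<close> vanishes at the end points, integrating by parts over
  the full interval leaves no boundary terms.\<close>

lemma wt_chebD_deriv:
 assumes "\<bar>x\<bar> < 1"
 shows "((\<lambda>x. wt (Suc p) x * chebD k (Suc p) x) has_real_derivative
  (- ((real k)^2 - (real p)^2) * (wt p x * chebD k p x))) (at x)"
proof -
 have "((\<lambda>x. wt (Suc p) x * chebD k (Suc p) x) has_real_derivative
  ((- (2 * real p + 1) * x * wt p x) * chebD k (Suc p) x + chebD k (Suc (Suc p)) x * wt (Suc p) x)) (at x)"
  by (intro DERIV_mult wt_Suc_deriv chebD_deriv assms)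
 also have "(- (2 * real p + 1) * x * wt p x) * chebD k (Suc p) x + chebD k (Suc (Suc p)) x * wt (Suc p) x
   = wt p x * ((1 - x\<^sup>2) * chebD k (Suc (Suc p)) x - (2 * real p + 1) * x * chebD k (Suc p) x)"
  by (simp add: wt_Suc algebra_simps)
 also have "\<dots> = - ((real k)^2 - (real p)^2) * (wt p x * chebD k p x)"
 proof -
  have "(1 - x\<^sup>2) * chebD k (Suc (Suc p)) x - (2 * real p + 1) * x * chebD k (Suc p) x
    = - ((real k)^2 - (real p)^2) * chebD k p x"
   using chebD_ode[of x k p] by linarith
  then show ?thesis by (simp only: mult.left_commute)
 qed
 finally show ?thesis .
qed

lemma integrable_wt: "integrable lborel (wt p)"
proof (cases p)
 case 0
 \<comment> \<open>The primitive is continuous up to the end points although its derivative blows up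
   there, so the fundamental theorem for interior derivatives applies; nonnegativity then upgrades
   the gauge integral to absolute integrability.\<close>
 have "(wt 0 has_integral (arcsin 1 / pi - arcsin (-1) / pi)) {-1..1}"
 proof (rule fundamental_theorem_of_calculus_interior)
  show "continuous_on {-1..1} (\<lambda>x. arcsin x / pi)"
   by (intro continuous_intros) auto
  show "((\<lambda>x. arcsin x / pi) has_vector_derivative wt 0 x) (at x)" if "x \<in> {-1<..<1}" for x
   unfolding has_real_derivative_iff_has_vector_derivative[symmetric]
   using that by (auto intro!: derivative_eq_intros simp: wt_0 abs_less_iff field_simps)
 qed simp
 then have "wt 0 absolutely_integrable_on {-1..1}"
  by (intro nonnegative_absolutely_integrable_1) (auto simp: wt_nonneg integrable_on_def)
 then have "integrable lebesgue (\<lambda>x. indicator {-1..1} x *\<^sub>R wt 0 x)"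
  by (simp add: set_integrable_def)
 also have "(\<lambda>x. indicator {-1..1} x *\<^sub>R wt 0 x) = wt 0"
  by (rule ext) (simp add: indicator_def wt_def abs_le_iff abs_less_iff)
 finally show ?thesis using 0 by (simp add: integrable_completion)
next
 case (Suc q)
 have "integrable lborel (\<lambda>x::real. indicator {-1..1} x :: real)"
  by (rule integrable_real_indicator) auto
 then show ?thesis unfolding Suc
  by (rule lint_bound)
   (auto simp: wt_nonneg wt_Suc_le indicator_def wt_eq_0 intro!: AE_I2)
qed

lemma integrable_bounded_times_wt:
 fixes f :: "real => real"
 assumes [measurable]: "f \<in> borel_measurable borel" and "\<And>x. \<bar>x\<bar> < 1 ==> \<bar>f x\<bar> \<le> B"
 shows "integrable lborel (\<lambda>x. f x * wt p x)"
proof (rule lint_bound[where f = "\<lambda>x. B * wt p x"])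
 show "integrable lborel (\<lambda>x. B * wt p x)" by (intro integrable_mult_right integrable_wt)
 show "AE x in lborel. norm (f x * wt p x) \<le> norm (B * wt p x)"
 proof (rule AE_I2)
  fix x show "norm (f x * wt p x) \<le> norm (B * wt p x)"
   using assms(2)[of x] by (cases "\<bar>x\<bar> < 1") (auto simp: wt_eq_0 abs_mult intro!: mult_right_mono)
 qed
qed simp

lemma integrable_wt_times:
 fixes f :: "real => real"
 assumes "f \<in> borel_measurable borel" and "\<And>x. \<bar>x\<bar> < 1 ==> \<bar>f x\<bar> \<le> B"
 shows "integrable lborel (\<lambda>x. wt p x * f x)"
 using integrable_bounded_times_wt[OF assms, of p] by (simp add: mult.commute)

lemma chebD_bounded: "\<exists>B. \<forall>x. \<bar>x\<bar> \<le> 1 --> \<bar>chebD k p x\<bar> \<le> B"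
proof -
 have "bounded (chebD k p ` {-1..1})"
  by (intro compact_imp_bounded compact_continuous_image continuous_chebD) simp
 then show ?thesis by (fastforce simp: bounded_iff abs_le_iff)
qed

lemma cheb_ibp:
 fixes V V' :: "real => real"
 assumes ab: "-1 \<le> a" "a \<le> b" "b \<le> 1" and S: "finite S"
  and D: "\<And>x. x \<in> {a<..<b} - S ==> (V has_real_derivative V' x) (at x)"
  and cont: "continuous_on {a..b} V"
  and [measurable]: "V \<in> borel_measurable borel" "V' \<in> borel_measurable borel"
  and B: "\<And>x. x \<in> {a..b} ==> \<bar>V' x\<bar> \<le> B"
 shows "((real k)^2 - (real p)^2) * (LBINT x. indicator {a..b} x * (V x * (wt p x * chebD k p x))) =
  (LBINT x. indicator {a..b} x * (V' x * (wt (Suc p) x * chebD k (Suc p) x)))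
  - (V b * (wt (Suc p) b * chebD k (Suc p) b) - V a * (wt (Suc p) a * chebD k (Suc p) a))"
proof -
 obtain B1 where B1: "\<bar>x\<bar> \<le> 1 ==> \<bar>chebD k p x\<bar> \<le> B1" for x using chebD_bounded[of k p] by auto
 obtain B2 where B2: "\<bar>x\<bar> \<le> 1 ==> \<bar>chebD k (Suc p) x\<bar> \<le> B2" for x using chebD_bounded[of k "Suc p"] by auto
 have "bounded (V ` {a..b})"
  by (intro compact_imp_bounded compact_continuous_image cont) simp
 then obtain B3 where B3: "x \<in> {a..b} ==> \<bar>V x\<bar> \<le> B3" for x
  by (fastforce simp: bounded_iff)
 have i1: "integrable lborel (\<lambda>x. indicator {a..b} x * (V x * (wt p x * chebD k p x)))"
 proof -
  have "integrable lborel (\<lambda>x. (indicator {a..b} x * V x * chebD k p x) * wt p x)"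
  proof (rule integrable_bounded_times_wt[where B = "\<bar>B3\<bar> * \<bar>B1\<bar>"])
   fix x :: real assume "\<bar>x\<bar> < 1"
   then show "\<bar>indicator {a..b} x * V x * chebD k p x\<bar> \<le> \<bar>B3\<bar> * \<bar>B1\<bar>"
    using B1[of x] B3[of x] by (auto simp: indicator_def abs_mult intro!: mult_mono)
  qed simp
  then show ?thesis by (simp add: mult_ac)
 qed
 have i2: "integrable lborel (\<lambda>x. indicator {a..b} x * (V' x * (wt (Suc p) x * chebD k (Suc p) x)))"
 proof -
  have "integrable lborel (\<lambda>x. (indicator {a..b} x * V' x * chebD k (Suc p) x) * wt (Suc p) x)"
  proof (rule integrable_bounded_times_wt[where B = "\<bar>B\<bar> * \<bar>B2\<bar>"])
   fix x :: real assume "\<bar>x\<bar> < 1"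
   then show "\<bar>indicator {a..b} x * V' x * chebD k (Suc p) x\<bar> \<le> \<bar>B\<bar> * \<bar>B2\<bar>"
    using B2[of x] B[of x] by (auto simp: indicator_def abs_mult intro!: mult_mono)
  qed simp
  then show ?thesis by (simp add: mult_ac)
 qed
 define f where "f x = V x * (wt (Suc p) x * chebD k (Suc p) x)" for x
 define f' where "f' x = V' x * (wt (Suc p) x * chebD k (Suc p) x)
   - ((real k)^2 - (real p)^2) * (V x * (wt p x * chebD k p x))" for x
 have "(f' has_integral (f b - f a)) {a..b}"
 proof (rule fundamental_theorem_of_calculus_interior_strong[OF S ab(2)])
  show "(f has_vector_derivative f' x) (at x)" if x: "x \<in> {a<..<b} - S" for x
  proof -
   have "(f has_real_derivative (V' x * (wt (Suc p) x * chebD k (Suc p) x) +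
    (- ((real k)^2 - (real p)^2) * (wt p x * chebD k p x)) * V x)) (at x)"
    unfolding f_def using x ab by (intro DERIV_mult D wt_chebD_deriv) (auto simp: abs_less_iff)
   then show ?thesis
    by (simp add: has_real_derivative_iff_has_vector_derivative[symmetric] f'_def algebra_simps)
  qed
  show "continuous_on {a..b} f"
   unfolding f_def using ab
   by (intro continuous_intros cont continuous_chebD continuous_on_subset[OF continuous_wt_Suc]) auto
 qed
 then have "((\<lambda>x. if x \<in> {a..b} then f' x else 0) has_integral (f b - f a)) UNIV"
  by (simp only: has_integral_restrict_UNIV)
 also have "(\<lambda>x. if x \<in> {a..b} then f' x else 0) = (\<lambda>x. indicator {a..b} x * (V' x * (wt (Suc p) x * chebD k (Suc p) x))
  - ((real k)^2 - (real p)^2) * (indicator {a..b} x * (V x * (wt p x * chebD k p x))))"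
  by (rule ext) (simp add: f'_def indicator_def)
 finally have "f b - f a = (LBINT x. indicator {a..b} x * (V' x * (wt (Suc p) x * chebD k (Suc p) x))
  - ((real k)^2 - (real p)^2) * (indicator {a..b} x * (V x * (wt p x * chebD k p x))))"
  using i1 i2 by (intro has_integral_unique[OF _ has_integral_integral_lborel]) auto
 also have "\<dots> = (LBINT x. indicator {a..b} x * (V' x * (wt (Suc p) x * chebD k (Suc p) x)))
  - ((real k)^2 - (real p)^2) * (LBINT x. indicator {a..b} x * (V x * (wt p x * chebD k p x)))"
  using i1 i2 by simp
 finally show ?thesis by (simp add: f_def)
qed

lemma indicator_Icc_wt [simp]: "indicator {-1..1} x * (c * (wt p x * d)) = c * (wt p x * d)"
 by (auto simp: indicator_def wt_def)

lemma cheb_ibp_full: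
 fixes V V' :: "real => real"
 assumes S: "finite S"
  and D: "\<And>x. x \<in> {-1<..<1} - S ==> (V has_real_derivative V' x) (at x)"
  and cont: "continuous_on {-1..1} V"
  and [measurable]: "V \<in> borel_measurable borel" "V' \<in> borel_measurable borel"
  and B: "\<And>x. x \<in> {-1..1} ==> \<bar>V' x\<bar> \<le> B"
 shows "((real k)^2 - (real p)^2) * (LBINT x. V x * (wt p x * chebD k p x)) =
  (LBINT x. V' x * (wt (Suc p) x * chebD k (Suc p) x))"
 using cheb_ibp[of "-1" 1 S V V' B k p] assms by (auto simp: wt_eq_0)

section \<open>Orthogonality of the derivatives\<close>

text \<open>The factor collected by p integrations by parts, and at the same time the squared norm
  of \<open>chebD k p\<close> for the weight \<open>wt p\<close>. It vanishes when k < p.\<close>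

definition lamk :: "nat => nat => real" where
 "lamk k p = (\<Prod>i<p. (real k)^2 - (real i)^2)"

lemma lamk_0 [simp]: "lamk k 0 = 1" and lamk_Suc: "lamk k (Suc p) = ((real k)^2 - (real p)^2) * lamk k p"
 by (simp_all add: lamk_def)

lemma lamk_pos: "p \<le> k ==> 0 < lamk k p"
 unfolding lamk_def by (intro prod_pos) (auto simp: power_strict_mono)

lemma integrable_cos_wt: "integrable lborel (\<lambda>x. cos (n * arccos x) * wt 0 x)"
proof -
 have "integrable lborel (\<lambda>x. (indicator {-1..1} x * cos (n * arccos x)) * wt 0 x)"
 proof (rule integrable_bounded_times_wt[where B = 1])
  have "(\<lambda>x. indicator {-1..1} x *\<^sub>R cos (n * arccos x)) \<in> borel_measurable borel"
   by (rule borel_measurable_continuous_on_indicator) (auto intro!: continuous_intros)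
  then show "(\<lambda>x. indicator {-1..1} x * cos (n * arccos x)) \<in> borel_measurable borel" by simp
  show "\<bar>indicator {- 1..1} x * cos (n * arccos x)\<bar> \<le> 1" for x
   by (auto simp: indicator_def)
 qed
 then show ?thesis
  by (rule Bochner_Integration.integrable_cong[THEN iffD1, OF refl, rotated])
   (auto simp: indicator_def wt_def)
qed

text \<open>The primitive is - sin (n arccos x) / (n pi), which vanishes at both end points when n
  is an integer. Negative n occur because n will be j - k as well as j + k.\<close>

lemma integral_cos_wt:
 assumes "n \<in> \<int>"
 shows "(LBINT x. cos (n * arccos x) * wt 0 x) = (if n = 0 then 1 else 0)"
proof -
 define F where "F x = (if n = 0 then arcsin x / pi else - sin (n * arccos x) / (n * pi))" for x
 have "((\<lambda>x. cos (n * arccos x) * wt 0 x) has_integral (F 1 - F (-1))) {-1..1}"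
 proof (rule fundamental_theorem_of_calculus_interior)
  show "continuous_on {-1..1} F"
   unfolding F_def by (cases "n = 0") (auto intro!: continuous_intros)
  show "(F has_vector_derivative cos (n * arccos x) * wt 0 x) (at x)" if "x \<in> {-1<..<1}" for x
   unfolding has_real_derivative_iff_has_vector_derivative[symmetric] F_def
   using that by (cases "n = 0") (auto intro!: derivative_eq_intros simp: wt_0 abs_less_iff field_simps)
 qed simp
 then have "((\<lambda>x. if x \<in> {-1..1} then cos (n * arccos x) * wt 0 x else 0) has_integral (F 1 - F (-1))) UNIV"
  by (simp only: has_integral_restrict_UNIV)
 also have "(\<lambda>x. if x \<in> {-1..1} then cos (n * arccos x) * wt 0 x else 0) = (\<lambda>x. cos (n * arccos x) * wt 0 x)"
  by (rule ext) (auto simp: wt_def)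
 finally have "((\<lambda>x. cos (n * arccos x) * wt 0 x) has_integral (F 1 - F (-1))) UNIV" .
 then have "(LBINT x. cos (n * arccos x) * wt 0 x) = F 1 - F (-1)"
  using has_integral_integral_lborel[OF integrable_cos_wt] has_integral_unique by blast
 also have "\<dots> = (if n = 0 then 1 else 0)"
  using assms by (auto simp: F_def sin_integer_2pi sin_zero_iff_int2 elim!: Ints_cases)
 finally show ?thesis .
qed

lemma cheb_orth_0:
 "(LBINT x. chebD j 0 x * (wt 0 x * chebD k 0 x)) = (if j = k then 1 else 0)"
proof -
 define a where "a = sqrt 2 ^ min 1 j * sqrt 2 ^ min 1 k / 2"
 note arc_meas = integrable_cos_wt[of "real_of_int n" for n]
 have "chebD j 0 x * (wt 0 x * chebD k 0 x) =
   a * (cos (real_of_int (int j - int k) * arccos x) * wt 0 x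
    + cos (real_of_int (int j + int k) * arccos x) * wt 0 x)" for x
 proof (cases "\<bar>x\<bar> < 1")
  case True
  then have "chebD j 0 x * chebD k 0 x = 2 * a * (cos (real j * arccos x) * cos (real k * arccos x))"
   by (simp add: chebD_eq_cheb_T cheb_T_def a_def)
  also have "\<dots> = a * (cos (real_of_int (int j - int k) * arccos x) + cos (real_of_int (int j + int k) * arccos x))"
   by (simp add: cos_times_cos algebra_simps)
  finally show ?thesis by (simp add: algebra_simps)
 qed (simp add: wt_eq_0)
 then have "(LBINT x. chebD j 0 x * (wt 0 x * chebD k 0 x)) =
  a * ((LBINT x. cos (real_of_int (int j - int k) * arccos x) * wt 0 x)
    + (LBINT x. cos (real_of_int (int j + int k) * arccos x) * wt 0 x))"
  using arc_meas[of "int j - int k"] arc_meas[of "int j + int k"] by simp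
 also have "\<dots> = a * ((if int j - int k = 0 then 1 else 0) + (if int j + int k = 0 then 1 else 0))"
  using integral_cos_wt[of "real_of_int (int j - int k)"] integral_cos_wt[of "real_of_int (int j + int k)"]
  by (simp only: Ints_of_int of_int_eq_0_iff simp_thms)
 also have "\<dots> = (if j = k then 1 else 0)"
  by (cases "j = 0"; cases "k = 0") (auto simp: a_def)
 finally show ?thesis .
qed

text \<open>Integration by parts with V = \<open>chebD j p\<close> raises the order of both factors
  by one, so orthogonality passes from p to p + 1 and the norm acquires the factor k^2 -
  p^2.\<close>

lemma cheb_orth:
 "(LBINT x. chebD j p x * (wt p x * chebD k p x)) = (if j = k then lamk k p else 0)"
proof (induction p)
 case (Suc p)
 obtain B where B: "\<bar>x\<bar> \<le> 1 ==> \<bar>chebD j (Suc p) x\<bar> \<le> B" for x using chebD_bounded[of j "Suc p"] by auto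
 have "(LBINT x. chebD j (Suc p) x * (wt (Suc p) x * chebD k (Suc p) x))
  = ((real k)^2 - (real p)^2) * (LBINT x. chebD j p x * (wt p x * chebD k p x))"
  by (rule cheb_ibp_full[OF finite.emptyI, symmetric])
   (auto intro!: chebD_deriv continuous_chebD B simp: abs_le_iff[of x 1 for x])
 then show ?case by (simp add: Suc lamk_Suc)
qed (simp add: cheb_orth_0)

text \<open>Integration by parts with V = 1; p < k keeps the factor k^2 - p^2 away from
  zero.\<close>

lemma cheb_integral_eq_0:
 assumes "p < k"
 shows "(LBINT x. wt p x * chebD k p x) = 0"
proof -
 have "((real k)^2 - (real p)^2) * (LBINT x. 1 * (wt p x * chebD k p x)) =
   (LBINT x. 0 * (wt (Suc p) x * chebD k (Suc p) x))"
  by (rule cheb_ibp_full[OF finite.emptyI]) auto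
 moreover have "(real k)^2 - (real p)^2 \<noteq> 0"
  using assms power_strict_mono[of "real p" "real k" 2] by simp
 ultimately show ?thesis by simp
qed

text \<open>Half of the weight is absorbed, so for k >= p these are orthonormal with respect to
  plain Lebesgue measure. The other half of the weight is later put on the function that is paired
  with them.\<close>

definition chebE :: "nat => nat => real => real" where
 "chebE k p x = chebD k p x * sqrt (wt p x) / sqrt (lamk k p)"

lemma chebE_measurable [measurable]: "chebE k p \<in> borel_measurable borel"
 unfolding chebE_def by measurable

lemma chebE_times: "p \<le> j ==> p \<le> k ==>
  chebE j p x * chebE k p x = chebD j p x * (wt p x * chebD k p x) / (sqrt (lamk j p) * sqrt (lamk k p))"
 using wt_nonneg[of p x] by (simp add: chebE_def field_simps)

lemma chebE_orth:
 assumes "p \<le> j" "p \<le> k"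
 shows "(LBINT x. chebE j p x * chebE k p x) = (if j = k then 1 else 0)"
 using lamk_pos[OF assms(2)] by (simp add: chebE_times[OF assms] cheb_orth)

lemma chebE_square_integrable: "integrable lborel (\<lambda>x. (chebE k p x)^2)"
proof -
 obtain B where B: "\<bar>x\<bar> \<le> 1 ==> \<bar>chebD k p x\<bar> \<le> B" for x using chebD_bounded[of k p] by auto
 have "integrable lborel (\<lambda>x. (chebD k p x)^2 * wt p x)"
 proof (rule integrable_bounded_times_wt[where B = "B\<^sup>2"])
  show "\<bar>(chebD k p x)^2\<bar> \<le> B\<^sup>2" if "\<bar>x\<bar> < 1" for x
   using B[of x] that power_mono[of "\<bar>chebD k p x\<bar>" B 2] by simp
 qed simp
 then have "integrable lborel (\<lambda>x. (chebD k p x)^2 * wt p x / (sqrt (lamk k p))^2)" by simp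
 then show ?thesis using wt_nonneg by (simp add: chebE_def power_divide power_mult_distrib)
qed

section \<open>Bessel's inequality\<close>

lemma integrable_square_mult:
 fixes u v :: "'a => 'b::{real_normed_field,banach,second_countable_topology}"
 assumes [measurable]: "u \<in> borel_measurable M" "v \<in> borel_measurable M"
  and "integrable M (\<lambda>x. (norm (u x))^2)" "integrable M (\<lambda>x. (norm (v x))^2)"
 shows "integrable M (\<lambda>x. u x * v x)"
proof (rule lint_bound[where f = "\<lambda>x. (norm (u x))^2 + (norm (v x))^2"])
 show "integrable M (\<lambda>x. (norm (u x))^2 + (norm (v x))^2)" using assms by simp
 show "AE x in M. norm (u x * v x) \<le> norm ((norm (u x))^2 + (norm (v x))^2)"
 proof (rule AE_I2)
  fix x
  have "2 * (norm (u x) * norm (v x)) \<le> (norm (u x))^2 + (norm (v x))^2"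
   using sum_squares_bound[of "norm (u x)" "norm (v x)"] by simp
  moreover have "0 \<le> norm (u x) * norm (v x)" by simp
  ultimately have "norm (u x) * norm (v x) \<le> (norm (u x))^2 + (norm (v x))^2" by linarith
  then show "norm (u x * v x) \<le> norm ((norm (u x))^2 + (norm (v x))^2)"
   by (simp add: norm_mult)
 qed
qed simp

text \<open>Expand the nonnegative integral of |u - sum c_k e_k|^2. The e_k are real and u is
  complex, so the coefficients are taken without conjugation and conjugates enter only through the
  cross terms.\<close>

lemma bessel_inequality:
 fixes e :: "'k => 'a => real" and u :: "'a => complex"
 assumes fin: "finite K"
  and em [measurable]: "\<And>k. k \<in> K ==> e k \<in> borel_measurable M"
  and e2: "\<And>k. k \<in> K ==> integrable M (\<lambda>x. (e k x)^2)"
  and orth: "\<And>j k. j \<in> K ==> k \<in> K ==> (\<integral>x. e j x * e k x \<partial>M) = (if j = k then 1 else 0)"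
  and um [measurable]: "u \<in> borel_measurable M" and u2: "integrable M (\<lambda>x. (cmod (u x))^2)"
 shows "(\<Sum>k\<in>K. (cmod (\<integral>x. of_real (e k x) * u x \<partial>M))^2) \<le> (\<integral>x. (cmod (u x))^2 \<partial>M)"
proof -
 define c where "c k = (\<integral>x. of_real (e k x) * u x \<partial>M)" for k
 have ie: "integrable M (\<lambda>x. e j x * e k x)" if "j \<in> K" "k \<in> K" for j k
  using that e2 by (intro integrable_square_mult) auto
 have ieu: "integrable M (\<lambda>x. complex_of_real (e k x) * u x)" if "k \<in> K" for k
  using that e2 u2 by (intro integrable_square_mult) auto
 have ieu': "integrable M (\<lambda>x. Re (cnj (c k) * (complex_of_real (e k x) * u x)))" if "k \<in> K" for k
  by (intro integrable_Re integrable_mult_right ieu that)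
 have exp: "(cmod (u x - (\<Sum>k\<in>K. c k * of_real (e k x))))^2 = (cmod (u x))^2
   - 2 * (\<Sum>k\<in>K. Re (cnj (c k) * (of_real (e k x) * u x)))
   + (\<Sum>j\<in>K. \<Sum>k\<in>K. Re (c j * cnj (c k)) * (e j x * e k x))" for x
 proof -
  have s: "(cmod (a - b))^2 = (cmod a)^2 - 2 * Re (cnj b * a) + Re (b * cnj b)" for a b
   unfolding cmod_power2 by (simp add: power2_eq_square algebra_simps)
  show ?thesis unfolding s
   by (simp add: sum_distrib_left sum_distrib_right sum_product algebra_simps)
 qed
 have "0 \<le> (\<integral>x. (cmod (u x - (\<Sum>k\<in>K. c k * of_real (e k x))))^2 \<partial>M)"
  by (intro integral_nonneg_AE AE_I2) simp
 also have "\<dots> = (\<integral>x. (cmod (u x))^2 \<partial>M)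
   - 2 * (\<Sum>k\<in>K. (\<integral>x. Re (cnj (c k) * (of_real (e k x) * u x)) \<partial>M))
   + (\<Sum>j\<in>K. \<Sum>k\<in>K. Re (c j * cnj (c k)) * (\<integral>x. e j x * e k x \<partial>M))"
 proof -
  define A where "A k x = Re (cnj (c k) * (complex_of_real (e k x) * u x))" for k x
  define E where "E j k x = e j x * e k x" for j k x
  have "integrable M (A k)" "integrable M (E j k)" if "j \<in> K" "k \<in> K" for j k
   unfolding A_def[abs_def] E_def[abs_def] using ieu' ie that by auto
  then show ?thesis
   unfolding exp A_def[symmetric] E_def[symmetric] using u2 fin by simp
 qed
 also have "(\<Sum>k\<in>K. (\<integral>x. Re (cnj (c k) * (of_real (e k x) * u x)) \<partial>M)) = (\<Sum>k\<in>K. (cmod (c k))^2)"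
 proof (rule sum.cong[OF refl])
  fix k assume k: "k \<in> K"
  have "(\<integral>x. Re (cnj (c k) * (of_real (e k x) * u x)) \<partial>M) = Re (\<integral>x. cnj (c k) * (of_real (e k x) * u x) \<partial>M)"
   by (intro integral_Re integrable_mult_right ieu k)
  also have "\<dots> = Re (cnj (c k) * c k)"
   by (simp add: c_def)
  also have "\<dots> = (cmod (c k))^2" unfolding cmod_power2 by (simp add: power2_eq_square)
  finally show "(\<integral>x. Re (cnj (c k) * (of_real (e k x) * u x)) \<partial>M) = (cmod (c k))^2" .
 qed
 also have "(\<Sum>j\<in>K. \<Sum>k\<in>K. Re (c j * cnj (c k)) * (\<integral>x. e j x * e k x \<partial>M)) = (\<Sum>k\<in>K. (cmod (c k))^2)"
 proof (rule sum.cong[OF refl])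
  fix j assume j: "j \<in> K"
  have "(\<Sum>k\<in>K. Re (c j * cnj (c k)) * (\<integral>x. e j x * e k x \<partial>M))
    = (\<Sum>k\<in>K. if j = k then Re (c j * cnj (c k)) else 0)"
   by (rule sum.cong) (auto simp: orth j)
  also have "\<dots> = Re (c j * cnj (c j))" using fin j by simp
  also have "\<dots> = (cmod (c j))^2" unfolding cmod_power2 by (simp add: power2_eq_square)
  finally show "(\<Sum>k\<in>K. Re (c j * cnj (c k)) * (\<integral>x. e j x * e k x \<partial>M)) = (cmod (c j))^2" .
 qed
 finally show ?thesis by (simp add: c_def)
qed

lemma cheb_bessel:
 fixes u :: "real => complex"
 assumes "finite K" "\<And>k. k \<in> K ==> p \<le> k"
  and "u \<in> borel_measurable borel" "integrable lborel (\<lambda>x. (cmod (u x))^2)"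
 shows "(\<Sum>k\<in>K. (cmod (LBINT x. of_real (chebE k p x) * u x))^2) \<le> (LBINT x. (cmod (u x))^2)"
 by (rule bessel_inequality) (use assms in \<open>auto simp: chebE_orth chebE_square_integrable\<close>)

section \<open>Tensor products of Bessel families\<close>

interpretation lborel_product: product_sigma_finite "\<lambda>_. lborel :: real measure"
 by (rule product_sigma_finite.intro) (rule sigma_finite_lborel)

lemma measurable_vec_lambda [measurable]:
 "(\<lambda>y. \<chi> l. y l) \<in> measurable (PiM UNIV (\<lambda>_::'d::finite. lborel :: real measure)) (borel :: (real^'d) measure)"
proof -
 have "(\<lambda>y. \<chi> l. y l) = (\<lambda>y. \<Sum>l\<in>UNIV. y l *\<^sub>R (axis l 1 :: real^'d))"
  by (auto simp: vec_eq_iff axis_def if_distrib cong: if_cong)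
 also have "\<dots> \<in> measurable (PiM UNIV (\<lambda>_::'d. lborel :: real measure)) borel"
  by measurable
 finally show ?thesis .
qed

text \<open>Both measures give a box the product of its side lengths, and this characterises
  \<open>lborel\<close>. It makes Fubini in one coordinate at a time, stated for \<open>PiM\<close>,
  available on \<open>real^'d\<close>.\<close>

lemma lborel_eq_PiM:
 "(lborel :: (real^'d::finite) measure) = distr (PiM UNIV (\<lambda>_::'d. lborel :: real measure)) borel (\<lambda>y. \<chi> l. y l)"
proof (rule lborel_eqI)
 fix a b :: "real^'d" assume le: "\<And>i. i \<in> Basis ==> a \<bullet> i \<le> b \<bullet> i"
 have lel: "a $ l \<le> b $ l" for l
  using le[of "axis l 1"] by (simp add: inner_axis)
 have "emeasure (distr (PiM UNIV (\<lambda>_::'d. lborel :: real measure)) borel (\<lambda>y. \<chi> l. y l)) (box a b)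
  = emeasure (PiM UNIV (\<lambda>_::'d. lborel :: real measure)) (PiE UNIV (\<lambda>l. {a $ l <..< b $ l}))"
  by (subst emeasure_distr) (auto intro!: arg_cong2[where f=emeasure] simp: space_PiM mem_box_cart PiE_UNIV_domain Pi_iff)
 also have "\<dots> = (\<Prod>l\<in>UNIV. emeasure lborel {a $ l <..< b $ l})"
  by (rule lborel_product.emeasure_PiM) auto
 also have "\<dots> = (\<Prod>l\<in>UNIV. ennreal (b $ l - a $ l))"
  using lel by simp
 also have "\<dots> = ennreal (\<Prod>l\<in>UNIV. b $ l - a $ l)"
  using lel by (intro prod_ennreal) simp
 also have "(\<Prod>l\<in>UNIV. b $ l - a $ l) = (\<Prod>i\<in>Basis. (b - a) \<bullet> i)"
  by (simp add: Basis_vec_def UNION_singleton_eq_range prod.reindex inj_on_def axis_eq_axis inner_axis)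
 finally show "emeasure (distr (PiM UNIV (\<lambda>_::'d. lborel :: real measure)) borel (\<lambda>y. \<chi> l. y l)) (box a b)
  = ennreal (\<Prod>i\<in>Basis. (b - a) \<bullet> i)" .
qed simp

lemma integrable_lborel_vec_iff:
 fixes f :: "real^'d::finite => 'b::{banach,second_countable_topology}"
 assumes "f \<in> borel_measurable borel"
 shows "integrable lborel f \<longleftrightarrow> integrable (PiM UNIV (\<lambda>_::'d. lborel)) (\<lambda>y. f (\<chi> l. y l))"
 unfolding lborel_eq_PiM using assms by (subst integrable_distr_eq) auto

lemma integral_lborel_vec:
 fixes f :: "real^'d::finite => 'b::{banach,second_countable_topology}"
 assumes "f \<in> borel_measurable borel"
 shows "(LBINT x. f x) = (\<integral>y. f (\<chi> l. y l) \<partial>PiM UNIV (\<lambda>_::'d. lborel))"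
 unfolding lborel_eq_PiM using assms by (subst integral_distr) auto

lemma integrable_prod_vec:
 fixes g :: "'d::finite => real => 'b::{real_normed_field,banach,second_countable_topology}"
 assumes "\<And>l. integrable lborel (g l)"
 shows "integrable lborel (\<lambda>x::real^'d. \<Prod>l\<in>UNIV. g l (x $ l))"
proof -
 have [measurable]: "g l \<in> borel_measurable borel" for l using assms[of l] by auto
 show ?thesis
  by (subst integrable_lborel_vec_iff)
   (use lborel_product.product_integrable_prod[of UNIV g] assms in auto)
qed

lemma integral_prod_vec:
 fixes g :: "'d::finite => real => 'b::{real_normed_field,banach,second_countable_topology}"
 assumes "\<And>l. integrable lborel (g l)"
 shows "(\<integral>x. (\<Prod>l\<in>UNIV. g l (x $ l)) \<partial>(lborel :: (real^'d) measure)) = (\<Prod>l\<in>UNIV. integral\<^sup>L lborel (g l))"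
proof -
 have [measurable]: "g l \<in> borel_measurable borel" for l using assms[of l] by auto
 show ?thesis
  by (subst integral_lborel_vec)
   (use lborel_product.product_integral_prod[of UNIV g] assms in auto)
qed

text \<open>Working with families of functionals instead of their Gram matrices makes the bound
 stable under tensor products, by Fubini's theorem.\<close>

definition bessel_family :: "'k set => ('k => real => real) => real => bool" where
 "bessel_family K g B \<longleftrightarrow> finite K \<and> 0 \<le> B \<and>
  (\<forall>k\<in>K. g k \<in> borel_measurable borel \<and> integrable lborel (\<lambda>x. (g k x)^2)) \<and>
  (\<forall>u :: real => complex. u \<in> borel_measurable borel --> integrable lborel (\<lambda>x. (cmod (u x))^2) -->
    (\<Sum>k\<in>K. (cmod (LBINT x. of_real (g k x) * u x))^2) \<le> B * (LBINT x. (cmod (u x))^2))"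

text \<open>Integrate out coordinate i first. The inner functionals \<open>U k\<close> of the slices
  are functions of the remaining coordinates, so the induction hypothesis applies to each of them;
  their squares are then summed over k pointwise by the one-dimensional bound. Over the empty index
  set the measure is a unit point mass and both sides equal |u|^2.\<close>

lemma bessel_family_PiM:
 fixes g :: "'d => 'k => real => real" and u :: "('d => real) => complex"
 assumes "finite L" "\<And>l. l \<in> L ==> bessel_family (K l) (g l) (B l)"
  and "u \<in> borel_measurable (PiM L (\<lambda>_. lborel))"
  and "integrable (PiM L (\<lambda>_. lborel)) (\<lambda>y. (cmod (u y))^2)"
 shows "(\<Sum>k\<in>PiE L K. (cmod (\<integral>y. of_real (\<Prod>l\<in>L. g l (k l) (y l)) * u y \<partial>PiM L (\<lambda>_. lborel)))^2)
  \<le> (\<Prod>l\<in>L. B l) * (\<integral>y. (cmod (u y))^2 \<partial>PiM L (\<lambda>_. lborel))"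
 using assms
proof (induction L arbitrary: u rule: finite_induct)
 case empty
 have "PiM {} (\<lambda>_::'d. lborel :: real measure) = count_space {\<lambda>_. undefined}"
  by (rule PiM_empty)
 then show ?case by (simp add: lebesgue_integral_count_space_finite)
next
 case (insert i L)
 let ?M = "\<lambda>_::'d. lborel :: real measure"
 note [measurable] = insert.prems(2)
 have bf: "bessel_family (K i) (g i) (B i)" using insert.prems by auto
 then have gi [measurable]: "\<And>k. k \<in> K i ==> g i k \<in> borel_measurable borel"
  and gi2: "\<And>k. k \<in> K i ==> integrable lborel (\<lambda>x. (g i k x)^2)"
  and finK: "finite (K i)" and Bi: "0 \<le> B i"
  and bi: "\<And>u. u \<in> borel_measurable borel ==> integrable lborel (\<lambda>x. (cmod (u x))^2) ==>
    (\<Sum>k\<in>K i. (cmod (LBINT x. of_real (g i k x) * u x))^2) \<le> B i * (LBINT x. (cmod (u x))^2)"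
  unfolding bessel_family_def by auto
 have gm [measurable]: "\<And>l k. l \<in> L ==> k \<in> K l ==> g l k \<in> borel_measurable borel"
  and g2: "\<And>l k. l \<in> L ==> k \<in> K l ==> integrable lborel (\<lambda>x. (g l k x)^2)"
  and BL: "\<And>l. l \<in> L ==> 0 \<le> B l"
  using insert.prems unfolding bessel_family_def by auto
 have upd [measurable]: "(\<lambda>p. (fst p)(i := snd p)) \<in> measurable (PiM L ?M \<Otimes>\<^sub>M lborel) (PiM (insert i L) ?M)"
  using measurable_add_dim[of i L ?M] by (simp add: case_prod_unfold)
 have um [measurable]: "(\<lambda>p. u ((fst p)(i := snd p))) \<in> borel_measurable (PiM L ?M \<Otimes>\<^sub>M lborel)"
  by measurable
 define U where "U k y = (LBINT t. of_real (g i k t) * u (y(i := t)))" for k y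
 have Um [measurable]: "U k \<in> borel_measurable (PiM L ?M)" if "k \<in> K i" for k
 proof -
  have "(\<lambda>(y, t). of_real (g i k t) * u (y(i := t))) \<in> borel_measurable (PiM L ?M \<Otimes>\<^sub>M lborel)"
   using that by (simp add: case_prod_unfold)
  from sigma_finite_measure.borel_measurable_lebesgue_integral[OF sigma_finite_lborel this]
  show ?thesis unfolding U_def[abs_def] .
 qed
 define N where "N y = (LBINT t. (cmod (u (y(i := t))))^2)" for y
 have int2: "integrable (PiM (insert i L) ?M) (\<lambda>y. (cmod (u y))^2)" by fact
 have nnfin: "(\<integral>\<^sup>+y. (\<integral>\<^sup>+t. ennreal ((cmod (u (y(i := t))))^2) \<partial>lborel) \<partial>PiM L ?M) < \<infinity>"
  using int2 insert.hyps
  by (subst lborel_product.product_nn_integral_insert[symmetric]) (auto simp: integrable_iff_bounded)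
 \<comment> \<open>Only almost every slice is square integrable, so the one-dimensional bound is
   available almost everywhere only.\<close>
 have "AE y in PiM L ?M. (\<integral>\<^sup>+t. ennreal ((cmod (u (y(i := t))))^2) \<partial>lborel) \<noteq> \<infinity>"
 proof (rule nn_integral_PInf_AE)
  show "(\<lambda>y. \<integral>\<^sup>+t. ennreal ((cmod (u (y(i := t))))^2) \<partial>lborel) \<in> borel_measurable (PiM L ?M)"
   by (intro sigma_finite_measure.borel_measurable_nn_integral[OF sigma_finite_lborel])
    (simp add: case_prod_unfold)
 qed (use nnfin in auto)
 then have AEfin: "AE y in PiM L ?M. y \<in> space (PiM L ?M) \<and> integrable lborel (\<lambda>t. (cmod (u (y(i := t))))^2)"
  using AE_space
 proof eventually_elim
  case (elim y)
  have "(\<lambda>t. y(i := t)) \<in> measurable lborel (PiM (insert i L) ?M)"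
   using measurable_component_update[OF elim(2), of i] insert.hyps by simp
  from measurable_compose[OF this insert.prems(2)]
  have "(\<lambda>t. u (y(i := t))) \<in> borel_measurable lborel" .
  with elim show ?case by (auto simp: integrable_iff_bounded less_top)
 qed
 have Nint: "integrable (PiM L ?M) N"
  and Neq: "(\<integral>y. N y \<partial>PiM L ?M) = (\<integral>y. (cmod (u y))^2 \<partial>PiM (insert i L) ?M)"
 proof -
  have Nm: "N \<in> borel_measurable (PiM L ?M)"
  proof -
   have "(\<lambda>(y, t). (cmod (u (y(i := t))))^2) \<in> borel_measurable (PiM L ?M \<Otimes>\<^sub>M lborel)"
    by (simp add: case_prod_unfold)
   from sigma_finite_measure.borel_measurable_lebesgue_integral[OF sigma_finite_lborel this]
   show ?thesis unfolding N_def[abs_def] .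
  qed
  \<comment> \<open>On a slice that is not integrable \<open>N y\<close> is the default value 0, so
    the inequality holds for every y.\<close>
  have le: "ennreal (N y) \<le> (\<integral>\<^sup>+t. ennreal ((cmod (u (y(i := t))))^2) \<partial>lborel)" for y
  proof (cases "integrable lborel (\<lambda>t. (cmod (u (y(i := t))))^2)")
   case True
   then show ?thesis unfolding N_def by (subst nn_integral_eq_integral) auto
  qed (simp add: N_def not_integrable_integral_eq)
  show "integrable (PiM L ?M) N"
  proof (rule integrableI_nonneg[OF Nm])
   show "AE y in PiM L ?M. 0 \<le> N y"
    unfolding N_def by (intro AE_I2 integral_nonneg_AE) auto
   have "(\<integral>\<^sup>+y. ennreal (N y) \<partial>PiM L ?M) \<le> (\<integral>\<^sup>+y. (\<integral>\<^sup>+t. ennreal ((cmod (u (y(i := t))))^2) \<partial>lborel) \<partial>PiM L ?M)"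
    by (intro nn_integral_mono le)
   with nnfin show "(\<integral>\<^sup>+y. ennreal (N y) \<partial>PiM L ?M) < \<infinity>" by (simp add: order_le_less_trans)
  qed
  show "(\<integral>y. N y \<partial>PiM L ?M) = (\<integral>y. (cmod (u y))^2 \<partial>PiM (insert i L) ?M)"
   unfolding N_def using insert.hyps int2
   by (intro lborel_product.product_integral_insert[symmetric]) auto
 qed
 have sumU: "AE y in PiM L ?M. (\<Sum>k\<in>K i. (cmod (U k y))^2) \<le> B i * N y"
  using AEfin
 proof eventually_elim
  case (elim y)
  have "(\<lambda>t. y(i := t)) \<in> measurable lborel (PiM (insert i L) ?M)"
   using measurable_component_update[of y L ?M i] elim insert.hyps by simp
  from measurable_compose[OF this insert.prems(2)]
  have "(\<lambda>t. u (y(i := t))) \<in> borel_measurable borel" by (simp only: measurable_lborel1 measurable_lborel2)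
  with elim show ?case unfolding U_def N_def by (intro bi) auto
 qed
 have U2: "integrable (PiM L ?M) (\<lambda>y. (cmod (U k y))^2)" if k: "k \<in> K i" for k
 proof (rule lint_bound[where f = "\<lambda>y. B i * N y"])
  show "integrable (PiM L ?M) (\<lambda>y. B i * N y)" using Nint by simp
  show "AE y in PiM L ?M. norm ((cmod (U k y))^2) \<le> norm (B i * N y)"
   using sumU
  proof eventually_elim
   case (elim y)
   have "(cmod (U k y))^2 \<le> (\<Sum>k\<in>K i. (cmod (U k y))^2)"
    using k finK by (intro member_le_sum) auto
   also note elim
   finally show ?case by auto
  qed
 qed (use k in simp)
 \<comment> \<open>The functional with index \<open>k(i := j)\<close> is the functional j on the
   slices followed by the functional k in the other coordinates.\<close>
 have ieq: "(\<integral>y. of_real (\<Prod>l\<in>insert i L. g l ((k(i := j)) l) (y l)) * u y \<partial>PiM (insert i L) ?M) =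
   (\<integral>y. of_real (\<Prod>l\<in>L. g l (k l) (y l)) * U j y \<partial>PiM L ?M)" if j: "j \<in> K i" and k: "k \<in> PiE L K" for j k
 proof -
  have kK: "k l \<in> K l" if "l \<in> L" for l using k that by auto
  define G where "G y = (\<Prod>l\<in>insert i L. g l ((k(i := j)) l) (y l))" for y
  have mG: "(k(i := j)) l \<in> K l" if "l \<in> insert i L" for l using that j kK by auto
  have Gm [measurable]: "G \<in> borel_measurable (PiM (insert i L) ?M)"
   unfolding G_def[abs_def]
  proof (intro borel_measurable_prod)
   fix l assume l: "l \<in> insert i L"
   then have [measurable]: "g l ((k(i := j)) l) \<in> borel_measurable borel"
    using mG[OF l] gi gm by auto
   show "(\<lambda>y. g l ((k(i := j)) l) (y l)) \<in> borel_measurable (PiM (insert i L) ?M)"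
    using l by measurable
  qed
  have "integrable (PiM (insert i L) ?M) (\<lambda>y. \<Prod>l\<in>insert i L. (g l ((k(i := j)) l) (y l))^2)"
  proof (intro lborel_product.product_integrable_prod)
   fix l assume l: "l \<in> insert i L"
   then show "integrable lborel (\<lambda>x. (g l ((k(i := j)) l) x)^2)"
    using mG[OF l] gi2 g2 by (cases "l = i") auto
  qed (use insert.hyps in simp)
  then have "integrable (PiM (insert i L) ?M) (\<lambda>y. (G y)^2)"
   by (simp add: G_def prod_power_distrib)
  then have int: "integrable (PiM (insert i L) ?M) (\<lambda>y. complex_of_real (G y) * u y)"
   using insert.prems by (intro integrable_square_mult) auto
  have "(\<integral>y. of_real (G y) * u y \<partial>PiM (insert i L) ?M) =
   (\<integral>y. (LBINT t. of_real (G (y(i := t))) * u (y(i := t))) \<partial>PiM L ?M)"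
   using insert.hyps int by (intro lborel_product.product_integral_insert) auto
  also have "\<dots> = (\<integral>y. (LBINT t. of_real (\<Prod>l\<in>L. g l (k l) (y l)) * (of_real (g i j t) * u (y(i := t)))) \<partial>PiM L ?M)"
  proof -
   have "G (y(i := t)) = g i j t * (\<Prod>l\<in>L. g l (k l) (y l))" for y t
    unfolding G_def using insert.hyps
    by (simp, intro disjI2 prod.cong) auto
   then show ?thesis by (simp add: mult_ac)
  qed
  also have "\<dots> = (\<integral>y. of_real (\<Prod>l\<in>L. g l (k l) (y l)) * U j y \<partial>PiM L ?M)"
   by (simp only: U_def integral_mult_right_zero)
  finally show ?thesis by (simp add: G_def)
 qed
 have "(\<Sum>k\<in>PiE (insert i L) K. (cmod (\<integral>y. of_real (\<Prod>l\<in>insert i L. g l (k l) (y l)) * u y \<partial>PiM (insert i L) ?M))^2)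
  = (\<Sum>j\<in>K i. \<Sum>k\<in>PiE L K. (cmod (\<integral>y. of_real (\<Prod>l\<in>L. g l (k l) (y l)) * U j y \<partial>PiM L ?M))^2)"
  unfolding PiE_insert_eq sum.cartesian_product
 proof (subst sum.reindex[OF inj_combinator[OF insert.hyps(2)]], rule sum.cong[OF refl])
  fix p assume "p \<in> K i \<times> PiE L K"
  then obtain j k where p: "p = (j, k)" "j \<in> K i" "k \<in> PiE L K" by auto
  show "((\<lambda>k. (cmod (\<integral>y. of_real (\<Prod>l\<in>insert i L. g l (k l) (y l)) * u y \<partial>PiM (insert i L) ?M))^2) \<circ> (\<lambda>(y, g). g(i := y))) p
   = (case p of (j, k) => (cmod (\<integral>y. of_real (\<Prod>l\<in>L. g l (k l) (y l)) * U j y \<partial>PiM L ?M))^2)"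
   unfolding p(1) o_def prod.case ieq[OF p(2,3)] ..
 qed
 also have "\<dots> \<le> (\<Sum>j\<in>K i. (\<Prod>l\<in>L. B l) * (\<integral>y. (cmod (U j y))^2 \<partial>PiM L ?M))"
  using insert.prems U2 by (intro sum_mono insert.IH) auto
 also have "\<dots> = (\<Prod>l\<in>L. B l) * (\<integral>y. (\<Sum>j\<in>K i. (cmod (U j y))^2) \<partial>PiM L ?M)"
  using U2 by (simp add: sum_distrib_left lint_sum)
 also have "\<dots> \<le> (\<Prod>l\<in>L. B l) * (\<integral>y. B i * N y \<partial>PiM L ?M)"
  using U2 Nint sumU BL by (intro mult_left_mono integral_mono_AE prod_nonneg) auto
 also have "\<dots> = (\<Prod>l\<in>insert i L. B l) * (\<integral>y. (cmod (u y))^2 \<partial>PiM (insert i L) ?M)"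
  using insert.hyps by (simp add: Neq mult_ac)
 finally show ?case .
qed

lemma bessel_family_vec:
 fixes g :: "'d::finite => 'k => real => real" and u :: "real^'d => complex"
 assumes bf: "\<And>l. bessel_family (K l) (g l) (B l)"
  and [measurable]: "u \<in> borel_measurable borel" and u2: "integrable lborel (\<lambda>y. (cmod (u y))^2)"
 shows "(\<Sum>k\<in>PiE UNIV K. (cmod (LBINT y. of_real (\<Prod>l\<in>UNIV. g l (k l) (y $ l)) * u y))^2)
  \<le> (\<Prod>l\<in>UNIV. B l) * (LBINT y. (cmod (u y))^2)"
proof -
 have gm: "g l k \<in> borel_measurable borel" if "k \<in> K l" for l k
  using bf that unfolding bessel_family_def by auto
 have eq: "(LBINT y. of_real (\<Prod>l\<in>UNIV. g l (k l) (y $ l)) * u y) =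
  (\<integral>y. of_real (\<Prod>l\<in>UNIV. g l (k l) (y l)) * u (\<chi> l. y l) \<partial>PiM UNIV (\<lambda>_. lborel))"
  if k: "k \<in> PiE UNIV K" for k
 proof -
  have [measurable]: "g l (k l) \<in> borel_measurable borel" for l using k gm by auto
  show ?thesis by (subst integral_lborel_vec) auto
 qed
 have "(\<Sum>k\<in>PiE UNIV K. (cmod (LBINT y. of_real (\<Prod>l\<in>UNIV. g l (k l) (y $ l)) * u y))^2)
  = (\<Sum>k\<in>PiE UNIV K. (cmod (\<integral>y. of_real (\<Prod>l\<in>UNIV. g l (k l) (y l)) * u (\<chi> l. y l) \<partial>PiM UNIV (\<lambda>_. lborel)))^2)"
  by (rule sum.cong[OF refl]) (simp only: eq)
 also have "\<dots> \<le> (\<Prod>l\<in>UNIV. B l) * (\<integral>y. (cmod (u (\<chi> l. y l)))^2 \<partial>PiM UNIV (\<lambda>_. lborel))"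
  using u2 by (intro bessel_family_PiM) (auto simp: bf integrable_lborel_vec_iff)
 also have "\<dots> = (\<Prod>l\<in>UNIV. B l) * (LBINT y. (cmod (u y))^2)"
  by (subst integral_lborel_vec[of "\<lambda>y. (cmod (u y))^2"]) auto
 finally show ?thesis .
qed

section \<open>Chebyshev coefficients of a sum of tensor kernels\<close>

lemma measurable_vec_nth [measurable]: "(\<lambda>x::real^'d::finite. x $ l) \<in> borel_measurable borel"
 by (intro borel_measurable_continuous_onI continuous_intros)

text \<open>Density times T_k, zero off (-1,1): pairing with T_k under the Chebyshev measure becomes
  a Lebesgue integral over the line.\<close>

definition cheb_fun :: "nat => real => real" where
 "cheb_fun k x = wt 0 x * chebD k 0 x"

lemma cheb_fun_measurable [measurable]: "cheb_fun k \<in> borel_measurable borel"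
 unfolding cheb_fun_def by measurable

lemma cheb_fun_outside: "1 \<le> \<bar>x\<bar> ==> cheb_fun k x = 0"
 by (simp add: cheb_fun_def wt_eq_0)

lemma integrable_cheb_fun_times:
 assumes [measurable]: "f \<in> borel_measurable borel" and "\<And>x. \<bar>x\<bar> < 1 ==> \<bar>f x\<bar> \<le> (B::real)"
 shows "integrable lborel (\<lambda>x. f x * cheb_fun k x)"
proof -
 obtain C where C: "\<bar>x\<bar> \<le> 1 ==> \<bar>chebD k 0 x\<bar> \<le> C" for x using chebD_bounded[of k 0] by auto
 have "integrable lborel (\<lambda>x. (f x * chebD k 0 x) * wt 0 x)"
 proof (rule integrable_bounded_times_wt[where B = "\<bar>B\<bar> * \<bar>C\<bar>"])
  show "\<bar>f x * chebD k 0 x\<bar> \<le> \<bar>B\<bar> * \<bar>C\<bar>" if "\<bar>x\<bar> < 1" for x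
   unfolding abs_mult using C[of x] assms(2)[OF that] that by (intro mult_mono) auto
 qed simp
 then show ?thesis by (simp add: cheb_fun_def mult_ac)
qed

lemma integrable_cheb_fun: "integrable lborel (cheb_fun k)"
 using integrable_cheb_fun_times[of "\<lambda>_. 1" 1 k] by simp

text \<open>Bessel's inequality for the single function f divided by its norm; if the norm is zero,
  f vanishes almost everywhere.\<close>

lemma integral_cauchy_schwarz:
 fixes f :: "'a => real" and u :: "'a => complex"
 assumes [measurable]: "f \<in> borel_measurable M" "u \<in> borel_measurable M"
  and f2: "integrable M (\<lambda>x. (f x)^2)" and u2: "integrable M (\<lambda>x. (cmod (u x))^2)"
 shows "(cmod (\<integral>x. of_real (f x) * u x \<partial>M))^2 \<le> (\<integral>x. (f x)^2 \<partial>M) * (\<integral>x. (cmod (u x))^2 \<partial>M)"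
proof (cases "(\<integral>x. (f x)^2 \<partial>M) = 0")
 case True
 then have "AE x in M. (f x)^2 = 0"
  using f2 by (subst integral_nonneg_eq_0_iff_AE[symmetric]) auto
 then have "AE x in M. of_real (f x) * u x = 0" by eventually_elim simp
 then have "(\<integral>x. of_real (f x) * u x \<partial>M) = 0"
  by (subst integral_cong_AE[where g = "\<lambda>_. 0"]) auto
 then show ?thesis by (simp add: True)
next
 case False
 define n where "n = (\<integral>x. (f x)^2 \<partial>M)"
 have n: "n > 0" using False integral_nonneg_AE[where M = M and f = "\<lambda>x. (f x)^2"] by (simp add: n_def order_less_le)
 define e where "e x = f x / sqrt n" for x
 have e2: "e x * e x = (f x)^2 / n" for x
  using n by (simp add: e_def power2_eq_square)
 have "(\<Sum>k\<in>{()}. (cmod (\<integral>x. of_real (e x) * u x \<partial>M))^2) \<le> (\<integral>x. (cmod (u x))^2 \<partial>M)"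
  using f2 u2 n by (intro bessel_inequality) (auto simp: e2 power2_eq_square[of "e x" for x] n_def[symmetric], simp_all add: e_def[abs_def])
 moreover have "(\<integral>x. of_real (e x) * u x \<partial>M) = (\<integral>x. of_real (f x) * u x \<partial>M) / of_real (sqrt n)"
  by (simp add: e_def)
 ultimately show ?thesis
  using n by (simp add: norm_divide power_divide divide_le_eq n_def[symmetric] mult.commute)
qed

lemma integrable_tensor:
 fixes g :: "'a::euclidean_space => real" and u :: "'b::euclidean_space => complex"
 assumes g: "integrable lborel g" and u: "integrable lborel u"
 shows "integrable (lborel \<Otimes>\<^sub>M lborel) (\<lambda>p. of_real (g (fst p)) * u (snd p))"
proof -
 have [measurable]: "g \<in> borel_measurable borel" "u \<in> borel_measurable borel" using g u by auto
 show ?thesis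
 proof (rule lborel_pair.Fubini_integrable)
  show "integrable lborel (\<lambda>x. (LBINT y. norm (complex_of_real (g (fst (x, y))) * u (snd (x, y)))))"
   using g by (simp add: norm_mult)
  show "AE x in lborel. integrable lborel (\<lambda>y. complex_of_real (g (fst (x, y))) * u (snd (x, y)))"
   using u by (intro AE_I2) simp
 qed simp
qed

lemma weighted_cauchy_schwarz:
 fixes a :: "'a => complex" and q :: "'a => real"
 assumes "finite A" and q: "\<And>t. t \<in> A ==> 0 < q t"
 shows "(cmod (\<Sum>t\<in>A. a t))^2 \<le> (\<Sum>t\<in>A. 1 / q t) * (\<Sum>t\<in>A. q t * (cmod (a t))^2)"
proof -
 have "cmod (\<Sum>t\<in>A. a t) \<le> (\<Sum>t\<in>A. cmod (a t))" by (rule norm_sum)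
 also have "\<dots> = (\<Sum>t\<in>A. (1 / sqrt (q t)) * (sqrt (q t) * cmod (a t)))"
  using q by (intro sum.cong) (auto simp: less_imp_neq[symmetric])
 finally have "(cmod (\<Sum>t\<in>A. a t))^2 \<le> (\<Sum>t\<in>A. (1 / sqrt (q t)) * (sqrt (q t) * cmod (a t)))^2"
  by (intro power_mono) auto
 also have "\<dots> \<le> (\<Sum>t\<in>A. (1 / sqrt (q t))^2) * (\<Sum>t\<in>A. (sqrt (q t) * cmod (a t))^2)"
  by (rule Cauchy_Schwarz_ineq_sum)
 also have "\<dots> = (\<Sum>t\<in>A. 1 / q t) * (\<Sum>t\<in>A. q t * (cmod (a t))^2)"
  using q by (intro arg_cong2[where f="(*)"] sum.cong) (auto simp: power_divide power_mult_distrib less_imp_le)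
 finally show ?thesis .
qed

lemma sqrt_prod: "sqrt (prod f A) = (\<Prod>x\<in>A. sqrt (f x))"
 by (induction A rule: infinite_finite_induct) (auto simp: real_sqrt_mult)

text \<open>A Schur-type estimate. Fubini moves the Chebyshev pairing from F to the kernels, where
  it factorises over the coordinates. The sum over \<open>\<tau>\<close> is removed by
  Cauchy-Schwarz with product weights q, whose reciprocals sum to at most S in each coordinate; for
  fixed \<open>\<tau>\<close> the sum over k is a tensor product of the families in
  \<open>H1\<close>, which already carry the weights q.\<close>

theorem tensor_chebyshev_bound:
 fixes \<kappa> :: "'t => real => real => real" and u :: "('d::finite => 't) => real^'d => complex"
  and F :: "real^'d => complex"
 assumes fin: "finite \<Theta>" and finK: "finite K"
  and km: "\<And>t. t \<in> \<Theta> ==> (\<lambda>p. \<kappa> t (fst p) (snd p)) \<in> borel_measurable (borel \<Otimes>\<^sub>M borel)"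
  and kb: "\<And>t x y. t \<in> \<Theta> ==> \<bar>x\<bar> \<le> 1 ==> \<bar>\<kappa> t x y\<bar> \<le> C t"
  and H1: "\<And>t. t \<in> \<Theta> ==> bessel_family K
    (\<lambda>k y. sqrt (\<omega> k * q t k) * (LBINT x. \<kappa> t x y * cheb_fun k x)) (B * (\<beta> t)^2)"
  and \<omega>: "\<And>k. 0 \<le> \<omega> k" and q: "\<And>t k. 0 < q t k"
  and H2: "\<And>k. (\<Sum>t\<in>\<Theta>. 1 / q t k) \<le> S" and B: "0 \<le> B"
  and um: "\<And>\<tau>. \<tau> \<in> PiE UNIV (\<lambda>_. \<Theta>) ==> u \<tau> \<in> borel_measurable borel"
  and u1: "\<And>\<tau>. \<tau> \<in> PiE UNIV (\<lambda>_. \<Theta>) ==> integrable lborel (u \<tau>)"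
  and u2: "\<And>\<tau>. \<tau> \<in> PiE UNIV (\<lambda>_. \<Theta>) ==> integrable lborel (\<lambda>y. (cmod (u \<tau> y))^2)"
  and F: "\<And>x. (\<And>l. \<bar>x $ l\<bar> \<le> 1) ==> F x = (\<Sum>\<tau>\<in>PiE UNIV (\<lambda>_. \<Theta>). (LBINT y. of_real (\<Prod>l\<in>UNIV. \<kappa> (\<tau> l) (x $ l) (y $ l)) * u \<tau> y))"
 shows "(\<Sum>k\<in>PiE UNIV (\<lambda>_. K). (\<Prod>l\<in>UNIV. \<omega> (k l)) *
    (cmod (LBINT x. of_real (\<Prod>l\<in>UNIV. cheb_fun (k l) (x $ l)) * F x))^2)
  \<le> (S * B) ^ CARD('d) * (\<Sum>\<tau>\<in>PiE UNIV (\<lambda>_. \<Theta>). (\<Prod>l\<in>UNIV. (\<beta> (\<tau> l))^2) * (LBINT y. (cmod (u \<tau> y))^2))"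
proof -
 let ?T = "PiE (UNIV :: 'd set) (\<lambda>_. \<Theta>)"
 have finT: "finite ?T" using fin by (intro finite_PiE) auto
 have tau: "\<tau> l \<in> \<Theta>" if "\<tau> \<in> ?T" for \<tau> l using that by auto
 define h :: "('d => nat) => real^'d => real" where "h k x = (\<Prod>l\<in>UNIV. cheb_fun (k l) (x $ l))" for k x
 define G where "G t k y = (LBINT x. \<kappa> t x y * cheb_fun k x)" for t k y
 define a where "a k \<tau> = (LBINT y. of_real (\<Prod>l\<in>UNIV. G (\<tau> l) (k l) (y $ l)) * u \<tau> y)" for k \<tau>
 \<comment> \<open>Nothing is known about F outside the cube, but there the test function
   vanishes.\<close>
 have hout: "h k x = 0" if "\<not> (\<forall>l. \<bar>x $ l\<bar> \<le> 1)" for k x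
 proof -
  from that obtain l where "\<not> \<bar>x $ l\<bar> \<le> 1" by blast
  then have "cheb_fun (k l) (x $ l) = 0" by (intro cheb_fun_outside) simp
  then show ?thesis by (auto simp: h_def intro!: exI[of _ l])
 qed
 have hint: "integrable lborel (h k)" for k
  unfolding h_def[abs_def] by (intro integrable_prod_vec integrable_cheb_fun)
 have hm [measurable]: "h k \<in> borel_measurable borel" for k using hint[of k] by auto
 have kint: "integrable lborel (\<lambda>x. \<kappa> t x y * cheb_fun k x)" if t: "t \<in> \<Theta>" for t k y
 proof (rule integrable_cheb_fun_times[where B = "C t"])
  have "(\<lambda>x. (x, y)) \<in> measurable borel (borel \<Otimes>\<^sub>M borel)" by measurable
  from measurable_compose[OF this km[OF t]]
  show "(\<lambda>x. \<kappa> t x y) \<in> borel_measurable borel" by simp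
  show "\<bar>\<kappa> t x y\<bar> \<le> C t" if "\<bar>x\<bar> < 1" for x using kb[OF t, of x y] that by simp
 qed
 have step1: "(LBINT x. of_real (h k x) * F x) = (\<Sum>\<tau>\<in>?T. a k \<tau>)" for k
 proof -
  define v where "v \<tau> x = (LBINT y. of_real (h k x) * (of_real (\<Prod>l\<in>UNIV. \<kappa> (\<tau> l) (x $ l) (y $ l)) * u \<tau> y))" for \<tau> x
  \<comment> \<open>On the cube the tensor kernel is bounded by the product of the
    \<open>C (\<tau> l)\<close>, and both the test function and \<open>u \<tau>\<close> are
    integrable; this dominates the double integral.\<close>
  have int: "integrable (lborel \<Otimes>\<^sub>M lborel) (\<lambda>(x, y). of_real (h k x) * (of_real (\<Prod>l\<in>UNIV. \<kappa> (\<tau> l) (x $ l) (y $ l)) * u \<tau> y))"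
   if T: "\<tau> \<in> ?T" for \<tau>
  proof (rule lint_bound[OF integrable_tensor[OF integrable_mult_right[OF hint[of k], of "\<Prod>l\<in>UNIV. C (\<tau> l)"] u1[OF T]]])
   have [measurable]: "u \<tau> \<in> borel_measurable borel" by (rule um[OF T])
   have [measurable]: "(\<lambda>p. \<kappa> (\<tau> l) (fst p $ l) (snd p $ l)) \<in> borel_measurable (borel \<Otimes>\<^sub>M (borel :: (real^'d) measure))" for l :: 'd
   proof -
    have "(\<lambda>p :: (real^'d) \<times> (real^'d). (fst p $ l, snd p $ l)) \<in> measurable (borel \<Otimes>\<^sub>M borel) (borel \<Otimes>\<^sub>M borel)"
     by (intro measurable_Pair measurable_compose[OF measurable_fst measurable_vec_nth] measurable_compose[OF measurable_snd measurable_vec_nth])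
    from measurable_compose[OF this km[OF tau[OF T, of l]]] show ?thesis by simp
   qed
   show "(\<lambda>(x, y). complex_of_real (h k x) * (of_real (\<Prod>l\<in>UNIV. \<kappa> (\<tau> l) (x $ l) (y $ l)) * u \<tau> y)) \<in> borel_measurable (lborel \<Otimes>\<^sub>M lborel)"
    by (simp add: case_prod_unfold)
   show "AE p in lborel \<Otimes>\<^sub>M lborel. norm (case p of (x, y) => complex_of_real (h k x) * (of_real (\<Prod>l\<in>UNIV. \<kappa> (\<tau> l) (x $ l) (y $ l)) * u \<tau> y))
     \<le> norm (complex_of_real ((\<Prod>l\<in>UNIV. C (\<tau> l)) * h k (fst p)) * u \<tau> (snd p))"
   proof (rule AE_I2)
    fix p :: "(real^'d) \<times> (real^'d)"
    obtain x y where p: "p = (x, y)" by (cases p)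
    show "norm (case p of (x, y) => complex_of_real (h k x) * (of_real (\<Prod>l\<in>UNIV. \<kappa> (\<tau> l) (x $ l) (y $ l)) * u \<tau> y))
     \<le> norm (complex_of_real ((\<Prod>l\<in>UNIV. C (\<tau> l)) * h k (fst p)) * u \<tau> (snd p))"
    proof (cases "\<forall>l. \<bar>x $ l\<bar> \<le> 1")
     case True
     have "\<bar>\<Prod>l\<in>UNIV. \<kappa> (\<tau> l) (x $ l) (y $ l)\<bar> \<le> (\<Prod>l\<in>UNIV. C (\<tau> l))"
      unfolding abs_prod using True by (intro prod_mono conjI kb tau[OF T]) auto
     then have "\<bar>\<Prod>l\<in>UNIV. \<kappa> (\<tau> l) (x $ l) (y $ l)\<bar> \<le> \<bar>\<Prod>l\<in>UNIV. C (\<tau> l)\<bar>" by linarith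
     then have "\<bar>h k x\<bar> * (\<bar>\<Prod>l\<in>UNIV. \<kappa> (\<tau> l) (x $ l) (y $ l)\<bar> * cmod (u \<tau> y)) \<le> \<bar>h k x\<bar> * (\<bar>\<Prod>l\<in>UNIV. C (\<tau> l)\<bar> * cmod (u \<tau> y))"
      by (intro mult_left_mono mult_right_mono) auto
     then show ?thesis by (simp add: p norm_mult abs_mult mult_ac del: of_real_prod)
    qed (simp add: p hout)
   qed
  qed
  have "(LBINT x. of_real (h k x) * F x) = (LBINT x. (\<Sum>\<tau>\<in>?T. v \<tau> x))"
  proof (rule lint_cong[OF refl])
   fix x :: "real^'d"
   show "of_real (h k x) * F x = (\<Sum>\<tau>\<in>?T. v \<tau> x)"
   proof (cases "\<forall>l. \<bar>x $ l\<bar> \<le> 1")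
    case True
    then show ?thesis by (simp add: F v_def sum_distrib_left del: of_real_prod)
   qed (simp add: hout v_def)
  qed
  also have "\<dots> = (\<Sum>\<tau>\<in>?T. (LBINT x. v \<tau> x))"
  proof (rule lint_sum)
   fix \<tau> assume "\<tau> \<in> ?T"
   from lborel_pair.integrable_fst'[OF int[OF this]] show "integrable lborel (v \<tau>)" by (simp add: v_def[abs_def])
  qed
  also have "\<dots> = (\<Sum>\<tau>\<in>?T. a k \<tau>)"
  proof (rule sum.cong[OF refl])
   fix \<tau> assume T: "\<tau> \<in> ?T"
   have "(LBINT x. v \<tau> x) = (LBINT y. (LBINT x. of_real (h k x) * (of_real (\<Prod>l\<in>UNIV. \<kappa> (\<tau> l) (x $ l) (y $ l)) * u \<tau> y)))"
    unfolding v_def using lborel_pair.Fubini_integral[OF int[OF T]] by simp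
   also have "\<dots> = (LBINT y. of_real (LBINT x. (\<Prod>l\<in>UNIV. \<kappa> (\<tau> l) (x $ l) (y $ l) * cheb_fun (k l) (x $ l))) * u \<tau> y)"
   proof (rule lint_cong[OF refl])
    fix y :: "real^'d"
    have "(LBINT x. of_real (h k x) * (of_real (\<Prod>l\<in>UNIV. \<kappa> (\<tau> l) (x $ l) (y $ l)) * u \<tau> y))
     = (LBINT x. of_real (\<Prod>l\<in>UNIV. \<kappa> (\<tau> l) (x $ l) (y $ l) * cheb_fun (k l) (x $ l)) * u \<tau> y)"
     by (intro lint_cong) (auto simp: h_def prod.distrib mult_ac)
    also have "\<dots> = of_real (LBINT x. (\<Prod>l\<in>UNIV. \<kappa> (\<tau> l) (x $ l) (y $ l) * cheb_fun (k l) (x $ l))) * u \<tau> y"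
     by (simp only: integral_mult_left_zero integral_complex_of_real)
    finally show "(LBINT x. of_real (h k x) * (of_real (\<Prod>l\<in>UNIV. \<kappa> (\<tau> l) (x $ l) (y $ l)) * u \<tau> y)) = \<dots>" .
   qed
   also have "\<dots> = a k \<tau>"
    unfolding a_def G_def
    by (subst integral_prod_vec) (auto intro!: kint tau[OF T])
   finally show "(LBINT x. v \<tau> x) = a k \<tau>" .
  qed
  finally show ?thesis .
 qed
 define Q where "Q k \<tau> = (\<Prod>l\<in>UNIV. q (\<tau> l) (k l))" for k :: "'d => nat" and \<tau>
 have Qpos: "0 < Q k \<tau>" for k \<tau> unfolding Q_def by (intro prod_pos) (simp add: q)
 have S0: "0 \<le> S" by (rule order_trans[OF sum_nonneg H2[of 0]]) (simp add: q less_imp_le)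
 have Qsum: "(\<Sum>\<tau>\<in>?T. 1 / Q k \<tau>) \<le> S ^ CARD('d)" for k
 proof -
  have "(\<Sum>\<tau>\<in>?T. 1 / Q k \<tau>) = (\<Prod>l\<in>UNIV. \<Sum>t\<in>\<Theta>. 1 / q t (k l))"
   using fin by (subst prod_sum_PiE) (auto simp: Q_def prod_dividef)
  also have "\<dots> \<le> (\<Prod>l\<in>(UNIV::'d set). S)"
   by (intro prod_mono conjI H2 sum_nonneg) (simp add: q less_imp_le)
  finally show ?thesis by simp
 qed
 define W where "W k = (\<Prod>l\<in>UNIV. \<omega> (k l))" for k :: "'d => nat"
 have Wnn: "0 \<le> W k" for k unfolding W_def by (intro prod_nonneg) (simp add: \<omega>)
 have bes: "(\<Sum>k\<in>PiE UNIV (\<lambda>_. K). W k * (Q k \<tau> * (cmod (a k \<tau>))^2))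
   \<le> B ^ CARD('d) * ((\<Prod>l\<in>UNIV. (\<beta> (\<tau> l))^2) * (LBINT y. (cmod (u \<tau> y))^2))" if T: "\<tau> \<in> ?T" for \<tau>
 proof -
  define g where "g l k y = sqrt (\<omega> k * q (\<tau> l) k) * G (\<tau> l) k y" for l :: 'd and k y
  have "(\<Sum>k\<in>PiE UNIV (\<lambda>_. K). (cmod (LBINT y. of_real (\<Prod>l\<in>UNIV. g l (k l) (y $ l)) * u \<tau> y))^2)
   \<le> (\<Prod>l\<in>UNIV. B * (\<beta> (\<tau> l))^2) * (LBINT y. (cmod (u \<tau> y))^2)"
   unfolding g_def G_def by (intro bessel_family_vec H1 tau um u2 T)
  moreover have "(cmod (LBINT y. of_real (\<Prod>l\<in>UNIV. g l (k l) (y $ l)) * u \<tau> y))^2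
   = W k * (Q k \<tau> * (cmod (a k \<tau>))^2)" for k
  proof -
   have "(\<Prod>l\<in>UNIV. g l (k l) (y $ l)) = sqrt (W k * Q k \<tau>) * (\<Prod>l\<in>UNIV. G (\<tau> l) (k l) (y $ l))" for y :: "real^'d"
    by (simp add: g_def prod.distrib W_def Q_def sqrt_prod real_sqrt_mult)
   then have "(LBINT y. of_real (\<Prod>l\<in>UNIV. g l (k l) (y $ l)) * u \<tau> y) = of_real (sqrt (W k * Q k \<tau>)) * a k \<tau>"
    by (simp only: a_def of_real_mult mult.assoc integral_mult_right_zero)
   then show ?thesis
    using Wnn[of k] Qpos[of k \<tau>] by (simp add: norm_mult power_mult_distrib)
  qed
  ultimately show ?thesis by (simp add: prod.distrib mult_ac)
 qed
 have "(\<Sum>k\<in>PiE UNIV (\<lambda>_. K). W k * (cmod (LBINT x. of_real (h k x) * F x))^2)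
  \<le> (\<Sum>k\<in>PiE UNIV (\<lambda>_. K). W k * (S ^ CARD('d) * (\<Sum>\<tau>\<in>?T. Q k \<tau> * (cmod (a k \<tau>))^2)))"
 proof (intro sum_mono mult_left_mono Wnn)
  fix k :: "'d => nat"
  have "(cmod (LBINT x. of_real (h k x) * F x))^2 \<le> (\<Sum>\<tau>\<in>?T. 1 / Q k \<tau>) * (\<Sum>\<tau>\<in>?T. Q k \<tau> * (cmod (a k \<tau>))^2)"
   unfolding step1 by (intro weighted_cauchy_schwarz finT Qpos)
  also have "\<dots> \<le> S ^ CARD('d) * (\<Sum>\<tau>\<in>?T. Q k \<tau> * (cmod (a k \<tau>))^2)"
   by (intro mult_right_mono Qsum sum_nonneg mult_nonneg_nonneg less_imp_le[OF Qpos]) simp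
  finally show "(cmod (LBINT x. of_real (h k x) * F x))^2 \<le> \<dots>" .
 qed
 \<comment> \<open>The order of summation is interchanged because the Bessel bound controls the sum
   over k for one \<open>\<tau>\<close> at a time.\<close>
 also have "\<dots> = S ^ CARD('d) * (\<Sum>\<tau>\<in>?T. \<Sum>k\<in>PiE UNIV (\<lambda>_. K). W k * (Q k \<tau> * (cmod (a k \<tau>))^2))"
  by (subst sum.swap[where A = ?T]) (simp add: sum_distrib_left mult_ac)
 also have "\<dots> \<le> S ^ CARD('d) * (\<Sum>\<tau>\<in>?T. B ^ CARD('d) * ((\<Prod>l\<in>UNIV. (\<beta> (\<tau> l))^2) * (LBINT y. (cmod (u \<tau> y))^2)))"
  by (intro mult_left_mono sum_mono bes) (auto simp: S0)
 also have "\<dots> = (S * B) ^ CARD('d) * (\<Sum>\<tau>\<in>?T. (\<Prod>l\<in>UNIV. (\<beta> (\<tau> l))^2) * (LBINT y. (cmod (u \<tau> y))^2))"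
  by (simp add: sum_distrib_left power_mult_distrib mult_ac)
 finally show ?thesis unfolding W_def h_def .
qed

section \<open>Smooth functions on the line\<close>

text \<open>The class C^n, with the derivative existentially quantified at each order: each closure
  property then follows by induction from a single differentiation rule, with no Leibniz or Faa di
  Bruno formula.\<close>

fun ck :: "nat => (real => real) => bool" where
 "ck 0 f = continuous_on UNIV f"
| "ck (Suc n) f = (\<exists>f'. (\<forall>x. (f has_real_derivative f' x) (at x)) \<and> ck n f')"

definition smooth_real :: "(real => real) => bool" where
 "smooth_real f \<longleftrightarrow> (\<forall>n. ck n f)"

lemma deriv_everywhere_continuous:
 "(\<And>x. (f has_real_derivative f' x) (at x)) ==> continuous_on UNIV f"
 by (intro continuous_at_imp_continuous_on ballI) (rule DERIV_isCont)

lemma ck_continuous: "ck n f ==> continuous_on UNIV f"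
 by (cases n) (auto intro: deriv_everywhere_continuous)

lemma ck_SucI: "ck n f' ==> (\<And>x. (f has_real_derivative f' x) (at x)) ==> ck (Suc n) f"
 by auto

lemma ck_SucD: "ck (Suc n) f ==> ck n f"
 by (induction n arbitrary: f) (auto intro: deriv_everywhere_continuous)

lemma ck_add: "ck n f ==> ck n g ==> ck n (\<lambda>x. f x + g x)"
proof (induction n arbitrary: f g)
 case (Suc n)
 then obtain f' g' where "\<And>x. (f has_real_derivative f' x) (at x)" "ck n f'"
  "\<And>x. (g has_real_derivative g' x) (at x)" "ck n g'" by auto
 then show ?case using Suc.IH[of f' g'] by (intro ck_SucI[of _ "\<lambda>x. f' x + g' x"] DERIV_add)
qed (auto intro!: continuous_intros)

lemma ck_mult: "ck n f ==> ck n g ==> ck n (\<lambda>x. f x * g x)"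
proof (induction n arbitrary: f g)
 case (Suc n)
 then obtain f' g' where d: "\<And>x. (f has_real_derivative f' x) (at x)" "ck n f'"
  "\<And>x. (g has_real_derivative g' x) (at x)" "ck n g'" by auto
 have "ck n (\<lambda>x. f' x * g x + f x * g' x)"
  using Suc.prems[THEN ck_SucD] d by (intro ck_add Suc.IH)
 moreover have "((\<lambda>x. f x * g x) has_real_derivative (f' x * g x + f x * g' x)) (at x)" for x
  using DERIV_mult[OF d(1)[of x] d(3)[of x]] by (simp add: mult.commute)
 ultimately show ?case by (rule ck_SucI)
qed (auto intro!: continuous_intros)

lemma ck_const: "ck n (\<lambda>x. c)"
 by (induction n arbitrary: c) (auto intro!: exI[of _ "\<lambda>_. 0"])

lemma ck_affine: "ck n f ==> ck n (\<lambda>x. f (a * x + b))"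
proof (induction n arbitrary: f)
 case 0
 then show ?case by (auto intro!: continuous_intros continuous_on_compose2[of UNIV f])
next
 case (Suc n)
 then obtain f' where d: "\<And>x. (f has_real_derivative f' x) (at x)" "ck n f'" by auto
 have "ck n (\<lambda>x. a * f' (a * x + b))" by (intro ck_mult ck_const Suc.IH d)
 moreover have "((\<lambda>x. f (a * x + b)) has_real_derivative (a * f' (a * x + b))) (at x)" for x
 proof -
  have "((\<lambda>x. a * x + b) has_real_derivative a) (at x)" by (auto intro!: derivative_eq_intros)
  from DERIV_chain2[OF d(1) this] show ?thesis by (simp add: mult.commute)
 qed
 ultimately show ?case by (rule ck_SucI)
qed

lemma ck_inverse: "ck n f ==> (\<And>x. f x \<noteq> 0) ==> ck n (\<lambda>x. inverse (f x))"
proof (induction n arbitrary: f)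
 case (Suc n)
 then obtain f' where d: "\<And>x. (f has_real_derivative f' x) (at x)" "ck n f'" by auto
 have "ck n (\<lambda>x. (-1) * (f' x * (inverse (f x) * inverse (f x))))"
  by (intro ck_mult ck_const d(2) Suc.IH[OF ck_SucD[OF Suc.prems(1)] Suc.prems(2)])
 moreover have "((\<lambda>x. inverse (f x)) has_real_derivative (-1) * (f' x * (inverse (f x) * inverse (f x)))) (at x)" for x
  using Suc.prems(2) by (auto intro!: derivative_eq_intros d(1))
 ultimately show ?case by (rule ck_SucI)
qed (auto intro!: continuous_intros)

lemma smooth_real_deriv:
 assumes "smooth_real f"
 shows "(f has_real_derivative deriv f x) (at x)" "smooth_real (deriv f)"
proof -
 have *: "\<exists>f'. (\<forall>x. (f has_real_derivative f' x) (at x)) \<and> ck n f'" for n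
  using assms[unfolded smooth_real_def, rule_format, of "Suc n"] by simp
 then have D: "(f has_real_derivative deriv f x) (at x)" for x
  using DERIV_deriv_iff_real_differentiable real_differentiable_def by blast
 show "(f has_real_derivative deriv f x) (at x)" by (rule D)
 show "smooth_real (deriv f)" unfolding smooth_real_def
 proof
  fix n
  obtain f' where f': "\<And>x. (f has_real_derivative f' x) (at x)" "ck n f'" using * by blast
  have "f' = deriv f" by (rule ext) (rule DERIV_unique[OF f'(1) D])
  with f' show "ck n (deriv f)" by simp
 qed
qed

lemma smooth_realI: "(\<And>x. (f has_real_derivative f' x) (at x)) ==> smooth_real f' ==> smooth_real f"
 unfolding smooth_real_def
proof
 fix n assume "\<And>x. (f has_real_derivative f' x) (at x)" "\<forall>n. ck n f'"
 then show "ck n f" by (intro ck_SucD[of n f]) auto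
qed

lemma smooth_real_continuous: "smooth_real f ==> continuous_on A f"
 unfolding smooth_real_def using ck_continuous continuous_on_subset by blast

lemma smooth_real_measurable: "smooth_real f ==> f \<in> borel_measurable borel"
 by (intro borel_measurable_continuous_onI smooth_real_continuous)

lemma smooth_real_add: "smooth_real f ==> smooth_real g ==> smooth_real (\<lambda>x. f x + g x)"
 and smooth_real_mult: "smooth_real f ==> smooth_real g ==> smooth_real (\<lambda>x. f x * g x)"
 and smooth_real_const: "smooth_real (\<lambda>x. c)"
 and smooth_real_affine: "smooth_real f ==> smooth_real (\<lambda>x. f (a * x + b))"
 and smooth_real_inverse: "smooth_real f ==> (\<And>x. f x \<noteq> 0) ==> smooth_real (\<lambda>x. inverse (f x))"
 unfolding smooth_real_def by (simp_all add: ck_add ck_mult ck_const ck_affine ck_inverse)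

lemma smooth_real_sum: "(\<And>i. i \<in> A ==> smooth_real (f i)) ==> smooth_real (\<lambda>x. \<Sum>i\<in>A. f i x)"
 by (induction A rule: infinite_finite_induct) (auto intro: smooth_real_add smooth_real_const)

lemma smooth_real_higher_deriv: "smooth_real f ==> smooth_real ((deriv ^^ n) f)"
 by (induction n) (auto intro: smooth_real_deriv)

section \<open>Flat functions, transition functions and bumps\<close>

text \<open>The factor p(1/x) makes the family closed under differentiation: with y = 1/x the
  derivative replaces p by y^2 (p - p'). Smoothness of exp (- 1/x) thus follows by an induction over
  all p simultaneously.\<close>

definition expinv :: "real poly => real => real" where
 "expinv p x = (if x \<le> 0 then 0 else poly p (1 / x) * exp (- (1 / x)))"

lemma poly_exp_tendsto_0: "((\<lambda>y. poly p y * exp (- y :: real)) \<longlongrightarrow> 0) at_top"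
proof -
 have "((\<lambda>y::real. \<Sum>i\<le>degree p. coeff p i * (y ^ i / exp y)) \<longlongrightarrow> (\<Sum>i\<le>degree p. coeff p i * 0)) at_top"
  by (intro tendsto_intros tendsto_power_div_exp_0)
 then show ?thesis
  by (simp add: poly_altdef sum_distrib_right exp_minus divide_inverse mult.assoc)
qed

lemma expinv_deriv:
 "(expinv p has_real_derivative expinv ([:0,0,1:] * (p - pderiv p)) x) (at x)"
proof -
 consider "x < 0" | "x > 0" | "x = 0" by linarith
 then show ?thesis
 proof cases
  case 1
  have "((\<lambda>_. 0) has_real_derivative expinv ([:0,0,1:] * (p - pderiv p)) x) (at x)"
   using 1 by (simp add: expinv_def)
  then show ?thesis
   by (rule has_field_derivative_transform_within_open[where S = "{..<0}"])
    (use 1 in \<open>auto simp: expinv_def\<close>)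
 next
  case 2
  have "((\<lambda>x. poly p (1 / x) * exp (- (1 / x))) has_real_derivative
   (poly (pderiv p) (1 / x) * (- 1 / x\<^sup>2)) * exp (- (1 / x)) + exp (- (1 / x)) * (1 / x\<^sup>2) * poly p (1 / x)) (at x)"
  proof (intro DERIV_mult)
   have "((\<lambda>x. 1 / x) has_real_derivative (- 1 / x\<^sup>2)) (at x)"
    using 2 by (auto intro!: derivative_eq_intros simp: power2_eq_square)
   then show "((\<lambda>x. poly p (1 / x)) has_real_derivative poly (pderiv p) (1 / x) * (- 1 / x\<^sup>2)) (at x)"
    by (rule DERIV_chain2[OF poly_DERIV])
  qed (use 2 in \<open>auto intro!: derivative_eq_intros simp: power2_eq_square\<close>)
  also have "(poly (pderiv p) (1 / x) * (- 1 / x\<^sup>2)) * exp (- (1 / x)) + exp (- (1 / x)) * (1 / x\<^sup>2) * poly p (1 / x)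
   = expinv ([:0,0,1:] * (p - pderiv p)) x"
   using 2 by (simp add: expinv_def power2_eq_square field_simps)
  finally show ?thesis
   by (rule has_field_derivative_transform_within_open[where S = "{0<..}"])
    (use 2 in \<open>auto simp: expinv_def\<close>)
 next
  case 3
  \<comment> \<open>The difference quotient at 0 is y p(y) exp(-y) with y = 1/h, and
    \<open>pCons 0 p\<close> is the polynomial y p(y).\<close>
  have "((\<lambda>y. poly (pCons 0 p) y * exp (- y)) \<longlongrightarrow> 0) at_top" by (rule poly_exp_tendsto_0)
  then have "((\<lambda>h. poly (pCons 0 p) (inverse h) * exp (- (inverse h))) \<longlongrightarrow> 0) (at_right 0)"
   using filterlim_inverse_at_top_right by (rule filterlim_compose)
  then have "((\<lambda>h. (expinv p (0 + h) - expinv p 0) / h) \<longlongrightarrow> 0) (at_right 0)"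
   by (rule Lim_transform_eventually)
    (auto simp: eventually_at_filter expinv_def field_simps)
  moreover have "((\<lambda>h. (expinv p (0 + h) - expinv p 0) / h) \<longlongrightarrow> 0) (at_left 0)"
   by (rule Lim_transform_eventually[OF tendsto_const])
    (auto simp: eventually_at_filter expinv_def)
  ultimately have "((\<lambda>h. (expinv p (0 + h) - expinv p 0) / h) \<longlongrightarrow> 0) (at 0)"
   by (rule filterlim_split_at[rotated])
  then show ?thesis using 3 by (simp add: DERIV_def expinv_def)
 qed
qed

lemma smooth_expinv: "smooth_real (expinv p)"
proof -
 have "ck n (expinv p)" for n
 proof (induction n arbitrary: p)
  case 0
  then show ?case using deriv_everywhere_continuous[OF expinv_deriv] by simp
 next
  case (Suc n)
  show ?case by (rule ck_SucI[OF Suc expinv_deriv])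
 qed
 then show ?thesis by (simp add: smooth_real_def)
qed

text \<open>A transition from 0 (for t <= 0) to 1 (for t >= 1). The quotient form is chosen for the
  symmetry \<open>smooth_step t + smooth_step (1 - t) = 1\<close>, from which the partition of unity
  \<open>psi\<close> is made.\<close>

definition smooth_step :: "real => real" where
 "smooth_step t = expinv 1 t / (expinv 1 t + expinv 1 (1 - t))"

lemma expinv_1_pos: "x > 0 ==> expinv 1 x > 0" and expinv_1_nonneg: "expinv 1 x \<ge> 0"
 by (auto simp: expinv_def)

lemma smooth_step_denom: "expinv 1 t + expinv 1 (1 - t) > 0"
proof (cases "t > 0")
 case True
 then show ?thesis using expinv_1_pos[of t] expinv_1_nonneg[of "1 - t"] by linarith
next
 case False
 then show ?thesis using expinv_1_pos[of "1 - t"] expinv_1_nonneg[of t] by simp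
qed

lemma smooth_smooth_step: "smooth_real smooth_step"
proof -
 have 1: "smooth_real (\<lambda>t. expinv 1 (1 - t))"
  using smooth_real_affine[OF smooth_expinv[of 1], of "-1" 1] by simp
 have "smooth_real (\<lambda>t. expinv 1 t * inverse (expinv 1 t + expinv 1 (1 - t)))"
  using smooth_step_denom by (intro smooth_real_mult smooth_real_inverse smooth_real_add smooth_expinv 1) (simp add: less_imp_neq[symmetric])
 then show ?thesis by (simp add: smooth_step_def[abs_def] divide_inverse)
qed

lemma smooth_step_compl: "smooth_step t + smooth_step (1 - t) = 1"
proof -
 have "smooth_step (1 - t) = expinv 1 (1 - t) / (expinv 1 t + expinv 1 (1 - t))"
  by (simp add: smooth_step_def add.commute)
 then show ?thesis using smooth_step_denom[of t]
  unfolding smooth_step_def[of t] by (simp only: add_divide_distrib[symmetric]) simp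
qed

lemma smooth_step_0: "t \<le> 0 ==> smooth_step t = 0"
 by (simp add: smooth_step_def expinv_def)

lemma smooth_step_1: "t \<ge> 1 ==> smooth_step t = 1"
 using smooth_step_compl[of t] smooth_step_0[of "1 - t"] by simp

lemma smooth_step_range: "0 \<le> smooth_step t" "smooth_step t \<le> 1"
 using smooth_step_denom[of t] expinv_1_nonneg[of t] expinv_1_nonneg[of "1 - t"]
 by (auto simp: smooth_step_def divide_le_eq)

lemma smooth_bump_exists:
 fixes a b :: real
 assumes "a < b"
 obtains \<nu> :: "real => real" where "smooth_real \<nu>" "\<And>x. 0 \<le> \<nu> x" "\<And>x. x \<notin> {a..b} ==> \<nu> x = 0"
  "integrable lborel \<nu>" "(LBINT x. \<nu> x) = 1"
proof -
 define \<beta> where "\<beta> x = expinv 1 (x - a) * expinv 1 (b - x)" for x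
 have sm: "smooth_real \<beta>"
  unfolding \<beta>_def[abs_def]
  using smooth_real_mult[OF smooth_real_affine[OF smooth_expinv[of 1], of 1 "-a"] smooth_real_affine[OF smooth_expinv[of 1], of "-1" b]]
  by simp
 have out: "\<beta> x = 0" if "x \<notin> {a..b}" for x
  using that by (auto simp: \<beta>_def expinv_def)
 have nn: "0 \<le> \<beta> x" for x unfolding \<beta>_def by (intro mult_nonneg_nonneg expinv_1_nonneg)
 have int: "integrable lborel \<beta>"
 proof -
  have "set_integrable lborel {a..b} \<beta>"
   by (rule borel_integrable_atLeastAtMost') (rule smooth_real_continuous[OF sm])
  then show ?thesis unfolding set_integrable_def
   by (rule Bochner_Integration.integrable_cong[THEN iffD1, OF refl, rotated]) (use out in \<open>auto simp: indicator_def\<close>)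
 qed
 have pos: "(LBINT x. \<beta> x) > 0"
 proof (rule ccontr)
  assume "\<not> ?thesis"
  then have "(LBINT x. \<beta> x) = 0" using integral_nonneg_AE[where M = lborel and f = \<beta>] nn by (simp add: not_less order_antisym)
  then have "AE x in lborel. \<beta> x = 0" using int nn by (subst integral_nonneg_eq_0_iff_AE[symmetric]) auto
  then have "AE x in lborel. x \<notin> {a<..<b}"
  proof eventually_elim
   case (elim x)
   have "\<beta> x > 0" if "x \<in> {a<..<b}" using that by (auto simp: \<beta>_def intro!: mult_pos_pos expinv_1_pos)
   with elim show ?case by auto
  qed
  then have "emeasure lborel {a<..<b} = 0" by (subst (asm) AE_iff_measurable[of "{a<..<b}"]) auto
  then show False using assms by simp
 qed
 show ?thesis
 proof
  show "smooth_real (\<lambda>x. (1 / (LBINT x. \<beta> x)) * \<beta> x)" by (intro smooth_real_mult smooth_real_const sm)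
 qed (use nn out int pos in auto)
qed

section \<open>Kernels concentrated near the diagonal\<close>

lemma norm_add3_square_le:
 fixes a b c :: "'a::real_normed_vector"
 shows "(norm (a + b + c))^2 \<le> 3 * ((norm a)^2 + (norm b)^2 + (norm c)^2)"
proof -
 have "norm (a + b + c) \<le> norm a + norm b + norm c"
  by (meson norm_triangle_mono order_refl)
 then have "(norm (a + b + c))^2 \<le> (norm a + norm b + norm c)^2" by (intro power_mono) auto
 also have "\<dots> \<le> 3 * ((norm a)^2 + (norm b)^2 + (norm c)^2)"
  using zero_le_power2[of "norm a - norm b"] zero_le_power2[of "norm b - norm c"] zero_le_power2[of "norm a - norm c"]
  by (simp add: power2_eq_square algebra_simps)
 finally show ?thesis .
qed

lemma norm_add_square_le:
 fixes a b :: "'a::real_normed_vector"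
 shows "(norm (a + b))^2 \<le> 2 * ((norm a)^2 + (norm b)^2)"
proof -
 have "(norm (a + b))^2 \<le> (norm a + norm b)^2" by (intro power_mono norm_triangle_ineq) auto
 also have "\<dots> \<le> 2 * ((norm a)^2 + (norm b)^2)"
  using zero_le_power2[of "norm a - norm b"] by (simp add: power2_eq_square algebra_simps)
 finally show ?thesis .
qed

lemma chebD_0_bound: "\<bar>x\<bar> \<le> 1 ==> \<bar>chebD k 0 x\<bar> \<le> sqrt 2"
proof -
 assume "\<bar>x\<bar> \<le> 1"
 then have "chebD k 0 x = sqrt 2 ^ min 1 k * cos (real k * arccos x)"
  by (simp add: chebD_eq_cheb_T cheb_T_def)
 moreover have "sqrt 2 ^ min 1 k \<le> sqrt 2 ^ 1" by (intro power_increasing) auto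
 moreover have "sqrt 2 ^ min 1 k * \<bar>cos (real k * arccos x)\<bar> \<le> sqrt 2 ^ min 1 k * 1"
  by (intro mult_left_mono) auto
 ultimately have "sqrt 2 ^ min 1 k * \<bar>cos (real k * arccos x)\<bar> \<le> sqrt 2"
  by (metis mult.right_neutral order_trans power_one_right)
 then show ?thesis using \<open>chebD k 0 x = _\<close> by (simp add: abs_mult)
qed

text \<open>At x = cos t the left side is at most sqrt 2 * k * |sin (k t)| / pi. A boundary term of
  one integration by parts is therefore O(k), against a gain of k^2.\<close>

lemma wt_1_chebD_1_bound: "\<bar>x\<bar> \<le> 1 ==> \<bar>wt (Suc 0) x * chebD k (Suc 0) x\<bar> \<le> real k"
proof -
 assume x: "\<bar>x\<bar> \<le> 1"
 define t where "t = arccos x"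
 have ct: "cos t = x" using x by (simp add: t_def cos_arccos abs_le_iff)
 have "sin t = sqrt (1 - x\<^sup>2)" using x by (simp add: t_def sin_arccos abs_le_iff)
 then have "wt (Suc 0) x * chebD k (Suc 0) x = chebD k (Suc 0) (cos t) * sin t / pi"
  using x by (simp add: wt_1 ct)
 also have "\<dots> = sqrt 2 ^ min 1 k * real k * sin (real k * t) / pi" by (simp only: chebD_1_cos)
 finally have "\<bar>wt (Suc 0) x * chebD k (Suc 0) x\<bar> = sqrt 2 ^ min 1 k * real k * \<bar>sin (real k * t)\<bar> / pi"
  by (simp add: abs_mult)
 also have "\<dots> \<le> sqrt 2 ^ 1 * real k * 1 / pi"
  by (intro divide_right_mono mult_mono power_increasing) auto
 also have "\<dots> \<le> real k"
 proof -
  have "sqrt 2 \<le> 2" by (rule real_le_lsqrt) auto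
  then have "sqrt 2 / pi \<le> 1" using pi_gt3 by (simp add: divide_le_eq)
  then have "sqrt 2 / pi * real k \<le> 1 * real k" by (intro mult_right_mono) auto
  then show ?thesis by simp
 qed
 finally show ?thesis .
qed

text \<open>For i < M <= k one has k <= (k - i) (i + 1) <= (k - i) M and k <= k + i, hence k^2 <= M
  (k^2 - i^2) for each factor. So \<open>lamk k M\<close> is comparable to k^(2 M) from k = M
  on.\<close>

lemma lamk_lower: "M \<le> k ==> 1 \<le> M ==> ((real k)^2 / real M) ^ M \<le> lamk k M"
proof -
 assume k: "M \<le> k" and M: "1 \<le> M"
 have "(\<Prod>i<M. (real k)^2 / real M) \<le> (\<Prod>i<M. (real k)^2 - (real i)^2)"
 proof (intro prod_mono conjI)
  fix i assume "i \<in> {..<M}"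
  then have i: "real i + 1 \<le> real M" "real M \<le> real k" using k by auto
  have "real k \<le> (real k - real i) * (real i + 1)"
  proof -
   have "0 \<le> real i * (real k - real i - 1)" using i by (intro mult_nonneg_nonneg) auto
   then show ?thesis by (simp add: algebra_simps)
  qed
  also have "\<dots> \<le> (real k - real i) * real M" using i by (intro mult_left_mono) auto
  finally have "real k * real k \<le> ((real k - real i) * real M) * (real k + real i)"
   by (intro mult_mono) auto
  then have "(real k)^2 \<le> ((real k)^2 - (real i)^2) * real M"
   by (simp add: power2_eq_square algebra_simps)
  then show "(real k)^2 / real M \<le> (real k)^2 - (real i)^2"
   using M by (simp add: pos_divide_le_eq)
 qed simp
 then show ?thesis by (simp add: lamk_def)
qed

section \<open>Kernels of one scale and their Chebyshev coefficients\<close>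

text \<open>\<open>D p\<close> is the p-th x-derivative of a kernel of scale 1/R: size R on a window
  of length 1/R, every derivative costing a factor R. The window lies to the right of x; kernels
  looking to the left are obtained later by reflection.\<close>

locale local_kernel =
 fixes D :: "nat => real => real => real" and C R :: real and M :: nat
 assumes M1: "1 \<le> M" and R1: "1 \<le> R" and C0: "0 \<le> C"
  and Dm: "\<And>p. p \<le> M ==> (\<lambda>z. D p (fst z) (snd z)) \<in> borel_measurable (borel \<Otimes>\<^sub>M borel)"
  and Db: "\<And>p x y. p \<le> M ==> \<bar>D p x y\<bar> \<le> C * R ^ (p + 1)"
  and Ds: "\<And>p x y. p \<le> M ==> y \<notin> {x..x + 1 / R} ==> D p x y = 0"
  and Dd: "\<And>p x y. p < M ==> ((\<lambda>x. D p x y) has_real_derivative D (Suc p) x y) (at x)"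
begin

text \<open>Formally the p-th derivative of the smoothed function \<open>v u 0\<close>. It is never
  differentiated as such: integrations by parts are made in \<open>D\<close> for fixed y and
  transferred to \<open>v\<close> by Fubini.\<close>

definition v :: "(real => complex) => nat => real => complex" where
 "v u p x = (LBINT y. of_real (D p x y) * u y)"

text \<open>The Chebyshev coefficient of the kernel in its first variable; its pairing with u is the
  Chebyshev coefficient of the smoothed function, see \<open>A_eq\<close>.\<close>

definition G :: "nat => real => real" where
 "G k y = (LBINT x. D 0 x y * cheb_fun k x)"

lemma D_x_measurable: "p \<le> M ==> (\<lambda>y. D p x y) \<in> borel_measurable borel"
 and D_y_measurable: "p \<le> M ==> (\<lambda>x. D p x y) \<in> borel_measurable borel"
proof -
 assume p: "p \<le> M"
 have "(\<lambda>y. (x, y)) \<in> measurable borel (borel \<Otimes>\<^sub>M borel)" by measurable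
 from measurable_compose[OF this Dm[OF p]] show "(\<lambda>y. D p x y) \<in> borel_measurable borel" by simp
 have "(\<lambda>x. (x, y)) \<in> measurable borel (borel \<Otimes>\<^sub>M borel)" by measurable
 from measurable_compose[OF this Dm[OF p]] show "(\<lambda>x. D p x y) \<in> borel_measurable borel" by simp
qed

lemma D_square_le: "p \<le> M ==> (D p x y)^2 \<le> (C * R ^ (p + 1))^2 * indicator {x..x + 1 / R} y"
 using power_mono[OF Db[of p x y], of 2] Ds[of p y x] by (cases "y \<in> {x..x + 1 / R}") auto

lemma D_square_integrable:
 assumes p: "p \<le> M"
 shows "integrable lborel (\<lambda>y. (D p x y)^2)"
proof (rule lint_bound)
 have "integrable lborel (indicator {x..x + 1 / R} :: real => real)"
  by (rule integrable_real_indicator) (use R1 in auto)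
 then show "integrable lborel (\<lambda>y. (C * R ^ (p + 1))^2 * indicator {x..x + 1 / R} y)"
  by (rule integrable_mult_right)
 show "(\<lambda>y. (D p x y)^2) \<in> borel_measurable lborel" using D_x_measurable[OF p, of x] by measurable
 show "AE y in lborel. norm ((D p x y)^2) \<le> norm ((C * R ^ (p + 1))^2 * indicator {x..x + 1 / R} y)"
  using D_square_le[OF p, of x] by (intro AE_I2) (auto intro: order_trans[OF _ abs_ge_self])
qed

text \<open>Cauchy-Schwarz on the window: the square of the kernel is at most C^2 R^(2 p + 2), and
  the window has length 1/R.\<close>

lemma v_local:
 assumes p: "p \<le> M" and [measurable]: "u \<in> borel_measurable borel"
  and u2: "integrable lborel (\<lambda>y. (cmod (u y))^2)"
 shows "(cmod (v u p x))^2 \<le> C\<^sup>2 * R ^ (2 * p + 1) * (LBINT y. indicator {x..x + 1 / R} y * (cmod (u y))^2)"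
proof -
 note [measurable] = D_x_measurable[OF p, of x]
 let ?I = "{x..x + 1 / R}"
 have ii: "integrable lborel (indicator ?I :: real => real)" by (rule integrable_real_indicator) (use R1 in auto)
 note D2le = D_square_le[OF p, of x] and D2 = D_square_integrable[OF p, of x]
 have D2int: "(LBINT y. (D p x y)^2) \<le> C\<^sup>2 * R ^ (2 * p + 1)"
 proof -
  have "(LBINT y. (D p x y)^2) \<le> (LBINT y. (C * R ^ (p + 1))^2 * indicator ?I y)"
   by (intro integral_mono D2 integrable_mult_right ii D2le)
  also have "\<dots> = (C * R ^ (p + 1))^2 * (1 / R)" using R1 by simp
  also have "\<dots> = C\<^sup>2 * R ^ (2 * p + 1)"
  proof -
   have "(R ^ (p + 1))^2 = R ^ (2 * p + 1) * R" by (simp add: power2_eq_square power_add mult_2)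
   then show ?thesis using R1 by (simp add: power_mult_distrib)
  qed
  finally show ?thesis .
 qed
 have uI: "integrable lborel (\<lambda>y. (cmod (indicator ?I y * u y))^2)"
  by (rule lint_bound[OF u2]) (auto simp: indicator_def)
 have "v u p x = (LBINT y. of_real (D p x y) * (indicator ?I y * u y))"
  unfolding v_def
 proof (rule lint_cong[OF refl])
  fix y show "of_real (D p x y) * u y = of_real (D p x y) * (indicator ?I y * u y)"
   by (cases "y \<in> ?I") (simp_all add: Ds[OF p])
 qed
 then have "(cmod (v u p x))^2 \<le> (LBINT y. (D p x y)^2) * (LBINT y. (cmod (indicator ?I y * u y))^2)"
  using integral_cauchy_schwarz[of "D p x" lborel "\<lambda>y. indicator ?I y * u y"] D2 uI by simp
 also have "\<dots> \<le> C\<^sup>2 * R ^ (2 * p + 1) * (LBINT y. (cmod (indicator ?I y * u y))^2)"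
  by (intro mult_right_mono D2int integral_nonneg_AE) auto
 also have "(\<lambda>y. (cmod (indicator ?I y * u y))^2) = (\<lambda>y. indicator ?I y * (cmod (u y))^2)"
  by (auto simp: indicator_def)
 finally show ?thesis .
qed

lemma v_sup:
 assumes p: "p \<le> M" and [measurable]: "u \<in> borel_measurable borel"
  and u2: "integrable lborel (\<lambda>y. (cmod (u y))^2)"
 shows "(cmod (v u p x))^2 \<le> C\<^sup>2 * R ^ (2 * p + 1) * (LBINT y. (cmod (u y))^2)"
proof -
 have "(LBINT y. indicator {x..x + 1 / R} y * (cmod (u y))^2) \<le> (LBINT y. (cmod (u y))^2)"
  by (intro integral_mono u2 lint_bound[OF u2]) (auto simp: indicator_def)
 then have "C\<^sup>2 * R ^ (2 * p + 1) * (LBINT y. indicator {x..x + 1 / R} y * (cmod (u y))^2)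
   \<le> C\<^sup>2 * R ^ (2 * p + 1) * (LBINT y. (cmod (u y))^2)"
  using R1 by (intro mult_left_mono) auto
 with v_local[OF assms, of x] show ?thesis by linarith
qed

lemma v_measurable:
 assumes p: "p \<le> M" and um [measurable]: "u \<in> borel_measurable borel"
 shows "v u p \<in> borel_measurable borel"
proof -
 note [measurable] = Dm[OF p]
 have "(\<lambda>(x, y). complex_of_real (D p x y) * u y) \<in> borel_measurable (borel \<Otimes>\<^sub>M lborel)"
  by (simp add: case_prod_unfold)
 from sigma_finite_measure.borel_measurable_lebesgue_integral[OF sigma_finite_lborel this]
 show ?thesis unfolding v_def[abs_def] .
qed

text \<open>Integrate \<open>v_local\<close> over x. A point y lies in the window of x exactly when
  x lies in [y - 1/R, y], and the length 1/R of this interval lowers the power of R by one.\<close>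

lemma v_L2:
 assumes p: "p \<le> M" and [measurable]: "u \<in> borel_measurable borel"
  and u2: "integrable lborel (\<lambda>y. (cmod (u y))^2)"
 shows "integrable lborel (\<lambda>x. (cmod (v u p x))^2)"
  and "(LBINT x. (cmod (v u p x))^2) \<le> C\<^sup>2 * R ^ (2 * p) * (LBINT y. (cmod (u y))^2)"
proof -
 note [measurable] = v_measurable[OF p assms(2)]
 let ?c = "C\<^sup>2 * R ^ (2 * p + 1)"
 let ?I = "(LBINT y. (cmod (u y))^2)"
 have c0: "0 \<le> ?c" using R1 by simp
 have "(\<integral>\<^sup>+x. ennreal ((cmod (v u p x))^2) \<partial>lborel)
  \<le> (\<integral>\<^sup>+x. ennreal ?c * (\<integral>\<^sup>+y. indicator {x..x + 1 / R} y * ennreal ((cmod (u y))^2) \<partial>lborel) \<partial>lborel)"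
 proof (rule nn_integral_mono)
  fix x :: real
  have int: "integrable lborel (\<lambda>y. indicator {x..x + 1 / R} y * (cmod (u y))^2)"
   by (rule lint_bound[OF u2]) (auto simp: indicator_def)
  have "ennreal ((cmod (v u p x))^2) \<le> ennreal (?c * (LBINT y. indicator {x..x + 1 / R} y * (cmod (u y))^2))"
   by (intro ennreal_leI v_local assms)
  also have "\<dots> = ennreal ?c * (\<integral>\<^sup>+y. ennreal (indicator {x..x + 1 / R} y * (cmod (u y))^2) \<partial>lborel)"
   using int c0 by (subst nn_integral_eq_integral) (auto simp: ennreal_mult intro!: integral_nonneg_AE)
  also have "(\<integral>\<^sup>+y. ennreal (indicator {x..x + 1 / R} y * (cmod (u y))^2) \<partial>lborel)
   = (\<integral>\<^sup>+y. indicator {x..x + 1 / R} y * ennreal ((cmod (u y))^2) \<partial>lborel)"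
   by (intro nn_integral_cong) (auto simp: indicator_def)
  finally show "ennreal ((cmod (v u p x))^2)
    \<le> ennreal ?c * (\<integral>\<^sup>+y. indicator {x..x + 1 / R} y * ennreal ((cmod (u y))^2) \<partial>lborel)" .
 qed
 also have "\<dots> = ennreal ?c * (\<integral>\<^sup>+x. (\<integral>\<^sup>+y. indicator {y - 1 / R..y} x * ennreal ((cmod (u y))^2) \<partial>lborel) \<partial>lborel)"
  by (subst nn_integral_cmult)
   (auto intro!: arg_cong2[where f="(*)"] nn_integral_cong simp: indicator_def)
 also have "(\<integral>\<^sup>+x. (\<integral>\<^sup>+y. indicator {y - 1 / R..y} x * ennreal ((cmod (u y))^2) \<partial>lborel) \<partial>lborel)
  = (\<integral>\<^sup>+y. (\<integral>\<^sup>+x. indicator {y - 1 / R..y} x * ennreal ((cmod (u y))^2) \<partial>lborel) \<partial>lborel)"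
  by (rule lborel_pair.Fubini') (simp add: case_prod_unfold indicator_def of_bool_def)
 also have "\<dots> = (\<integral>\<^sup>+y. ennreal (1 / R) * ennreal ((cmod (u y))^2) \<partial>lborel)"
  using R1 by (intro nn_integral_cong) (simp add: nn_integral_multc)
 also have "\<dots> = ennreal (1 / R) * ennreal ?I"
  using u2 by (simp add: nn_integral_cmult nn_integral_eq_integral)
 also have "ennreal ?c * (ennreal (1 / R) * ennreal ?I) = ennreal (C\<^sup>2 * R ^ (2 * p) * ?I)"
  using R1 c0 by (simp add: ennreal_mult[symmetric] integral_nonneg_AE field_simps)
 finally have le: "(\<integral>\<^sup>+x. ennreal ((cmod (v u p x))^2) \<partial>lborel) \<le> ennreal (C\<^sup>2 * R ^ (2 * p) * ?I)" .
 show int: "integrable lborel (\<lambda>x. (cmod (v u p x))^2)"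
  using le by (intro integrableI_nonneg) (auto simp: less_top[symmetric] top_unique)
 show "(LBINT x. (cmod (v u p x))^2) \<le> C\<^sup>2 * R ^ (2 * p) * ?I"
  using le R1 by (subst (asm) nn_integral_eq_integral[OF int]) (auto simp: ennreal_le_iff integral_nonneg_AE)
qed

text \<open>The exchange is stated for any integrable h that vanishes off [-1,1], so that it serves
  for full and truncated weights at every order p.\<close>

lemma v_Fubini:
 assumes p: "p \<le> M" and um [measurable]: "u \<in> borel_measurable borel"
  and u2: "integrable lborel (\<lambda>y. (cmod (u y))^2)"
  and h: "integrable lborel h" and h0: "\<And>x. \<not> \<bar>x\<bar> \<le> 1 ==> h x = 0"
 shows "(LBINT y. of_real (LBINT x. D p x y * h x) * u y) = (LBINT x. of_real (h x) * v u p x)"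
  and "integrable lborel (\<lambda>y. of_real (LBINT x. D p x y * h x) * u y)"
proof -
 note [measurable] = Dm[OF p]
 have [measurable]: "h \<in> borel_measurable borel" using h by auto
 define c where "c = C * R ^ (p + 1)"
 have c0: "0 \<le> c" and cb: "\<bar>D p x y\<bar> \<le> c" for x y
  unfolding c_def using C0 R1 Db[OF p] by auto
 \<comment> \<open>x in [-1,1] and 1/R <= 1 confine y to [-1,2]; on this bounded set u, merely
   square integrable on the line, is integrable.\<close>
 define u' where "u' y = of_real (indicator {-1..2::real} y) * u y" for y
 have "integrable lborel (indicator {-1..2::real} :: real => real)"
  by (rule integrable_real_indicator) auto
 moreover have "(\<lambda>y. (norm (complex_of_real (indicator {-1..2::real} y)))^2) = indicator {-1..2}"
  by (auto simp: indicator_def fun_eq_iff)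
 ultimately have "integrable lborel u'"
  unfolding u'_def[abs_def] using u2 by (intro integrable_square_mult) auto
 then have "integrable (lborel \<Otimes>\<^sub>M lborel) (\<lambda>z. of_real (c * h (fst z)) * u' (snd z))"
  using h by (intro integrable_tensor) auto
 then have int: "integrable (lborel \<Otimes>\<^sub>M lborel) (\<lambda>(x, y). of_real (D p x y * h x) * u y)"
 proof (rule lint_bound)
  show "AE z in lborel \<Otimes>\<^sub>M lborel. norm (case z of (x, y) => complex_of_real (D p x y * h x) * u y)
   \<le> norm (complex_of_real (c * h (fst z)) * u' (snd z))"
  proof (rule AE_I2)
   fix z :: "real \<times> real"
   obtain x y where z: "z = (x, y)" by (cases z)
   show "norm (case z of (x, y) => complex_of_real (D p x y * h x) * u y)
   \<le> norm (complex_of_real (c * h (fst z)) * u' (snd z))"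
   proof (cases "\<bar>x\<bar> \<le> 1 \<and> y \<in> {x..x + 1 / R}")
    case True
    have "1 / R \<le> 1" using R1 by simp
    with True have "y \<in> {-1..2}" by (auto simp: abs_le_iff)
    then have "u' y = u y" by (simp add: u'_def)
    moreover have "\<bar>D p x y\<bar> * (\<bar>h x\<bar> * cmod (u y)) \<le> c * (\<bar>h x\<bar> * cmod (u y))"
     by (intro mult_right_mono cb) auto
    ultimately show ?thesis using c0 by (simp add: z norm_mult abs_mult mult.assoc)
   qed (auto simp: z h0 Ds[OF p])
  qed
 qed (simp add: case_prod_unfold)
 have a: "(LBINT x. of_real (D p x y * h x) * u y) = of_real (LBINT x. D p x y * h x) * u y" for y
  by (simp only: integral_mult_left_zero integral_complex_of_real)
 have b: "(LBINT y. of_real (D p x y * h x) * u y) = of_real (h x) * v u p x" for x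
 proof -
  have "(LBINT y. of_real (D p x y * h x) * u y) = (LBINT y. of_real (h x) * (of_real (D p x y) * u y))"
   by (intro lint_cong) (auto simp: mult_ac)
  then show ?thesis by (simp only: v_def integral_mult_right_zero)
 qed
 from lborel_pair.Fubini_integral[OF int]
 show "(LBINT y. of_real (LBINT x. D p x y * h x) * u y) = (LBINT x. of_real (h x) * v u p x)"
  by (simp only: prod.case a b)
 from lborel_pair.integrable_snd[OF int]
 show "integrable lborel (\<lambda>y. of_real (LBINT x. D p x y * h x) * u y)"
  by (simp only: prod.case a)
qed

text \<open>p integrations by parts in x for fixed y over the whole interval, each without boundary
  terms and each contributing one factor of \<open>lamk\<close>.\<close>

lemma G_ibp:
 assumes "p \<le> M"
 shows "lamk k p * G k y = (LBINT x. D p x y * (wt p x * chebD k p x))"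
 using assms
proof (induction p)
 case (Suc p)
 have "((real k)^2 - (real p)^2) * (LBINT x. D p x y * (wt p x * chebD k p x)) =
  (LBINT x. D (Suc p) x y * (wt (Suc p) x * chebD k (Suc p) x))"
  using Suc.prems
  by (intro cheb_ibp_full[OF finite.emptyI, where B = "C * R ^ (Suc p + 1)"] Db Dd D_y_measurable
     DERIV_continuous_on[where D = "\<lambda>x. D (Suc p) x y"] has_field_derivative_at_within) auto
 with Suc show ?case by (simp add: lamk_Suc mult.assoc)
qed (simp add: G_def cheb_fun_def)

context
 fixes u :: "real => complex"
 assumes um [measurable]: "u \<in> borel_measurable borel"
  and u2: "integrable lborel (\<lambda>y. (cmod (u y))^2)"
begin

definition "A k = (LBINT y. of_real (G k y) * u y)"
definition "U = (LBINT y. (cmod (u y))^2)"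

lemma U0: "0 \<le> U" unfolding U_def by (intro integral_nonneg_AE) auto

lemma A_eq: "A k = (LBINT x. of_real (cheb_fun k x) * v u 0 x)"
 unfolding A_def G_def
 by (intro v_Fubini um u2 integrable_cheb_fun) (auto intro: cheb_fun_outside)

text \<open>One half of the weight goes into the orthonormal \<open>chebE\<close>, the other half
  onto \<open>v u p\<close>, where a bound c of the weight on E costs just the factor c. For p >= 1
  the weight is at most 1 and E may be the whole line; for p = 0 it is unbounded and E has to avoid
  the end points.\<close>

lemma v_wt_bessel:
 assumes p: "p \<le> M" and fin: "finite K" and Kp: "\<And>k. k \<in> K ==> p \<le> k"
  and Em [measurable]: "E \<in> sets borel" and c: "\<And>x. x \<in> E ==> wt p x \<le> c" and c0: "0 \<le> c"
 shows "(\<Sum>k\<in>K. (cmod (LBINT x. of_real (indicator E x * (wt p x * chebD k p x)) * v u p x))^2 / lamk k p)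
  \<le> c * (C\<^sup>2 * R ^ (2 * p) * U)"
proof -
 note [measurable] = v_measurable[OF p um]
 define w where "w x = of_real (indicator E x * sqrt (wt p x)) * v u p x" for x
 have wm [measurable]: "w \<in> borel_measurable borel" unfolding w_def[abs_def] by measurable
 have wle: "(cmod (w x))^2 \<le> c * (cmod (v u p x))^2" for x
  using c[of x] c0 wt_nonneg[of p x]
  by (cases "x \<in> E") (auto simp: w_def norm_mult power_mult_distrib intro!: mult_right_mono)
 have w2: "integrable lborel (\<lambda>x. (cmod (w x))^2)"
  by (rule lint_bound[OF integrable_mult_right[OF v_L2(1)[OF p um u2], of c]])
   (use wle in \<open>auto intro: order_trans[OF _ abs_ge_self]\<close>)
 have "(\<Sum>k\<in>K. (cmod (LBINT x. of_real (indicator E x * (wt p x * chebD k p x)) * v u p x))^2 / lamk k p)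
   = (\<Sum>k\<in>K. (cmod (LBINT x. of_real (chebE k p x) * w x))^2)"
 proof (rule sum.cong[OF refl])
  fix k assume "k \<in> K"
  then have l: "0 < lamk k p" using lamk_pos Kp by simp
  have "(LBINT x. of_real (indicator E x * (wt p x * chebD k p x)) * v u p x)
   = (LBINT x. of_real (sqrt (lamk k p)) * (of_real (chebE k p x) * w x))"
  proof (rule lint_cong[OF refl])
   fix x
   have "indicator E x * (wt p x * chebD k p x) = sqrt (lamk k p) * (chebE k p x * (indicator E x * sqrt (wt p x)))"
    using l wt_nonneg[of p x] by (simp add: chebE_def)
   then show "of_real (indicator E x * (wt p x * chebD k p x)) * v u p x = of_real (sqrt (lamk k p)) * (of_real (chebE k p x) * w x)"
    by (simp only: w_def of_real_mult mult.assoc)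
  qed
  also have "\<dots> = of_real (sqrt (lamk k p)) * (LBINT x. of_real (chebE k p x) * w x)"
   by (rule integral_mult_right_zero)
  finally show "(cmod (LBINT x. of_real (indicator E x * (wt p x * chebD k p x)) * v u p x))^2 / lamk k p
   = (cmod (LBINT x. of_real (chebE k p x) * w x))^2"
   using l by (simp add: norm_mult power_mult_distrib)
 qed
 also have "\<dots> \<le> (LBINT x. (cmod (w x))^2)" by (intro cheb_bessel fin Kp wm w2)
 also have "\<dots> \<le> (LBINT x. c * (cmod (v u p x))^2)"
  by (intro integral_mono w2 integrable_mult_right v_L2(1)[OF p um u2] wle)
 also have "\<dots> = c * (LBINT x. (cmod (v u p x))^2)" by simp
 also have "\<dots> \<le> c * (C\<^sup>2 * R ^ (2 * p) * U)"
  unfolding U_def by (intro mult_left_mono v_L2(2) p um u2 c0)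
 finally show ?thesis .
qed

text \<open>After M integrations by parts \<open>lamk k M * A k\<close> is the pairing of
  \<open>v u M\<close> with the M-th derivative of T_k under \<open>wt M\<close>, a weight bounded
  by 1 because M >= 1. Squaring and dividing by \<open>lamk k M\<close> leaves one factor
  \<open>lamk\<close> on the left.\<close>

lemma A_high:
 assumes "finite K" "\<And>k. k \<in> K ==> M \<le> k"
 shows "(\<Sum>k\<in>K. lamk k M * (cmod (A k))^2) \<le> C\<^sup>2 * R ^ (2 * M) * U"
proof -
 obtain m where m: "M = Suc m" using M1 by (cases M) auto
 have "(\<Sum>k\<in>K. lamk k M * (cmod (A k))^2)
  = (\<Sum>k\<in>K. (cmod (LBINT x. of_real (indicator UNIV x * (wt M x * chebD k M x)) * v u M x))^2 / lamk k M)"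
 proof (rule sum.cong[OF refl])
  fix k assume "k \<in> K"
  then have l: "0 < lamk k M" using lamk_pos assms(2) by simp
  obtain B where B: "\<bar>x\<bar> \<le> 1 ==> \<bar>chebD k M x\<bar> \<le> B" for x using chebD_bounded[of k M] by auto
  have "(LBINT x. of_real (wt M x * chebD k M x) * v u M x)
   = (LBINT y. of_real (LBINT x. D M x y * (wt M x * chebD k M x)) * u y)"
   by (intro v_Fubini(1)[symmetric] um u2 integrable_wt_times[where B = B] B) (auto simp: wt_eq_0)
  also have "\<dots> = (LBINT y. of_real (lamk k M) * (of_real (G k y) * u y))"
   by (simp add: G_ibp[symmetric] mult.assoc)
  also have "\<dots> = of_real (lamk k M) * A k" by (simp only: integral_mult_right_zero A_def)
  finally show "lamk k M * (cmod (A k))^2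
   = (cmod (LBINT x. of_real (indicator UNIV x * (wt M x * chebD k M x)) * v u M x))^2 / lamk k M"
   using l by (simp add: norm_mult power_mult_distrib power2_eq_square)
 qed
 also have "\<dots> \<le> 1 * (C\<^sup>2 * R ^ (2 * M) * U)"
  by (rule v_wt_bessel) (use assms in \<open>auto simp: m wt_Suc_le\<close>)
 finally show ?thesis by simp
qed

text \<open>Uses only |T_k| <= sqrt 2, the total mass 1 of the Chebyshev measure and the uniform
  bound on \<open>v u 0\<close>. It serves the exceptional frequencies, such as k = 0.\<close>

lemma A_sup: "(cmod (A k))^2 \<le> 2 * C\<^sup>2 * R * U"
proof -
 define s where "s = sqrt (C\<^sup>2 * R * U)"
 have s: "cmod (v u 0 x) \<le> s" for x
  unfolding s_def using v_sup[OF _ um u2, of 0 x] by (intro real_le_rsqrt) (simp add: U_def)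
 have s0: "0 \<le> s" using s[of 0] norm_ge_zero order_trans by blast
 note [measurable] = v_measurable[OF le0 um]
 have "cmod (A k) \<le> (LBINT x. cmod (of_real (cheb_fun k x) * v u 0 x))"
  unfolding A_eq by (rule integral_norm_bound)
 also have "\<dots> \<le> (LBINT x. (sqrt 2 * s) * wt 0 x)"
 proof (rule integral_mono_AE')
  show "integrable lborel (\<lambda>x. (sqrt 2 * s) * wt 0 x)" by (intro integrable_mult_right integrable_wt)
  show "AE x in lborel. cmod (of_real (cheb_fun k x) * v u 0 x) \<le> (sqrt 2 * s) * wt 0 x"
  proof (rule AE_I2)
   fix x show "cmod (of_real (cheb_fun k x) * v u 0 x) \<le> (sqrt 2 * s) * wt 0 x"
   proof (cases "\<bar>x\<bar> \<le> 1")
    case True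
    have "\<bar>chebD k 0 x\<bar> * cmod (v u 0 x) \<le> sqrt 2 * s"
     by (intro mult_mono chebD_0_bound True s) auto
    then have "wt 0 x * (\<bar>chebD k 0 x\<bar> * cmod (v u 0 x)) \<le> wt 0 x * (sqrt 2 * s)"
     by (intro mult_left_mono wt_nonneg)
    then show ?thesis by (simp add: cheb_fun_def norm_mult abs_mult wt_nonneg mult_ac)
   qed (simp add: cheb_fun_outside wt_eq_0)
  qed
 qed (use s0 in \<open>auto simp: wt_nonneg\<close>)
 also have "\<dots> = sqrt 2 * s"
  using integral_cos_wt[of 0] by simp
 finally have "(cmod (A k))^2 \<le> (sqrt 2 * s)^2" by (intro power_mono) auto
 also have "\<dots> = 2 * C\<^sup>2 * R * U"
  using U0 R1 by (simp add: s_def power_mult_distrib)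
 finally show ?thesis .
qed

text \<open>The window \<open>1 - x\<^sup>2 \<le> \<delta>\<^sup>2\<close> with \<open>\<delta> = N / R\<close> balances the weight in the middle against one
 integration by parts near the end points.\<close>

lemma A_low:
 assumes fin: "finite K" and K: "\<And>k. k \<in> K ==> N \<le> real k" and card: "real (card K) \<le> N"
  and N: "1 \<le> N" "N \<le> R"
 shows "(\<Sum>k\<in>K. (cmod (A k))^2) \<le> 27 * C\<^sup>2 * (R / N) * U"
proof -
 define \<delta> where "\<delta> = N / R"
 \<comment> \<open>Chosen so that 1 - a^2 lies between (\<open>\<delta>\<close> / 2)^2 and
   \<open>\<delta>\<close>^2: inside (-a, a) this gives \<open>wt 0\<close> <= 1 /
   \<open>\<delta>\<close>, outside it gives \<open>wt 1\<close> <= \<open>\<delta>\<close>.\<close>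
 define a where "a = 1 - \<delta>\<^sup>2 / 2"
 have \<delta>: "0 < \<delta>" "\<delta> \<le> 1" using N R1 by (auto simp: \<delta>_def)
 have d2: "\<delta>\<^sup>2 \<le> 1" "0 < \<delta>\<^sup>2" using \<delta> by (auto simp: power_le_one)
 have a: "1/2 \<le> a" "a < 1" using d2 by (auto simp: a_def)
 have v0m [measurable]: "v u 0 \<in> borel_measurable borel" by (rule v_measurable[OF le0 um])
 have wtmid: "wt 0 x \<le> 1 / \<delta>" if "x \<in> {-a<..<a}" for x
 proof -
  have ax: "\<bar>x\<bar> < a" using that by auto
  then have "\<bar>x\<bar>\<^sup>2 \<le> a\<^sup>2" by (intro power_mono) auto
  moreover have "(\<delta> / 2)^2 \<le> 1 - a\<^sup>2"
  proof -
   have "1 - a\<^sup>2 = \<delta>\<^sup>2 * (1 - \<delta>\<^sup>2 / 4)" by (simp add: a_def power2_eq_square field_simps)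
   also have "\<dots> \<ge> \<delta>\<^sup>2 * (1 / 4)" using d2 by (intro mult_left_mono) auto
   finally show ?thesis by (simp add: power_divide)
  qed
  ultimately have "(\<delta> / 2)^2 \<le> 1 - x\<^sup>2" by simp
  then have s: "\<delta> / 2 \<le> sqrt (1 - x\<^sup>2)" by (rule real_le_rsqrt)
  have "\<delta> \<le> 2 * sqrt (1 - x\<^sup>2)" using s by simp
  also have "\<dots> \<le> pi * sqrt (1 - x\<^sup>2)"
  proof (rule mult_right_mono)
   show "0 \<le> sqrt (1 - x\<^sup>2)" using s \<delta> by linarith
  qed (use pi_gt3 in simp)
  finally have "inverse (pi * sqrt (1 - x\<^sup>2)) \<le> inverse \<delta>" using \<delta> by (intro le_imp_inverse_le)
  then show ?thesis using ax a by (simp add: wt_0 inverse_eq_divide)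
 qed
 have wtend: "wt (Suc 0) x \<le> \<delta>" if "a \<le> \<bar>x\<bar>" "\<bar>x\<bar> \<le> 1" for x
 proof -
  have "a\<^sup>2 \<le> \<bar>x\<bar>\<^sup>2" using that a by (intro power_mono) auto
  moreover have "1 - a\<^sup>2 \<le> \<delta>\<^sup>2" using \<delta> by (simp add: a_def power2_eq_square field_simps)
  ultimately have "1 - x\<^sup>2 \<le> \<delta>\<^sup>2" by simp
  then have s: "sqrt (1 - x\<^sup>2) \<le> \<delta>" using \<delta> by (intro real_le_lsqrt) auto
  have "sqrt (1 - x\<^sup>2) / pi \<le> \<delta> / 1"
   using s pi_gt3 \<delta> that by (intro frac_le) (auto simp: abs_square_le_1)
  then show ?thesis using that by (simp add: wt_1)
 qed
 define Amid where "Amid k = (LBINT x. of_real (indicator {-a<..<a} x * (wt 0 x * chebD k 0 x)) * v u 0 x)" for k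
 define Ar where "Ar k = (LBINT x. of_real (indicator {a..1} x * (wt 0 x * chebD k 0 x)) * v u 0 x)" for k
 define Al where "Al k = (LBINT x. of_real (indicator {-1..-a} x * (wt 0 x * chebD k 0 x)) * v u 0 x)" for k
 obtain V where V: "cmod (v u 0 x) \<le> V" for x
 proof
  show "cmod (v u 0 x) \<le> sqrt (C\<^sup>2 * R * U)" for x
   using v_sup[OF _ um u2, of 0 x] by (intro real_le_rsqrt) (simp add: U_def)
 qed
 have int: "integrable lborel (\<lambda>x. of_real (indicator E x * (wt 0 x * chebD k 0 x)) * v u 0 x)"
  if [measurable]: "E \<in> sets borel" for E k
 proof (rule lint_bound)
  show "integrable lborel (\<lambda>x. V * cheb_fun k x)" by (intro integrable_mult_right integrable_cheb_fun)
  show "AE x in lborel. norm (complex_of_real (indicator E x * (wt 0 x * chebD k 0 x)) * v u 0 x) \<le> norm (V * cheb_fun k x)"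
  proof (rule AE_I2)
   fix x
   have "cmod (v u 0 x) * \<bar>cheb_fun k x\<bar> \<le> \<bar>V\<bar> * \<bar>cheb_fun k x\<bar>"
    using V[of x] by (intro mult_right_mono) auto
   then show "norm (complex_of_real (indicator E x * (wt 0 x * chebD k 0 x)) * v u 0 x) \<le> norm (V * cheb_fun k x)"
    by (simp add: norm_mult abs_mult cheb_fun_def indicator_def mult_ac)
  qed
 qed simp
 have split: "A k = Amid k + Ar k + Al k" for k
 proof -
  have "A k = (LBINT x. of_real (indicator {-a<..<a} x * (wt 0 x * chebD k 0 x)) * v u 0 x
    + of_real (indicator {a..1} x * (wt 0 x * chebD k 0 x)) * v u 0 x
    + of_real (indicator {-1..-a} x * (wt 0 x * chebD k 0 x)) * v u 0 x)"
   unfolding A_eq cheb_fun_def using a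
   by (intro lint_cong) (auto simp: indicator_def wt_def)
  then show ?thesis
   unfolding Amid_def Ar_def Al_def using int by simp
 qed
 have mid: "(\<Sum>k\<in>K. (cmod (Amid k))^2) \<le> (1 / \<delta>) * (C\<^sup>2 * U)"
  using v_wt_bessel[OF le0 fin, of "{-a<..<a}" "1 / \<delta>"] wtmid \<delta> by (simp add: Amid_def)
 \<comment> \<open>Both end pieces are treated at once. One integration by parts replaces the
   unbounded \<open>wt 0\<close> by \<open>wt 1\<close>, which is at most \<open>\<delta>\<close>
   here; the price is a boundary term at the inner end e, where the weight does not vanish.\<close>
 have ends: "(\<Sum>k\<in>K. (cmod (LBINT x. of_real (indicator {b..c} x * (wt 0 x * chebD k 0 x)) * v u 0 x))^2)
   \<le> 4 * C\<^sup>2 * (R / N) * U"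
  if bc: "(b = a \<and> c = 1) \<or> (b = -1 \<and> c = -a)" for b c
 proof -
  define e where "e = (if b = a then a else -a)"
  define sg :: real where "sg = (if b = a then 1 else -1)"
  define X where "X k = (LBINT x. of_real (indicator {b..c} x * (wt (Suc 0) x * chebD k (Suc 0) x)) * v u (Suc 0) x)" for k
  have eq: "(LBINT x. of_real (indicator {b..c} x * (wt 0 x * chebD k 0 x)) * v u 0 x)
   = (X k + of_real (sg * (wt (Suc 0) e * chebD k (Suc 0) e)) * v u 0 e) / of_real ((real k)^2)" if k: "k \<in> K" for k
  proof -
   have k0: "real k > 0" using K[OF k] N by simp
   have ibp: "(real k)^2 * (LBINT x. D 0 x y * (indicator {b..c} x * (wt 0 x * chebD k 0 x))) =
    (LBINT x. D (Suc 0) x y * (indicator {b..c} x * (wt (Suc 0) x * chebD k (Suc 0) x)))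
    + sg * (wt (Suc 0) e * chebD k (Suc 0) e) * D 0 e y" for y
   proof -
    have "((real k)^2 - (real 0)^2) * (LBINT x. indicator {b..c} x * (D 0 x y * (wt 0 x * chebD k 0 x))) =
    (LBINT x. indicator {b..c} x * (D (Suc 0) x y * (wt (Suc 0) x * chebD k (Suc 0) x)))
    - (D 0 c y * (wt (Suc 0) c * chebD k (Suc 0) c) - D 0 b y * (wt (Suc 0) b * chebD k (Suc 0) b))"
     using bc a M1
     by (intro cheb_ibp[OF _ _ _ finite.emptyI, where B = "C * R ^ (Suc 0 + 1)"] Db Dd D_y_measurable
      DERIV_continuous_on[where D = "\<lambda>x. D (Suc 0) x y"] has_field_derivative_at_within) auto
    moreover have "- (D 0 c y * (wt (Suc 0) c * chebD k (Suc 0) c) - D 0 b y * (wt (Suc 0) b * chebD k (Suc 0) b))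
     = sg * (wt (Suc 0) e * chebD k (Suc 0) e) * D 0 e y"
     using bc a by (auto simp: sg_def e_def wt_eq_0)
    ultimately show ?thesis by (simp add: mult_ac)
   qed
   have i: "integrable lborel (\<lambda>x. indicator {b..c} x * (wt p x * chebD k p x))" for p
   proof -
    obtain B where B: "\<bar>x\<bar> \<le> 1 ==> \<bar>chebD k p x\<bar> \<le> B" for x using chebD_bounded[of k p] by auto
    have "integrable lborel (\<lambda>x. wt p x * chebD k p x)" by (rule integrable_wt_times[where B = B]) (auto intro: B)
    from integrable_real_mult_indicator[OF _ this, of "{b..c}"] show ?thesis by (simp add: mult.commute)
   qed
   note i0 = i[of 0] and i1 = i[of "Suc 0"]
   have F0: "(LBINT y. of_real (LBINT x. D 0 x y * (indicator {b..c} x * (wt 0 x * chebD k 0 x))) * u y)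
     = (LBINT x. of_real (indicator {b..c} x * (wt 0 x * chebD k 0 x)) * v u 0 x)"
    by (intro v_Fubini(1) um u2 i0) (auto simp: wt_eq_0)
   have F1: "(LBINT y. of_real (LBINT x. D (Suc 0) x y * (indicator {b..c} x * (wt (Suc 0) x * chebD k (Suc 0) x))) * u y) = X k"
    and F1i: "integrable lborel (\<lambda>y. of_real (LBINT x. D (Suc 0) x y * (indicator {b..c} x * (wt (Suc 0) x * chebD k (Suc 0) x))) * u y)"
    unfolding X_def using M1 by (intro v_Fubini um u2 i1; auto simp: wt_eq_0)+
   define f where "f y = (LBINT x. D (Suc 0) x y * (indicator {b..c} x * (wt (Suc 0) x * chebD k (Suc 0) x)))" for y
   define w where "w = sg * (wt (Suc 0) e * chebD k (Suc 0) e)"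
   have Dint: "integrable lborel (\<lambda>y. of_real (D 0 e y) * u y)"
    using D_square_integrable[OF le0, of e] D_x_measurable[OF le0, of e] u2
    by (intro integrable_square_mult) auto
   have "of_real ((real k)^2) * (LBINT x. of_real (indicator {b..c} x * (wt 0 x * chebD k 0 x)) * v u 0 x)
    = (LBINT y. of_real ((real k)^2) * (of_real (LBINT x. D 0 x y * (indicator {b..c} x * (wt 0 x * chebD k 0 x))) * u y))"
    by (simp only: F0[symmetric] integral_mult_right_zero)
   also have "\<dots> = (LBINT y. of_real (f y) * u y + of_real w * (of_real (D 0 e y) * u y))"
   proof (rule lint_cong[OF refl])
    fix y
    have "of_real ((real k)^2) * (of_real (LBINT x. D 0 x y * (indicator {b..c} x * (wt 0 x * chebD k 0 x))) * u y)
     = of_real (f y + w * D 0 e y) * u y"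
     unfolding f_def w_def ibp[symmetric] by (simp only: of_real_mult mult.assoc)
    then show "of_real ((real k)^2) * (of_real (LBINT x. D 0 x y * (indicator {b..c} x * (wt 0 x * chebD k 0 x))) * u y)
     = of_real (f y) * u y + of_real w * (of_real (D 0 e y) * u y)"
     by (simp only: of_real_add of_real_mult distrib_right mult.assoc)
   qed
   also have "\<dots> = X k + of_real w * v u 0 e"
    using F1 F1i Dint unfolding f_def[symmetric] v_def by simp
   finally show ?thesis using k0 by (simp add: w_def field_simps)
  qed
  \<comment> \<open>Dividing by k^2 and squaring: since \<open>lamk k 1\<close> = k^2, the integral
    part is 1/k^2 times a Bessel summand, and the boundary part is at most 1/k^2 times the squared
    sup bound of \<open>v u 0\<close>, by \<open>wt_1_chebD_1_bound\<close>.\<close>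
  have "(\<Sum>k\<in>K. (cmod (LBINT x. of_real (indicator {b..c} x * (wt 0 x * chebD k 0 x)) * v u 0 x))^2)
   \<le> (\<Sum>k\<in>K. 2 / N\<^sup>2 * ((cmod (X k))^2 / lamk k (Suc 0)) + 2 / N\<^sup>2 * (C\<^sup>2 * R * U))"
  proof (rule sum_mono)
   fix k assume k: "k \<in> K"
   have kN: "N \<le> real k" "0 < real k" using K[OF k] N by auto
   have N2: "N\<^sup>2 \<le> (real k)^2" "0 < N\<^sup>2" using kN N by (auto intro: power_mono)
   define w where "w = sg * (wt (Suc 0) e * chebD k (Suc 0) e)"
   have "\<bar>w\<bar> \<le> real k" 
   proof -
    have "\<bar>e\<bar> \<le> 1" "\<bar>sg\<bar> = 1" using a by (auto simp: e_def sg_def)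
    then show ?thesis using wt_1_chebD_1_bound[of e k] by (simp add: w_def abs_mult)
   qed
   then have w2: "w\<^sup>2 \<le> (real k)^2" using power_mono[of "\<bar>w\<bar>" "real k" 2] by simp
   have v2: "(cmod (v u 0 e))^2 \<le> C\<^sup>2 * R * U" using v_sup[OF _ um u2, of 0 e] by (simp add: U_def)
   have "(cmod (LBINT x. of_real (indicator {b..c} x * (wt 0 x * chebD k 0 x)) * v u 0 x))^2
    = (cmod (X k + of_real w * v u 0 e))^2 / ((real k)^2 * (real k)^2)"
    unfolding eq[OF k] w_def[symmetric] norm_divide norm_of_real power_divide
    by (simp only: power2_abs power2_eq_square[of "(real k)^2"])
   also have "\<dots> \<le> (2 * ((cmod (X k))^2 + (real k)^2 * (C\<^sup>2 * R * U))) / ((real k)^2 * (real k)^2)"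
   proof (rule divide_right_mono)
    have "(cmod (of_real w * v u 0 e))^2 \<le> (real k)^2 * (C\<^sup>2 * R * U)"
     unfolding norm_mult power_mult_distrib norm_of_real power2_abs using w2 v2 by (intro mult_mono) auto
    then show "(cmod (X k + of_real w * v u 0 e))^2 \<le> 2 * ((cmod (X k))^2 + (real k)^2 * (C\<^sup>2 * R * U))"
     by (intro order_trans[OF norm_add_square_le] mult_left_mono add_left_mono) auto
   qed simp
   also have "\<dots> = 2 / (real k)^2 * ((cmod (X k))^2 / lamk k (Suc 0)) + 2 / (real k)^2 * (C\<^sup>2 * R * U)"
    using kN by (simp add: lamk_Suc field_simps)
   also have "\<dots> \<le> 2 / N\<^sup>2 * ((cmod (X k))^2 / lamk k (Suc 0)) + 2 / N\<^sup>2 * (C\<^sup>2 * R * U)"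
    using N2 U0 R1 kN by (intro add_mono mult_right_mono divide_left_mono) (auto simp: lamk_Suc)
   finally show "(cmod (LBINT x. of_real (indicator {b..c} x * (wt 0 x * chebD k 0 x)) * v u 0 x))^2 \<le> \<dots>" .
  qed
  also have "\<dots> = 2 / N\<^sup>2 * (\<Sum>k\<in>K. (cmod (X k))^2 / lamk k (Suc 0)) + real (card K) * (2 / N\<^sup>2 * (C\<^sup>2 * R * U))"
   by (simp add: sum.distrib sum_distrib_left)
  \<comment> \<open>The boundary term gains nothing from orthogonality and is simply counted, with
    \<open>card K\<close> <= N. With \<open>\<delta>\<close> = N / R both contributions become 2 C^2
    (R / N) U.\<close>
  also have "\<dots> \<le> 2 / N\<^sup>2 * (\<delta> * (C\<^sup>2 * R ^ (2 * Suc 0) * U)) + N * (2 / N\<^sup>2 * (C\<^sup>2 * R * U))"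
  proof (intro add_mono mult_left_mono mult_right_mono card)
   show "(\<Sum>k\<in>K. (cmod (X k))^2 / lamk k (Suc 0)) \<le> \<delta> * (C\<^sup>2 * R ^ (2 * Suc 0) * U)"
    unfolding X_def
   proof (rule v_wt_bessel)
    show "Suc 0 \<le> k" if "k \<in> K" for k using K[OF that] N by simp
    show "wt (Suc 0) x \<le> \<delta>" if "x \<in> {b..c}" for x
     using that bc a by (intro wtend) (auto simp: abs_le_iff)
   qed (use M1 fin \<delta> in auto)
  qed (use U0 R1 in auto)
  also have "\<dots> = 4 * C\<^sup>2 * (R / N) * U"
   using N R1 by (simp add: \<delta>_def power2_eq_square field_simps)
  finally show ?thesis .
 qed
 have "(\<Sum>k\<in>K. (cmod (A k))^2) \<le> (\<Sum>k\<in>K. 3 * ((cmod (Amid k))^2 + (cmod (Ar k))^2 + (cmod (Al k))^2))"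
  unfolding split by (intro sum_mono norm_add3_square_le)
 also have "\<dots> = 3 * ((\<Sum>k\<in>K. (cmod (Amid k))^2) + (\<Sum>k\<in>K. (cmod (Ar k))^2) + (\<Sum>k\<in>K. (cmod (Al k))^2))"
  by (simp add: sum.distrib sum_distrib_left)
 \<comment> \<open>1 / \<open>\<delta>\<close> = R / N, so the middle and the two ends contribute 1
   + 4 + 4 multiples of C^2 (R / N) U; the factor 3 from squaring a sum of three terms makes
   27.\<close>
 also have "\<dots> \<le> 3 * ((1 / \<delta>) * (C\<^sup>2 * U) + 4 * C\<^sup>2 * (R / N) * U + 4 * C\<^sup>2 * (R / N) * U)"
  using mid ends[of a 1] ends[of "-1" "-a"] by (intro mult_left_mono add_mono) (auto simp: Ar_def Al_def)
 also have "\<dots> = 27 * C\<^sup>2 * (R / N) * U"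
  using N R1 by (simp add: \<delta>_def field_simps)
 finally show ?thesis .
qed

end

end

context local_kernel
begin

lemma G_measurable [measurable]: "G k \<in> borel_measurable borel"
proof -
 note [measurable] = Dm[OF le0]
 have "(\<lambda>(y, x). D 0 x y * cheb_fun k x) \<in> borel_measurable (borel \<Otimes>\<^sub>M lborel)"
 proof -
  have "(\<lambda>z. (snd z, fst z)) \<in> measurable (borel \<Otimes>\<^sub>M borel) (borel \<Otimes>\<^sub>M (borel :: real measure))" by measurable
  from measurable_compose[OF this Dm[OF le0]]
  have "(\<lambda>z. D 0 (snd z) (fst z)) \<in> borel_measurable (borel \<Otimes>\<^sub>M borel)" by simp
  then show ?thesis by (simp add: case_prod_unfold)
 qed
 from sigma_finite_measure.borel_measurable_lebesgue_integral[OF sigma_finite_lborel this]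
 show ?thesis unfolding G_def[abs_def] .
qed

text \<open>\<open>G k\<close> is bounded, and it vanishes for y outside [-1,2] because |x| < 1 and
  the window has length at most 1.\<close>

lemma G_square_integrable: "integrable lborel (\<lambda>y. (G k y)^2)"
proof (rule lint_bound)
 let ?B = "C * R * (LBINT x. \<bar>cheb_fun k x\<bar>)"
 have "integrable lborel (indicator {-1..2::real} :: real => real)" by (rule integrable_real_indicator) auto
 then show "integrable lborel (\<lambda>y. ?B\<^sup>2 * indicator {-1..2::real} y)" by (rule integrable_mult_right)
 show "AE y in lborel. norm ((G k y)^2) \<le> norm (?B\<^sup>2 * indicator {-1..2::real} y)"
 proof (rule AE_I2)
  fix y
  show "norm ((G k y)^2) \<le> norm (?B\<^sup>2 * indicator {-1..2::real} y)"
  proof (cases "y \<in> {-1..2}")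
   case True
   have "\<bar>G k y\<bar> \<le> (LBINT x. \<bar>D 0 x y * cheb_fun k x\<bar>)"
    unfolding G_def using integral_norm_bound[of lborel "\<lambda>x. D 0 x y * cheb_fun k x"] by simp
   also have "\<dots> \<le> (LBINT x. (C * R) * \<bar>cheb_fun k x\<bar>)"
    using integrable_cheb_fun[of k] C0 R1 Db[of 0]
    by (intro integral_mono_AE') (auto simp: abs_mult intro!: mult_right_mono)
   finally have "\<bar>G k y\<bar> \<le> ?B" by simp
   then show ?thesis using power_mono[of "\<bar>G k y\<bar>" ?B 2] True by simp
  next
   case False
   have "D 0 x y * cheb_fun k x = 0" for x
   proof (cases "\<bar>x\<bar> < 1")
    case True
    have "1 / R \<le> 1" using R1 by simp
    then have "y \<notin> {x..x + 1 / R}" using True False by auto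
    then show ?thesis by (simp add: Ds)
   qed (simp add: cheb_fun_outside)
   then have "G k y = 0" unfolding G_def by (simp only: integral_zero)
   then show ?thesis by simp
  qed
 qed
qed simp

end

section \<open>Dyadic frequency blocks\<close>

definition ndist :: "nat => nat => nat" where
 "ndist i j = (if i \<le> j then j - i else i - j)"

lemma sum_geometric_le:
 fixes r :: real
 assumes "finite F" "0 < r" "r < 1"
 shows "(\<Sum>n\<in>F. r ^ n) \<le> 1 / (1 - r)"
proof -
 have "(\<Sum>n\<in>F. r ^ n) \<le> (\<Sum>n. r ^ n)"
  using assms by (intro sum_le_suminf summable_geometric) auto
 also have "\<dots> = 1 / (1 - r)" using assms by (intro suminf_geometric) auto
 finally show ?thesis .
qed

lemma sum_ndist_le:
 fixes r :: real
 assumes F: "finite F" and r: "0 < r" "r < 1"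
 shows "(\<Sum>j\<in>F. r ^ ndist i j) \<le> 2 / (1 - r)"
proof -
 have "(\<Sum>j\<in>F. r ^ ndist i j) = (\<Sum>j\<in>{j\<in>F. i \<le> j}. r ^ ndist i j) + (\<Sum>j\<in>{j\<in>F. \<not> i \<le> j}. r ^ ndist i j)"
  using F by (subst sum.union_disjoint[symmetric]) (auto intro!: sum.cong)
 also have "(\<Sum>j\<in>{j\<in>F. i \<le> j}. r ^ ndist i j) = (\<Sum>n\<in>(\<lambda>j. j - i) ` {j\<in>F. i \<le> j}. r ^ n)"
  by (subst sum.reindex) (auto simp: inj_on_def ndist_def)
 also have "\<dots> \<le> 1 / (1 - r)" using F r by (intro sum_geometric_le) auto
 also have "(\<Sum>j\<in>{j\<in>F. \<not> i \<le> j}. r ^ ndist i j) = (\<Sum>n\<in>(\<lambda>j. i - j) ` {j\<in>F. \<not> i \<le> j}. r ^ n)"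
  by (subst sum.reindex) (auto simp: inj_on_def ndist_def)
 also have "\<dots> \<le> 1 / (1 - r)" using F r by (intro sum_geometric_le) auto
 finally show ?thesis by simp
qed

lemma floor_log_block: "k \<noteq> 0 ==> floor_log k = j \<longleftrightarrow> k \<in> {2 ^ j..<2 ^ Suc j}"
 using floor_log_eqI[of k j] floor_log_exp2_le[of k] floor_log_exp2_gt[of k] by auto

text \<open>29 = 27 + 2: \<open>A_low\<close> on a block at or below the scale plus
  \<open>A_sup\<close> for k = 0. The term M^M comes from \<open>lamk_lower\<close> above the scale,
  the last one from those k < M that lie above the scale.\<close>

definition dyadic_const :: "real => nat => real" where
 "dyadic_const s M = 29 + real M ^ M + 2 * real M ^ (2 * M + 2)"

locale dyadic_kernel = local_kernel D C "2 ^ i" M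
 for D :: "nat => real => real => real" and C :: real and i M :: nat +
 fixes s :: real
 assumes s: "1/2 < s" "s < real M"
begin

context
 fixes u :: "real => complex"
 assumes um [measurable]: "u \<in> borel_measurable borel"
  and u2: "integrable lborel (\<lambda>y. (cmod (u y))^2)"
begin

text \<open>Block j collects the k in [2^j, 2^(j+1)); k = 0 falls into block 0 because
  \<open>floor_log 0 = 0\<close>. Blocks j <= i are handled by \<open>A_low\<close> with N = 2^j,
  blocks j > i by \<open>A_high\<close> with \<open>lamk k M\<close> of order 2^(2 M j).\<close>

lemma block_bound:
 assumes fin: "finite K"
 shows "(\<Sum>k\<in>{k\<in>K. floor_log k = j}. (cmod (A u k))^2) \<le> dyadic_const s M * C\<^sup>2 *
   (if j \<le> i then 2 powr (real i - real j) else 2 powr (- 2 * real M * (real j - real i))) * U u"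
proof -
 note [simp] = dyadic_const_def
 have UU: "0 \<le> U u" by (rule U0[OF um u2])
 have CU: "0 \<le> C\<^sup>2 * U u" using UU by simp
 define Kp where "Kp = {k\<in>K. floor_log k = j \<and> k \<noteq> 0}"
 have finp: "finite Kp" and kb: "\<And>k. k \<in> Kp ==> k \<in> {2 ^ j..<2 ^ Suc j}"
  using fin floor_log_block by (auto simp: Kp_def)
 have card: "card Kp \<le> 2 ^ j"
 proof -
  have "card Kp \<le> card {2 ^ j..<(2 ^ Suc j :: nat)}" using kb by (intro card_mono) auto
  then show ?thesis by simp
 qed
 have M1': "1 \<le> real M" using M1 by simp
 show ?thesis
 proof (cases "j \<le> i")
  case True
  have "(\<Sum>k\<in>{k\<in>K. floor_log k = j}. (cmod (A u k))^2) \<le> (\<Sum>k\<in>Kp. (cmod (A u k))^2) + (if j = 0 then (cmod (A u 0))^2 else 0)"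
  proof (cases "0 \<in> K \<and> j = 0")
   case True
   then have "{k\<in>K. floor_log k = j} = insert 0 Kp" by (auto simp: Kp_def)
   then show ?thesis using True finp by (simp add: Kp_def)
  next
   case False
   then have "{k\<in>K. floor_log k = j} = Kp" by (auto simp: Kp_def intro!: Nat.gr0I)
   then show ?thesis by simp
  qed
  also have "(\<Sum>k\<in>Kp. (cmod (A u k))^2) \<le> 27 * C\<^sup>2 * (2 ^ i / 2 ^ j) * U u"
  proof (rule A_low[OF um u2 finp])
   show "(2::real) ^ j \<le> real k" if "k \<in> Kp" for k
    using kb[OF that] by (metis atLeastLessThan_iff numeral_power_le_of_nat_cancel_iff)
   show "real (card Kp) \<le> 2 ^ j" using card by (metis of_nat_le_numeral_power_cancel_iff)
  qed (use True in auto)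
  also have "(if j = 0 then (cmod (A u 0))^2 else 0) \<le> 2 * C\<^sup>2 * (2 ^ i / 2 ^ j) * U u"
   using A_sup[OF um u2, of 0] CU UU by (auto simp: mult_ac)
  also have "27 * C\<^sup>2 * (2 ^ i / 2 ^ j) * U u + 2 * C\<^sup>2 * (2 ^ i / 2 ^ j) * U u = 29 * (C\<^sup>2 * U u * (2 ^ i / 2 ^ j))"
   by (simp add: algebra_simps)
  also have "\<dots> \<le> dyadic_const s M * (C\<^sup>2 * U u * (2 ^ i / 2 ^ j))"
   using CU by (intro mult_right_mono) auto
  finally show ?thesis using True by (simp add: powr_diff powr_realpow mult_ac)
 next
  case False
  then have ij: "i < j" by simp
  have eqp: "2 powr (- 2 * real M * (real j - real i)) = 2 ^ (2 * M * i) / 2 ^ (2 * M * j)"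
  proof -
   have "- 2 * real M * (real j - real i) = real (2 * M * i) - real (2 * M * j)" by (simp add: algebra_simps)
   then show ?thesis by (simp only: powr_diff) (simp only: powr_realpow zero_less_numeral)
  qed
  define E where "E = (2::real) ^ (2 * M * i) / 2 ^ (2 * M * j)"
  have E0: "0 < E" by (simp add: E_def)
  have Keq: "{k\<in>K. floor_log k = j} = {k\<in>Kp. M \<le> k} \<union> {k\<in>Kp. k < M}"
   using ij by (auto simp: Kp_def intro!: Nat.gr0I)
  have hi: "(\<Sum>k\<in>{k\<in>Kp. M \<le> k}. (cmod (A u k))^2) \<le> real M ^ M * E * (C\<^sup>2 * U u)"
  proof -
   have "(\<Sum>k\<in>{k\<in>Kp. M \<le> k}. (cmod (A u k))^2) \<le> (\<Sum>k\<in>{k\<in>Kp. M \<le> k}. (real M ^ M / 2 ^ (2 * M * j)) * (lamk k M * (cmod (A u k))^2))"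
   proof (rule sum_mono)
    fix k assume k: "k \<in> {k\<in>Kp. M \<le> k}"
    have "(2::real) ^ j \<le> real k"
     using kb[of k] k by (metis (mono_tags, lifting) atLeastLessThan_iff mem_Collect_eq numeral_power_le_of_nat_cancel_iff)
    then have "((2::real) ^ j) ^ (2 * M) \<le> real k ^ (2 * M)" by (intro power_mono) auto
    then have "2 ^ (2 * M * j) \<le> ((real k)^2) ^ M" by (simp add: power_mult[symmetric] mult.commute)
    also have "\<dots> = real M ^ M * ((real k)^2 / real M) ^ M" using M1' by (simp add: power_divide)
    also have "\<dots> \<le> real M ^ M * lamk k M" using k M1 by (intro mult_left_mono lamk_lower) auto
    finally have "1 \<le> real M ^ M / 2 ^ (2 * M * j) * lamk k M" by (simp add: pos_le_divide_eq)
    then have "1 * (cmod (A u k))^2 \<le> (real M ^ M / 2 ^ (2 * M * j) * lamk k M) * (cmod (A u k))^2"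
     by (intro mult_right_mono) auto
    then show "(cmod (A u k))^2 \<le> (real M ^ M / 2 ^ (2 * M * j)) * (lamk k M * (cmod (A u k))^2)" by (simp only: mult.assoc mult_1)
   qed
   also have "\<dots> = (real M ^ M / 2 ^ (2 * M * j)) * (\<Sum>k\<in>{k\<in>Kp. M \<le> k}. lamk k M * (cmod (A u k))^2)"
    by (simp only: sum_distrib_left)
   also have "\<dots> \<le> (real M ^ M / 2 ^ (2 * M * j)) * (C\<^sup>2 * (2 ^ i) ^ (2 * M) * U u)"
    using finp by (intro mult_left_mono A_high[OF um u2]) auto
   also have "\<dots> = real M ^ M * E * (C\<^sup>2 * U u)"
    by (simp add: E_def power_mult[symmetric] mult_ac)
   finally show ?thesis .
  qed
  \<comment> \<open>\<open>A_high\<close> does not cover k < M. But if block j > i contains such a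
    k, then 2^i <= 2^j <= M, the claimed decay E is at least M^(-2 M), and the crude bound
    \<open>A_sup\<close> for at most M frequencies suffices.\<close>
  have lo: "(\<Sum>k\<in>{k\<in>Kp. k < M}. (cmod (A u k))^2) \<le> 2 * real M ^ (2 * M + 2) * E * (C\<^sup>2 * U u)"
  proof (cases "{k\<in>Kp. k < M} = {}")
   case True
   show ?thesis unfolding True using E0 CU by simp
  next
   case False
   then obtain k where k: "k \<in> Kp" "k < M" by auto
   have jM: "(2::nat) ^ j \<le> M" using kb[OF k(1)] k(2) by auto
   then have jM': "(2::real) ^ j \<le> real M" by (metis numeral_power_le_of_nat_cancel_iff)
   have iM: "(2::real) ^ i \<le> real M" using ij by (intro order_trans[OF power_increasing jM']) auto
   have "(\<Sum>k\<in>{k\<in>Kp. k < M}. (cmod (A u k))^2) \<le> (\<Sum>k\<in>{k\<in>Kp. k < M}. 2 * C\<^sup>2 * real M * U u)"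
   proof (rule sum_mono)
    fix k
    have "(cmod (A u k))^2 \<le> 2 * (C\<^sup>2 * U u) * 2 ^ i" using A_sup[OF um u2, of k] by (simp add: mult_ac)
    also have "\<dots> \<le> 2 * (C\<^sup>2 * U u) * real M" using CU iM by (intro mult_left_mono) auto
    finally show "(cmod (A u k))^2 \<le> 2 * C\<^sup>2 * real M * U u" by (simp add: mult_ac)
   qed
   also have "\<dots> = real (card {k\<in>Kp. k < M}) * (2 * real M * (C\<^sup>2 * U u))" by simp
   also have "\<dots> \<le> real M * (2 * real M * (C\<^sup>2 * U u))"
   proof (intro mult_right_mono)
    have "card {k\<in>Kp. k < M} \<le> card {..<M}" by (intro card_mono) auto
    then show "real (card {k\<in>Kp. k < M}) \<le> real M" by simp
   qed (use CU in auto)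
   also have "\<dots> = 2 * real M ^ 2 * 1 * (C\<^sup>2 * U u)" by (simp add: power2_eq_square)
   also have "\<dots> \<le> 2 * real M ^ 2 * (real M ^ (2 * M) * E) * (C\<^sup>2 * U u)"
   proof (intro mult_right_mono mult_left_mono)
    have "(2::real) ^ (2 * M * j) \<le> real M ^ (2 * M)"
     using power_mono[OF jM', of "2 * M"] by (simp add: power_mult[symmetric] mult.commute)
    also have "\<dots> \<le> real M ^ (2 * M) * 2 ^ (2 * M * i)"
     using M1' by (simp add: mult_le_cancel_left1)
    finally show "1 \<le> real M ^ (2 * M) * E" by (simp add: E_def pos_le_divide_eq)
   qed (use CU in auto)
   also have "\<dots> = 2 * real M ^ (2 * M + 2) * E * (C\<^sup>2 * U u)" by (simp add: power_add power2_eq_square mult_ac)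
   finally show ?thesis .
  qed
  have "(\<Sum>k\<in>{k\<in>K. floor_log k = j}. (cmod (A u k))^2)
   = (\<Sum>k\<in>{k\<in>Kp. M \<le> k}. (cmod (A u k))^2) + (\<Sum>k\<in>{k\<in>Kp. k < M}. (cmod (A u k))^2)"
   unfolding Keq using finp by (intro sum.union_disjoint) auto
  also have "\<dots> \<le> real M ^ M * E * (C\<^sup>2 * U u) + 2 * real M ^ (2 * M + 2) * E * (C\<^sup>2 * U u)"
   using hi lo by (rule add_mono)
  also have "\<dots> = (real M ^ M + 2 * real M ^ (2 * M + 2)) * (E * (C\<^sup>2 * U u))"
   by (simp add: algebra_simps)
  also have "\<dots> \<le> dyadic_const s M * (E * (C\<^sup>2 * U u))"
   using CU E0 by (intro mult_right_mono) auto
  finally show ?thesis unfolding if_not_P[OF False] eqp E_def[symmetric] by (simp only: mult_ac)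
 qed
qed

text \<open>After weighting, block j has spare decay with exponent 2 s - 1 per step below the scale
  and 2 M - 2 s per step above it, both at least 2 \<open>\<epsilon>\<close>. One half absorbs the
  growing weight (1/r)^|i-j|, the other half makes the sum over j geometric. Here s > 1/2 and s < M
  are decisive.\<close>

lemma dyadic_bound:
 assumes fin: "finite K" and \<epsilon>: "\<epsilon> = min (s - 1/2) (real M - s)" and r: "r = 2 powr (- \<epsilon>)"
 shows "(\<Sum>k\<in>K. ((1 + (real k)^2) powr s * (1 / r) ^ ndist i (floor_log k)) * (cmod (A u k))^2)
  \<le> (4 powr s * dyadic_const s M * C\<^sup>2 * (2 / (1 - r))) * (2 powr (s * real i))^2 * U u"
proof -
 have \<epsilon>0: "0 < \<epsilon>" using s by (simp add: \<epsilon>)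
 have e1: "\<epsilon> \<le> s - 1/2" "\<epsilon> \<le> real M - s" by (simp_all add: \<epsilon>)
 have r0: "0 < r" by (simp add: r)
 have r1: "r < 1" unfolding r using \<epsilon>0 by (simp add: powr_less_one)
 have UU: "0 \<le> U u" by (rule U0[OF um u2])
 have dc: "0 \<le> dyadic_const s M" by (simp add: dyadic_const_def)
 have rp: "r ^ n = 2 powr (- \<epsilon> * real n)" for n
  using r0 by (simp add: r powr_realpow[symmetric] powr_powr)
 have blk: "(\<Sum>k\<in>{k\<in>K. floor_log k = j}. ((1 + (real k)^2) powr s * (1 / r) ^ ndist i (floor_log k)) * (cmod (A u k))^2)
  \<le> (4 powr s * dyadic_const s M * C\<^sup>2 * (2 powr (s * real i))^2 * U u) * r ^ ndist i j" for j
 proof -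
  define b where "b = (if j \<le> i then 2 powr (real i - real j) else 2 powr (- 2 * real M * (real j - real i)))"
  have w: "(1 + (real k)^2) powr s \<le> 4 powr s * 2 powr (2 * s * real j)" if "floor_log k = j" for k
  proof -
   have "real k \<le> 2 * 2 ^ j"
   proof (cases "k = 0")
    case False
    then have "k < 2 ^ Suc j" using floor_log_block that by auto
    then have "k \<le> 2 * 2 ^ j" by simp
    then show ?thesis by (metis (mono_tags, lifting) of_nat_le_iff of_nat_mult of_nat_numeral of_nat_power)
   qed simp
   \<comment> \<open>For k > 0 in block j, k + 1 <= 2 * 2^j, and squaring gives 1 + k^2 <= 4 * 4^j;
     this is the origin of the factor 4 powr s.\<close>
   have "(real k)^2 + 1 \<le> 4 * (2 ^ j)^2"
   proof (cases "k = 0")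
    case True
    have "(1::real) \<le> (2 ^ j)^2" by (simp add: one_le_power)
    then have "0 + 1 \<le> 4 * (2 ^ j :: real)^2" by linarith
    then show ?thesis using True by simp
   next
    case False
    then have "k < 2 ^ Suc j" using floor_log_block that by auto
    then have "k + 1 \<le> 2 * 2 ^ j" by simp
    then have "real k + 1 \<le> 2 * 2 ^ j" by (metis (mono_tags, lifting) of_nat_1 of_nat_add of_nat_le_iff of_nat_mult of_nat_numeral of_nat_power)
    then have "(real k + 1)^2 \<le> (2 * 2 ^ j)^2" by (intro power_mono) auto
    then show ?thesis by (simp add: power2_eq_square algebra_simps)
   qed
   then have "(1 + (real k)^2) powr s \<le> (4 * (2 ^ j)^2) powr s"
    using s by (intro powr_mono2) (auto simp: add.commute)
   also have "\<dots> = 4 powr s * ((2 ^ j)^2) powr s" by (rule powr_mult)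
   also have "((2 ^ j)^2 :: real) = 2 powr (2 * real j)"
   proof -
    have "(2::real) powr (2 * real j) = 2 powr real (j * 2)" by (simp add: mult.commute)
    then show ?thesis by (simp only: powr_realpow zero_less_numeral power_mult)
   qed
   finally show ?thesis by (simp add: powr_powr mult_ac)
  qed
  have "(\<Sum>k\<in>{k\<in>K. floor_log k = j}. ((1 + (real k)^2) powr s * (1 / r) ^ ndist i (floor_log k)) * (cmod (A u k))^2)
   \<le> (\<Sum>k\<in>{k\<in>K. floor_log k = j}. ((4 powr s * 2 powr (2 * s * real j)) * (1 / r) ^ ndist i j) * (cmod (A u k))^2)"
   using r0 w by (intro sum_mono mult_right_mono) auto
  also have "\<dots> = ((4 powr s * 2 powr (2 * s * real j)) * (1 / r) ^ ndist i j) * (\<Sum>k\<in>{k\<in>K. floor_log k = j}. (cmod (A u k))^2)"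
   by (simp only: sum_distrib_left)
  also have "\<dots> \<le> ((4 powr s * 2 powr (2 * s * real j)) * (1 / r) ^ ndist i j) * (dyadic_const s M * C\<^sup>2 * b * U u)"
   unfolding b_def using r0 by (intro mult_left_mono block_bound fin) auto
  also have "\<dots> = (4 powr s * dyadic_const s M * C\<^sup>2 * U u) * (2 powr (2 * s * real j) * (1 / r) ^ ndist i j * b)"
   by (simp add: mult_ac)
  also have "\<dots> \<le> (4 powr s * dyadic_const s M * C\<^sup>2 * U u) * ((2 powr (s * real i))^2 * r ^ ndist i j)"
  proof (rule mult_left_mono)
   have "(1 / r) ^ ndist i j = 2 powr (\<epsilon> * real (ndist i j))"
   proof -
    have "(1 / r) ^ ndist i j = 1 / 2 powr (- (\<epsilon> * real (ndist i j)))"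
     by (simp only: power_one_over rp minus_mult_left)
    then show ?thesis by (simp only: powr_minus_divide) simp
   qed
   then have "2 powr (2 * s * real j) * (1 / r) ^ ndist i j * b = 2 powr (2 * s * real j + \<epsilon> * real (ndist i j)
     + (if j \<le> i then real i - real j else - 2 * real M * (real j - real i)))"
    by (simp add: b_def powr_add)
   also have "\<dots> \<le> 2 powr (2 * (s * real i) + (- \<epsilon> * real (ndist i j)))"
   proof (rule powr_mono)
    show "2 * s * real j + \<epsilon> * real (ndist i j) + (if j \<le> i then real i - real j else - 2 * real M * (real j - real i))
     \<le> 2 * (s * real i) + (- \<epsilon> * real (ndist i j))"
    proof (cases "j \<le> i")
     case True
     have nd: "real (ndist i j) = real i - real j" using True by (simp add: ndist_def)
     have "0 \<le> (2 * s - 2 * \<epsilon> - 1) * (real i - real j)" using True e1 by (intro mult_nonneg_nonneg) auto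
     then show ?thesis unfolding nd using True by (simp add: algebra_simps)
    next
     case False
     have nd: "real (ndist i j) = real j - real i" using False by (simp add: ndist_def)
     have "0 \<le> (2 * real M - 2 * s - 2 * \<epsilon>) * (real j - real i)" using False e1 by (intro mult_nonneg_nonneg) auto
     then show ?thesis unfolding nd using False by (simp add: algebra_simps)
    qed
   qed simp
   also have "\<dots> = (2 powr (s * real i))^2 * r ^ ndist i j"
    unfolding powr_add rp by (simp only: mult_2 powr_add power2_eq_square)
   finally show "2 powr (2 * s * real j) * (1 / r) ^ ndist i j * b \<le> (2 powr (s * real i))^2 * r ^ ndist i j" .
  qed (use UU dc in auto)
  finally show ?thesis by (simp add: mult_ac)
 qed
 have "(\<Sum>k\<in>K. ((1 + (real k)^2) powr s * (1 / r) ^ ndist i (floor_log k)) * (cmod (A u k))^2)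
  = (\<Sum>j\<in>floor_log ` K. \<Sum>k\<in>{k\<in>K. floor_log k = j}. ((1 + (real k)^2) powr s * (1 / r) ^ ndist i (floor_log k)) * (cmod (A u k))^2)"
  using fin by (intro sum.group[symmetric]) auto
 also have "\<dots> \<le> (\<Sum>j\<in>floor_log ` K. (4 powr s * dyadic_const s M * C\<^sup>2 * (2 powr (s * real i))^2 * U u) * r ^ ndist i j)"
  by (intro sum_mono blk)
 also have "\<dots> = (4 powr s * dyadic_const s M * C\<^sup>2 * (2 powr (s * real i))^2 * U u) * (\<Sum>j\<in>floor_log ` K. r ^ ndist i j)"
  by (simp only: sum_distrib_left)
 also have "\<dots> \<le> (4 powr s * dyadic_const s M * C\<^sup>2 * (2 powr (s * real i))^2 * U u) * (2 / (1 - r))"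
  using fin r0 r1 UU dc by (intro mult_left_mono sum_ndist_le) auto
 finally show ?thesis by (simp add: mult_ac)
qed

end

lemma dyadic_bessel_family:
 assumes fin: "finite K" and \<epsilon>: "\<epsilon> = min (s - 1/2) (real M - s)" and r: "r = 2 powr (- \<epsilon>)"
 shows "bessel_family K (\<lambda>k y. sqrt ((1 + (real k)^2) powr s * (1 / r) ^ ndist i (floor_log k)) * G k y)
  ((4 powr s * dyadic_const s M * C\<^sup>2 * (2 / (1 - r))) * (2 powr (s * real i))^2)"
 unfolding bessel_family_def
proof (intro conjI ballI allI impI)
 have r1: "0 < r" "r < 1" using s by (simp_all add: r \<epsilon> powr_less_one)
 then show "0 \<le> (4 powr s * dyadic_const s M * C\<^sup>2 * (2 / (1 - r))) * (2 powr (s * real i))^2"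
  by (simp add: dyadic_const_def)
 fix u :: "real => complex" assume u: "u \<in> borel_measurable borel" "integrable lborel (\<lambda>x. (cmod (u x))^2)"
 have "(cmod (LBINT x. of_real (sqrt ((1 + (real k)^2) powr s * (1 / r) ^ ndist i (floor_log k)) * G k x) * u x))^2
  = ((1 + (real k)^2) powr s * (1 / r) ^ ndist i (floor_log k)) * (cmod (A u k))^2" for k
 proof -
  have "(LBINT x. of_real (sqrt ((1 + (real k)^2) powr s * (1 / r) ^ ndist i (floor_log k)) * G k x) * u x)
   = of_real (sqrt ((1 + (real k)^2) powr s * (1 / r) ^ ndist i (floor_log k))) * A u k"
   by (simp only: A_def[OF u] of_real_mult mult.assoc integral_mult_right_zero)
  then show ?thesis using r1 by (simp only: norm_mult power_mult_distrib norm_of_real power2_abs real_sqrt_pow2) simp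
 qed
 then show "(\<Sum>k\<in>K. (cmod (LBINT x. of_real (sqrt ((1 + (real k)^2) powr s * (1 / r) ^ ndist i (floor_log k)) * G k x) * u x))^2)
  \<le> (4 powr s * dyadic_const s M * C\<^sup>2 * (2 / (1 - r))) * (2 powr (s * real i))^2 * (LBINT x. (cmod (u x))^2)"
  using dyadic_bound[OF u fin \<epsilon> r] by (simp only: U_def[OF u])
qed (use fin in \<open>auto simp: power_mult_distrib intro!: integrable_mult_right G_square_integrable\<close>)

end

section \<open>Multilevel smoothing\<close>

text \<open>n-fold differentiability in x with p-th derivative at most C R^p: each recursion step
  multiplies the constant by R. Constants of sums, products and dilations are tracked without naming
  the derivatives.\<close>

fun scaled_ck :: "real => nat => real => (real => real => real) => bool" where
 "scaled_ck R 0 C k = ((\<lambda>z. k (fst z) (snd z)) \<in> borel_measurable (borel \<Otimes>\<^sub>M borel) \<and> (\<forall>x y. \<bar>k x y\<bar> \<le> C))"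
| "scaled_ck R (Suc n) C k = ((\<lambda>z. k (fst z) (snd z)) \<in> borel_measurable (borel \<Otimes>\<^sub>M borel) \<and> (\<forall>x y. \<bar>k x y\<bar> \<le> C) \<and>
  (\<exists>k'. (\<forall>x y. ((\<lambda>x. k x y) has_real_derivative k' x y) (at x)) \<and> scaled_ck R n (C * R) k'))"

lemma scaled_ck_0D: "scaled_ck R n C k ==> (\<lambda>z. k (fst z) (snd z)) \<in> borel_measurable (borel \<Otimes>\<^sub>M borel)"
 and scaled_ck_bound: "scaled_ck R n C k ==> \<bar>k x y\<bar> \<le> C"
 by (cases n; simp)+

lemma scaled_ck_C_nonneg: "scaled_ck R n C k ==> 0 \<le> C"
 using scaled_ck_bound[of R n C k 0 0] by linarith

lemma scaled_ck_SucI: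
 "(\<lambda>z. k (fst z) (snd z)) \<in> borel_measurable (borel \<Otimes>\<^sub>M borel) ==> (\<And>x y. \<bar>k x y\<bar> \<le> C) ==>
 (\<And>x y. ((\<lambda>x. k x y) has_real_derivative k' x y) (at x)) ==> scaled_ck R n (C * R) k' ==> scaled_ck R (Suc n) C k"
 by auto

lemma scaled_ck_mono: "scaled_ck R n C k ==> C \<le> C' ==> 0 \<le> R ==> R \<le> R' ==> scaled_ck R' n C' k"
proof (induction n arbitrary: C C' k)
 case 0
 then show ?case by (auto intro: order_trans)
next
 case (Suc n)
 note C0 = scaled_ck_C_nonneg[OF Suc.prems(1)]
 from Suc.prems(1) obtain k' where k': "\<And>x y. ((\<lambda>x. k x y) has_real_derivative k' x y) (at x)" "scaled_ck R n (C * R) k'"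
  by auto
 have "C * R \<le> C' * R'" using Suc.prems C0 by (intro mult_mono) auto
 then have "scaled_ck R' n (C' * R') k'" using Suc.IH[OF k'(2)] Suc.prems by auto
 then show ?case
  using order_trans[OF scaled_ck_bound[OF Suc.prems(1)] Suc.prems(2)]
  by (intro scaled_ck_SucI[OF scaled_ck_0D[OF Suc.prems(1)] _ k'(1)]) auto
qed

lemma scaled_ck_SucD: "scaled_ck R (Suc n) C k ==> scaled_ck R n C k"
proof (induction n arbitrary: C k)
 case (Suc n)
 from Suc.prems obtain k' where k': "\<And>x y. ((\<lambda>x. k x y) has_real_derivative k' x y) (at x)" "scaled_ck R (Suc n) (C * R) k'"
  by auto
 show ?case
  by (rule scaled_ck_SucI[OF scaled_ck_0D[OF Suc.prems] scaled_ck_bound[OF Suc.prems] k'(1) Suc.IH[OF k'(2)]])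
qed auto

lemma scaled_ck_add: "scaled_ck R n C k ==> scaled_ck R n C' l ==> scaled_ck R n (C + C') (\<lambda>x y. k x y + l x y)"
proof (induction n arbitrary: C C' k l)
 case 0
 then have [measurable]: "(\<lambda>z. k (fst z) (snd z)) \<in> borel_measurable (borel \<Otimes>\<^sub>M borel)" "(\<lambda>z. l (fst z) (snd z)) \<in> borel_measurable (borel \<Otimes>\<^sub>M borel)" by auto
 from 0 show ?case by (auto intro!: order_trans[OF abs_triangle_ineq] add_mono)
next
 case (Suc n)
 note [measurable] = scaled_ck_0D[OF Suc.prems(1)] scaled_ck_0D[OF Suc.prems(2)]
 from Suc.prems(1) obtain k' where k': "\<And>x y. ((\<lambda>x. k x y) has_real_derivative k' x y) (at x)" "scaled_ck R n (C * R) k'"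
  by auto
 from Suc.prems(2) obtain l' where l': "\<And>x y. ((\<lambda>x. l x y) has_real_derivative l' x y) (at x)" "scaled_ck R n (C' * R) l'"
  by auto
 show ?case
 proof (rule scaled_ck_SucI)
  show "((\<lambda>x. k x y + l x y) has_real_derivative (k' x y + l' x y)) (at x)" for x y
   by (intro DERIV_add k' l')
  show "scaled_ck R n ((C + C') * R) (\<lambda>x y. k' x y + l' x y)"
   using Suc.IH[OF k'(2) l'(2)] by (simp add: distrib_right)
  show "\<bar>k x y + l x y\<bar> \<le> C + C'" for x y
   using scaled_ck_bound[OF Suc.prems(1), of x y] scaled_ck_bound[OF Suc.prems(2), of x y] by linarith
 qed measurable
qed

text \<open>The product rule has two terms at each order, whence 2^n.\<close>

lemma scaled_ck_mult: "scaled_ck R n C k ==> scaled_ck R n C' l ==> scaled_ck R n (2 ^ n * C * C') (\<lambda>x y. k x y * l x y)"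
proof (induction n arbitrary: C C' k l)
 case 0
 then have [measurable]: "(\<lambda>z. k (fst z) (snd z)) \<in> borel_measurable (borel \<Otimes>\<^sub>M borel)" "(\<lambda>z. l (fst z) (snd z)) \<in> borel_measurable (borel \<Otimes>\<^sub>M borel)" by auto
 from 0 show ?case by (auto simp: abs_mult intro!: mult_mono intro: order_trans[OF abs_ge_zero])
next
 case (Suc n)
 note [measurable] = scaled_ck_0D[OF Suc.prems(1)] scaled_ck_0D[OF Suc.prems(2)]
 note C0 = scaled_ck_C_nonneg[OF Suc.prems(1)] scaled_ck_C_nonneg[OF Suc.prems(2)]
 from Suc.prems(1) obtain k' where k': "\<And>x y. ((\<lambda>x. k x y) has_real_derivative k' x y) (at x)" "scaled_ck R n (C * R) k'"
  by auto
 from Suc.prems(2) obtain l' where l': "\<And>x y. ((\<lambda>x. l x y) has_real_derivative l' x y) (at x)" "scaled_ck R n (C' * R) l'"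
  by auto
 show ?case
 proof (rule scaled_ck_SucI)
  show "((\<lambda>x. k x y * l x y) has_real_derivative (k' x y * l x y + l' x y * k x y)) (at x)" for x y
   by (intro DERIV_mult k' l')
  have "scaled_ck R n (2 ^ n * (C * R) * C' + 2 ^ n * (C' * R) * C) (\<lambda>x y. k' x y * l x y + l' x y * k x y)"
   by (intro scaled_ck_add Suc.IH k'(2) l'(2) scaled_ck_SucD[OF Suc.prems(1)] scaled_ck_SucD[OF Suc.prems(2)])
  then show "scaled_ck R n (2 ^ Suc n * C * C' * R) (\<lambda>x y. k' x y * l x y + l' x y * k x y)"
   by (simp add: algebra_simps)
  have "\<bar>k x y * l x y\<bar> \<le> 1 * (C * C')" for x y
   using scaled_ck_bound[OF Suc.prems(1), of x y] scaled_ck_bound[OF Suc.prems(2), of x y] C0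
   by (auto simp: abs_mult intro!: mult_mono)
  also have "\<dots> \<le> 2 ^ Suc n * (C * C')" using C0 by (intro mult_right_mono one_le_power) auto
  finally show "\<bar>k x y * l x y\<bar> \<le> 2 ^ Suc n * C * C'" for x y by (simp add: mult.assoc)
 qed measurable
qed

lemma scaled_ck_cmult: "scaled_ck R n C k ==> scaled_ck R n (\<bar>a\<bar> * C) (\<lambda>x y. a * k x y)"
proof (induction n arbitrary: C k)
 case 0
 then have [measurable]: "(\<lambda>z. k (fst z) (snd z)) \<in> borel_measurable (borel \<Otimes>\<^sub>M borel)" by auto
 from 0 show ?case by (auto simp: abs_mult intro!: mult_left_mono)
next
 case (Suc n)
 note [measurable] = scaled_ck_0D[OF Suc.prems]
 from Suc.prems obtain k' where k': "\<And>x y. ((\<lambda>x. k x y) has_real_derivative k' x y) (at x)" "scaled_ck R n (C * R) k'"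
  by auto
 show ?case
 proof (rule scaled_ck_SucI)
  show "((\<lambda>x. a * k x y) has_real_derivative (a * k' x y)) (at x)" for x y by (intro DERIV_cmult k')
  show "scaled_ck R n (\<bar>a\<bar> * C * R) (\<lambda>x y. a * k' x y)" using Suc.IH[OF k'(2)] by (simp add: mult.assoc)
  show "\<bar>a * k x y\<bar> \<le> \<bar>a\<bar> * C" for x y
   using scaled_ck_bound[OF Suc.prems, of x y] by (auto simp: abs_mult intro!: mult_left_mono)
 qed measurable
qed

lemma smooth_compact_support_bounded:
 assumes "smooth_real f" "\<And>x. x \<notin> {a..b} ==> f x = 0"
 obtains B where "0 \<le> B" "\<And>x. \<bar>f x\<bar> \<le> B"
proof -
 have "bounded (f ` {a..b})"
  by (intro compact_imp_bounded compact_continuous_image smooth_real_continuous assms) simp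
 then obtain B where B: "\<And>x. x \<in> {a..b} ==> \<bar>f x\<bar> \<le> B" by (fastforce simp: bounded_iff)
 show ?thesis
 proof
  show "\<bar>f x\<bar> \<le> \<bar>B\<bar>" for x using B[of x] assms(2)[of x] by (cases "x \<in> {a..b}") auto
 qed simp
qed

lemma deriv_zero_outside:
 assumes "\<And>x. (f has_real_derivative f' x) (at x)" "\<And>x. x \<notin> {a..b} ==> f x = (0::real)" "x \<notin> {a..b}"
 shows "f' x = 0"
proof -
 have "open (- {a..b})" by (simp add: open_Compl)
 then have "(f has_real_derivative 0) (at x)"
  using assms by - (rule has_field_derivative_transform_within_open[of "\<lambda>_. 0" 0 x "- {a..b}"], auto)
 then show ?thesis using assms(1) DERIV_unique by blast
qed

text \<open>Each derivative of f(R (y - x)) in x produces the factor -R, precisely what the scale R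
  allows; C is therefore independent of R.\<close>

lemma scaled_ck_dilation:
 assumes "smooth_real f" "\<And>x. x \<notin> {a..b} ==> f x = 0"
 shows "\<exists>C. \<forall>R>0. scaled_ck R n C (\<lambda>x y. f (R * (y - x)))"
 using assms
proof (induction n arbitrary: f)
 case (0 f)
 then obtain B where B: "0 \<le> B" "\<And>x. \<bar>f x\<bar> \<le> B" using smooth_compact_support_bounded by blast
 note [measurable] = smooth_real_measurable[OF 0(1)]
 show ?case using B by auto
next
 case (Suc n f)
 then obtain B where B: "0 \<le> B" "\<And>x. \<bar>f x\<bar> \<le> B" using smooth_compact_support_bounded by blast
 note [measurable] = smooth_real_measurable[OF Suc.prems(1)]
 note d = smooth_real_deriv[OF Suc.prems(1)]
 have dz: "deriv f x = 0" if "x \<notin> {a..b}" for x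
  by (rule deriv_zero_outside[OF d(1) Suc.prems(2) that])
 obtain C where C: "\<And>R. R > 0 ==> scaled_ck R n C (\<lambda>x y. deriv f (R * (y - x)))"
  using Suc.IH[OF d(2) dz] by blast
 have "scaled_ck R (Suc n) (max B C) (\<lambda>x y. f (R * (y - x)))" if R: "R > 0" for R
 proof (rule scaled_ck_SucI)
  show "((\<lambda>x. f (R * (y - x))) has_real_derivative ((- R) * deriv f (R * (y - x)))) (at x)" for x y
  proof -
   have "((\<lambda>x. R * (y - x)) has_real_derivative (- R)) (at x)" by (auto intro!: derivative_eq_intros)
   from DERIV_chain2[OF d(1) this] show ?thesis by (simp add: mult.commute)
  qed
  have "scaled_ck R n (\<bar>- R\<bar> * C) (\<lambda>x y. (- R) * deriv f (R * (y - x)))"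
   by (intro scaled_ck_cmult C R)
  then show "scaled_ck R n (max B C * R) (\<lambda>x y. (- R) * deriv f (R * (y - x)))"
   using R by (elim scaled_ck_mono) (auto simp: mult.commute intro!: mult_right_mono)
  show "\<bar>f (R * (y - x))\<bar> \<le> max B C" for x y using B(2)[of "R * (y - x)"] by linarith
 qed measurable
 then show ?case by blast
qed

lemma scaled_ck_1_variable:
 assumes "smooth_real f" "\<And>x. x \<notin> {a..b} ==> f x = 0"
 shows "\<exists>C. \<forall>R\<ge>1. scaled_ck R n C (\<lambda>x y. f x)"
 using assms
proof (induction n arbitrary: f)
 case (0 f)
 then obtain B where B: "0 \<le> B" "\<And>x. \<bar>f x\<bar> \<le> B" using smooth_compact_support_bounded by blast
 note [measurable] = smooth_real_measurable[OF 0(1)]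
 show ?case using B by auto
next
 case (Suc n f)
 then obtain B where B: "0 \<le> B" "\<And>x. \<bar>f x\<bar> \<le> B" using smooth_compact_support_bounded by blast
 note [measurable] = smooth_real_measurable[OF Suc.prems(1)]
 note d = smooth_real_deriv[OF Suc.prems(1)]
 have dz: "deriv f x = 0" if "x \<notin> {a..b}" for x
  by (rule deriv_zero_outside[OF d(1) Suc.prems(2) that])
 obtain C where C: "\<And>R. R \<ge> 1 ==> scaled_ck R n C (\<lambda>x y. deriv f x)"
  using Suc.IH[OF d(2) dz] by blast
 have "scaled_ck R (Suc n) (max B C) (\<lambda>x y. f x)" if R: "R \<ge> 1" for R
 proof (rule scaled_ck_SucI)
  show "((\<lambda>x. f x) has_real_derivative deriv f x) (at x)" for x by (rule d)
  have "max B C * 1 \<le> max B C * R" using R B(1) by (intro mult_left_mono) auto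
  then show "scaled_ck R n (max B C * R) (\<lambda>x y. deriv f x)"
   using R by (intro scaled_ck_mono[OF C[OF R]]) auto
  show "\<bar>f x\<bar> \<le> max B C" for x using B(2)[of x] by linarith
 qed measurable
 then show ?case by blast
qed

text \<open>Unfolds the nested existential derivatives into one sequence, the shape in which
  \<open>local_kernel\<close> wants them.\<close>

lemma scaled_ck_derivatives:
 assumes "scaled_ck R n C k"
 shows "\<exists>D. D 0 = k \<and> (\<forall>p<n. \<forall>x y. ((\<lambda>x. D p x y) has_real_derivative D (Suc p) x y) (at x)) \<and>
  (\<forall>p\<le>n. (\<lambda>z. D p (fst z) (snd z)) \<in> borel_measurable (borel \<Otimes>\<^sub>M borel) \<and> (\<forall>x y. \<bar>D p x y\<bar> \<le> C * R ^ p))"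
 using assms
proof (induction n arbitrary: C k)
 case 0
 then show ?case by (intro exI[of _ "\<lambda>_. k"]) auto
next
 case (Suc n)
 from Suc.prems obtain k' where k': "\<And>x y. ((\<lambda>x. k x y) has_real_derivative k' x y) (at x)" "scaled_ck R n (C * R) k'"
  by auto
 from Suc.IH[OF k'(2)] obtain D where D': "D 0 = k' \<and> (\<forall>p<n. \<forall>x y. ((\<lambda>x. D p x y) has_real_derivative D (Suc p) x y) (at x)) \<and>
  (\<forall>p\<le>n. (\<lambda>z. D p (fst z) (snd z)) \<in> borel_measurable (borel \<Otimes>\<^sub>M borel) \<and> (\<forall>x y. \<bar>D p x y\<bar> \<le> C * R * R ^ p))" ..
 have D: "D 0 = k'" "\<And>p x y. p < n ==> ((\<lambda>x. D p x y) has_real_derivative D (Suc p) x y) (at x)"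
  "\<And>p. p \<le> n ==> (\<lambda>z. D p (fst z) (snd z)) \<in> borel_measurable (borel \<Otimes>\<^sub>M borel)" "\<And>p x y. p \<le> n ==> \<bar>D p x y\<bar> \<le> C * R * R ^ p"
  using D' by simp_all
 define E where "E p = (case p of 0 => k | Suc q => D q)" for p
 have "((\<lambda>x. E p x y) has_real_derivative E (Suc p) x y) (at x)" if "p < Suc n" for p x y
  using that D(1,2) k'(1) by (cases p) (auto simp: E_def)
 moreover have "(\<lambda>z. E p (fst z) (snd z)) \<in> borel_measurable (borel \<Otimes>\<^sub>M borel)" if "p \<le> Suc n" for p
  using that D(3) scaled_ck_0D[OF Suc.prems] by (cases p) (auto simp: E_def)
 moreover have "\<bar>E p x y\<bar> \<le> C * R ^ p" if "p \<le> Suc n" for p x y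
  using that D(4) scaled_ck_bound[OF Suc.prems] by (cases p) (auto simp: E_def mult.assoc)
 ultimately show ?case by (intro exI[of _ E]) (auto simp: E_def)
qed

section \<open>The multilevel kernels\<close>

definition dil :: "nat => (real => real) => real => real" where
 "dil i f z = 2 ^ i * f (2 ^ i * z)"

text \<open>Multilevel one-sided smoothing: \<open>phi\<close> is the kernel of \<open>f \<mapsto> f - (-1)\<^sup>M \<integral> \<Delta>\<^sub>h\<^sup>M f \<nu>(h) dh\<close>, and
 \<open>phi\<^sub>i * phi\<^sub>i\<close> is telescoped so that each summand is a smooth kernel (\<open>level_kernel\<close>) applied to an
 average of \<open>M\<close>-th differences (with density \<open>step_density\<close>). Level 0 carries no difference.\<close>

locale smoothing =
 fixes M :: nat and \<nu> :: "real => real"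
 assumes M1: "1 \<le> M" and \<nu>_smooth: "smooth_real \<nu>" and \<nu>_nonneg: "\<And>x. 0 \<le> \<nu> x"
  and \<nu>_supp: "\<And>x. x \<notin> {0..1 / (4 * real M)} ==> \<nu> x = 0"
  and \<nu>_int: "integrable lborel \<nu>" and \<nu>_1: "(LBINT x. \<nu> x) = 1"
begin

text \<open>\<open>\<nu> (z / m) / m\<close> is the density of m h when h has density
  \<open>\<nu>\<close>, so each summand averages the shift by m h. The shift m = 0 of the M-th
  difference cancels against the identity.\<close>

definition phi :: "real => real" where
 "phi z = (\<Sum>m=1..M. (-1) ^ (m + 1) * real (M choose m) / real m * \<nu> (z / real m))"

text \<open>From a*a - b*b = (a - b)*(a + b) for convolutions, with a and b consecutive dilates of
  \<open>phi\<close>: the factor a + b is kept as the smooth kernel, while a - b is the difference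
  average with density \<open>step_density\<close>.\<close>

fun level_kernel :: "nat => real => real" where
 "level_kernel 0 = phi"
| "level_kernel (Suc 0) = phi"
| "level_kernel (Suc (Suc i)) = (\<lambda>z. dil (Suc i) phi z + dil i phi z)"

fun step_density :: "nat => real => real" where
 "step_density 0 = \<nu>"
| "step_density (Suc 0) = \<nu>"
| "step_density (Suc (Suc i)) = (\<lambda>z. dil (Suc i) \<nu> z - dil i \<nu> z)"

text \<open>Turns the coefficients (-1)^(M - m) of the M-th difference into the (-1)^(m + 1) of
  \<open>phi\<close>.\<close>

definition level_sign :: "nat => real" where
 "level_sign i = (if i = 0 then 1 else (-1) ^ (M + 1))"

text \<open>1 for x <= -1/2 and 0 for x >= 1/2, with psi(x) + psi(-x) = 1: it localises to the left
  part of the interval, where there is room for differences to the right.\<close>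

definition psi :: "real => real" where
 "psi x = smooth_step (1/2 - x)"

definition kapL :: "nat => real => real => real" where
 "kapL i x y = level_sign i * psi x * level_kernel i (y - x)"

text \<open>The index is a side and a level. True looks to the right from the left part; False is
  its mirror image.\<close>

definition kap :: "bool \<times> nat => real => real => real" where
 "kap t x y = (if fst t then kapL (snd t) x y else kapL (snd t) (- x) (- y))"

lemma smooth_phi: "smooth_real phi"
 unfolding phi_def[abs_def]
 by (intro smooth_real_sum smooth_real_mult smooth_real_const)
  (use smooth_real_affine[OF \<nu>_smooth, of "1 / real m" 0 for m] in simp)

lemma phi_supp: "z \<notin> {0..1/4} ==> phi z = 0"
 unfolding phi_def
proof (intro sum.neutral ballI)
 fix m assume z: "z \<notin> {0..1/4}" and m: "m \<in> {1..M}"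
 have "z / real m \<notin> {0..1 / (4 * real M)}"
 proof
  assume a: "z / real m \<in> {0..1 / (4 * real M)}"
  have "z = (z / real m) * real m" using m by simp
  also have "\<dots> \<le> 1 / (4 * real M) * real M" using a m by (intro mult_mono) auto
  also have "\<dots> = 1/4" using M1 by simp
  finally have "z \<le> 1/4" .
  moreover have "0 \<le> z" using a m by (simp add: zero_le_divide_iff)
  ultimately show False using z by simp
 qed
 then show "(-1) ^ (m + 1) * real (M choose m) / real m * \<nu> (z / real m) = 0" by (simp add: \<nu>_supp)
qed

text \<open>Level i + 2 consists of dilates by 2^i and 2^(i+1); the missing factor 4 is supplied by
  the support [0,1/4] of \<open>phi\<close>, one reason why \<open>\<nu>\<close> lives on
  [0, 1 / (4 M)].\<close>

lemma level_kernel_supp: "z \<notin> {0..1 / 2 ^ i} ==> level_kernel i z = 0"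
proof (induction i rule: level_kernel.induct)
 case (3 i)
 have "2 ^ i * z \<notin> {0..1/4}" "2 ^ Suc i * z \<notin> {0..1/4}"
  using 3 zero_less_power[of "2::real" i] by (auto simp: field_simps zero_le_mult_iff dest: leD)
 then show ?case by (simp add: dil_def phi_supp)
qed (auto intro!: phi_supp)

text \<open>A uniform bound for all levels, also the coarse ones: it keeps y in the interval when x
  < 1/2.\<close>

lemma level_kernel_supp': "z \<notin> {0..1/4} ==> level_kernel i z = 0"
proof (induction i rule: level_kernel.induct)
 case (3 i)
 have "2 ^ i * z \<notin> {0..1/4}" "2 ^ Suc i * z \<notin> {0..1/4}"
 proof -
  have "2 ^ j * z \<notin> {0..1/4}" for j
  proof
   assume a: "2 ^ j * z \<in> {0..1/4}"
   then have "0 \<le> z" using zero_less_power[of "2::real" j] by (auto simp: zero_le_mult_iff dest: leD)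
   moreover then have "1 * z \<le> 2 ^ j * z" by (intro mult_right_mono) auto
   ultimately show False using a 3 by auto
  qed
  then show "2 ^ i * z \<notin> {0..1/4}" "2 ^ Suc i * z \<notin> {0..1/4}" by blast+
 qed
 then show ?case by (simp add: dil_def phi_supp)
qed (auto intro!: phi_supp)

lemma smooth_psi: "smooth_real psi"
 using smooth_real_affine[OF smooth_smooth_step, of "-1" "1/2"] by (simp add: psi_def[abs_def])

lemma psi_range: "0 \<le> psi x" "psi x \<le> 1"
 using smooth_step_range by (auto simp: psi_def)

lemma psi_compl: "psi x + psi (- x) = 1"
 using smooth_step_compl[of "1/2 - x"] by (simp add: psi_def)

lemma psi_0: "1/2 \<le> x ==> psi x = 0"
 by (simp add: psi_def smooth_step_0)

text \<open>\<open>psi\<close> is not compactly supported but its derivative is, so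
  \<open>scaled_ck_1_variable\<close> takes over from the first derivative on.\<close>

lemma psi_scaled: "\<exists>C. \<forall>R\<ge>1. scaled_ck R n C (\<lambda>x y. psi x)"
proof (cases n)
 case 0
 note [measurable] = smooth_real_measurable[OF smooth_psi]
 show ?thesis using psi_range 0 by (intro exI[of _ 1]) auto
next
 case (Suc m)
 note [measurable] = smooth_real_measurable[OF smooth_psi]
 note d = smooth_real_deriv[OF smooth_psi]
 have "deriv psi x = 0" if "x \<notin> {-1/2..1/2}" for x
 proof -
  have "psi x = (if x < 0 then 1 else 0)" if "x \<notin> {-1/2..1/2}" for x
   using that by (auto simp: psi_def smooth_step_0 smooth_step_1)
  moreover have "open (- {-1/2..1/2::real})" by (simp add: open_Compl)
  moreover have "((\<lambda>x. if x < 0 then 1 else 0 :: real) has_real_derivative 0) (at x)"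
  proof (cases "x < 0")
   case True
   then show ?thesis
    by - (rule has_field_derivative_transform_within_open[of "\<lambda>_. 1" 0 x "{..<0}"], auto)
  next
   case False
   then have "x > 0" using that by (cases "x = 0") auto
   then show ?thesis
    by - (rule has_field_derivative_transform_within_open[of "\<lambda>_. 0" 0 x "{0<..}"], auto)
  qed
  ultimately have "(psi has_real_derivative 0) (at x)"
   using that by - (rule has_field_derivative_transform_within_open[of "\<lambda>x. if x < 0 then 1 else 0" 0 x "- {-1/2..1/2}"], auto)
  then show ?thesis using d(1) DERIV_unique by blast
 qed
 from scaled_ck_1_variable[OF d(2) this] obtain C where C: "\<And>R. R \<ge> 1 ==> scaled_ck R m C (\<lambda>x y. deriv psi x)" by blast
 have "scaled_ck R (Suc m) (max 1 C) (\<lambda>x y. psi x)" if R: "R \<ge> 1" for R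
 proof (rule scaled_ck_SucI)
  show "((\<lambda>x. psi x) has_real_derivative deriv psi x) (at x)" for x by (rule d)
  have "max 1 C * 1 \<le> max 1 C * R" using R by (intro mult_left_mono) auto
  then show "scaled_ck R m (max 1 C * R) (\<lambda>x y. deriv psi x)"
   using R by (intro scaled_ck_mono[OF C[OF R]]) auto
  show "\<bar>psi x\<bar> \<le> max 1 C" for x using psi_range[of x] by auto
 qed measurable
 then show ?thesis using Suc by blast
qed

text \<open>The point is a single C for all levels. Dilated kernels satisfy the bounds of their own
  scale with the constant of \<open>phi\<close> times 2^i, and \<open>psi\<close> satisfies them at
  every scale R >= 1 with one constant.\<close>

lemma kapL_local_kernel:
 "\<exists>C. \<forall>i. \<exists>D. D 0 = kapL i \<and> local_kernel D C (2 ^ i) M"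
proof -
 obtain C1 where C1: "\<And>R. R \<ge> 1 ==> scaled_ck R M C1 (\<lambda>x y. psi x)" using psi_scaled[of M] by blast
 obtain C2 where C2: "\<And>R. R > 0 ==> scaled_ck R M C2 (\<lambda>x y. phi (R * (y - x)))"
  using scaled_ck_dilation[OF smooth_phi phi_supp, of 0 "1/4" M] by auto
 have C10: "0 \<le> C1" using scaled_ck_C_nonneg[OF C1[of 1]] by simp
 have C20: "0 \<le> C2" using scaled_ck_C_nonneg[OF C2[of 1]] by simp
 define C where "C = 2 ^ M * C1 * (2 * C2)"
 have C0: "0 \<le> C" using C10 C20 by (simp add: C_def)
 have lev: "scaled_ck (2 ^ i) M (2 * C2 * 2 ^ i) (\<lambda>x y. level_kernel i (y - x))" for i
 proof (induction i rule: level_kernel.induct)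
  case 1
  have "scaled_ck 1 M C2 (\<lambda>x y. phi (1 * (y - x)))" by (rule C2) simp
  then show ?case using C20 by (auto elim!: scaled_ck_mono)
 next
  case 2
  have "scaled_ck 1 M C2 (\<lambda>x y. phi (1 * (y - x)))" by (rule C2) simp
  then show ?case using C20 by (auto elim!: scaled_ck_mono)
 next
  case (3 i)
  have a: "scaled_ck (2 ^ Suc (Suc i)) M (2 ^ j * C2) (\<lambda>x y. dil j phi (y - x))" if "j \<le> Suc i" for j
  proof -
   have "scaled_ck (2 ^ j) M (\<bar>2 ^ j\<bar> * C2) (\<lambda>x y. 2 ^ j * phi (2 ^ j * (y - x)))"
    by (intro scaled_ck_cmult C2) simp
   moreover have "(2::real) ^ j \<le> 2 ^ Suc (Suc i)" using that by (intro power_increasing) auto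
   ultimately show ?thesis unfolding dil_def by (elim scaled_ck_mono) auto
  qed
  have "scaled_ck (2 ^ Suc (Suc i)) M (2 ^ Suc i * C2 + 2 ^ i * C2) (\<lambda>x y. dil (Suc i) phi (y - x) + dil i phi (y - x))"
   by (intro scaled_ck_add a) auto
  then show ?case unfolding level_kernel.simps
   by (rule scaled_ck_mono) (use C20 in \<open>auto intro: mult_right_mono simp: algebra_simps\<close>)
 qed
 have "\<exists>D. D 0 = kapL i \<and> local_kernel D C (2 ^ i) M" for i
 proof -
  have "scaled_ck (2 ^ i) M (\<bar>level_sign i\<bar> * (2 ^ M * C1 * (2 * C2 * 2 ^ i))) (\<lambda>x y. level_sign i * (psi x * level_kernel i (y - x)))"
   by (intro scaled_ck_cmult scaled_ck_mult C1 lev) simp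
  moreover have "\<bar>level_sign i\<bar> = 1" by (simp add: level_sign_def power_abs)
  ultimately have "scaled_ck (2 ^ i) M (C * 2 ^ i) (kapL i)"
   by (simp add: kapL_def[abs_def] C_def mult_ac)
  from scaled_ck_derivatives[OF this] obtain D where D': "D 0 = kapL i \<and>
   (\<forall>p<M. \<forall>x y. ((\<lambda>x. D p x y) has_real_derivative D (Suc p) x y) (at x)) \<and>
   (\<forall>p\<le>M. (\<lambda>z. D p (fst z) (snd z)) \<in> borel_measurable (borel \<Otimes>\<^sub>M borel) \<and> (\<forall>x y. \<bar>D p x y\<bar> \<le> C * 2 ^ i * (2 ^ i) ^ p))" ..
  have D: "D 0 = kapL i"
   "\<And>p x y. p < M ==> ((\<lambda>x. D p x y) has_real_derivative D (Suc p) x y) (at x)"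
   "\<And>p. p \<le> M ==> (\<lambda>z. D p (fst z) (snd z)) \<in> borel_measurable (borel \<Otimes>\<^sub>M borel)"
   "\<And>p x y. p \<le> M ==> \<bar>D p x y\<bar> \<le> C * 2 ^ i * (2 ^ i) ^ p"
   using D' by simp_all
  have supp: "x \<notin> {y - 1 / 2 ^ i..y} ==> D p x y = 0" if "p \<le> M" for p x y
   using that
  proof (induction p arbitrary: x)
   case 0
   then have "y - x \<notin> {0..1 / 2 ^ i}" by auto
   then show ?case by (simp add: D(1) kapL_def level_kernel_supp)
  next
   case (Suc p)
   show ?case
   proof (rule deriv_zero_outside[where f = "\<lambda>x. D p x y" and f' = "\<lambda>x. D (Suc p) x y" and a = "y - 1 / 2 ^ i" and b = y])
    show "((\<lambda>x. D p x y) has_real_derivative D (Suc p) x y) (at x)" for x using D(2)[of p] Suc.prems by simp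
   qed (use Suc in auto)
  qed
  have "local_kernel D C (2 ^ i) M"
  proof
   show "D p x y = 0" if "p \<le> M" "y \<notin> {x..x + 1 / 2 ^ i}" for p x y
    using that by (intro supp) auto
  qed (use M1 C0 D in \<open>auto simp: mult_ac\<close>)
  with D(1) show ?thesis by blast
 qed
 then show ?thesis by blast
qed

end

section \<open>Borel representatives on the cube\<close>

lemma ennsqrt_power2: "(ennsqrt x)^2 = x"
proof (cases "x = \<infinity>")
 case False
 then have "x < top" by (simp add: less_top)
 then have "ennreal (enn2real x) = x" by simp
 then show ?thesis using False by (simp add: ennsqrt_def ennreal_power)
qed (simp add: ennsqrt_def)

lemma L2_norm_power2: "(L2_norm M f)^2 = (\<integral>\<^sup>+x. ennreal ((cmod (f x))^2) \<partial>M)"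
 by (simp add: L2_norm_def ennsqrt_power2)

lemma ennsqrt_less_top: "ennsqrt x < \<infinity> \<longleftrightarrow> x < \<infinity>"
 by (auto simp: ennsqrt_def less_top)

lemma cube_eq_cbox: "(cube :: (real^'d::finite) set) = cbox (\<chi> l. -1) (\<chi> l. 1)"
 by (auto simp: cube_def mem_box_cart)

lemma cube_borel [measurable]: "(cube :: (real^'d::finite) set) \<in> sets borel"
 unfolding cube_eq_cbox by simp

lemma mem_cube_iff: "x \<in> cube \<longleftrightarrow> (\<forall>l. \<bar>x $ l\<bar> \<le> 1)"
 by (auto simp: cube_def abs_le_iff)

lemma integrable_indicator_cube: "integrable lborel (indicator cube :: real^'d::finite => real)"
 by (rule integrable_real_indicator) (simp_all add: cube_eq_cbox emeasure_bounded_finite[unfolded infinity_ennreal_def])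

lemma L2_on_cube_integrable:
 fixes f :: "real^'d::finite => complex"
 assumes [measurable]: "f \<in> borel_measurable borel" and out: "\<And>x. x \<notin> cube ==> f x = 0"
  and f2: "integrable lborel (\<lambda>x. (cmod (f x))^2)"
 shows "integrable lborel f"
proof -
 have "integrable lborel (\<lambda>x. complex_of_real (indicator cube x) * f x)"
 proof (rule integrable_square_mult)
  have "(\<lambda>x. (norm (complex_of_real (indicator cube x)))^2) = (indicator cube :: real^'d => real)"
   by (auto simp: indicator_def fun_eq_iff)
  then show "integrable lborel (\<lambda>x::real^'d. (norm (complex_of_real (indicator cube x)))^2)"
   using integrable_indicator_cube by simp
 qed (use f2 in auto)
 moreover have "(\<lambda>x. complex_of_real (indicator cube x) * f x) = f"
  using out by (auto simp: indicator_def fun_eq_iff)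
 ultimately show ?thesis by simp
qed

text \<open>Boxes form an intersection-stable generator of the Borel sets, so h = f - g integrates
  to zero over every Borel set and hence vanishes almost everywhere.\<close>

lemma AE_eq_of_box_integrals:
 fixes f g :: "real^'d::finite => complex"
 assumes f: "integrable lborel f" and g: "integrable lborel g"
  and eq: "\<And>a b. (LBINT x. indicator (box a b) x *\<^sub>R f x) = (LBINT x. indicator (box a b) x *\<^sub>R g x)"
 shows "AE x in lborel. f x = g x"
proof -
 define h where "h x = f x - g x" for x
 have h: "integrable lborel h" unfolding h_def[abs_def] using f g by simp
 have hb: "(LBINT x. indicator (box a b) x *\<^sub>R h x) = 0" for a b
 proof -
  have "(LBINT x. indicator (box a b) x *\<^sub>R h x)
   = (LBINT x. indicator (box a b) x *\<^sub>R f x - indicator (box a b) x *\<^sub>R g x)"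
   by (simp add: h_def scaleR_diff_right)
  also have "\<dots> = 0"
   using f g eq[of a b] by (subst Bochner_Integration.integral_diff) (auto intro: integrable_mult_indicator)
  finally show ?thesis .
 qed
 have hi: "integrable lborel (\<lambda>x. indicator A x *\<^sub>R h x)" if "A \<in> sets borel" for A
  using that h by (intro integrable_mult_indicator) auto
 \<comment> \<open>The integral over the whole space, needed for complements, is the limit over
   growing boxes.\<close>
 have lim: "(LBINT x. h x) = 0"
 proof -
  define B where "B n = box (\<chi> l. - real n) ((\<chi> l. real n) :: real^'d)" for n
  have "(\<lambda>n. (LBINT x. indicator (B n) x *\<^sub>R h x)) \<longlonglongrightarrow> (LBINT x. h x)"
  proof (rule integral_dominated_convergence[where w = "\<lambda>x. norm (h x)"])
   show "AE x in lborel. (\<lambda>n. indicator (B n) x *\<^sub>R h x) \<longlonglongrightarrow> h x"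
   proof (rule AE_I2)
    fix x :: "real^'d"
    obtain N :: nat where N: "norm x < real N" using reals_Archimedean2 by blast
    have "x \<in> B n" if "n \<ge> N" for n
    proof -
     have "\<bar>x $ l\<bar> < real n" for l using component_le_norm_cart[of x l] N that by linarith
     then show ?thesis unfolding B_def mem_box_cart by (auto simp: abs_less_iff) (metis minus_less_iff)
    qed
    then have "\<forall>\<^sub>F n in sequentially. indicator (B n) x *\<^sub>R h x = h x"
     unfolding eventually_sequentially by (intro exI[of _ N]) auto
    then show "(\<lambda>n. indicator (B n) x *\<^sub>R h x) \<longlonglongrightarrow> h x" by (rule tendsto_eventually)
   qed
  qed (use h in \<open>auto simp: B_def indicator_def\<close>)
  moreover have "(LBINT x. indicator (B n) x *\<^sub>R h x) = 0" for n unfolding B_def by (rule hb)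
  ultimately show ?thesis using LIMSEQ_unique[OF _ tendsto_const[of 0]] by simp
 qed
 have all: "(LBINT x. indicator A x *\<^sub>R h x) = 0" if "A \<in> sets borel" for A
 proof -
  have "Int_stable (range (\<lambda>(a, b). box a b :: (real^'d) set))"
   by (auto simp: Int_stable_def box_Int_box)
  moreover have "range (\<lambda>(a, b). box a b :: (real^'d) set) \<subseteq> Pow UNIV" by simp
  moreover have "A \<in> sigma_sets UNIV (range (\<lambda>(a, b). box a b :: (real^'d) set))"
   using that unfolding borel_eq_box by simp
  ultimately show ?thesis
  proof (induction rule: sigma_sets_induct_disjoint)
   case (basic A)
   then show ?case using hb by auto
  next
   case (compl A)
   then have A: "A \<in> sets borel" unfolding borel_eq_box by simp
   have "(LBINT x. indicator (UNIV - A) x *\<^sub>R h x) = (LBINT x. h x - indicator A x *\<^sub>R h x)"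
    by (intro lint_cong) (auto simp: indicator_def)
   then show ?case using compl h hi[OF A] lim by simp
  next
   case (union A)
   then have A: "A i \<in> sets borel" for i unfolding borel_eq_box by auto
   have "(\<integral>x\<in>(\<Union>i. A i). h x \<partial>lborel) = (\<Sum>i. (\<integral>x\<in>A i. h x \<partial>lborel))"
    using A union.hyps(1) h
    by (intro lebesgue_integral_countable_add) (auto simp: disjoint_family_on_def set_integrable_def intro!: integrable_mult_indicator)
   then show ?case using union.IH by (simp add: set_lebesgue_integral_def)
  qed (auto)
 qed
 have "AE x in lborel. h x = 0"
  using all by (intro sigma_finite_measure.density_zero[OF sigma_finite_lborel] h) (auto simp: set_lebesgue_integral_def)
 then show ?thesis by (simp add: h_def)
qed

lemma borel_representative:
 fixes f :: "real^'d::finite => complex"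
 assumes "f \<in> borel_measurable (lebesgue_on cube)"
 obtains g where "g \<in> borel_measurable borel" "\<And>x. x \<notin> cube ==> g x = 0"
  "AE x in lborel. x \<in> cube --> f x = g x"
proof -
 have m: "(\<lambda>x. indicator cube x *\<^sub>R f x) \<in> borel_measurable lebesgue"
  using assms by (subst (asm) borel_measurable_restrict_space_iff) auto
 have re: "(\<lambda>x. Re (indicator cube x *\<^sub>R f x)) \<in> borel_measurable lebesgue"
  and im: "(\<lambda>x. Im (indicator cube x *\<^sub>R f x)) \<in> borel_measurable lebesgue"
  using m by measurable
 from completion_ex_borel_measurable_real[OF re] obtain a
  where a: "a \<in> borel_measurable lborel" "AE x in lborel. Re (indicator cube x *\<^sub>R f x) = a x" by blast
 from completion_ex_borel_measurable_real[OF im] obtain b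
  where b: "b \<in> borel_measurable lborel" "AE x in lborel. Im (indicator cube x *\<^sub>R f x) = b x" by blast
 from a(1) b(1) have [measurable]: "a \<in> borel_measurable borel" "b \<in> borel_measurable borel" by auto
 define g where "g x = indicator cube x *\<^sub>R (complex_of_real (a x) + \<i> * complex_of_real (b x))" for x
 show ?thesis
 proof
  show "g \<in> borel_measurable borel" unfolding g_def[abs_def] by measurable
  show "g x = 0" if "x \<notin> cube" for x using that by (simp add: g_def)
  show "AE x in lborel. x \<in> cube --> f x = g x"
   using a(2) b(2) by eventually_elim (auto simp: g_def complex_eq_iff)
 qed
qed

lemma nn_integral_lebesgue_on_cube:
 fixes f g :: "real^'d::finite => complex"
 assumes "AE x in lborel. x \<in> cube --> f x = g x" "\<And>x. x \<notin> cube ==> g x = 0"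
 shows "(\<integral>\<^sup>+x. ennreal ((cmod (f x))^2) \<partial>lebesgue_on cube) = (\<integral>\<^sup>+x. ennreal ((cmod (g x))^2) \<partial>lborel)"
proof -
 have "(\<integral>\<^sup>+x. ennreal ((cmod (f x))^2) \<partial>lebesgue_on cube) = (\<integral>\<^sup>+x. ennreal ((cmod (f x))^2) * indicator cube x \<partial>lborel)"
  by (subst nn_integral_restrict_space) (auto simp: nn_integral_completion)
 also have "\<dots> = (\<integral>\<^sup>+x. ennreal ((cmod (g x))^2) \<partial>lborel)"
 proof (rule nn_integral_cong_AE, use assms(1) in eventually_elim)
  case (elim x)
  then show ?case using assms(2)[of x] by (cases "x \<in> cube") auto
 qed
 finally show ?thesis .
qed

lemma nn_integral_eq_integral_cmod2:
 fixes g :: "'a => complex"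
 assumes [measurable]: "g \<in> borel_measurable M"
  and fin: "(\<integral>\<^sup>+x. ennreal ((cmod (g x))^2) \<partial>M) < \<infinity>"
 shows "integrable M (\<lambda>x. (cmod (g x))^2)"
  and "(\<integral>\<^sup>+x. ennreal ((cmod (g x))^2) \<partial>M) = ennreal (\<integral>x. (cmod (g x))^2 \<partial>M)"
proof -
 show i: "integrable M (\<lambda>x. (cmod (g x))^2)"
  using fin by (intro integrableI_nonneg) auto
 show "(\<integral>\<^sup>+x. ennreal ((cmod (g x))^2) \<partial>M) = ennreal (\<integral>x. (cmod (g x))^2 \<partial>M)"
  by (rule nn_integral_eq_integral[OF i]) simp
qed

section \<open>From estimates for a bounded representative to the Chebyshev series\<close>

text \<open>Membership in L2 of the Chebyshev measure comes from the boundedness of F and the finite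
  mass of the measure. The infinite sum is the supremum of its finite partial sums, and each of
  these is dominated by a sum over a finite product set.\<close>

lemma chebyshev_conclusion:
 fixes f F :: "real^'d::finite => complex"
 assumes fm: "f \<in> borel_measurable (lebesgue_on cube)" and Fm [measurable]: "F \<in> borel_measurable borel"
  and eq: "AE x in lborel. x \<in> cube --> f x = F x" and b: "\<And>x. x \<in> cube ==> cmod (F x) \<le> b"
  and \<omega>: "\<And>k. 0 \<le> \<omega> k"
  and fin: "\<And>K :: nat set. finite K ==> (\<Sum>k\<in>PiE UNIV (\<lambda>_. K). (\<Prod>l\<in>UNIV. \<omega> (k l)) *
    (cmod (LBINT x. of_real (\<Prod>l\<in>UNIV. cheb_fun (k l) (x $ l)) * F x))^2) \<le> E"
 shows "f \<in> L2_space cheb_measure"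
  and "(\<Sum>\<^sub>\<infinity> k \<in> (UNIV :: (nat^'d) set).
     ennreal ((cmod (L2_inner cheb_measure f (cheb_eta k)))^2 * (\<Prod>l\<in>UNIV. \<omega> (k $ l)))) \<le> ennreal E"
proof -
 define W where "W x = (\<Prod>l\<in>UNIV. inverse (pi * sqrt (1 - (x $ l)^2)))" for x :: "real^'d"
 define W' where "W' x = (\<Prod>l\<in>UNIV. wt 0 (x $ l))" for x :: "real^'d"
 \<comment> \<open>The two densities agree also on the faces: where some coordinate is 1 or -1, the
   inverse of 0 is 0, and so is \<open>wt 0\<close>.\<close>
 have WW: "indicator cube x * W x = W' x" for x
 proof (cases "x \<in> cube")
  case True
  have "inverse (pi * sqrt (1 - (x $ l)^2)) = wt 0 (x $ l)" for l
  proof (cases "\<bar>x $ l\<bar> < 1")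
   case False
   moreover have "\<bar>x $ l\<bar> \<le> 1" using True by (simp add: mem_cube_iff)
   ultimately have "\<bar>x $ l\<bar> = 1" by simp
   then have "(x $ l)^2 = 1" by (simp add: abs_square_eq_1)
   then show ?thesis using \<open>\<bar>x $ l\<bar> = 1\<close> by (simp add: wt_def)
  qed (simp add: wt_0)
  then show ?thesis using True by (simp add: W_def W'_def)
 next
  case False
  then obtain l where "\<not> \<bar>x $ l\<bar> \<le> 1" by (auto simp: mem_cube_iff)
  then have "wt 0 (x $ l) = 0" by (intro wt_eq_0) simp
  then show ?thesis using False by (auto simp: W'_def intro!: exI[of _ l])
 qed
 have [measurable]: "W \<in> borel_measurable borel" "W' \<in> borel_measurable borel"
  unfolding W_def[abs_def] W'_def[abs_def] by measurable
 have Wnn: "0 \<le> W x" if "x \<in> cube" for x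
  unfolding W_def using that by (intro prod_nonneg ballI) (auto simp: mem_cube_iff abs_square_le_1)
 have W'int: "integrable lborel W'"
  unfolding W'_def[abs_def] by (intro integrable_prod_vec integrable_wt)
 have W'nn: "0 \<le> W' x" for x unfolding W'_def by (intro prod_nonneg ballI wt_nonneg)
 have sp: "cube \<inter> space lebesgue \<in> sets (lebesgue :: (real^'d) measure)" by auto
 have cheb: "cheb_measure = density (lebesgue_on cube) (\<lambda>x. ennreal (W x))"
  by (simp add: cheb_measure_def W_def)
 have Wm: "W \<in> borel_measurable (lebesgue_on cube)"
  by (intro measurable_restrict_space1 measurable_completion) simp
 show "f \<in> L2_space cheb_measure"
  unfolding L2_space_def
 proof (intro CollectI conjI)
  show "f \<in> borel_measurable cheb_measure" unfolding cheb using fm by simp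
  have "(\<integral>\<^sup>+x. ennreal ((cmod (f x))^2) \<partial>cheb_measure) = (\<integral>\<^sup>+x. ennreal (W x) * ennreal ((cmod (f x))^2) \<partial>lebesgue_on cube)"
   unfolding cheb using fm Wm by (intro nn_integral_density) auto
  also have "\<dots> = (\<integral>\<^sup>+x. ennreal (W x) * ennreal ((cmod (f x))^2) * indicator cube x \<partial>lborel)"
   by (subst nn_integral_restrict_space[OF sp]) (simp add: nn_integral_completion)
  also have "\<dots> \<le> (\<integral>\<^sup>+x. ennreal (b\<^sup>2 * W' x) \<partial>lborel)"
  proof (rule nn_integral_mono_AE, use eq in eventually_elim)
   case (elim x)
   show ?case
   proof (cases "x \<in> cube")
    case True
    then have "(cmod (f x))^2 \<le> b\<^sup>2" using elim b[of x] by (simp add: power_mono)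
    then have "ennreal (W x * (cmod (f x))^2) \<le> ennreal (b\<^sup>2 * W' x)"
     using True Wnn[of x] WW[of x] by (intro ennreal_leI) (simp add: mult.commute mult_left_mono)
    then show ?thesis using True Wnn[of x] by (simp add: ennreal_mult)
   qed simp
  qed
  also have "\<dots> < \<infinity>"
   using W'int W'nn by (subst nn_integral_eq_integral) auto
  finally show "L2_norm cheb_measure f < \<infinity>" by (simp only: L2_norm_def ennsqrt_less_top)
 qed
 have inner: "L2_inner cheb_measure f (cheb_eta k) = (LBINT x. of_real (\<Prod>l\<in>UNIV. cheb_fun (k $ l) (x $ l)) * F x)" for k :: "nat^'d"
 proof -
  define Ch where "Ch x = (\<Prod>l\<in>UNIV. chebD (k $ l) 0 (x $ l))" for x :: "real^'d"
  have [measurable]: "Ch \<in> borel_measurable borel" unfolding Ch_def[abs_def] by measurable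
  have eta: "cheb_eta k x = of_real (Ch x)" if "x \<in> cube" for x
   unfolding cheb_eta_def Ch_def using that by (simp add: mem_cube_iff chebD_eq_cheb_T)
  have cnj: "cnj (cheb_eta k x) = cheb_eta k x" for x by (simp add: cheb_eta_def)
  have Chm: "(\<lambda>x. of_real (Ch x) :: complex) \<in> borel_measurable (lebesgue_on cube)"
   by (intro measurable_restrict_space1 measurable_completion) simp
  have "(\<lambda>x. cheb_eta k x) \<in> borel_measurable (lebesgue_on cube)"
   using Chm by (rule measurable_cong[THEN iffD1, rotated]) (auto simp: eta)
  then have "L2_inner cheb_measure f (cheb_eta k) = (\<integral>x. W x *\<^sub>R (f x * cnj (cheb_eta k x)) \<partial>lebesgue_on cube)"
   unfolding L2_inner_def cheb cnj using fm Wm Wnn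
   by (intro integral_density AE_I2) auto
  also have "\<dots> = (\<integral>x. indicator cube x *\<^sub>R (W x *\<^sub>R (f x * cnj (cheb_eta k x))) \<partial>lebesgue)"
   by (rule integral_restrict_space[OF sp])
  also have "\<dots> = (\<integral>x. of_real (W' x * Ch x) * F x \<partial>lebesgue)"
  proof (rule integral_cong_AE)
   have "(\<lambda>x. W x *\<^sub>R (f x * cnj (cheb_eta k x))) \<in> borel_measurable (lebesgue_on cube)"
    unfolding cnj
    by (intro borel_measurable_scaleR borel_measurable_times fm Wm \<open>(\<lambda>x. cheb_eta k x) \<in> borel_measurable (lebesgue_on cube)\<close>)
   then show "(\<lambda>x. indicator cube x *\<^sub>R (W x *\<^sub>R (f x * cnj (cheb_eta k x)))) \<in> borel_measurable lebesgue"
    by (subst (asm) borel_measurable_restrict_space_iff[OF sp])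
   show "AE x in lebesgue. indicator cube x *\<^sub>R (W x *\<^sub>R (f x * cnj (cheb_eta k x))) = of_real (W' x * Ch x) * F x"
    using AE_completion[OF eq]
   proof eventually_elim
    case (elim x)
    show ?case
    proof (cases "x \<in> cube")
     case True
     then show ?thesis using elim WW[of x] by (simp add: eta scaleR_conv_of_real mult_ac)
    next
     case False
     then show ?thesis using WW[of x] by simp
    qed
   qed
   show "(\<lambda>x. of_real (W' x * Ch x) * F x) \<in> borel_measurable lebesgue" by (intro measurable_completion) measurable
  qed
  also have "\<dots> = (LBINT x. of_real (W' x * Ch x) * F x)"
   by (rule integral_completion) measurable
  also have "(\<lambda>x. W' x * Ch x) = (\<lambda>x. \<Prod>l\<in>UNIV. cheb_fun (k $ l) (x $ l))"
   by (simp add: W'_def Ch_def cheb_fun_def prod.distrib)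
  finally show ?thesis by (simp del: of_real_prod)
 qed
 show "(\<Sum>\<^sub>\<infinity> k \<in> (UNIV :: (nat^'d) set).
     ennreal ((cmod (L2_inner cheb_measure f (cheb_eta k)))^2 * (\<Prod>l\<in>UNIV. \<omega> (k $ l)))) \<le> ennreal E"
 proof (subst nonneg_infsum_complete, simp, rule SUP_least)
  fix A :: "(nat^'d) set" assume "A \<in> {F. finite F \<and> F \<subseteq> UNIV}"
  then have A: "finite A" by simp
  \<comment> \<open>All entries of all multi-indices in A, so that A lies in the d-fold product of
    K.\<close>
  define K where "K = (\<Union>k\<in>A. range (($) k))"
  define T where "T k = (\<Prod>l\<in>UNIV. \<omega> (k l)) * (cmod (LBINT x. of_real (\<Prod>l\<in>UNIV. cheb_fun (k l) (x $ l)) * F x))^2" for k :: "'d => nat"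
  have T0: "0 \<le> T k" for k unfolding T_def by (intro mult_nonneg_nonneg prod_nonneg) (auto simp: \<omega>)
  have K: "finite K" using A by (auto simp: K_def)
  have "(\<Sum>k\<in>A. ennreal ((cmod (L2_inner cheb_measure f (cheb_eta k)))^2 * (\<Prod>l\<in>UNIV. \<omega> (k $ l)))) = (\<Sum>k\<in>A. ennreal (T (($) k)))"
   by (intro sum.cong) (auto simp: inner T_def mult.commute simp del: of_real_prod)
  also have "\<dots> = ennreal (\<Sum>k\<in>A. T (($) k))" by (intro sum_ennreal T0)
  also have "\<dots> \<le> ennreal E"
  proof (rule ennreal_leI)
   have "(\<Sum>k\<in>A. T (($) k)) = (\<Sum>k\<in>(\<lambda>k. ($) k) ` A. T k)"
    by (subst sum.reindex) (auto simp: inj_on_def vec_eq_iff fun_eq_iff)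
   also have "\<dots> \<le> (\<Sum>k\<in>PiE UNIV (\<lambda>_. K). T k)"
    using K T0 by (intro sum_mono2 finite_PiE) (auto simp: K_def)
   also have "\<dots> \<le> E" unfolding T_def by (rule fin[OF K])
   finally show "(\<Sum>k\<in>A. T (($) k)) \<le> E" .
  qed
  finally show "(\<Sum>k\<in>A. ennreal ((cmod (L2_inner cheb_measure f (cheb_eta k)))^2 * (\<Prod>l\<in>UNIV. \<omega> (k $ l)))) \<le> ennreal E" .
 qed
qed

text \<open>By dominated convergence the box integrals of the bounded functions \<open>Fn n\<close>
  converge to those of F; by assumption they converge to those of f. Comparison over all boxes gives
  f = F almost everywhere on the cube.\<close>

lemma AE_eq_of_weak_limit:
 fixes f F :: "real^'d::finite => complex" and Fn :: "nat => real^'d => complex"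
 assumes f: "integrable lborel f" and fout: "\<And>x. x \<notin> cube ==> f x = 0"
  and Fnm: "\<And>n. Fn n \<in> borel_measurable borel" and Fm: "F \<in> borel_measurable borel"
  and Fn: "\<And>x. x \<in> cube ==> (\<lambda>n. Fn n x) \<longlonglongrightarrow> F x" and b: "\<And>n x. x \<in> cube ==> cmod (Fn n x) \<le> c"
  and boxes: "\<And>a b. (\<And>l. -1 \<le> a $ l \<and> a $ l < b $ l \<and> b $ l \<le> 1) ==>
   (\<lambda>n. (LBINT x. indicator (box a b) x *\<^sub>R Fn n x)) \<longlonglongrightarrow> (LBINT x. indicator (box a b) x *\<^sub>R f x)"
 shows "AE x in lborel. x \<in> cube --> f x = F x"
proof -
 note [measurable] = Fnm Fm
 have Fb: "cmod (F x) \<le> c" if "x \<in> cube" for x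
  using Lim_bounded[OF tendsto_norm[OF Fn[OF that]], of 0 c] b[OF that] by simp
 define G where "G x = indicator cube x *\<^sub>R F x" for x
 have Gint: "integrable lborel G"
 proof (rule lint_bound)
  show "integrable lborel (\<lambda>x::real^'d. c * indicator cube x)"
   by (intro integrable_mult_right integrable_indicator_cube)
  show "AE x in lborel. norm (G x) \<le> norm (c * indicator cube x)"
   using Fb by (intro AE_I2) (auto simp: G_def indicator_def intro: order_trans[OF _ abs_ge_self])
 qed (simp add: G_def[abs_def])
 have open_cube: "box (\<chi> l. -1) (\<chi> l. 1) = interior (cube :: (real^'d) set)"
  by (simp add: cube_eq_cbox interior_cbox)
 have null: "AE x in lborel. x \<in> (cube :: (real^'d) set) --> x \<in> box (\<chi> l. -1) (\<chi> l. 1)"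
 proof -
  have "negligible (cube - box (\<chi> l. -1) (\<chi> l. 1) :: (real^'d) set)"
   unfolding cube_eq_cbox by (rule negligible_frontier_interval)
  then have "cube - box (\<chi> l. -1) (\<chi> l. 1) \<in> null_sets (lebesgue :: (real^'d) measure)"
   by (simp add: negligible_iff_null_sets)
  then have "cube - box (\<chi> l. -1) (\<chi> l. 1) \<in> null_sets (lborel :: (real^'d) measure)"
   by (simp add: null_sets_completion_iff)
  then have "AE x in lborel. x \<notin> (cube - box (\<chi> l. -1) (\<chi> l. 1) :: (real^'d) set)" by (rule AE_not_in)
  then show ?thesis by eventually_elim auto
 qed
 have "AE x in lborel. f x = G x"
 proof (rule AE_eq_of_box_integrals[OF f Gint])
  fix a b :: "real^'d"
  \<comment> \<open>A general box is intersected with the cube; this alters the integral only on the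
    null boundary of the cube.\<close>
  define a' where "a' = ((\<chi> l. max (-1) (a $ l)) :: real^'d)"
  define b' where "b' = ((\<chi> l. min 1 (b $ l)) :: real^'d)"
  have red: "(LBINT x. indicator (box a b) x *\<^sub>R h x) = (LBINT x. indicator (box a' b') x *\<^sub>R h x)"
   if hm [measurable]: "h \<in> borel_measurable borel" and h0: "\<And>x. x \<notin> cube ==> h x = 0" for h :: "real^'d => complex"
  proof (rule integral_cong_AE)
   show "AE x in lborel. indicator (box a b) x *\<^sub>R h x = indicator (box a' b') x *\<^sub>R h x"
    using null
   proof eventually_elim
    case (elim x)
    show ?case
    proof (cases "x \<in> cube")
     case True
     then have "x \<in> box a b \<longleftrightarrow> x \<in> box a' b'"
      using elim by (auto simp: mem_box_cart a'_def b'_def)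
     then show ?thesis by (simp add: indicator_def)
    qed (simp add: h0)
   qed
  qed measurable
  have "(LBINT x. indicator (box a' b') x *\<^sub>R f x) = (LBINT x. indicator (box a' b') x *\<^sub>R G x)"
  proof (cases "\<forall>l. a' $ l < b' $ l")
   case False
   then have "box a' b' = {}" by (auto simp: mem_box_cart set_eq_iff) (meson less_trans)
   then show ?thesis by simp
  next
   case True
   then have ab: "-1 \<le> a' $ l \<and> a' $ l < b' $ l \<and> b' $ l \<le> 1" for l by (auto simp: a'_def b'_def)
   have bc: "x \<in> cube" if "x \<in> box a' b'" for x
    unfolding mem_cube_iff using that ab by (auto simp: mem_box_cart abs_le_iff) (smt (verit))+
   have "(\<lambda>n. (LBINT x. indicator (box a' b') x *\<^sub>R Fn n x)) \<longlonglongrightarrow> (LBINT x. indicator (box a' b') x *\<^sub>R F x)"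
   proof (rule integral_dominated_convergence[where w = "\<lambda>x. c * indicator cube x"])
    show "AE x in lborel. (\<lambda>n. indicator (box a' b') x *\<^sub>R Fn n x) \<longlonglongrightarrow> indicator (box a' b') x *\<^sub>R F x"
     using Fn bc by (intro AE_I2) (auto simp: indicator_def)
    show "integrable lborel (\<lambda>x::real^'d. c * indicator cube x)"
     by (intro integrable_mult_right integrable_indicator_cube)
    show "AE x in lborel. norm (indicator (box a' b') x *\<^sub>R Fn n x) \<le> c * indicator cube x" for n
     using b bc order_trans[OF norm_ge_zero b] by (intro AE_I2) (auto simp: indicator_def)
   qed auto
   moreover have "(\<lambda>n. (LBINT x. indicator (box a' b') x *\<^sub>R Fn n x)) \<longlonglongrightarrow> (LBINT x. indicator (box a' b') x *\<^sub>R f x)"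
    by (rule boxes[OF ab])
   ultimately have "(LBINT x. indicator (box a' b') x *\<^sub>R f x) = (LBINT x. indicator (box a' b') x *\<^sub>R F x)"
    by (rule LIMSEQ_unique[rotated])
   also have "\<dots> = (LBINT x. indicator (box a' b') x *\<^sub>R G x)"
    using bc by (intro lint_cong) (auto simp: G_def indicator_def)
   finally show ?thesis .
  qed
  then show "(LBINT x. indicator (box a b) x *\<^sub>R f x) = (LBINT x. indicator (box a b) x *\<^sub>R G x)"
   using f by (subst (1 2) red) (auto simp: fout G_def[abs_def])
 qed
 then show ?thesis by eventually_elim (simp add: G_def)
qed

section \<open>The multilevel decomposition\<close>

lemma integral_reflect_real:
 fixes f :: "real => 'b::{banach,second_countable_topology}"
 shows "(LBINT x. f (c - x)) = (LBINT x. f x)"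
 using lborel_integral_real_affine[of "-1" f c] by simp

lemma integrable_reflect_real:
 fixes f :: "real => 'b::{banach,second_countable_topology}"
 shows "integrable lborel f ==> integrable lborel (\<lambda>x. f (c - x))"
 using lborel_integrable_real_affine[of f "-1" c] by simp

lemma integral_uminus_real:
 fixes f :: "real => 'b::{banach,second_countable_topology}"
 shows "(LBINT x. f (- x)) = (LBINT x. f x)"
 using integral_reflect_real[of f 0] by simp

text \<open>T_k has the parity of k. Reflecting both variables thus changes coefficients only by a
  sign, which carries bounds for the left kernels over to the right ones.\<close>

lemma cheb_fun_uminus: "cheb_fun k (- x) = (-1) ^ k * cheb_fun k x"
proof -
 have "poly (cheb_poly n) (- x) = (-1) ^ n * poly (cheb_poly n) x" for n
  by (induction n rule: cheb_poly.induct) (auto simp: algebra_simps)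
 then show ?thesis by (simp add: cheb_fun_def chebD_def wt_uminus)
qed

lemma bessel_family_reflect:
 assumes bf: "bessel_family K g B" and \<sigma>: "\<And>k. \<bar>\<sigma> k\<bar> = 1"
 shows "bessel_family K (\<lambda>k y. \<sigma> k * g k (- y)) B"
 unfolding bessel_family_def
proof (intro conjI ballI allI impI)
 have m: "g k \<in> borel_measurable borel" and i: "integrable lborel (\<lambda>x. (g k x)^2)" if "k \<in> K" for k
  using bf that by (auto simp: bessel_family_def)
 show "(\<lambda>y. \<sigma> k * g k (- y)) \<in> borel_measurable borel" if "k \<in> K" for k
  using m[OF that] by measurable
 show "integrable lborel (\<lambda>y. (\<sigma> k * g k (- y))^2)" if "k \<in> K" for k
  using integrable_reflect_real[OF i[OF that], of 0] by (simp add: power_mult_distrib)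
 fix u :: "real => complex" assume [measurable]: "u \<in> borel_measurable borel" and u2: "integrable lborel (\<lambda>x. (cmod (u x))^2)"
 have "(cmod (LBINT x. of_real (\<sigma> k * g k (- x)) * u x))^2 = (cmod (LBINT x. of_real (g k x) * u (- x)))^2" for k
 proof -
  have "(LBINT x. of_real (\<sigma> k * g k (- x)) * u x) = of_real (\<sigma> k) * (LBINT x. of_real (g k (- x)) * u x)"
   by (simp only: of_real_mult mult.assoc integral_mult_right_zero)
  also have "(LBINT x. of_real (g k (- x)) * u x) = (LBINT x. of_real (g k x) * u (- x))"
   using integral_uminus_real[of "\<lambda>x. of_real (g k x) * u (- x)"] by simp
  finally show ?thesis using \<sigma>[of k] by (simp add: norm_mult)
 qed
 then have "(\<Sum>k\<in>K. (cmod (LBINT x. of_real (\<sigma> k * g k (- x)) * u x))^2)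
  = (\<Sum>k\<in>K. (cmod (LBINT x. of_real (g k x) * u (- x)))^2)" by simp
 also have "\<dots> \<le> B * (LBINT x. (cmod (u (- x)))^2)"
  using bf integrable_reflect_real[OF u2, of 0] by (simp add: bessel_family_def)
 also have "(LBINT x. (cmod (u (- x)))^2) = (LBINT x. (cmod (u x))^2)"
  by (rule integral_uminus_real)
 finally show "(\<Sum>k\<in>K. (cmod (LBINT x. of_real (\<sigma> k * g k (- x)) * u x))^2) \<le> B * (LBINT x. (cmod (u x))^2)" .
qed (use bf in \<open>auto simp: bessel_family_def\<close>)

section \<open>Convolutions and telescoping\<close>

text \<open>Bounded and integrable: stable under all operations needed here, and enough for a
  convolution to exist at every point.\<close>

definition bdd_integrable :: "(real => real) => bool" where
 "bdd_integrable f \<longleftrightarrow> f \<in> borel_measurable borel \<and> integrable lborel f \<and> (\<exists>B. \<forall>x. \<bar>f x\<bar> \<le> B)"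

lemma bdd_integrable_add: "bdd_integrable f ==> bdd_integrable g ==> bdd_integrable (\<lambda>x. f x + g x)"
 and bdd_integrable_diff: "bdd_integrable f ==> bdd_integrable g ==> bdd_integrable (\<lambda>x. f x - g x)"
proof -
 assume f: "bdd_integrable f" and g: "bdd_integrable g"
 then obtain A B where A: "\<And>x. \<bar>f x\<bar> \<le> A" and B: "\<And>x. \<bar>g x\<bar> \<le> B" by (auto simp: bdd_integrable_def)
 have "\<bar>f x + g x\<bar> \<le> A + B" "\<bar>f x - g x\<bar> \<le> A + B" for x
  using A[of x] B[of x] by linarith+
 then show "bdd_integrable (\<lambda>x. f x + g x)" "bdd_integrable (\<lambda>x. f x - g x)"
  using f g by (auto simp: bdd_integrable_def)
qed

lemma bdd_integrable_cmult: "bdd_integrable f ==> bdd_integrable (\<lambda>x. c * f x)"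
proof -
 assume f: "bdd_integrable f"
 then obtain A where "\<And>x. \<bar>f x\<bar> \<le> A" by (auto simp: bdd_integrable_def)
 then have "\<bar>c * f x\<bar> \<le> \<bar>c\<bar> * A" for x by (simp add: abs_mult mult_left_mono)
 then show ?thesis using f by (auto simp: bdd_integrable_def)
qed

lemma bdd_integrable_scale: "bdd_integrable f ==> c \<noteq> 0 ==> bdd_integrable (\<lambda>x. f (c * x))"
 using lborel_integrable_real_affine[of f c 0] by (auto simp: bdd_integrable_def)

lemma bdd_integrable_sum: "(\<And>i. i \<in> A ==> bdd_integrable (f i)) ==> bdd_integrable (\<lambda>x. \<Sum>i\<in>A. f i x)"
proof (induction A rule: infinite_finite_induct)
 case (insert i A)
 then show ?case by (simp add: bdd_integrable_add)
qed (auto simp: bdd_integrable_def)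

lemma bdd_integrable_dil: "bdd_integrable f ==> bdd_integrable (dil i f)"
 unfolding dil_def[abs_def] by (intro bdd_integrable_cmult bdd_integrable_scale) auto

definition cv :: "(real => real) => (real => real) => real => real" where
 "cv a b z = (LBINT w. a w * b (z - w))"

lemma integrable_cv:
 assumes "bdd_integrable a" "bdd_integrable b"
 shows "integrable lborel (\<lambda>w. a w * b (z - w))"
proof -
 obtain B where B: "\<And>x. \<bar>b x\<bar> \<le> B" using assms by (auto simp: bdd_integrable_def)
 have [measurable]: "a \<in> borel_measurable borel" "b \<in> borel_measurable borel" using assms by (auto simp: bdd_integrable_def)
 show ?thesis
 proof (rule lint_bound)
  show "integrable lborel (\<lambda>w. a w * B)" using assms by (auto simp: bdd_integrable_def)
  have "\<bar>b (z - w)\<bar> \<le> \<bar>B\<bar>" for w using B[of "z - w"] by linarith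
  then show "AE w in lborel. norm (a w * b (z - w)) \<le> norm (a w * B)"
   by (intro AE_I2) (simp add: abs_mult mult_left_mono)
 qed measurable
qed

lemma cv_commute: "cv a b z = cv b a z"
 unfolding cv_def using integral_reflect_real[of "\<lambda>w. b w * a (z - w)" z] by (simp add: mult.commute)

context smoothing
begin

lemma \<nu>_good: "bdd_integrable \<nu>"
proof -
 obtain B where "0 \<le> B" "\<And>x. \<bar>\<nu> x\<bar> \<le> B"
  using smooth_compact_support_bounded[OF \<nu>_smooth \<nu>_supp] by blast
 then show ?thesis using \<nu>_int smooth_real_measurable[OF \<nu>_smooth] by (auto simp: bdd_integrable_def)
qed

lemma \<nu>_div_good: "1 \<le> m ==> bdd_integrable (\<lambda>x. \<nu> (x / real m))"
 using bdd_integrable_scale[OF \<nu>_good, of "1 / real m"] by simp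

lemma phi_good: "bdd_integrable phi"
 unfolding phi_def[abs_def] by (intro bdd_integrable_sum bdd_integrable_cmult \<nu>_div_good) auto

lemma level_kernel_good: "bdd_integrable (level_kernel i)"
 by (induction i rule: level_kernel.induct) (auto intro: phi_good bdd_integrable_add bdd_integrable_dil)

lemma step_density_good: "bdd_integrable (step_density i)"
 by (induction i rule: step_density.induct) (auto intro: \<nu>_good bdd_integrable_diff bdd_integrable_dil)

lemma integral_scale_div:
 fixes f :: "real => real"
 shows "1 \<le> m ==> (LBINT x. f (x / real m)) = real m * (LBINT x. f x)"
 using lborel_integral_real_affine[of "1 / real m" f 0] by simp

lemma integral_dil: "(LBINT x. dil i f x) = (LBINT x. f x)"
proof -
 have "(LBINT x. f x) = 2 ^ i * (LBINT x. f (2 ^ i * x))"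
  using lborel_integral_real_affine[of "2 ^ i" f 0] by simp
 then show ?thesis by (simp add: dil_def)
qed

lemma alternating_binomial: "(\<Sum>m=1..M. (-1) ^ (m + 1) * real (M choose m)) = 1"
proof -
 have "(\<Sum>m\<le>M. (-1) ^ m * real (M choose m)) = 0"
  using M1 by (intro choose_alternating_sum) simp
 also have "{..M} = insert 0 {1..M}" by auto
 finally have "(\<Sum>m=1..M. (-1) ^ m * real (M choose m)) = -1" by simp
 then show ?thesis by (simp add: sum_negf)
qed

text \<open>Each \<open>\<nu> (x / m) / m\<close> has mass one, so the total mass is the alternating
  binomial sum without its term m = 0.\<close>

lemma integral_phi: "(LBINT x. phi x) = 1"
proof -
 have "(LBINT x. phi x) = (\<Sum>m=1..M. (LBINT x. (-1) ^ (m + 1) * real (M choose m) / real m * \<nu> (x / real m)))"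
  unfolding phi_def using \<nu>_div_good
  by (intro lint_sum integrable_mult_right) (auto simp: bdd_integrable_def)
 also have "\<dots> = (\<Sum>m=1..M. (-1) ^ (m + 1) * real (M choose m))"
  by (intro sum.cong) (auto simp: integral_scale_div \<nu>_1)
 finally show ?thesis by (simp only: alternating_binomial)
qed

text \<open>From level 2 on the density is a difference of two probability densities. Its zero mean
  removes the unshifted term of the M-th difference in \<open>redL_pos\<close>.\<close>

lemma integral_step_density: "(LBINT x. step_density i x) = (if i \<le> 1 then 1 else 0)"
proof (induction i rule: step_density.induct)
 case (3 i)
 have "integrable lborel (dil j \<nu>)" for j using bdd_integrable_dil[OF \<nu>_good, of j] by (auto simp: bdd_integrable_def)
 then show ?case by (simp add: integral_dil del: One_nat_def)
qed (auto simp: \<nu>_1)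

lemma step_density_abs: "(LBINT x. \<bar>step_density i x\<bar>) \<le> 2"
proof (induction i rule: step_density.induct)
 case (3 i)
 have i: "integrable lborel (dil j \<nu>)" for j using bdd_integrable_dil[OF \<nu>_good, of j] by (auto simp: bdd_integrable_def)
 have nn: "0 \<le> dil j \<nu> x" for j x by (simp add: dil_def \<nu>_nonneg)
 have "(LBINT x. \<bar>step_density (Suc (Suc i)) x\<bar>) \<le> (LBINT x. dil (Suc i) \<nu> x + dil i \<nu> x)"
 proof (rule integral_mono_AE')
  show "AE x in lborel. \<bar>step_density (Suc (Suc i)) x\<bar> \<le> dil (Suc i) \<nu> x + dil i \<nu> x"
   using nn[of "Suc i"] nn[of i] by (intro AE_I2) (simp add: abs_le_iff add.commute)
 qed (use i nn in auto)
 also have "\<dots> = 2" using i by (simp add: integral_dil \<nu>_1)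
 finally show ?case .
qed (auto simp: \<nu>_nonneg \<nu>_1)

lemma step_density_supp: "h \<notin> {0..1 / (4 * real M)} ==> step_density i h = 0"
proof (induction i rule: step_density.induct)
 case (3 i)
 have "2 ^ j * h \<notin> {0..1 / (4 * real M)}" for j
 proof
  assume a: "2 ^ j * h \<in> {0..1 / (4 * real M)}"
  then have "0 \<le> h" using zero_less_power[of "2::real" j] by (auto simp: zero_le_mult_iff dest: leD)
  moreover then have "1 * h \<le> 2 ^ j * h" by (intro mult_right_mono) auto
  ultimately show False using a 3 by auto
 qed
 then have z: "\<nu> (2 ^ j * h) = 0" for j by (intro \<nu>_supp)
 show ?case using z[of "Suc i"] z[of i] by (simp add: dil_def)
qed (auto simp: \<nu>_supp)

text \<open>2 / 2^i = 2^-(i - 1): a level i >= 1 is charged to index i - 1 of the seminorm.\<close>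

lemma step_density_supp': "1 \<le> i ==> \<not> \<bar>h\<bar> \<le> 2 / 2 ^ i ==> step_density i h = 0"
proof (induction i rule: step_density.induct)
 case 2
 have "1 / (4 * real M) \<le> 1" using M1 by (simp add: divide_le_eq)
 then show ?case using 2 by (auto intro!: \<nu>_supp)
next
 case (3 i)
 have "2 ^ j * h \<notin> {0..1 / (4 * real M)}" if "i \<le> j" for j
 proof
  assume a: "2 ^ j * h \<in> {0..1 / (4 * real M)}"
  then have h: "0 \<le> h" using zero_less_power[of "2::real" j] by (auto simp: zero_le_mult_iff dest: leD)
  have "2 ^ i * h \<le> 2 ^ j * h" using h that by (intro mult_right_mono power_increasing) auto
  also have "\<dots> \<le> 1 / (4 * real M)" using a by simp
  also have "\<dots> \<le> 1 / 4" using M1 by (simp add: divide_simps)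
  finally have "h \<le> (1 / 4) / 2 ^ i" by (simp add: field_simps)
  also have "\<dots> \<le> 2 / 2 ^ Suc (Suc i)" by (simp add: field_simps)
  finally show False using 3 h by simp
 qed
 then have z: "\<nu> (2 ^ j * h) = 0" if "i \<le> j" for j using that by (intro \<nu>_supp)
 show ?case using z[of "Suc i"] z[of i] by (simp add: dil_def)
qed simp

text \<open>The coefficients of the M-th forward difference, and those of the identity at level
  0.\<close>

definition diff_coeff :: "nat => nat => real" where
 "diff_coeff i m = (if i = 0 then (if m = 0 then 1 else 0) else (-1) ^ (M - m) * real (M choose m))"

text \<open>The kernel seen by f itself: the averaged difference has been moved from f onto
  \<open>kapL\<close> by the substitution z = y + m h. Summing these kernels over the levels
  telescopes.\<close>

definition redL :: "nat => real => real => real" where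
 "redL i x z = (\<Sum>m\<le>M. diff_coeff i m * (LBINT h. step_density i h * kapL i x (z - real m * h)))"

lemma redL_0: "redL 0 x z = psi x * phi (z - x)"
proof -
 have "redL 0 x z = (\<Sum>m\<le>M. if m = 0 then (LBINT h. \<nu> h * kapL 0 x z) else 0)"
  unfolding redL_def by (intro sum.cong) (auto simp: diff_coeff_def)
 then show ?thesis by (simp add: \<nu>_1 kapL_def level_sign_def)
qed

text \<open>For m >= 1 the substitution w = m h turns the m-th shift into a convolution with the
  density of m h. The shift m = 0 needs no integration against the kernel and leaves the mass of the
  density.\<close>

lemma redL_pos:
 assumes i: "1 \<le> i"
 shows "redL i x z = psi x * (cv (\<lambda>w. \<Sum>m=1..M. (-1) ^ (m + 1) * real (M choose m) / real m * step_density i (w / real m)) (level_kernel i) (z - x)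
   - (LBINT h. step_density i h) * level_kernel i (z - x))"
proof -
 define \<sigma> where "\<sigma> = step_density i"
 define K where "K = level_kernel i"
 have good: "bdd_integrable \<sigma>" "bdd_integrable K" by (simp_all add: \<sigma>_def K_def step_density_good level_kernel_good)
 define I where "I m = (LBINT h. \<sigma> h * K (z - x - real m * h))" for m
 have trm: "(LBINT h. step_density i h * kapL i x (z - real m * h)) = level_sign i * psi x * I m" for m
 proof -
  have "(LBINT h. step_density i h * kapL i x (z - real m * h)) = (LBINT h. (level_sign i * psi x) * (\<sigma> h * K (z - x - real m * h)))"
   by (intro lint_cong) (auto simp: kapL_def \<sigma>_def K_def algebra_simps)
  then show ?thesis by (simp only: integral_mult_right_zero I_def)
 qed
 have Im: "I m = cv (\<lambda>w. \<sigma> (w / real m) / real m) K (z - x)" if "1 \<le> m" for m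
 proof -
  have "cv (\<lambda>w. \<sigma> (w / real m) / real m) K (z - x) = (LBINT w. (\<lambda>h. \<sigma> h / real m * K (z - x - real m * h)) (w / real m))"
   unfolding cv_def using that by (intro lint_cong) auto
  also have "\<dots> = real m * (LBINT h. \<sigma> h / real m * K (z - x - real m * h))"
   by (rule integral_scale_div[OF that])
  also have "\<dots> = (LBINT h. real m * (\<sigma> h / real m * K (z - x - real m * h)))"
   by (simp only: integral_mult_right_zero)
  also have "\<dots> = I m"
   unfolding I_def using that by (intro lint_cong) auto
  finally show ?thesis by simp
 qed
 have I0: "I 0 = (LBINT h. \<sigma> h) * K (z - x)" by (simp add: I_def)
 have sg: "level_sign i * diff_coeff i m = (-1) ^ (m + 1) * real (M choose m)" if "m \<le> M" for m
 proof -
  have "(-1::real) ^ (M + 1) * (-1) ^ (M - m) = (-1) ^ (m + 1)"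
  proof -
   have "M + 1 + (M - m) = 2 * (M - m) + (m + 1)" using that by simp
   then show ?thesis by (simp only: power_add[symmetric]) (simp add: power_add power_mult)
  qed
  then show ?thesis using i by (simp add: level_sign_def diff_coeff_def)
 qed
 have "redL i x z = (\<Sum>m\<le>M. psi x * ((level_sign i * diff_coeff i m) * I m))"
  unfolding redL_def trm by (intro sum.cong) auto
 also have "\<dots> = psi x * (\<Sum>m\<le>M. (-1) ^ (m + 1) * real (M choose m) * I m)"
  by (simp add: sg sum_distrib_left)
 also have "(\<Sum>m\<le>M. (-1) ^ (m + 1) * real (M choose m) * I m) = (\<Sum>m=1..M. (-1) ^ (m + 1) * real (M choose m) * I m) - I 0"
 proof -
  have "{..M} = insert 0 {1..M}" by auto
  then show ?thesis by simp
 qed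
 also have "(\<Sum>m=1..M. (-1) ^ (m + 1) * real (M choose m) * I m)
  = cv (\<lambda>w. \<Sum>m=1..M. (-1) ^ (m + 1) * real (M choose m) / real m * \<sigma> (w / real m)) K (z - x)"
 proof -
  have "cv (\<lambda>w. \<Sum>m=1..M. (-1) ^ (m + 1) * real (M choose m) / real m * \<sigma> (w / real m)) K (z - x)
   = (LBINT w. (\<Sum>m=1..M. ((-1) ^ (m + 1) * real (M choose m)) * (\<sigma> (w / real m) / real m * K (z - x - w))))"
   unfolding cv_def sum_distrib_right by (intro lint_cong sum.cong) auto
  also have "\<dots> = (\<Sum>m=1..M. (LBINT w. ((-1) ^ (m + 1) * real (M choose m)) * (\<sigma> (w / real m) / real m * K (z - x - w))))"
  proof (intro lint_sum integrable_mult_right)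
   fix m assume m: "m \<in> {1..M}"
   have "bdd_integrable (\<lambda>w. (1 / real m) * \<sigma> ((1 / real m) * w))"
    using m by (intro bdd_integrable_cmult bdd_integrable_scale good) auto
   from integrable_cv[OF this good(2), of "z - x"]
   show "integrable lborel (\<lambda>w. \<sigma> (w / real m) / real m * K (z - x - w))" by simp
  qed
  also have "\<dots> = (\<Sum>m=1..M. (-1) ^ (m + 1) * real (M choose m) * I m)"
   by (intro sum.cong) (auto simp: Im cv_def)
  finally show ?thesis by simp
 qed
 finally show ?thesis by (simp add: I0 \<sigma>_def K_def)
qed

lemma redL_1: "redL (Suc 0) x z = psi x * (cv phi phi (z - x) - phi (z - x))"
proof -
 have eq: "(\<lambda>w. \<Sum>m=1..M. (-1) ^ (m + 1) * real (M choose m) / real m * \<nu> (w / real m)) = phi"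
  by (rule ext) (simp only: phi_def)
 have "1 \<le> Suc 0" by simp
 from redL_pos[OF this, of x z] show ?thesis
  unfolding level_kernel.simps step_density.simps \<nu>_1 mult_1 eq .
qed

text \<open>(a - b)*(a + b) = a*a - b*b, the mixed terms cancelling because convolution commutes;
  the term m = 0 is absent since the density has mean zero.\<close>

lemma redL_Suc_Suc: "redL (Suc (Suc i)) x z =
  psi x * (cv (dil (Suc i) phi) (dil (Suc i) phi) (z - x) - cv (dil i phi) (dil i phi) (z - x))"
proof -
 define a where "a = dil (Suc i) phi"
 define b where "b = dil i phi"
 have g: "bdd_integrable a" "bdd_integrable b" by (simp_all add: a_def b_def bdd_integrable_dil phi_good)
 have d: "(\<Sum>m=1..M. (-1) ^ (m + 1) * real (M choose m) / real m * dil j \<nu> (w / real m)) = dil j phi w" for j w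
  by (simp add: dil_def phi_def sum_distrib_left mult_ac)
 have eq: "(\<lambda>w. \<Sum>m=1..M. (-1) ^ (m + 1) * real (M choose m) / real m * step_density (Suc (Suc i)) (w / real m)) = (\<lambda>w. a w - b w)"
  unfolding a_def b_def d[symmetric] step_density.simps right_diff_distrib sum_subtractf ..
 have "cv (\<lambda>w. a w - b w) (\<lambda>z. a z + b z) (z - x) = cv a a (z - x) + cv a b (z - x) - cv b a (z - x) - cv b b (z - x)"
 proof -
  have "cv (\<lambda>w. a w - b w) (\<lambda>z. a z + b z) (z - x) =
   (LBINT w. a w * a (z - x - w) + a w * b (z - x - w) - b w * a (z - x - w) - b w * b (z - x - w))"
   unfolding cv_def by (intro lint_cong) (auto simp: algebra_simps)
  then show ?thesis unfolding cv_def using integrable_cv g by simp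
 qed
 also have "cv b a (z - x) = cv a b (z - x)" by (rule cv_commute)
 finally have cveq: "cv (\<lambda>w. a w - b w) (\<lambda>z. a z + b z) (z - x) = cv a a (z - x) - cv b b (z - x)" by simp
 have i0: "(LBINT h. step_density (Suc (Suc i)) h) = 0"
  by (simp add: integral_step_density del: step_density.simps)
 have "1 \<le> Suc (Suc i)" by simp
 from redL_pos[OF this, of x z] have "redL (Suc (Suc i)) x z = psi x * (cv (\<lambda>w. a w - b w) (\<lambda>z. a z + b z) (z - x) - 0)"
  unfolding eq i0 level_kernel.simps(3) a_def[symmetric] b_def[symmetric] mult_zero_left .
 then show ?thesis by (simp only: cveq a_def[symmetric] b_def[symmetric] diff_zero)
qed

text \<open>Levels 0 and 1 together give \<open>phi\<close> convolved with itself, and each further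
  level exchanges the current dilate for the next one.\<close>

lemma redL_sum: "(\<Sum>i\<le>Suc n. redL i x z) = psi x * cv (dil n phi) (dil n phi) (z - x)"
proof (induction n)
 case 0
 have "dil 0 phi = phi" by (rule ext) (simp add: dil_def)
 then show ?case by (simp add: redL_0 redL_1 algebra_simps)
next
 case (Suc n)
 have "(\<Sum>i\<le>Suc (Suc n). redL i x z) = (\<Sum>i\<le>Suc n. redL i x z) + redL (Suc (Suc n)) x z" by simp
 then show ?case by (simp only: Suc redL_Suc_Suc) (simp add: algebra_simps)
qed

text \<open>Substituting twice by the scale 2^n writes the smoothing as a double average of H over
  shifts of size 2^-n; in this form boundedness and the limit are visible.\<close>

lemma smoothed_interval:
 fixes H :: "real => real"
 assumes Hm [measurable]: "H \<in> borel_measurable borel" and Hi: "integrable lborel H" and H1: "\<And>x. \<bar>H x\<bar> \<le> 1"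
 shows "(LBINT x. H x * cv (dil n phi) (dil n phi) (z - x))
  = (LBINT v. phi v * (LBINT w. phi w * H (z - (v + w) / 2 ^ n)))"
proof -
 define N where "N = (2::real) ^ n"
 have N: "0 < N" by (simp add: N_def)
 obtain B where B: "\<And>x. \<bar>phi x\<bar> \<le> B" using phi_good by (auto simp: bdd_integrable_def)
 have pm [measurable]: "phi \<in> borel_measurable borel" and pi: "integrable lborel phi" using phi_good by (auto simp: bdd_integrable_def)
 have cveq: "cv (dil n phi) (dil n phi) \<zeta> = (LBINT v. phi v * (N * phi (N * \<zeta> - v)))" for \<zeta>
 proof -
  have "(LBINT v. phi v * (N * phi (N * \<zeta> - v))) = N * (LBINT w. phi (N * w) * (N * phi (N * \<zeta> - N * w)))"
   using lborel_integral_real_affine[of N "\<lambda>v. phi v * (N * phi (N * \<zeta> - v))" 0] N by simp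
  also have "\<dots> = (LBINT w. N * (phi (N * w) * (N * phi (N * \<zeta> - N * w))))" by simp
  also have "\<dots> = cv (dil n phi) (dil n phi) \<zeta>"
   unfolding cv_def dil_def N_def by (intro lint_cong) (auto simp: algebra_simps)
  finally show ?thesis by simp
 qed
 have int: "integrable (lborel \<Otimes>\<^sub>M lborel) (\<lambda>(x, v). H x * (phi v * (N * phi (N * (z - x) - v))))"
 proof (rule lint_bound)
  show "integrable (lborel \<Otimes>\<^sub>M lborel) (\<lambda>p. of_real (H (fst p)) * complex_of_real (N * B * phi (snd p)))"
   using Hi pi by (intro integrable_tensor) auto
  show "AE p in lborel \<Otimes>\<^sub>M lborel. norm (case p of (x, v) => H x * (phi v * (N * phi (N * (z - x) - v))))
    \<le> norm (of_real (H (fst p)) * complex_of_real (N * B * phi (snd p)))"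
  proof (rule AE_I2)
   fix p :: "real \<times> real"
   obtain x v where p: "p = (x, v)" by (cases p)
   have "\<bar>H x\<bar> * (\<bar>phi v\<bar> * (N * \<bar>phi (N * (z - x) - v)\<bar>)) \<le> \<bar>H x\<bar> * (\<bar>phi v\<bar> * (N * \<bar>B\<bar>))"
    using B[of "N * (z - x) - v"] N by (intro mult_left_mono) auto
   then show "norm (case p of (x, v) => H x * (phi v * (N * phi (N * (z - x) - v))))
    \<le> norm (of_real (H (fst p)) * complex_of_real (N * B * phi (snd p)))"
    using N by (simp add: p norm_mult abs_mult mult_ac)
  qed
 qed (simp add: case_prod_unfold)
 have "(LBINT x. H x * cv (dil n phi) (dil n phi) (z - x)) = (LBINT x. (LBINT v. H x * (phi v * (N * phi (N * (z - x) - v)))))"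
  by (simp only: cveq integral_mult_right_zero)
 also have "\<dots> = (LBINT v. (LBINT x. H x * (phi v * (N * phi (N * (z - x) - v)))))"
  using lborel_pair.Fubini_integral[OF int] by simp
 also have "\<dots> = (LBINT v. phi v * (LBINT w. phi w * H (z - (v + w) / N)))"
 proof (rule lint_cong[OF refl])
  fix v
  have "(LBINT x. H x * (phi v * (N * phi (N * (z - x) - v)))) = (1 / N) * (LBINT w. H (z - (v + w) / N) * (phi v * (N * phi w)))"
  proof -
   define g where "g x = H x * (phi v * (N * phi (N * (z - x) - v)))" for x
   have gs: "g ((z - v / N) + (- 1 / N) * w) = H (z - (v + w) / N) * (phi v * (N * phi w))" for w
   proof -
    have a: "(z - v / N) + (- 1 / N) * w = z - (v + w) / N" by (simp add: add_divide_distrib)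
    have b: "N * (z - (z - (v + w) / N)) - v = w" using N by simp
    show ?thesis unfolding g_def a b ..
   qed
   have "(LBINT x. g x) = \<bar>- 1 / N\<bar> *\<^sub>R (LBINT w. g ((z - v / N) + (- 1 / N) * w))"
    by (rule lborel_integral_real_affine) (use N in simp)
   then have "(LBINT x. g x) = \<bar>- 1 / N\<bar> *\<^sub>R (LBINT w. H (z - (v + w) / N) * (phi v * (N * phi w)))"
    by (simp only: gs)
   then show ?thesis using N by (simp add: g_def)
  qed
  also have "(LBINT w. H (z - (v + w) / N) * (phi v * (N * phi w))) = (LBINT w. (phi v * N) * (phi w * H (z - (v + w) / N)))"
   by (intro lint_cong) auto
  finally show "(LBINT x. H x * (phi v * (N * phi (N * (z - x) - v)))) = phi v * (LBINT w. phi w * H (z - (v + w) / N))"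
   using N by simp
 qed
 finally show ?thesis by (simp add: N_def)
qed

lemma smoothed_interval_bound:
 fixes H :: "real => real"
 assumes Hm: "H \<in> borel_measurable borel" and H1: "\<And>x. \<bar>H x\<bar> \<le> 1"
 shows "\<bar>(LBINT w. phi w * H (z - (v + w) / 2 ^ n))\<bar> \<le> (LBINT w. \<bar>phi w\<bar>)"
  and "\<bar>(LBINT v. phi v * (LBINT w. phi w * H (z - (v + w) / 2 ^ n)))\<bar> \<le> (LBINT w. \<bar>phi w\<bar>)^2"
proof -
 have pi: "integrable lborel phi" using phi_good by (auto simp: bdd_integrable_def)
 have a: "\<bar>(LBINT w. phi w * H (z - (v + w) / 2 ^ n))\<bar> \<le> (LBINT w. \<bar>phi w\<bar>)" for v
 proof -
  have "\<bar>(LBINT w. phi w * H (z - (v + w) / 2 ^ n))\<bar> \<le> (LBINT w. \<bar>phi w * H (z - (v + w) / 2 ^ n)\<bar>)"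
   using integral_norm_bound[of lborel "\<lambda>w. phi w * H (z - (v + w) / 2 ^ n)"] by simp
  also have "\<dots> \<le> (LBINT w. \<bar>phi w\<bar>)"
   using pi H1 by (intro integral_mono_AE') (auto simp: abs_mult intro!: mult_left_le)
  finally show ?thesis .
 qed
 show "\<bar>(LBINT w. phi w * H (z - (v + w) / 2 ^ n))\<bar> \<le> (LBINT w. \<bar>phi w\<bar>)" by (rule a)
 have "\<bar>(LBINT v. phi v * (LBINT w. phi w * H (z - (v + w) / 2 ^ n)))\<bar>
  \<le> (LBINT v. \<bar>phi v * (LBINT w. phi w * H (z - (v + w) / 2 ^ n))\<bar>)"
  using integral_norm_bound[of lborel "\<lambda>v. phi v * (LBINT w. phi w * H (z - (v + w) / 2 ^ n))"] by simp
 also have "\<dots> \<le> (LBINT v. \<bar>phi v\<bar> * (LBINT w. \<bar>phi w\<bar>))"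
  using pi by (intro integral_mono_AE') (auto simp: abs_mult intro!: mult_left_mono a integral_nonneg_AE)
 also have "\<dots> = (LBINT w. \<bar>phi w\<bar>)^2" by (simp add: power2_eq_square)
 finally show "\<bar>(LBINT v. phi v * (LBINT w. phi w * H (z - (v + w) / 2 ^ n)))\<bar> \<le> (LBINT w. \<bar>phi w\<bar>)^2" .
qed

text \<open>Two nested dominated convergences. \<open>phi\<close> changes sign in general, so its L1
  norm is the majorant while its integral 1 yields the limit.\<close>

lemma smoothed_interval_limit:
 fixes H :: "real => real"
 assumes Hm [measurable]: "H \<in> borel_measurable borel" and H1: "\<And>x. \<bar>H x\<bar> \<le> 1" and cont: "isCont H z"
 shows "(\<lambda>n. (LBINT v. phi v * (LBINT w. phi w * H (z - (v + w) / 2 ^ n)))) \<longlonglongrightarrow> H z"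
proof -
 have pm [measurable]: "phi \<in> borel_measurable borel" and pi: "integrable lborel phi" using phi_good by (auto simp: bdd_integrable_def)
 have inner: "(\<lambda>n. (LBINT w. phi w * H (z - (v + w) / 2 ^ n))) \<longlonglongrightarrow> (LBINT w. phi w * H z)" for v
 proof (rule integral_dominated_convergence[where w = "\<lambda>w. \<bar>phi w\<bar>"])
  show "AE w in lborel. (\<lambda>n. phi w * H (z - (v + w) / 2 ^ n)) \<longlonglongrightarrow> phi w * H z"
  proof (rule AE_I2, intro tendsto_mult tendsto_const)
   fix w
   have "(\<lambda>n. z - (v + w) * (1 / 2) ^ n) \<longlonglongrightarrow> z - (v + w) * 0"
    by (intro tendsto_intros LIMSEQ_power_zero) auto
   then have "(\<lambda>n. z - (v + w) / 2 ^ n) \<longlonglongrightarrow> z" by (simp add: power_divide)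
   then show "(\<lambda>n. H (z - (v + w) / 2 ^ n)) \<longlonglongrightarrow> H z" by (rule isCont_tendsto_compose[OF cont])
  qed
  show "AE w in lborel. norm (phi w * H (z - (v + w) / 2 ^ n)) \<le> \<bar>phi w\<bar>" for n
   using H1 by (intro AE_I2) (auto simp: abs_mult intro!: mult_left_le)
 qed (use pi in auto)
 have "(\<lambda>n. (LBINT v. phi v * (LBINT w. phi w * H (z - (v + w) / 2 ^ n)))) \<longlonglongrightarrow> (LBINT v. phi v * (LBINT w. phi w * H z))"
 proof (rule integral_dominated_convergence[where w = "\<lambda>v. \<bar>phi v\<bar> * (LBINT w. \<bar>phi w\<bar>)"])
  show "(\<lambda>v. phi v * (LBINT w. phi w * H (z - (v + w) / 2 ^ n))) \<in> borel_measurable lborel" for n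
   by measurable
  show "AE v in lborel. (\<lambda>n. phi v * (LBINT w. phi w * H (z - (v + w) / 2 ^ n))) \<longlonglongrightarrow> phi v * (LBINT w. phi w * H z)"
   by (intro AE_I2 tendsto_mult tendsto_const inner)
  show "AE v in lborel. norm (phi v * (LBINT w. phi w * H (z - (v + w) / 2 ^ n))) \<le> \<bar>phi v\<bar> * (LBINT w. \<bar>phi w\<bar>)" for n
   by (intro AE_I2) (auto simp: abs_mult intro!: mult_left_mono smoothed_interval_bound Hm H1)
 qed (use pi in auto)
 then show ?thesis by (simp add: integral_phi)
qed

definition red :: "bool \<times> nat => real => real => real" where
 "red t x z = (if fst t then redL (snd t) x z else redL (snd t) (- x) (- z))"

definition levels :: "nat => (bool \<times> nat) set" where
 "levels n = UNIV \<times> {..Suc n}"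

lemma finite_levels: "finite (levels n)" by (simp add: levels_def)

lemma red_sum: "(\<Sum>t\<in>levels n. red t x z) =
  psi x * cv (dil n phi) (dil n phi) (z - x) + psi (- x) * cv (dil n phi) (dil n phi) (- z - - x)"
proof -
 have "(\<Sum>t\<in>levels n. red t x z) = (\<Sum>b\<in>UNIV. \<Sum>i\<le>Suc n. red (b, i) x z)"
  unfolding levels_def by (simp only: sum.cartesian_product) (simp add: case_prod_unfold)
 also have "\<dots> = (\<Sum>i\<le>Suc n. redL i x z) + (\<Sum>i\<le>Suc n. redL i (- x) (- z))"
  by (simp add: UNIV_bool red_def add.commute)
 finally show ?thesis by (simp only: redL_sum)
qed

text \<open>The kernels are tested in x, with z the variable of f: this is the adjoint smoothing
  applied to the indicator of (a, b). It converges at points of continuity, hence off the two end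
  points, and with a bound independent of n and z.\<close>

lemma red_sum_weak_limit:
 assumes ab: "a < b"
 shows "z \<noteq> a ==> z \<noteq> b ==> (\<lambda>n. (LBINT x. indicator {a<..<b} x * (\<Sum>t\<in>levels n. red t x z))) \<longlonglongrightarrow> indicator {a<..<b} z"
  and "\<bar>(LBINT x. indicator {a<..<b} x * (\<Sum>t\<in>levels n. red t x z))\<bar> \<le> 2 * (LBINT w. \<bar>phi w\<bar>)^2"
proof -
 note [measurable] = smooth_real_measurable[OF smooth_psi]
 define H where "H a b x = indicator {a<..<b} x * psi x" for a b x :: real
 have Hm [measurable]: "H a b \<in> borel_measurable borel" for a b unfolding H_def[abs_def] by measurable
 have H1: "\<bar>H a b x\<bar> \<le> 1" for a b x using psi_range[of x] by (auto simp: H_def indicator_def)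
 have Hi: "integrable lborel (H a b)" for a b
 proof (rule lint_bound)
  show "integrable lborel (indicator {a<..<b} :: real => real)"
   by (cases "a \<le> b") auto
  show "AE x in lborel. norm (H a b x) \<le> norm (indicator {a<..<b} x :: real)"
   using psi_range by (intro AE_I2) (auto simp: H_def indicator_def)
 qed measurable
 define S where "S n a b z = (LBINT v. phi v * (LBINT w. phi w * H a b (z - (v + w) / 2 ^ n)))" for n a b z
 have part: "(LBINT x. H a b x * cv (dil n phi) (dil n phi) (z - x)) = S n a b z" for a b n z
  unfolding S_def by (rule smoothed_interval[OF Hm Hi H1])
 have cvm: "cv (dil n phi) (dil n phi) \<in> borel_measurable borel" for n
 proof -
  have [measurable]: "dil n phi \<in> borel_measurable borel" using bdd_integrable_dil[OF phi_good] by (auto simp: bdd_integrable_def)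
  show ?thesis unfolding cv_def[abs_def] by measurable
 qed
 have cvb: "\<exists>B. \<forall>\<zeta>. \<bar>cv (dil n phi) (dil n phi) \<zeta>\<bar> \<le> B" for n
 proof -
  have g: "bdd_integrable (dil n phi)" by (rule bdd_integrable_dil[OF phi_good])
  then obtain B where B: "\<And>x. \<bar>dil n phi x\<bar> \<le> B" by (auto simp: bdd_integrable_def)
  have "\<bar>cv (dil n phi) (dil n phi) \<zeta>\<bar> \<le> (LBINT w. B * \<bar>dil n phi w\<bar>)" for \<zeta>
  proof -
   have "\<bar>cv (dil n phi) (dil n phi) \<zeta>\<bar> \<le> (LBINT w. \<bar>dil n phi w * dil n phi (\<zeta> - w)\<bar>)"
    unfolding cv_def using integral_norm_bound[of lborel "\<lambda>w. dil n phi w * dil n phi (\<zeta> - w)"] by simp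
   also have "\<dots> \<le> (LBINT w. B * \<bar>dil n phi w\<bar>)"
   proof (rule integral_mono_AE')
    show "integrable lborel (\<lambda>w. B * \<bar>dil n phi w\<bar>)" using g by (auto simp: bdd_integrable_def)
    show "AE w in lborel. \<bar>dil n phi w * dil n phi (\<zeta> - w)\<bar> \<le> B * \<bar>dil n phi w\<bar>"
     unfolding abs_mult mult.commute[of B] by (intro AE_I2 mult_left_mono B) auto
    show "AE w in lborel. 0 \<le> B * \<bar>dil n phi w\<bar>"
     by (intro AE_I2 mult_nonneg_nonneg order_trans[OF abs_ge_zero B[of 0]]) auto
   qed
   finally show ?thesis .
  qed
  then show ?thesis by blast
 qed
 have intg: "integrable lborel (\<lambda>x. H a b x * cv (dil n phi) (dil n phi) (z - x))" for a b n z
 proof -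
  note [measurable] = cvm
  obtain B where B: "\<And>\<zeta>. \<bar>cv (dil n phi) (dil n phi) \<zeta>\<bar> \<le> B" using cvb by blast
  show ?thesis
  proof (rule lint_bound)
   show "integrable lborel (\<lambda>x. H a b x * B)" using Hi by simp
   show "AE x in lborel. norm (H a b x * cv (dil n phi) (dil n phi) (z - x)) \<le> norm (H a b x * B)"
    using B by (intro AE_I2) (auto simp: abs_mult intro!: mult_left_mono order_trans[OF B abs_ge_self])
  qed measurable
 qed
 \<comment> \<open>The right-sided kernels are reflected into left-sided ones for the interval (-b,
   -a); in the limit the two sides add up by psi(z) + psi(-z) = 1.\<close>
 have eq: "(LBINT x. indicator {a<..<b} x * (\<Sum>t\<in>levels n. red t x z)) = S n a b z + S n (- b) (- a) (- z)" for n z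
 proof -
  have "(LBINT x. indicator {a<..<b} x * (\<Sum>t\<in>levels n. red t x z))
   = (LBINT x. H a b x * cv (dil n phi) (dil n phi) (z - x) + H (- b) (- a) (- x) * cv (dil n phi) (dil n phi) (- z - - x))"
   unfolding red_sum by (intro lint_cong) (auto simp: H_def indicator_def)
  also have "\<dots> = S n a b z + (LBINT x. H (- b) (- a) (- x) * cv (dil n phi) (dil n phi) (- z - - x))"
   using intg integrable_reflect_real[OF intg[of "- b" "- a" n "- z"], of 0] by (simp add: part)
  also have "(LBINT x. H (- b) (- a) (- x) * cv (dil n phi) (dil n phi) (- z - - x)) = S n (- b) (- a) (- z)"
   using integral_uminus_real[of "\<lambda>x. H (- b) (- a) x * cv (dil n phi) (dil n phi) (- z - x)"] by (simp add: part)
  finally show ?thesis .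
 qed
 show "\<bar>(LBINT x. indicator {a<..<b} x * (\<Sum>t\<in>levels n. red t x z))\<bar> \<le> 2 * (LBINT w. \<bar>phi w\<bar>)^2"
  unfolding eq S_def
  using smoothed_interval_bound(2)[OF Hm[of a b] H1, of z n] smoothed_interval_bound(2)[OF Hm[of "-b" "-a"] H1, of "-z" n] by linarith
 assume z: "z \<noteq> a" "z \<noteq> b"
 have psic: "isCont psi w" for w
  using smooth_real_deriv(1)[OF smooth_psi] by (rule DERIV_isCont)
 have lim: "(\<lambda>n. S n a b w) \<longlonglongrightarrow> H a b w" if "w \<noteq> a" "w \<noteq> b" "a < b" for a b w
 proof -
  have "w \<notin> frontier {a<..<b}" using that by (simp add: frontier_def interior_open)
  then have "isCont (indicator {a<..<b} :: real => real) w" by (simp add: isCont_indicator)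
  then have "isCont (H a b) w" unfolding H_def[abs_def] by (intro continuous_intros psic)
  then show ?thesis unfolding S_def by (intro smoothed_interval_limit Hm H1)
 qed
 have "(\<lambda>n. S n a b z + S n (- b) (- a) (- z)) \<longlonglongrightarrow> H a b z + H (- b) (- a) (- z)"
  using z ab by (intro tendsto_add lim) auto
 also have "H a b z + H (- b) (- a) (- z) = indicator {a<..<b} z"
  using psi_compl[of z] by (auto simp: H_def indicator_def)
 finally show "(\<lambda>n. (LBINT x. indicator {a<..<b} x * (\<Sum>t\<in>levels n. red t x z))) \<longlonglongrightarrow> indicator {a<..<b} z"
  by (simp only: eq)
qed

lemma kapL_properties:
 obtains C where "0 \<le> C" "\<And>i. (\<lambda>p. kapL i (fst p) (snd p)) \<in> borel_measurable (borel \<Otimes>\<^sub>M borel)"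
  "\<And>i x y. \<bar>kapL i x y\<bar> \<le> C * 2 ^ i"
  "\<And>i x. integrable lborel (\<lambda>y. (kapL i x y)^2)" "\<And>i x. (LBINT y. (kapL i x y)^2) \<le> C\<^sup>2 * 2 ^ i"
  "\<And>s K i. 1/2 < s ==> s < real M ==> finite K ==>
   bessel_family K (\<lambda>k y. sqrt ((1 + (real k)^2) powr s * (1 / 2 powr (- min (s - 1/2) (real M - s))) ^ ndist i (floor_log k)) * (LBINT x. kapL i x y * cheb_fun k x))
   ((4 powr s * dyadic_const s M * C\<^sup>2 * (2 / (1 - 2 powr (- min (s - 1/2) (real M - s))))) * (2 powr (s * real i))^2)"
proof -
 from kapL_local_kernel obtain C where C: "\<forall>i. \<exists>D. D 0 = kapL i \<and> local_kernel D C (2 ^ i) M" ..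
 then obtain D where D: "\<And>i. D i 0 = kapL i" "\<And>i. local_kernel (D i) C (2 ^ i) M" by metis
 show ?thesis
 proof
  show "0 \<le> C" using local_kernel.C0[OF D(2)[of 0]] .
  fix i :: nat
  interpret lk: local_kernel "D i" C "2 ^ i" M by (rule D)
  show "(\<lambda>p. kapL i (fst p) (snd p)) \<in> borel_measurable (borel \<Otimes>\<^sub>M borel)"
   using lk.Dm[OF le0] by (simp add: D)
  show "\<bar>kapL i x y\<bar> \<le> C * 2 ^ i" for x y using lk.Db[of 0 x y] by (simp add: D)
  show "integrable lborel (\<lambda>y. (kapL i x y)^2)" for x using lk.D_square_integrable[OF le0, of x] by (simp add: D)
  have ii: "integrable lborel (indicator {x..x + 1 / 2 ^ i} :: real => real)" for x
   by (rule integrable_real_indicator) auto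
  show "(LBINT y. (kapL i x y)^2) \<le> C\<^sup>2 * 2 ^ i" for x
  proof -
   have "(LBINT y. (D i 0 x y)^2) \<le> (LBINT y. (C * (2 ^ i) ^ (0 + 1))^2 * indicator {x..x + 1 / 2 ^ i} y)"
    by (intro integral_mono lk.D_square_integrable integrable_mult_right ii lk.D_square_le) auto
   also have "\<dots> = C\<^sup>2 * 2 ^ i" by (simp add: power2_eq_square)
   finally show ?thesis by (simp add: D)
  qed
  fix s K assume s: "1/2 < s" "s < real M" and K: "finite (K :: nat set)"
  interpret dk: dyadic_kernel "D i" C i M s by unfold_locales (use s in auto)
  show "bessel_family K (\<lambda>k y. sqrt ((1 + (real k)^2) powr s * (1 / 2 powr (- min (s - 1/2) (real M - s))) ^ ndist i (floor_log k)) * (LBINT x. kapL i x y * cheb_fun k x))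
   ((4 powr s * dyadic_const s M * C\<^sup>2 * (2 / (1 - 2 powr (- min (s - 1/2) (real M - s))))) * (2 powr (s * real i))^2)"
   using dk.dyadic_bessel_family[OF K refl refl] unfolding lk.G_def D .
 qed
qed

text \<open>Right-sided kernels are reflections, and by the parity of T_k reflection only multiplies
  the functionals by signs.\<close>

lemma kap_bessel_family:
 assumes "bessel_family K (\<lambda>k y. c k * (LBINT x. kapL i x y * cheb_fun k x)) B"
 shows "bessel_family K (\<lambda>k y. c k * (LBINT x. kap (b, i) x y * cheb_fun k x)) B"
proof (cases b)
 case False
 have "(LBINT x. kap (b, i) x y * cheb_fun k x) = (-1) ^ k * (LBINT x. kapL i x (- y) * cheb_fun k x)" for k y
 proof -
  have "(LBINT x. kap (b, i) x y * cheb_fun k x) = (LBINT x. kapL i (- x) (- y) * cheb_fun k (- (- x)))"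
   using False by (simp add: kap_def)
  also have "\<dots> = (LBINT x. kapL i x (- y) * cheb_fun k (- x))"
   by (rule integral_uminus_real)
  also have "\<dots> = (LBINT x. (-1) ^ k * (kapL i x (- y) * cheb_fun k x))"
   by (simp only: cheb_fun_uminus mult.left_commute)
  finally show ?thesis by simp
 qed
 then have "(\<lambda>k y. c k * (LBINT x. kap (b, i) x y * cheb_fun k x)) = (\<lambda>k y. (-1) ^ k * (c k * (LBINT x. kapL i x (- y) * cheb_fun k x)))"
  by (simp add: fun_eq_iff mult_ac)
 then show ?thesis using bessel_family_reflect[OF assms, of "\<lambda>k. (-1) ^ k"] by (simp add: power_abs)
qed (use assms in \<open>simp add: kap_def\<close>)

end

section \<open>Mixed differences\<close>

lemma measurable_vec_lambda_fun [measurable]: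
 assumes [measurable]: "\<And>l. f l \<in> borel_measurable N"
 shows "(\<lambda>p. \<chi> l. f l p :: real^'d::finite) \<in> borel_measurable N"
proof -
 have "(\<lambda>p. \<chi> l. f l p) = (\<lambda>p. \<Sum>l\<in>UNIV. f l p *\<^sub>R (axis l 1 :: real^'d))"
  by (auto simp: vec_eq_iff axis_def if_distrib cong: if_cong)
 also have "\<dots> \<in> borel_measurable N" by measurable
 finally show ?thesis .
qed

lemma integral_translate:
 fixes f :: "'a::euclidean_space => 'b::{banach,second_countable_topology}"
 assumes [measurable]: "f \<in> borel_measurable borel"
 shows "(LBINT x. f (x + c)) = (LBINT x. f x)"
proof -
 have "(LBINT x. f x) = (\<integral>x. f x \<partial>distr lborel borel ((+) c))" by (simp add: lborel_distr_plus)
 also have "\<dots> = (LBINT x. f (c + x))" by (rule integral_distr) auto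
 finally show ?thesis by (simp add: add.commute)
qed

lemma integrable_translate:
 fixes f :: "'a::euclidean_space => 'b::{banach,second_countable_topology}"
 assumes f: "integrable lborel f"
 shows "integrable lborel (\<lambda>x. f (x + c))"
proof -
 have [measurable]: "f \<in> borel_measurable borel" using f by auto
 have "integrable (distr lborel borel ((+) c)) f" using f by (simp add: lborel_distr_plus)
 then have "integrable lborel (\<lambda>x. f (c + x))" by (subst (asm) integrable_distr_eq) auto
 then show ?thesis by (simp add: add.commute)
qed

lemma fwd_diff_power:
 "(fwd_diff l t ^^ n) f x = (\<Sum>m\<le>n. of_real ((-1) ^ (n - m) * real (n choose m)) * f (x + (real m * t) *\<^sub>R axis l 1))"
proof (induction n arbitrary: x)
 case (Suc n)
 define a where "a n m = complex_of_real ((-1) ^ (n - m) * real (n choose m))" for n m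
 define F where "F m = f (x + (real m * t) *\<^sub>R axis l 1)" for m
 have F: "f (x + t *\<^sub>R axis l 1 + (real m * t) *\<^sub>R axis l 1) = F (Suc m)" for m
  by (simp add: F_def algebra_simps)
 have "(fwd_diff l t ^^ Suc n) f x = (\<Sum>m\<le>n. a n m * F (Suc m)) - (\<Sum>m\<le>n. a n m * F m)"
  by (simp only: funpow.simps o_apply fwd_diff_def[of l t "(fwd_diff l t ^^ n) f"] Suc F a_def[symmetric] F_def[symmetric])
 also have "(\<Sum>m\<le>n. a n m * F (Suc m)) = (\<Sum>m\<le>Suc n. (if m = 0 then 0 else a n (m - 1)) * F m)"
  by (subst sum.atMost_Suc_shift) simp
 also have "(\<Sum>m\<le>n. a n m * F m) = (\<Sum>m\<le>Suc n. (if m \<le> n then a n m else 0) * F m)" by simp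
 also have "(\<Sum>m\<le>Suc n. (if m = 0 then 0 else a n (m - 1)) * F m) - (\<Sum>m\<le>Suc n. (if m \<le> n then a n m else 0) * F m)
  = (\<Sum>m\<le>Suc n. a (Suc n) m * F m)"
  unfolding sum_subtractf[symmetric] left_diff_distrib[symmetric]
 proof (rule sum.cong[OF refl])
  fix m assume m: "m \<in> {..Suc n}"
  have "(if m = 0 then 0 else a n (m - 1)) - (if m \<le> n then a n m else 0) = a (Suc n) m"
  proof (cases m)
   case 0
   then show ?thesis by (simp add: a_def)
  next
   case (Suc j)
   show ?thesis
   proof (cases "m \<le> n")
    case True
    then have "n - j = Suc (n - m)" "Suc n - m = Suc (n - m)" using Suc by auto
    then show ?thesis using Suc True by (simp add: a_def algebra_simps)
   next
    case False
    then show ?thesis using Suc m by (simp add: a_def)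
   qed
  qed
  then show "((if m = 0 then 0 else a n (m - 1)) - (if m \<le> n then a n m else 0)) * F m = a (Suc n) m * F m" by simp
 qed
 finally show ?case by (simp only: a_def F_def)
qed simp

lemma mixed_diff_expansion:
 fixes f :: "real^'d::finite => complex"
 shows "mixed_diff M e h f x = (\<Sum>m\<in>PiE e (\<lambda>_. {..M}). of_real (\<Prod>l\<in>e. (-1) ^ (M - m l) * real (M choose m l)) *
   f (x + (\<Sum>l\<in>e. (real (m l) * h $ l) *\<^sub>R axis l 1)))"
proof -
 have "finite e" by simp
 then show ?thesis
 proof (induction e arbitrary: x rule: finite_induct)
  case empty
  then show ?case by (simp add: mixed_diff_def)
 next
  case (insert i e)
  define c where "c j = (-1) ^ (M - j) * real (M choose j)" for j
  interpret comp_fun_commute "\<lambda>l. fwd_diff l (h $ l) ^^ M :: (real^'d => complex) => _" by (rule comp_fun_commute_fwd_diff)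
  have "mixed_diff M (insert i e) h f = (fwd_diff i (h $ i) ^^ M) (mixed_diff M e h f)"
   unfolding mixed_diff_def using insert.hyps by simp
  then have "mixed_diff M (insert i e) h f x = (\<Sum>j\<le>M. \<Sum>m\<in>PiE e (\<lambda>_. {..M}). of_real (c j) * (of_real (\<Prod>l\<in>e. c (m l)) *
   f (x + (real j * h $ i) *\<^sub>R axis i 1 + (\<Sum>l\<in>e. (real (m l) * h $ l) *\<^sub>R axis l 1))))"
   by (simp only: fwd_diff_power insert.IH c_def[symmetric] sum_distrib_left)
  also have "\<dots> = (\<Sum>m\<in>PiE (insert i e) (\<lambda>_. {..M}). of_real (\<Prod>l\<in>insert i e. c (m l)) * f (x + (\<Sum>l\<in>insert i e. (real (m l) * h $ l) *\<^sub>R axis l 1)))"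
   unfolding PiE_insert_eq sum.cartesian_product
  proof (subst sum.reindex[OF inj_combinator[OF insert.hyps(2)]], rule sum.cong[OF refl])
   fix p assume "p \<in> {..M} \<times> PiE e (\<lambda>_. {..M})"
   then obtain j m where p: "p = (j, m)" by (cases p)
   have pr: "(\<Prod>l\<in>insert i e. c ((m(i := j)) l)) = c j * (\<Prod>l\<in>e. c (m l))"
   proof -
    have "(\<Prod>l\<in>e. c ((m(i := j)) l)) = (\<Prod>l\<in>e. c (m l))"
     using insert.hyps by (intro prod.cong) auto
    then show ?thesis using insert.hyps by simp
   qed
   have su: "(\<Sum>l\<in>insert i e. (real ((m(i := j)) l) * h $ l) *\<^sub>R axis l 1) =
     (real j * h $ i) *\<^sub>R axis i 1 + (\<Sum>l\<in>e. (real (m l) * h $ l) *\<^sub>R (axis l 1 :: real^'d))"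
   proof -
    have "(\<Sum>l\<in>e. (real ((m(i := j)) l) * h $ l) *\<^sub>R axis l 1) = (\<Sum>l\<in>e. (real (m l) * h $ l) *\<^sub>R (axis l 1 :: real^'d))"
     using insert.hyps by (intro sum.cong) auto
    then show ?thesis using insert.hyps by simp
   qed
   show "(case p of (j, m) => of_real (c j) * (of_real (\<Prod>l\<in>e. c (m l)) * f (x + (real j * h $ i) *\<^sub>R axis i 1 + (\<Sum>l\<in>e. (real (m l) * h $ l) *\<^sub>R axis l 1))))
    = ((\<lambda>m. of_real (\<Prod>l\<in>insert i e. c (m l)) * f (x + (\<Sum>l\<in>insert i e. (real (m l) * h $ l) *\<^sub>R axis l 1))) \<circ> (\<lambda>(y, g). g(i := y))) p"
    unfolding p o_def prod.case pr su by (simp only: of_real_mult mult.assoc add.assoc)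
  qed
  finally show ?case by (simp only: c_def)
 qed
qed

lemma axis_sum_nth: "(\<Sum>l\<in>e. a l *\<^sub>R (axis l 1 :: real^'d::finite)) $ i = (if i \<in> e then a i else 0)"
proof -
 have "(\<Sum>l\<in>e. a l *\<^sub>R (axis l 1 :: real^'d)) $ i = (\<Sum>l\<in>e. if i = l then a l else 0)"
  unfolding sum_component by (rule sum.cong) (simp_all add: axis_def)
 then show ?thesis by (simp add: sum.delta')
qed

lemma closed_cube: "closed (cube :: (real^'d::finite) set)"
 by (simp only: cube_eq_cbox closed_cbox)

lemma diff_domain_borel: "(diff_domain M e h :: (real^'d::finite) set) \<in> sets borel"
proof -
 have "diff_domain M e h = cube \<inter> (\<Inter>m\<in>{m :: nat^'d. \<forall>l\<in>e. m $ l \<le> M}. (\<lambda>x. x + (\<Sum>l\<in>e. (real (m $ l) * h $ l) *\<^sub>R axis l 1)) -` cube)"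
  by (auto simp: diff_domain_def)
 also have "closed \<dots>"
  by (intro closed_Int closed_cube closed_INT ballI closed_vimage continuous_intros)
 finally show ?thesis by (rule borel_closed)
qed

definition diff_sup :: "nat => 'd::finite set => nat^'d => (real^'d => complex) => ennreal" where
 "diff_sup M e j f = (SUP h \<in> {h :: real^'d. \<forall>l. \<bar>h $ l\<bar> \<le> 2 powr (- real (j $ l))}.
     (L2_norm (lebesgue_on (diff_domain M e h)) (mixed_diff M e h f))^2)"

lemma R_seminorm_power2:
 "(R_seminorm s M e f)^2 = (\<Sum>\<^sub>\<infinity> j \<in> {j :: nat^'d::finite. \<forall>l. l \<notin> e --> j $ l = 0}.
    ennreal (2 powr (2 * s * real (\<Sum>l\<in>UNIV. j $ l))) * diff_sup M e j f)"
 by (simp only: R_seminorm_def ennsqrt_power2 diff_sup_def)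

text \<open>The supremum runs over uncountably many h, but it is taken outside the norms. For one h
  only finitely many shifts of f occur, so the exceptional set is null, and it may depend on
  h.\<close>

lemma diff_sup_cong_AE:
 fixes f g :: "real^'d::finite => complex"
 assumes eq: "AE x in lborel. x \<in> cube --> f x = g x"
 shows "diff_sup M e j f = diff_sup M e j g"
proof -
 have "(\<integral>\<^sup>+x. ennreal ((cmod (mixed_diff M e h f x))^2) \<partial>lebesgue_on (diff_domain M e h)) =
  (\<integral>\<^sup>+x. ennreal ((cmod (mixed_diff M e h g x))^2) \<partial>lebesgue_on (diff_domain M e h))" for h
 proof -
  define sh where "sh m = (\<Sum>l\<in>e. (real (m l) * h $ l) *\<^sub>R axis l 1 :: real^'d)" for m :: "'d => nat"
  have "AE x in lborel. \<forall>m\<in>PiE e (\<lambda>_. {..M}). x + sh m \<in> cube --> f (x + sh m) = g (x + sh m)"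
  proof (rule AE_finite_allI)
   fix m
   have "AE x in distr lborel borel ((+) (sh m)). x \<in> cube --> f x = g x"
    by (subst lborel_distr_plus) (rule eq)
   then have "AE x in lborel. sh m + x \<in> cube --> f (sh m + x) = g (sh m + x)"
    by (rule AE_distrD[rotated]) simp
   then show "AE x in lborel. x + sh m \<in> cube --> f (x + sh m) = g (x + sh m)" by (simp add: add.commute)
  qed (simp add: finite_PiE)
  then have "AE x in lborel. x \<in> diff_domain M e h --> mixed_diff M e h f x = mixed_diff M e h g x"
  proof eventually_elim
   case (elim x)
   show ?case
   proof
    assume x: "x \<in> diff_domain M e h"
    have "f (x + sh m) = g (x + sh m)" if m: "m \<in> PiE e (\<lambda>_. {..M})" for m
    proof -
     have "\<forall>m :: nat^'d. (\<forall>l\<in>e. m $ l \<le> M) --> x + (\<Sum>l\<in>e. (real (m $ l) * h $ l) *\<^sub>R axis l 1) \<in> cube"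
      using x by (simp add: diff_domain_def)
     from this[THEN spec, of "\<chi> l. m l"] have "x + (\<Sum>l\<in>e. (real (m l) * h $ l) *\<^sub>R axis l 1) \<in> cube"
      using m by (simp add: PiE_iff)
     then show ?thesis using elim m by (simp add: sh_def)
    qed
    then show "mixed_diff M e h f x = mixed_diff M e h g x"
     unfolding mixed_diff_expansion sh_def[symmetric] by (intro sum.cong) auto
   qed
  qed
  then have "AE x in lborel. ennreal ((cmod (mixed_diff M e h f x))^2) * indicator (diff_domain M e h) x
   = ennreal ((cmod (mixed_diff M e h g x))^2) * indicator (diff_domain M e h) x"
   by eventually_elim (auto simp: indicator_def)
  then show ?thesis
   using diff_domain_borel[of M e h]
   by (subst (1 2) nn_integral_restrict_space) (auto simp: nn_integral_completion intro: nn_integral_cong_AE)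
 qed
 then show ?thesis by (simp add: diff_sup_def L2_norm_power2)
qed

section \<open>Averaged differences in the cube\<close>

context smoothing
begin

definition side :: "bool \<times> nat => real" where
 "side t = (if fst t then 1 else -1)"

definition diff_shift :: "('d::finite => bool \<times> nat) => ('d => nat) => real^'d => real^'d" where
 "diff_shift \<tau> m h = (\<chi> l. side (\<tau> l) * (real (m l) * h $ l))"

definition diff_sum :: "('d::finite => bool \<times> nat) => (real^'d => complex) => real^'d => real^'d => complex" where
 "diff_sum \<tau> f h y = (\<Sum>m\<in>PiE UNIV (\<lambda>_. {..M}). of_real (\<Prod>l\<in>UNIV. diff_coeff (snd (\<tau> l)) (m l)) * f (y + diff_shift \<tau> m h))"

definition step_dens :: "('d::finite => bool \<times> nat) => real^'d => real" where
 "step_dens \<tau> h = (\<Prod>l\<in>UNIV. step_density (snd (\<tau> l)) (h $ l))"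

text \<open>The y from which up to M steps of length at most 1 / (4 M) in the given direction stay
  in [-1,1]. At level 0 no step is taken.\<close>

definition region :: "bool \<times> nat => real set" where
 "region t = (if snd t = 0 then {-1..1} else if fst t then {-1..3/4} else {-3/4..1})"

text \<open>Cut off to the region so that f is evaluated in the cube only. Nothing is lost, because
  the kernels paired with it vanish off the region, see \<open>kap_region\<close>.\<close>

definition avg_diff :: "('d::finite => bool \<times> nat) => (real^'d => complex) => real^'d => complex" where
 "avg_diff \<tau> f y = indicator {y. \<forall>l. y $ l \<in> region (\<tau> l)} y *\<^sub>R (LBINT h. of_real (step_dens \<tau> h) * diff_sum \<tau> f h y)"

definition diff_dirs :: "('d::finite => bool \<times> nat) => 'd set" where
 "diff_dirs \<tau> = {l. snd (\<tau> l) \<noteq> 0}"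

text \<open>\<open>psi\<close> lives on x < 1/2 and a level kernel reaches at most 1/4 further, so y
  <= 3/4; the other side is symmetric.\<close>

lemma kap_region:
 assumes "\<bar>x\<bar> \<le> 1" "kap t x y \<noteq> 0"
 shows "y \<in> region t"
proof -
 have L: "y \<in> {-1..3/4}" if "\<bar>x\<bar> \<le> 1" "kapL i x y \<noteq> 0" for i x y
 proof -
  have "psi x \<noteq> 0" "level_kernel i (y - x) \<noteq> 0" using that by (auto simp: kapL_def)
  then have "x < 1/2" "y - x \<in> {0..1/4}" using psi_0[of x] level_kernel_supp'[of "y - x" i] by (auto simp: not_le[symmetric])
  then show ?thesis using that by auto
 qed
 show ?thesis using assms L[of x "snd t" y] L[of "- x" "snd t" "- y"]
  by (auto simp: kap_def region_def split: if_splits)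
qed

text \<open>In a coordinate of level 0 \<open>diff_coeff\<close> vanishes except at m = 0, so the
  sum over all multi-indices collapses to those supported in
  \<open>diff_dirs \<tau>\<close>.\<close>

lemma diff_sum_eq_mixed_diff:
 "diff_sum \<tau> f h y = mixed_diff M (diff_dirs \<tau>) (\<chi> l. side (\<tau> l) * h $ l) f y"
proof -
 let ?e = "diff_dirs \<tau>"
 define c where "c j = (-1) ^ (M - j) * real (M choose j)" for j
 define ext where "ext m l = (if l \<in> ?e then m l else 0)" for m :: "'a => nat" and l
 have "diff_sum \<tau> f h y = (\<Sum>m\<in>{m\<in>PiE UNIV (\<lambda>_. {..M}). \<forall>l. l \<notin> ?e --> m l = 0}. of_real (\<Prod>l\<in>UNIV. diff_coeff (snd (\<tau> l)) (m l)) * f (y + diff_shift \<tau> m h))"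
  unfolding diff_sum_def
 proof (rule sum.mono_neutral_right)
  show "\<forall>m\<in>PiE UNIV (\<lambda>_. {..M}) - {m\<in>PiE UNIV (\<lambda>_. {..M}). \<forall>l. l \<notin> ?e --> m l = 0}.
    of_real (\<Prod>l\<in>UNIV. diff_coeff (snd (\<tau> l)) (m l)) * f (y + diff_shift \<tau> m h) = 0"
  proof
   fix m assume "m \<in> PiE UNIV (\<lambda>_. {..M}) - {m\<in>PiE UNIV (\<lambda>_. {..M}). \<forall>l. l \<notin> ?e --> m l = 0}"
   then obtain l where "l \<notin> ?e" "m l \<noteq> 0" by auto
   then have "diff_coeff (snd (\<tau> l)) (m l) = 0" by (simp add: diff_coeff_def diff_dirs_def)
   then have "(\<Prod>l\<in>UNIV. diff_coeff (snd (\<tau> l)) (m l)) = 0" by (intro prod_zero) auto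
   then show "of_real (\<Prod>l\<in>UNIV. diff_coeff (snd (\<tau> l)) (m l)) * f (y + diff_shift \<tau> m h) = 0" by (simp only: of_real_0 mult_zero_left)
  qed
 qed (auto simp: finite_PiE)
 also have "\<dots> = (\<Sum>m\<in>PiE ?e (\<lambda>_. {..M}). of_real (\<Prod>l\<in>?e. c (m l)) * f (y + (\<Sum>l\<in>?e. (real (m l) * (\<chi> l. side (\<tau> l) * h $ l) $ l) *\<^sub>R axis l 1)))"
 proof (rule sum.reindex_bij_witness[where i = ext and j = "\<lambda>m. restrict m ?e"])
  fix m assume m: "m \<in> {m\<in>PiE UNIV (\<lambda>_. {..M}). \<forall>l. l \<notin> ?e --> m l = 0}"
  show "ext (restrict m ?e) = m" using m by (auto simp: ext_def fun_eq_iff)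
  show "restrict m ?e \<in> PiE ?e (\<lambda>_. {..M})" using m by (auto simp: PiE_iff)
  have "(\<Prod>l\<in>UNIV. diff_coeff (snd (\<tau> l)) (m l)) = (\<Prod>l\<in>?e. c (m l))"
   using m by (intro prod.mono_neutral_cong_right) (auto simp: diff_coeff_def diff_dirs_def c_def)
  moreover have "diff_shift \<tau> m h = (\<Sum>l\<in>?e. (real (m l) * (\<chi> l. side (\<tau> l) * h $ l) $ l) *\<^sub>R axis l 1)"
  proof (rule vec_eq_iff[THEN iffD2], rule allI)
   fix i
   show "diff_shift \<tau> m h $ i = (\<Sum>l\<in>?e. (real (m l) * (\<chi> l. side (\<tau> l) * h $ l) $ l) *\<^sub>R axis l 1 :: real^'a) $ i"
    unfolding axis_sum_nth using m by (auto simp: diff_shift_def)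
  qed
  ultimately show "of_real (\<Prod>l\<in>?e. c (restrict m ?e l)) * f (y + (\<Sum>l\<in>?e. (real (restrict m ?e l) * (\<chi> l. side (\<tau> l) * h $ l) $ l) *\<^sub>R axis l 1))
   = of_real (\<Prod>l\<in>UNIV. diff_coeff (snd (\<tau> l)) (m l)) * f (y + diff_shift \<tau> m h)"
   by simp
 next
  fix m assume m: "m \<in> PiE ?e (\<lambda>_. {..M})"
  show "restrict (ext m) ?e = m" using m by (auto simp: ext_def fun_eq_iff PiE_iff extensional_def)
  show "ext m \<in> {m\<in>PiE UNIV (\<lambda>_. {..M}). \<forall>l. l \<notin> ?e --> m l = 0}" using m by (auto simp: ext_def PiE_iff)
 qed
 finally show ?thesis by (simp only: mixed_diff_expansion c_def)
qed

lemma step_density_measurable [measurable]: "step_density i \<in> borel_measurable borel"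
 using step_density_good by (simp add: bdd_integrable_def)

lemma step_dens_measurable [measurable]: "step_dens \<tau> \<in> borel_measurable borel"
 unfolding step_dens_def[abs_def] by measurable

lemma step_dens_integrable: "integrable lborel (step_dens \<tau>)"
 unfolding step_dens_def[abs_def] using step_density_good
 by (intro integrable_prod_vec) (simp add: bdd_integrable_def)

lemma step_dens_abs: "(\<integral>\<^sup>+h. ennreal \<bar>step_dens \<tau> h\<bar> \<partial>(lborel :: (real^'d::finite) measure)) \<le> ennreal (2 ^ CARD('d))"
proof -
 have i: "integrable lborel (\<lambda>x. \<bar>step_density j x\<bar>)" for j using step_density_good[of j] by (simp add: bdd_integrable_def)
 have eq: "(\<integral>\<^sup>+h. ennreal \<bar>step_dens \<tau> h\<bar> \<partial>lborel) = ennreal (\<integral>h. \<bar>step_dens \<tau> h\<bar> \<partial>(lborel :: (real^'d) measure))"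
  using step_dens_integrable by (intro nn_integral_eq_integral) auto
 have "(\<integral>h. \<bar>step_dens \<tau> h\<bar> \<partial>(lborel :: (real^'d) measure)) = (\<Prod>l\<in>UNIV. (LBINT x. \<bar>step_density (snd (\<tau> l)) x\<bar>))"
  unfolding step_dens_def abs_prod by (rule integral_prod_vec) (rule i)
 also have "\<dots> \<le> (\<Prod>l\<in>(UNIV :: 'd set). 2)"
  by (intro prod_mono conjI step_density_abs integral_nonneg_AE) auto
 finally show ?thesis unfolding eq by (intro ennreal_leI) simp
qed

lemma diff_sum_measurable:
 assumes [measurable]: "f \<in> borel_measurable borel"
 shows "(\<lambda>p. diff_sum \<tau> f (fst p) (snd p)) \<in> borel_measurable (borel \<Otimes>\<^sub>M borel)"
 unfolding diff_sum_def diff_shift_def by measurable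

lemma avg_diff_measurable:
 fixes f :: "real^'d::finite => complex"
 assumes [measurable]: "f \<in> borel_measurable borel"
 shows "avg_diff \<tau> f \<in> borel_measurable borel"
proof -
 have "(\<lambda>p. (snd p, fst p)) \<in> measurable (borel \<Otimes>\<^sub>M lborel) (borel \<Otimes>\<^sub>M (borel :: (real^'d) measure))" by measurable
 from measurable_compose[OF this diff_sum_measurable[OF assms, of \<tau>]]
 have [measurable]: "(\<lambda>p. diff_sum \<tau> f (snd p) (fst p)) \<in> borel_measurable (borel \<Otimes>\<^sub>M lborel)" by simp
 have "(\<lambda>(y, h). of_real (step_dens \<tau> h) * diff_sum \<tau> f h y) \<in> borel_measurable (borel \<Otimes>\<^sub>M lborel)"
  by (simp add: case_prod_unfold)
 from sigma_finite_measure.borel_measurable_lebesgue_integral[OF sigma_finite_lborel this]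
 have [measurable]: "(\<lambda>y. (LBINT h. of_real (step_dens \<tau> h) * diff_sum \<tau> f h y)) \<in> borel_measurable borel" .
 have "{y :: real^'d. \<forall>l. y $ l \<in> region (\<tau> l)} = (\<Inter>l. (\<lambda>y. y $ l) -` region (\<tau> l))" by auto
 also have "closed \<dots>" by (intro closed_INT ballI closed_vimage continuous_intros) (auto simp: region_def)
 finally have [measurable]: "{y :: real^'d. \<forall>l. y $ l \<in> region (\<tau> l)} \<in> sets borel" by (rule borel_closed)
 show ?thesis unfolding avg_diff_def[abs_def] by measurable
qed

text \<open>Cauchy-Schwarz with respect to |\<open>step_dens \<tau>\<close>|, whose mass is at most
  2^d, then Fubini: every h in the support is admissible in the supremum, and integrating over h
  gives 2^d once more. The truncated \<open>snd (\<tau> l) - 1\<close> is 0 at level 0 too, as the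
  seminorm requires off \<open>diff_dirs \<tau>\<close>.\<close>

lemma avg_diff_norm:
 fixes f :: "real^'d::finite => complex"
 assumes fm [measurable]: "f \<in> borel_measurable borel"
 shows "(\<integral>\<^sup>+y. ennreal ((cmod (avg_diff \<tau> f y))^2) \<partial>lborel) \<le> ennreal (4 ^ CARD('d)) * diff_sup M (diff_dirs \<tau>) (\<chi> l. snd (\<tau> l) - 1) f"
proof -
 define Bx where "Bx = {y :: real^'d. \<forall>l. y $ l \<in> region (\<tau> l)}"
 have "Bx = (\<Inter>l. (\<lambda>y. y $ l) -` region (\<tau> l))" by (auto simp: Bx_def)
 also have "closed \<dots>" by (intro closed_INT ballI closed_vimage continuous_intros) (auto simp: region_def)
 finally have [measurable]: "Bx \<in> sets borel" by (rule borel_closed)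
 define S where "S h = \<bar>step_dens \<tau> h\<bar>" for h
 have [measurable]: "S \<in> borel_measurable borel" unfolding S_def[abs_def] by measurable
 have S0: "0 \<le> S h" for h by (simp add: S_def)
 let ?d = "CARD('d)"
 let ?e = "diff_dirs \<tau>" and ?j = "(\<chi> l. snd (\<tau> l) - 1) :: nat^'d"
 have dm [measurable]: "(\<lambda>h. diff_sum \<tau> f h y) \<in> borel_measurable borel" for y
 proof -
  have "(\<lambda>h. (h, y)) \<in> measurable borel (borel \<Otimes>\<^sub>M (borel :: (real^'d) measure))" by measurable
  from measurable_compose[OF this diff_sum_measurable[OF fm, of \<tau>]] show ?thesis by simp
 qed
 have dm2 [measurable]: "(\<lambda>p. diff_sum \<tau> f (fst p) (snd p)) \<in> borel_measurable (borel \<Otimes>\<^sub>M borel)" by (rule diff_sum_measurable[OF fm])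
 have dm3 [measurable]: "(\<lambda>p. diff_sum \<tau> f (snd p) (fst p)) \<in> borel_measurable (borel \<Otimes>\<^sub>M borel)"
 proof -
  have "(\<lambda>p. (snd p, fst p)) \<in> measurable (borel \<Otimes>\<^sub>M borel) (borel \<Otimes>\<^sub>M (borel :: (real^'d) measure))" by measurable
  from measurable_compose[OF this dm2] show ?thesis by simp
 qed
 have pt: "ennreal ((cmod (avg_diff \<tau> f y))^2) \<le>
   ennreal (2 ^ ?d) * (\<integral>\<^sup>+h. ennreal (S h) * (indicator Bx y * ennreal ((cmod (diff_sum \<tau> f h y))^2)) \<partial>lborel)" for y
 proof (cases "y \<in> Bx")
  case True
  define I where "I = (LBINT h. of_real (step_dens \<tau> h) * diff_sum \<tau> f h y)"
  have "ennreal (cmod I) \<le> (\<integral>\<^sup>+h. ennreal (S h * cmod (diff_sum \<tau> f h y)) \<partial>lborel)"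
  proof (cases "integrable lborel (\<lambda>h. of_real (step_dens \<tau> h) * diff_sum \<tau> f h y)")
   case True
   from integral_norm_bound_ennreal[OF True] show ?thesis by (simp add: I_def norm_mult S_def)
  qed (simp add: I_def not_integrable_integral_eq)
  also have "\<dots> = (\<integral>\<^sup>+h. ennreal (sqrt (S h)) * ennreal (sqrt (S h) * cmod (diff_sum \<tau> f h y)) \<partial>lborel)"
   using S0 by (intro nn_integral_cong) (simp add: ennreal_mult[symmetric] mult.assoc[symmetric])
  finally have "(ennreal (cmod I))^2 \<le> (\<integral>\<^sup>+h. ennreal (sqrt (S h)) * ennreal (sqrt (S h) * cmod (diff_sum \<tau> f h y)) \<partial>lborel)^2"
   by (rule power_mono) simp
  also have "\<dots> \<le> (\<integral>\<^sup>+h. ennreal (sqrt (S h)) ^ 2 \<partial>lborel) * (\<integral>\<^sup>+h. ennreal (sqrt (S h) * cmod (diff_sum \<tau> f h y)) ^ 2 \<partial>lborel)"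
   by (rule Cauchy_Schwarz_nn_integral) measurable
  also have "(\<integral>\<^sup>+h. ennreal (sqrt (S h)) ^ 2 \<partial>lborel) = (\<integral>\<^sup>+h. ennreal (S h) \<partial>lborel)"
   using S0 by (intro nn_integral_cong) (simp add: ennreal_power)
  also have "(\<integral>\<^sup>+h. ennreal (sqrt (S h) * cmod (diff_sum \<tau> f h y)) ^ 2 \<partial>lborel) = (\<integral>\<^sup>+h. ennreal (S h) * ennreal ((cmod (diff_sum \<tau> f h y))^2) \<partial>lborel)"
   using S0 by (intro nn_integral_cong) (simp add: ennreal_power power_mult_distrib ennreal_mult)
  also have "(\<integral>\<^sup>+h. ennreal (S h) \<partial>lborel) * (\<integral>\<^sup>+h. ennreal (S h) * ennreal ((cmod (diff_sum \<tau> f h y))^2) \<partial>lborel)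
   \<le> ennreal (2 ^ ?d) * (\<integral>\<^sup>+h. ennreal (S h) * ennreal ((cmod (diff_sum \<tau> f h y))^2) \<partial>lborel)"
   unfolding S_def by (intro mult_right_mono step_dens_abs) simp
  finally show ?thesis using True by (simp add: avg_diff_def I_def Bx_def[symmetric] ennreal_power)
 qed (simp add: avg_diff_def Bx_def[symmetric])
 \<comment> \<open>A single h where the density does not vanish: its steps are small enough for the
   supremum, and the region lies in the domain of the difference.\<close>
 have sl: "S h \<noteq> 0 ==> (\<integral>\<^sup>+y. indicator Bx y * ennreal ((cmod (diff_sum \<tau> f h y))^2) \<partial>lborel) \<le> diff_sup M ?e ?j f" for h
 proof -
  assume "S h \<noteq> 0"
  then have sd: "step_density (snd (\<tau> l)) (h $ l) \<noteq> 0" for l by (simp add: S_def step_dens_def)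
  have h1: "h $ l \<in> {0..1 / (4 * real M)}" for l using sd[of l] step_density_supp by blast
  have M4: "1 / (4 * real M) \<le> 1" using M1 by (simp add: divide_le_eq)
  define h' where "h' = ((\<chi> l. side (\<tau> l) * h $ l) :: real^'d)"
  have "\<bar>h' $ l\<bar> \<le> 2 powr (- real (?j $ l))" for l
  proof (cases "snd (\<tau> l) = 0")
   case True
   then show ?thesis using h1[of l] M4 by (simp add: h'_def side_def abs_mult)
  next
   case False
   then have "\<bar>h $ l\<bar> \<le> 2 / 2 ^ snd (\<tau> l)" using step_density_supp'[of "snd (\<tau> l)" "h $ l"] sd[of l] by auto
   also have "\<dots> = 2 powr (- real (?j $ l))"
   proof -
    obtain i where "snd (\<tau> l) = Suc i" using False by (cases "snd (\<tau> l)") auto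
    moreover have "2 powr (- real i) = 1 / 2 ^ i" for i :: nat
     by (simp only: powr_minus_divide powr_realpow zero_less_numeral)
    ultimately show ?thesis by (simp only: vec_lambda_beta diff_Suc_1 power_Suc)
   qed
   finally show ?thesis by (simp add: h'_def side_def abs_mult)
  qed
  then have h': "h' \<in> {h :: real^'d. \<forall>l. \<bar>h $ l\<bar> \<le> 2 powr (- real (?j $ l))}" by simp
  have sub: "y \<in> diff_domain M ?e h'" if y: "y \<in> Bx" for y
   unfolding diff_domain_def
  proof (intro CollectI conjI allI impI)
   have yr: "y $ l \<in> region (\<tau> l)" for l using y by (simp add: Bx_def)
   have yc: "\<bar>y $ l\<bar> \<le> 1" for l using yr[of l] by (auto simp: region_def split: if_splits)
   then show "y \<in> cube" by (simp add: mem_cube_iff)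
   fix m :: "nat^'d" assume m: "\<forall>l\<in>?e. m $ l \<le> M"
   show "y + (\<Sum>l\<in>?e. (real (m $ l) * h' $ l) *\<^sub>R axis l 1) \<in> cube"
    unfolding mem_cube_iff
   proof
    fix i
    have c: "(y + (\<Sum>l\<in>?e. (real (m $ l) * h' $ l) *\<^sub>R axis l 1)) $ i = y $ i + (if i \<in> ?e then real (m $ i) * h' $ i else 0)"
     by (simp only: vector_add_component axis_sum_nth)
    show "\<bar>(y + (\<Sum>l\<in>?e. (real (m $ l) * h' $ l) *\<^sub>R axis l 1)) $ i\<bar> \<le> 1"
    proof (cases "i \<in> ?e")
     case True
     \<comment> \<open>At most M steps of length 1 / (4 M) amount to 1/4, the distance kept by
       \<open>region\<close> from the end point.\<close>
     have "real (m $ i) * h $ i \<le> real M * (1 / (4 * real M))" using m True h1[of i] by (intro mult_mono) auto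
     also have "\<dots> = 1/4" using M1 by simp
     finally have "real (m $ i) * h $ i \<le> 1/4" .
     moreover have "0 \<le> real (m $ i) * h $ i" using h1[of i] by simp
     moreover have "snd (\<tau> i) \<noteq> 0" using True by (simp add: diff_dirs_def)
     ultimately show ?thesis unfolding c using True yr[of i]
      by (cases "fst (\<tau> i)") (auto simp: h'_def side_def region_def abs_le_iff)
    qed (use c yc in simp)
   qed
  qed
  have "(\<integral>\<^sup>+y. indicator Bx y * ennreal ((cmod (diff_sum \<tau> f h y))^2) \<partial>lborel)
   \<le> (\<integral>\<^sup>+y. ennreal ((cmod (mixed_diff M ?e h' f y))^2) * indicator (diff_domain M ?e h') y \<partial>lborel)"
   using sub by (intro nn_integral_mono) (auto simp: diff_sum_eq_mixed_diff h'_def indicator_def)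
  also have "\<dots> = (L2_norm (lebesgue_on (diff_domain M ?e h')) (mixed_diff M ?e h' f))^2"
   unfolding L2_norm_power2 using diff_domain_borel[of M ?e h']
   by (subst nn_integral_restrict_space) (auto simp: nn_integral_completion)
  also have "\<dots> \<le> diff_sup M ?e ?j f" unfolding diff_sup_def using h' by (rule SUP_upper)
  finally show ?thesis .
 qed
 have "(\<integral>\<^sup>+y. ennreal ((cmod (avg_diff \<tau> f y))^2) \<partial>lborel)
  \<le> (\<integral>\<^sup>+y. ennreal (2 ^ ?d) * (\<integral>\<^sup>+h. ennreal (S h) * (indicator Bx y * ennreal ((cmod (diff_sum \<tau> f h y))^2)) \<partial>lborel) \<partial>lborel)"
  by (intro nn_integral_mono pt)
 also have "\<dots> = ennreal (2 ^ ?d) * (\<integral>\<^sup>+y. (\<integral>\<^sup>+h. ennreal (S h) * (indicator Bx y * ennreal ((cmod (diff_sum \<tau> f h y))^2)) \<partial>lborel) \<partial>lborel)"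
  by (intro nn_integral_cmult sigma_finite_measure.borel_measurable_nn_integral[OF sigma_finite_lborel]) (simp add: case_prod_unfold)
 also have "(\<integral>\<^sup>+y. (\<integral>\<^sup>+h. ennreal (S h) * (indicator Bx y * ennreal ((cmod (diff_sum \<tau> f h y))^2)) \<partial>lborel) \<partial>lborel)
  = (\<integral>\<^sup>+h. (\<integral>\<^sup>+y. ennreal (S h) * (indicator Bx y * ennreal ((cmod (diff_sum \<tau> f h y))^2)) \<partial>lborel) \<partial>lborel)"
  by (rule lborel_pair.Fubini') (simp add: case_prod_unfold)
 also have "\<dots> \<le> (\<integral>\<^sup>+h. ennreal (S h) * diff_sup M ?e ?j f \<partial>lborel)"
 proof (rule nn_integral_mono)
  fix h
  have [measurable]: "(\<lambda>y. diff_sum \<tau> f h y) \<in> borel_measurable borel"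
  proof -
   have "(\<lambda>y. (h, y)) \<in> measurable borel (borel \<Otimes>\<^sub>M (borel :: (real^'d) measure))" by measurable
   from measurable_compose[OF this dm2] show ?thesis by simp
  qed
  have "(\<integral>\<^sup>+y. ennreal (S h) * (indicator Bx y * ennreal ((cmod (diff_sum \<tau> f h y))^2)) \<partial>lborel)
   = ennreal (S h) * (\<integral>\<^sup>+y. indicator Bx y * ennreal ((cmod (diff_sum \<tau> f h y))^2) \<partial>lborel)"
   by (rule nn_integral_cmult) measurable
  also have "\<dots> \<le> ennreal (S h) * diff_sup M ?e ?j f"
   using sl[of h] by (cases "S h = 0") (auto intro: mult_left_mono)
  finally show "(\<integral>\<^sup>+y. ennreal (S h) * (indicator Bx y * ennreal ((cmod (diff_sum \<tau> f h y))^2)) \<partial>lborel) \<le> ennreal (S h) * diff_sup M ?e ?j f" .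
 qed
 also have "\<dots> = (\<integral>\<^sup>+h. ennreal (S h) \<partial>lborel) * diff_sup M ?e ?j f" by (rule nn_integral_multc) measurable
 also have "\<dots> \<le> ennreal (2 ^ ?d) * diff_sup M ?e ?j f"
  unfolding S_def by (intro mult_right_mono step_dens_abs) simp
 also have "ennreal (2 ^ ?d) * (ennreal (2 ^ ?d) * diff_sup M ?e ?j f) = ennreal (4 ^ ?d) * diff_sup M ?e ?j f"
  by (simp add: mult.assoc[symmetric] ennreal_mult[symmetric] power_mult_distrib[symmetric])
 finally show ?thesis by (simp add: mult_left_mono)
qed

end

lemma ndist_commute: "ndist i j = ndist j i"
 by (simp add: ndist_def)

lemma AE_coordinates_neq: "AE x in lborel. \<forall>l. x $ l \<noteq> a $ l \<and> x $ l \<noteq> (b $ l :: real)" for a b :: "real^'d::finite"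
proof (rule AE_all_countable[THEN iffD2], rule allI)
 fix l :: 'd
 have n: "{x :: real^'d. x $ l = c} \<in> null_sets lborel" for c
 proof -
  have "negligible {x :: real^'d. x $ l = c}" using negligible_standard_hyperplane[of "axis l 1 :: real^'d" c] by (simp add: inner_axis)
  moreover have "closed {x :: real^'d. x $ l = c}" by (intro closed_Collect_eq continuous_intros)
  ultimately show ?thesis by (simp add: negligible_iff_null_sets null_sets_completion_iff)
 qed
 from AE_not_in[OF n[of "a $ l"]] AE_not_in[OF n[of "b $ l"]]
 show "AE x in lborel. x $ l \<noteq> a $ l \<and> x $ l \<noteq> b $ l" by eventually_elim auto
qed

context smoothing
begin

lemma kapL_bounded:
 "\<exists>C. (\<lambda>p. kapL i (fst p) (snd p)) \<in> borel_measurable (borel \<Otimes>\<^sub>M borel) \<and> (\<forall>x y. \<bar>kapL i x y\<bar> \<le> C)"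
 using kapL_properties by metis

lemma kap_measurable: "(\<lambda>p. kap t (fst p) (snd p)) \<in> borel_measurable (borel \<Otimes>\<^sub>M borel)"
proof -
 have m: "(\<lambda>p. kapL (snd t) (fst p) (snd p)) \<in> borel_measurable (borel \<Otimes>\<^sub>M borel)" using kapL_bounded by blast
 have "(\<lambda>p :: real \<times> real. (- fst p, - snd p)) \<in> measurable (borel \<Otimes>\<^sub>M borel) (borel \<Otimes>\<^sub>M (borel :: real measure))" by measurable
 from measurable_compose[OF this m]
 have "(\<lambda>p. kapL (snd t) (- fst p) (- snd p)) \<in> borel_measurable (borel \<Otimes>\<^sub>M borel)" by simp
 then show ?thesis using m by (cases "fst t") (simp_all add: kap_def)
qed

lemma kap_measurable' [measurable (raw)]:
 "f \<in> borel_measurable N ==> g \<in> borel_measurable N ==> (\<lambda>p. kap t (f p) (g p)) \<in> borel_measurable N"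
 using measurable_compose[OF measurable_Pair kap_measurable, of f N g t] by simp

lemma kap_bounded: "\<exists>C. \<forall>x y. \<bar>kap t x y\<bar> \<le> C"
proof -
 obtain C where "\<And>x y. \<bar>kapL (snd t) x y\<bar> \<le> C" using kapL_bounded by blast
 then show ?thesis by (auto simp: kap_def)
qed

lemma red_eq: "red t x z = (\<Sum>m\<le>M. diff_coeff (snd t) m * (LBINT h. step_density (snd t) h * kap t x (z - side t * (real m * h))))"
 by (simp add: red_def redL_def kap_def side_def)

text \<open>The substitution z = y + shift and Fubini move differences and averaging from f to the
  kernel. Densities, coefficients and kernels are products, so the resulting kernel is the product
  of the one-dimensional \<open>red\<close>.\<close>

lemma avg_diff_representation:
 fixes f :: "real^'d::finite => complex"
 assumes f: "integrable lborel f" and x: "\<And>l. \<bar>x $ l\<bar> \<le> 1"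
 shows "(LBINT y. of_real (\<Prod>l\<in>UNIV. kap (\<tau> l) (x $ l) (y $ l)) * avg_diff \<tau> f y)
  = (LBINT z. of_real (\<Prod>l\<in>UNIV. red (\<tau> l) (x $ l) (z $ l)) * f z)"
proof -
 have fm [measurable]: "f \<in> borel_measurable borel" using f by auto
 define Kx where "Kx y = (\<Prod>l\<in>UNIV. kap (\<tau> l) (x $ l) (y $ l))" for y :: "real^'d"
 have Km [measurable]: "Kx \<in> borel_measurable borel" unfolding Kx_def[abs_def] by measurable
 obtain Ck where Ck: "\<And>t x y. \<bar>kap t x y\<bar> \<le> Ck t" using kap_bounded by metis
 define C where "C = (\<Prod>l\<in>UNIV. Ck (\<tau> l))"
 have C: "\<bar>Kx y\<bar> \<le> C" for y unfolding Kx_def C_def abs_prod by (intro prod_mono conjI Ck) auto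
 have C0: "0 \<le> C" using C[of 0] by linarith
 let ?P = "PiE (UNIV :: 'd set) (\<lambda>_. {..M})"
 define c where "c m = (\<Prod>l\<in>UNIV. diff_coeff (snd (\<tau> l)) (m l))" for m :: "'d => nat"
 define Fm where "Fm m h y = of_real (Kx y * (step_dens \<tau> h * c m)) * f (y + diff_shift \<tau> m h)" for m h y
 define Gm where "Gm m h z = of_real (Kx (z - diff_shift \<tau> m h) * (step_dens \<tau> h * c m)) * f z" for m h z
 have shm [measurable]: "(\<lambda>p. diff_shift \<tau> m (fst p)) \<in> borel_measurable (borel \<Otimes>\<^sub>M (borel :: (real^'d) measure))" for m
  unfolding diff_shift_def by measurable
 have Fint: "integrable (lborel \<Otimes>\<^sub>M lborel) (\<lambda>(h, y). Fm m h y)" for m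
 proof (rule lborel_pair.Fubini_integrable)
  show meas: "(\<lambda>(h, y). Fm m h y) \<in> borel_measurable (lborel \<Otimes>\<^sub>M lborel)"
   unfolding Fm_def by (simp add: case_prod_unfold)
  have le: "cmod (Fm m h y) \<le> C * (\<bar>c m\<bar> * \<bar>step_dens \<tau> h\<bar>) * cmod (f (y + diff_shift \<tau> m h))" for h y
  proof -
   have "\<bar>Kx y\<bar> * (\<bar>step_dens \<tau> h\<bar> * \<bar>c m\<bar> * cmod (f (y + diff_shift \<tau> m h))) \<le> C * (\<bar>step_dens \<tau> h\<bar> * \<bar>c m\<bar> * cmod (f (y + diff_shift \<tau> m h)))"
    using C by (intro mult_right_mono) auto
   then show ?thesis by (simp add: Fm_def norm_mult abs_mult mult_ac)
  qed
  have fi: "integrable lborel (\<lambda>y. cmod (f (y + diff_shift \<tau> m h)))" for h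
   using integrable_translate[OF f] by (intro integrable_norm)
  have Fi: "integrable lborel (Fm m h)" for h
  proof (rule lint_bound)
   show "integrable lborel (\<lambda>y. C * (\<bar>c m\<bar> * \<bar>step_dens \<tau> h\<bar>) * cmod (f (y + diff_shift \<tau> m h)))"
    by (intro integrable_mult_right fi)
   show "Fm m h \<in> borel_measurable lborel" unfolding Fm_def[abs_def] by measurable
   show "AE y in lborel. norm (Fm m h y) \<le> norm (C * (\<bar>c m\<bar> * \<bar>step_dens \<tau> h\<bar>) * cmod (f (y + diff_shift \<tau> m h)))"
    using le by (intro AE_I2) (auto intro: order_trans[OF _ abs_ge_self])
  qed
  show "AE h in lborel. integrable lborel (\<lambda>y. case (h, y) of (h, y) => Fm m h y)" using Fi by simp
  show "integrable lborel (\<lambda>h. (LBINT y. norm (case (h, y) of (h, y) => Fm m h y)))"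
  proof (rule lint_bound)
   let ?N = "(LBINT y. cmod (f y))"
   show "integrable lborel (\<lambda>h. (C * \<bar>c m\<bar> * ?N) * \<bar>step_dens \<tau> h\<bar>)"
    using step_dens_integrable by (intro integrable_mult_right integrable_abs)
   have "(\<lambda>(h, y). norm (Fm m h y)) \<in> borel_measurable (lborel \<Otimes>\<^sub>M lborel)"
    using meas by (simp add: case_prod_unfold)
   from sigma_finite_measure.borel_measurable_lebesgue_integral[OF sigma_finite_lborel this]
   show "(\<lambda>h. (LBINT y. norm (case (h, y) of (h, y) => Fm m h y))) \<in> borel_measurable lborel" by simp
   show "AE h in lborel. norm (LBINT y. norm (case (h, y) of (h, y) => Fm m h y)) \<le> norm ((C * \<bar>c m\<bar> * ?N) * \<bar>step_dens \<tau> h\<bar>)"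
   proof (rule AE_I2)
    fix h
    have "(LBINT y. cmod (Fm m h y)) \<le> (LBINT y. C * (\<bar>c m\<bar> * \<bar>step_dens \<tau> h\<bar>) * cmod (f (y + diff_shift \<tau> m h)))"
     using Fi fi le by (intro integral_mono) auto
    also have "\<dots> = C * (\<bar>c m\<bar> * \<bar>step_dens \<tau> h\<bar>) * ?N"
     using integral_translate[of "\<lambda>y. cmod (f y)" "diff_shift \<tau> m h"] by simp
    finally have "(LBINT y. cmod (Fm m h y)) \<le> (C * \<bar>c m\<bar> * ?N) * \<bar>step_dens \<tau> h\<bar>" by (simp add: mult_ac)
    moreover have "0 \<le> (LBINT y. cmod (Fm m h y))" by (intro integral_nonneg_AE) auto
    ultimately show "norm (LBINT y. norm (case (h, y) of (h, y) => Fm m h y)) \<le> norm ((C * \<bar>c m\<bar> * ?N) * \<bar>step_dens \<tau> h\<bar>)"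
     by simp
   qed
  qed
 qed
 have Gint: "integrable (lborel \<Otimes>\<^sub>M lborel) (\<lambda>(h, z). Gm m h z)" for m
 proof (rule lint_bound[OF integrable_tensor[OF integrable_mult_right[OF step_dens_integrable, of "C * \<bar>c m\<bar>" \<tau>] f]])
  show "(\<lambda>(h, z). Gm m h z) \<in> borel_measurable (lborel \<Otimes>\<^sub>M lborel)"
   unfolding Gm_def by (simp add: case_prod_unfold)
  show "AE p in lborel \<Otimes>\<^sub>M lborel. norm (case p of (h, z) => Gm m h z) \<le> norm (complex_of_real (C * \<bar>c m\<bar> * step_dens \<tau> (fst p)) * f (snd p))"
  proof (rule AE_I2)
   fix p :: "(real^'d) \<times> (real^'d)"
   obtain h z where p: "p = (h, z)" by (cases p)
   have "\<bar>Kx (z - diff_shift \<tau> m h)\<bar> * (\<bar>step_dens \<tau> h\<bar> * \<bar>c m\<bar> * cmod (f z)) \<le> C * (\<bar>step_dens \<tau> h\<bar> * \<bar>c m\<bar> * cmod (f z))"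
    using C by (intro mult_right_mono) auto
   then show "norm (case p of (h, z) => Gm m h z) \<le> norm (complex_of_real (C * \<bar>c m\<bar> * step_dens \<tau> (fst p)) * f (snd p))"
    using C0 by (simp add: p Gm_def norm_mult abs_mult mult_ac)
  qed
 qed
 have one: "(\<integral>p. (case p of (h, y) => Fm m h y) \<partial>(lborel \<Otimes>\<^sub>M lborel))
  = (LBINT z. of_real (\<Prod>l\<in>UNIV. diff_coeff (snd (\<tau> l)) (m l) * (LBINT h. step_density (snd (\<tau> l)) h * kap (\<tau> l) (x $ l) (z $ l - side (\<tau> l) * (real (m l) * h)))) * f z)" for m
 proof -
  have "(\<integral>p. (case p of (h, y) => Fm m h y) \<partial>(lborel \<Otimes>\<^sub>M lborel)) = (LBINT h. (LBINT y. Fm m h y))"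
   using lborel_pair.integral_fst'[OF Fint[of m]] by simp
  also have "\<dots> = (LBINT h. (LBINT z. Gm m h z))"
  proof (rule lint_cong[OF refl])
   fix h
   have "(\<lambda>z. Gm m h z) \<in> borel_measurable borel" unfolding Gm_def by measurable
   from integral_translate[OF this, of "diff_shift \<tau> m h"]
   show "(LBINT y. Fm m h y) = (LBINT z. Gm m h z)" by (simp add: Fm_def Gm_def)
  qed
  also have "\<dots> = (LBINT z. (LBINT h. Gm m h z))"
   using lborel_pair.Fubini_integral[OF Gint[of m]] by simp
  also have "\<dots> = (LBINT z. of_real (\<Prod>l\<in>UNIV. diff_coeff (snd (\<tau> l)) (m l) * (LBINT h. step_density (snd (\<tau> l)) h * kap (\<tau> l) (x $ l) (z $ l - side (\<tau> l) * (real (m l) * h)))) * f z)"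
  proof (rule lint_cong[OF refl])
   fix z :: "real^'d"
   define e where "e l h = step_density (snd (\<tau> l)) h * kap (\<tau> l) (x $ l) (z $ l - side (\<tau> l) * (real (m l) * h))" for l h
   have ei: "integrable lborel (e l)" for l
   proof (rule lint_bound)
    show "integrable lborel (\<lambda>h. step_density (snd (\<tau> l)) h * Ck (\<tau> l))"
     using step_density_good[of "snd (\<tau> l)"] by (auto simp: bdd_integrable_def)
    show "e l \<in> borel_measurable lborel" unfolding e_def[abs_def] by measurable
    show "AE h in lborel. norm (e l h) \<le> norm (step_density (snd (\<tau> l)) h * Ck (\<tau> l))"
     unfolding e_def by (intro AE_I2) (auto simp: abs_mult intro!: mult_left_mono order_trans[OF Ck abs_ge_self])
   qed
   have "(LBINT h. Gm m h z) = (LBINT h. of_real (c m * (\<Prod>l\<in>UNIV. e l (h $ l))) * f z)"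
   proof (rule lint_cong[OF refl])
    fix h :: "real^'d"
    have "Kx (z - diff_shift \<tau> m h) * (step_dens \<tau> h * c m) = c m * (\<Prod>l\<in>UNIV. e l (h $ l))"
     by (simp add: Kx_def step_dens_def e_def prod.distrib diff_shift_def)
    then show "Gm m h z = of_real (c m * (\<Prod>l\<in>UNIV. e l (h $ l))) * f z" by (simp only: Gm_def)
   qed
   also have "\<dots> = of_real (LBINT h. c m * (\<Prod>l\<in>UNIV. e l (h $ l))) * f z"
    by (simp only: integral_mult_left_zero integral_complex_of_real)
   also have "(LBINT h. c m * (\<Prod>l\<in>UNIV. e l (h $ l))) = c m * (\<Prod>l\<in>UNIV. integral\<^sup>L lborel (e l))"
    using integral_prod_vec[of e] ei by simp
   also have "\<dots> = (\<Prod>l\<in>UNIV. diff_coeff (snd (\<tau> l)) (m l) * integral\<^sup>L lborel (e l))" by (simp only: c_def prod.distrib)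
   finally show "(LBINT h. Gm m h z) = of_real (\<Prod>l\<in>UNIV. diff_coeff (snd (\<tau> l)) (m l) * (LBINT h. step_density (snd (\<tau> l)) h * kap (\<tau> l) (x $ l) (z $ l - side (\<tau> l) * (real (m l) * h)))) * f z"
    unfolding e_def .
  qed
  finally show ?thesis .
 qed
 have "(LBINT y. of_real (Kx y) * avg_diff \<tau> f y) = (LBINT y. (LBINT h. (\<Sum>m\<in>?P. Fm m h y)))"
 proof (rule lint_cong[OF refl])
  fix y :: "real^'d"
  have "of_real (Kx y) * avg_diff \<tau> f y = of_real (Kx y) * (LBINT h. of_real (step_dens \<tau> h) * diff_sum \<tau> f h y)"
  proof (cases "\<forall>l. y $ l \<in> region (\<tau> l)")
   case False
   then obtain l where l: "y $ l \<notin> region (\<tau> l)" by blast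
   then have "kap (\<tau> l) (x $ l) (y $ l) = 0" using kap_region[OF x[of l], of "\<tau> l" "y $ l"] by blast
   then have "Kx y = 0" unfolding Kx_def by (intro prod_zero) auto
   then show ?thesis by simp
  qed (simp add: avg_diff_def)
  also have "\<dots> = (LBINT h. of_real (Kx y) * (of_real (step_dens \<tau> h) * diff_sum \<tau> f h y))"
   by (simp only: integral_mult_right_zero)
  also have "\<dots> = (LBINT h. (\<Sum>m\<in>?P. Fm m h y))"
   by (intro lint_cong)
    (auto simp: diff_sum_def Fm_def c_def sum_distrib_left mult_ac simp del: of_real_prod intro!: sum.cong)
  finally show "of_real (Kx y) * avg_diff \<tau> f y = (LBINT h. (\<Sum>m\<in>?P. Fm m h y))" .
 qed
 also have "\<dots> = (\<integral>p. (\<Sum>m\<in>?P. (case p of (h, y) => Fm m h y)) \<partial>(lborel \<Otimes>\<^sub>M lborel))"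
 proof -
  have "integrable (lborel \<Otimes>\<^sub>M lborel) (\<lambda>(h, y). \<Sum>m\<in>?P. Fm m h y)"
   using Fint by (simp add: case_prod_unfold)
  from lborel_pair.integral_snd[OF this] show ?thesis by (simp add: case_prod_unfold)
 qed
 also have "\<dots> = (\<Sum>m\<in>?P. \<integral>p. (case p of (h, y) => Fm m h y) \<partial>(lborel \<Otimes>\<^sub>M lborel))"
  by (intro lint_sum Fint)
 also have "\<dots> = (\<Sum>m\<in>?P. (LBINT z. of_real (\<Prod>l\<in>UNIV. diff_coeff (snd (\<tau> l)) (m l) * (LBINT h. step_density (snd (\<tau> l)) h * kap (\<tau> l) (x $ l) (z $ l - side (\<tau> l) * (real (m l) * h)))) * f z))"
  by (simp only: one)
 also have "\<dots> = (LBINT z. (\<Sum>m\<in>?P. of_real (\<Prod>l\<in>UNIV. diff_coeff (snd (\<tau> l)) (m l) * (LBINT h. step_density (snd (\<tau> l)) h * kap (\<tau> l) (x $ l) (z $ l - side (\<tau> l) * (real (m l) * h)))) * f z))"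
 proof (rule lint_sum[symmetric])
  fix m
  define R where "R z = (\<Prod>l\<in>UNIV. diff_coeff (snd (\<tau> l)) (m l) * (LBINT h. step_density (snd (\<tau> l)) h * kap (\<tau> l) (x $ l) (z $ l - side (\<tau> l) * (real (m l) * h))))" for z :: "real^'d"
  have [measurable]: "R \<in> borel_measurable borel"
   unfolding R_def[abs_def] by measurable
  define RB where "RB = (\<Prod>l\<in>UNIV. \<bar>diff_coeff (snd (\<tau> l)) (m l)\<bar> * (LBINT h. \<bar>step_density (snd (\<tau> l)) h\<bar> * Ck (\<tau> l)))"
  have RB: "\<bar>R z\<bar> \<le> RB" for z
   unfolding R_def RB_def abs_prod abs_mult
  proof (intro prod_mono conjI mult_left_mono mult_nonneg_nonneg)
   fix l
   have "\<bar>(LBINT h. step_density (snd (\<tau> l)) h * kap (\<tau> l) (x $ l) (z $ l - side (\<tau> l) * (real (m l) * h)))\<bar>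
    \<le> (LBINT h. \<bar>step_density (snd (\<tau> l)) h * kap (\<tau> l) (x $ l) (z $ l - side (\<tau> l) * (real (m l) * h))\<bar>)"
    using integral_norm_bound[of lborel "\<lambda>h. step_density (snd (\<tau> l)) h * kap (\<tau> l) (x $ l) (z $ l - side (\<tau> l) * (real (m l) * h))"] by simp
   also have "\<dots> \<le> (LBINT h. \<bar>step_density (snd (\<tau> l)) h\<bar> * Ck (\<tau> l))"
   proof (rule integral_mono_AE')
    show "integrable lborel (\<lambda>h. \<bar>step_density (snd (\<tau> l)) h\<bar> * Ck (\<tau> l))"
     using step_density_good[of "snd (\<tau> l)"] by (auto simp: bdd_integrable_def)
    show "AE h in lborel. \<bar>step_density (snd (\<tau> l)) h * kap (\<tau> l) (x $ l) (z $ l - side (\<tau> l) * (real (m l) * h))\<bar> \<le> \<bar>step_density (snd (\<tau> l)) h\<bar> * Ck (\<tau> l)"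
     unfolding abs_mult by (intro AE_I2 mult_left_mono Ck) auto
    show "AE h in lborel. 0 \<le> \<bar>step_density (snd (\<tau> l)) h\<bar> * Ck (\<tau> l)"
     by (intro AE_I2 mult_nonneg_nonneg order_trans[OF abs_ge_zero Ck[of _ 0 0]]) auto
   qed
   finally show "\<bar>(LBINT h. step_density (snd (\<tau> l)) h * kap (\<tau> l) (x $ l) (z $ l - side (\<tau> l) * (real (m l) * h)))\<bar> \<le> \<dots>" .
  qed auto
  have "integrable lborel (\<lambda>z. of_real (R z) * f z)"
  proof (rule lint_bound)
   show "integrable lborel (\<lambda>z. of_real RB * f z)" using f by (intro integrable_mult_right)
   show "AE z in lborel. norm (of_real (R z) * f z) \<le> norm (of_real RB * f z)"
    by (intro AE_I2) (auto simp: norm_mult intro!: mult_right_mono order_trans[OF RB abs_ge_self])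
  qed measurable
  then show "integrable lborel (\<lambda>z. of_real (\<Prod>l\<in>UNIV. diff_coeff (snd (\<tau> l)) (m l) * (LBINT h. step_density (snd (\<tau> l)) h * kap (\<tau> l) (x $ l) (z $ l - side (\<tau> l) * (real (m l) * h)))) * f z)"
   unfolding R_def .
 qed
 also have "\<dots> = (LBINT z. of_real (\<Prod>l\<in>UNIV. red (\<tau> l) (x $ l) (z $ l)) * f z)"
  unfolding red_eq
  by (subst prod_sum_PiE) (simp_all only: sum_distrib_right[symmetric] of_real_sum[symmetric] finite_atMost finite)
 finally show ?thesis unfolding Kx_def .
qed

end

section \<open>Fractional smoothness\<close>

abbreviation cheb_sum :: "real => nat set => (real^'d::finite => complex) => real" where
 "cheb_sum s K F \<equiv> (\<Sum>k\<in>PiE UNIV (\<lambda>_. K). (\<Prod>l\<in>UNIV. (1 + (real (k l))^2) powr s) *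
  (cmod (LBINT x. of_real (\<Prod>l\<in>UNIV. cheb_fun (k l) (x $ l)) * F x))^2)"

context smoothing
begin

lemma red_bounded: "\<exists>c. \<forall>x z. \<bar>red t x z\<bar> \<le> c"
proof -
 obtain C where C: "\<And>x y. \<bar>kap t x y\<bar> \<le> C" using kap_bounded by metis
 have i: "integrable lborel (\<lambda>h. \<bar>step_density (snd t) h\<bar> * C)"
  using step_density_good[of "snd t"] by (auto simp: bdd_integrable_def)
 have "\<bar>(LBINT h. step_density (snd t) h * kap t x (g h))\<bar> \<le> (LBINT h. \<bar>step_density (snd t) h\<bar> * C)" for x and g :: "real => real"
 proof -
  have "\<bar>(LBINT h. step_density (snd t) h * kap t x (g h))\<bar> \<le> (LBINT h. \<bar>step_density (snd t) h * kap t x (g h)\<bar>)"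
   using integral_norm_bound[of lborel "\<lambda>h. step_density (snd t) h * kap t x (g h)"] by simp
  also have "\<dots> \<le> (LBINT h. \<bar>step_density (snd t) h\<bar> * C)"
  proof (rule integral_mono_AE'[OF i])
   show "AE h in lborel. \<bar>step_density (snd t) h * kap t x (g h)\<bar> \<le> \<bar>step_density (snd t) h\<bar> * C"
    unfolding abs_mult by (intro AE_I2 mult_left_mono C) auto
   show "AE h in lborel. 0 \<le> \<bar>step_density (snd t) h\<bar> * C"
    by (intro AE_I2 mult_nonneg_nonneg order_trans[OF abs_ge_zero C[of 0 0]]) auto
  qed
  finally show ?thesis .
 qed
 then have "\<bar>red t x z\<bar> \<le> (\<Sum>m\<le>M. \<bar>diff_coeff (snd t) m\<bar> * (LBINT h. \<bar>step_density (snd t) h\<bar> * C))" for x z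
  unfolding red_eq by (intro order_trans[OF sum_abs] sum_mono) (auto simp: abs_mult intro!: mult_left_mono)
 then show ?thesis by blast
qed

lemma red_sum_bounded: "\<exists>c. \<forall>x z. \<bar>\<Sum>t\<in>levels n. red t x z\<bar> \<le> c"
proof -
 obtain c where c: "\<And>t x z. \<bar>red t x z\<bar> \<le> c t" using red_bounded by metis
 have "\<bar>\<Sum>t\<in>levels n. red t x z\<bar> \<le> (\<Sum>t\<in>levels n. c t)" for x z
  by (intro order_trans[OF sum_abs] sum_mono c)
 then show ?thesis by blast
qed

text \<open>F is the sum over all sides and levels of kernels applied to averaged differences.
  Cauchy-Schwarz sets the energy weights 2^(2 s i) against the squared norms of order 2^i of the
  kernels; since s > 1/2 the series converges absolutely with a uniform bound. Partial sums converge
  weakly to f by telescoping, which identifies F with f, and each of them obeys the Chebyshev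
  estimate with the same constant.\<close>

lemma fractional_core:
 fixes s :: real
 assumes s: "1/2 < s" "s < real M"
 shows "\<exists>A\<ge>0. \<forall>(f :: real^'d::finite => complex) Y. integrable lborel f --> f \<in> borel_measurable borel --> (\<forall>x. x \<notin> cube --> f x = 0) -->
  (\<forall>\<tau>. integrable lborel (\<lambda>y. (cmod (avg_diff \<tau> f y))^2)) -->
  (\<forall>T. finite T --> (\<Sum>\<tau>\<in>T. (\<Prod>l\<in>UNIV. (2 powr (s * real (snd (\<tau> l))))^2) * (LBINT y. (cmod (avg_diff \<tau> f y))^2)) \<le> Y) -->
  (\<exists>F b. F \<in> borel_measurable borel \<and> (\<forall>x. cmod (F x) \<le> b) \<and> (AE x in lborel. x \<in> cube --> f x = F x) \<and>
   (\<forall>K. finite K --> cheb_sum s K F \<le> A * Y))"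
proof -
 define r where "r = 2 powr (- min (s - 1/2) (real M - s))"
 have r: "0 < r" "r < 1" using s by (simp_all add: r_def powr_less_one)
 obtain C where C0: "0 \<le> C" and km: "\<And>i. (\<lambda>p. kapL i (fst p) (snd p)) \<in> borel_measurable (borel \<Otimes>\<^sub>M borel)"
  and kb: "\<And>i x y. \<bar>kapL i x y\<bar> \<le> C * 2 ^ i"
  and k2: "\<And>i x. integrable lborel (\<lambda>y. (kapL i x y)^2)" and k2b: "\<And>i x. (LBINT y. (kapL i x y)^2) \<le> C\<^sup>2 * 2 ^ i"
  and kbf: "\<And>K i. finite K ==> bessel_family K (\<lambda>k y. sqrt ((1 + (real k)^2) powr s * (1 / r) ^ ndist i (floor_log k)) * (LBINT x. kapL i x y * cheb_fun k x))
   ((4 powr s * dyadic_const s M * C\<^sup>2 * (2 / (1 - r))) * (2 powr (s * real i))^2)"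
 proof (rule kapL_properties, goal_cases)
  case (1 C)
  show thesis by (rule 1(1)[of C]) (rule 1(2-6) 1(7)[OF s, folded r_def] | assumption)+
 qed
 define B where "B = 4 powr s * dyadic_const s M * C\<^sup>2 * (2 / (1 - r))"
 \<comment> \<open>The two sides, times the geometric sum over the distance of the level to
   \<open>floor_log k\<close>.\<close>
 define S where "S = 2 * (2 / (1 - r))"
 define \<beta> where "\<beta> t = 2 powr (s * real (snd t))" for t :: "bool \<times> nat"
 define q where "q t k = (1 / r) ^ ndist (snd t) (floor_log k)" for t :: "bool \<times> nat" and k
 \<comment> \<open>C might be 0; with C + 1 the quantities \<open>sq\<close> are positive and may
   serve as denominators.\<close>
 define C1 where "C1 = C + 1"
 define sq where "sq t = C1\<^sup>2 * 2 ^ snd t" for t :: "bool \<times> nat"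
 \<comment> \<open>The ratio per level of the squared kernel norm 2^i to the energy weight 2^(2 s
   i).\<close>
 define \<rho> where "\<rho> = 2 powr (1 - 2 * s)"
 define Z where "Z = 2 * C1\<^sup>2 * (1 / (1 - \<rho>))"
 have C1: "0 < C1" "C\<^sup>2 \<le> C1\<^sup>2" using C0 by (auto simp: C1_def intro: power_mono)
 have \<rho>: "0 < \<rho>" "\<rho> < 1" using s by (simp_all add: \<rho>_def powr_less_one)
 have B0: "0 \<le> B" using r by (simp add: B_def dyadic_const_def)
 have S0: "0 \<le> S" using r by (simp add: S_def)
 have Z0: "0 \<le> Z" using \<rho> by (simp add: Z_def)
 have \<beta>0: "0 < \<beta> t" for t by (simp add: \<beta>_def)
 have sq0: "0 < sq t" for t using C1 by (simp add: sq_def)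
 have q0: "0 < q t k" for t k using r by (simp add: q_def)
 have H2: "(\<Sum>t\<in>levels n. 1 / q t k) \<le> S" for n k
 proof -
  have "(\<Sum>t\<in>levels n. 1 / q t k) = (\<Sum>b\<in>(UNIV :: bool set). \<Sum>i\<le>Suc n. r ^ ndist (floor_log k) i)"
   unfolding levels_def by (simp only: sum.cartesian_product) (simp add: case_prod_unfold q_def power_one_over ndist_commute)
  also have "\<dots> \<le> (\<Sum>b\<in>(UNIV :: bool set). 2 / (1 - r))"
   by (intro sum_mono sum_ndist_le r) auto
  finally show ?thesis by (simp add: S_def UNIV_bool)
 qed
 have ZS: "(\<Sum>t\<in>levels n. sq t / (\<beta> t)^2) \<le> Z" for n
 proof -
  have e: "sq (b, i) / (\<beta> (b, i))^2 = C1\<^sup>2 * \<rho> ^ i" for b i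
  proof -
   have "\<rho> ^ i = 2 powr (real i * (1 - 2 * s))" unfolding \<rho>_def by (simp add: powr_power)
   also have "\<dots> = 2 powr (real i - 2 * (s * real i))" by (simp add: algebra_simps)
   also have "\<dots> = 2 ^ i / (2 powr (s * real i) * 2 powr (s * real i))"
    by (simp only: powr_diff powr_realpow zero_less_numeral mult_2 powr_add)
   finally show ?thesis by (simp add: sq_def \<beta>_def power2_eq_square)
  qed
  have "(\<Sum>t\<in>levels n. sq t / (\<beta> t)^2) = (\<Sum>b\<in>(UNIV :: bool set). \<Sum>i\<le>Suc n. C1\<^sup>2 * \<rho> ^ i)"
   unfolding levels_def by (simp only: sum.cartesian_product) (auto simp: e intro!: sum.cong)
  also have "\<dots> \<le> (\<Sum>b\<in>(UNIV :: bool set). C1\<^sup>2 * (1 / (1 - \<rho>)))"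
   unfolding sum_distrib_left[symmetric] by (intro sum_mono mult_left_mono sum_geometric_le \<rho>) auto
  finally show ?thesis by (simp add: Z_def UNIV_bool)
 qed
 have kbt: "\<bar>kap t x y\<bar> \<le> C * 2 ^ snd t" for t x y using kb by (simp add: kap_def)
 have kap2: "integrable lborel (\<lambda>y. (kap t x y)^2)" "(LBINT y. (kap t x y)^2) \<le> sq t" for t x
 proof -
  have a: "(LBINT y. (kapL i x y)^2) \<le> C1\<^sup>2 * 2 ^ i" for i x
   by (rule order_trans[OF k2b]) (use C1 in \<open>auto intro: mult_right_mono\<close>)
  show "integrable lborel (\<lambda>y. (kap t x y)^2)"
   using k2[of "snd t" x] integrable_reflect_real[OF k2[of "snd t" "- x"], of 0] by (cases "fst t") (simp_all add: kap_def)
  show "(LBINT y. (kap t x y)^2) \<le> sq t"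
   using a[of "snd t" x] a[of "snd t" "- x"] integral_uminus_real[of "\<lambda>y. (kapL (snd t) (- x) y)^2"] by (cases "fst t") (simp_all add: kap_def sq_def)
 qed
 have H1: "bessel_family K (\<lambda>k y. sqrt ((1 + (real k)^2) powr s * q t k) * (LBINT x. kap t x y * cheb_fun k x)) (B * (\<beta> t)^2)"
  if "finite K" for K t
 proof -
  obtain b i where t: "t = (b, i)" by (cases t)
  from kap_bessel_family[OF kbf[OF that, of i], of b] show ?thesis by (simp add: t q_def B_def \<beta>_def)
 qed
 show ?thesis
 proof (intro exI[of _ "(S * B) ^ CARD('d)"] conjI allI impI)
  show "0 \<le> (S * B) ^ CARD('d)" using S0 B0 by simp
  fix f :: "real^'d => complex" and Y :: real
  assume fi: "integrable lborel f" and fm [measurable]: "f \<in> borel_measurable borel" and fout0: "\<forall>x. x \<notin> cube --> f x = 0"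
   and u20: "\<forall>\<tau>. integrable lborel (\<lambda>y. (cmod (avg_diff \<tau> f y))^2)"
   and Y0: "\<forall>T. finite T --> (\<Sum>\<tau>\<in>T. (\<Prod>l\<in>UNIV. (2 powr (s * real (snd (\<tau> l))))^2) * (LBINT y. (cmod (avg_diff \<tau> f y))^2)) \<le> Y"
  define u where "u \<tau> = avg_diff \<tau> f" for \<tau>
  have fout: "f x = 0" if "x \<notin> cube" for x using fout0 that by blast
  have u2: "integrable lborel (\<lambda>y. (cmod (u \<tau> y))^2)" for \<tau> using u20 by (simp add: u_def)
  have um [measurable]: "u \<tau> \<in> borel_measurable borel" for \<tau> unfolding u_def by (rule avg_diff_measurable[OF fm])
  have uout: "u \<tau> y = 0" if "y \<notin> cube" for \<tau> y
  proof -
   have "\<not> (\<forall>l. y $ l \<in> region (\<tau> l))"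
   proof
    assume a: "\<forall>l. y $ l \<in> region (\<tau> l)"
    have "\<bar>y $ l\<bar> \<le> 1" for l using a[rule_format, of l] by (auto simp: region_def split: if_splits)
    then show False using that by (simp add: mem_cube_iff)
   qed
   then show ?thesis by (simp add: u_def avg_diff_def)
  qed
  have u1: "integrable lborel (u \<tau>)" for \<tau> by (rule L2_on_cube_integrable[OF um uout u2])
  define U where "U \<tau> = (LBINT y. (cmod (u \<tau> y))^2)" for \<tau>
  have U0: "0 \<le> U \<tau>" for \<tau> unfolding U_def by (intro integral_nonneg_AE) auto
  define W where "W \<tau> = (\<Prod>l\<in>UNIV. (\<beta> (\<tau> l))^2)" for \<tau> :: "'d => bool \<times> nat"
  have Y: "(\<Sum>\<tau>\<in>T. W \<tau> * U \<tau>) \<le> Y" if "finite T" for T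
   using Y0[rule_format, OF that] by (simp add: W_def \<beta>_def U_def u_def)
  define TT where "TT n = PiE (UNIV :: 'd set) (\<lambda>_. levels n)" for n
  have finTT: "finite (TT n)" for n unfolding TT_def by (simp add: finite_PiE finite_levels)
  define v where "v \<tau> x = (LBINT y. of_real (\<Prod>l\<in>UNIV. kap (\<tau> l) (x $ l) (y $ l)) * u \<tau> y)" for \<tau> x
  have vm [measurable]: "v \<tau> \<in> borel_measurable borel" for \<tau>
  proof -
   have "(\<lambda>(x, y). of_real (\<Prod>l\<in>UNIV. kap (\<tau> l) (x $ l) (y $ l)) * u \<tau> y) \<in> borel_measurable (borel \<Otimes>\<^sub>M (lborel :: (real^'d) measure))"
    unfolding case_prod_unfold by measurable
   from sigma_finite_measure.borel_measurable_lebesgue_integral[OF sigma_finite_lborel this]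
   show ?thesis unfolding v_def[abs_def] .
  qed
  define sv where "sv \<tau> = (\<Prod>l\<in>UNIV. sq (\<tau> l))" for \<tau> :: "'d => bool \<times> nat"
  have vb: "(cmod (v \<tau> x))^2 \<le> sv \<tau> * U \<tau>" for \<tau> x
  proof -
   have p2: "(\<lambda>y::real^'d. (\<Prod>l\<in>UNIV. kap (\<tau> l) (x $ l) (y $ l))^2) = (\<lambda>y. \<Prod>l\<in>UNIV. (kap (\<tau> l) (x $ l) (y $ l))^2)"
    by (simp add: prod_power_distrib)
   have "(cmod (v \<tau> x))^2 \<le> (\<integral>y. (\<Prod>l\<in>UNIV. kap (\<tau> l) (x $ l) (y $ l))^2 \<partial>(lborel :: (real^'d) measure)) * U \<tau>"
    unfolding v_def U_def
   proof (rule integral_cauchy_schwarz)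
    show "integrable lborel (\<lambda>y::real^'d. (\<Prod>l\<in>UNIV. kap (\<tau> l) (x $ l) (y $ l))^2)"
     unfolding p2 by (intro integrable_prod_vec kap2)
   qed (use u2 in measurable)
   also have "\<dots> \<le> sv \<tau> * U \<tau>"
   proof (rule mult_right_mono[OF _ U0])
    have "(\<integral>y. (\<Prod>l\<in>UNIV. kap (\<tau> l) (x $ l) (y $ l))^2 \<partial>(lborel :: (real^'d) measure)) = (\<Prod>l\<in>UNIV. (LBINT y. (kap (\<tau> l) (x $ l) y)^2))"
     unfolding p2 by (intro integral_prod_vec kap2)
    also have "\<dots> \<le> sv \<tau>"
     unfolding sv_def by (intro prod_mono conjI kap2 integral_nonneg_AE) auto
    finally show "(\<integral>y. (\<Prod>l\<in>UNIV. kap (\<tau> l) (x $ l) (y $ l))^2 \<partial>(lborel :: (real^'d) measure)) \<le> sv \<tau>" .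
   qed
   finally show ?thesis .
  qed
  \<comment> \<open>T is enlarged to a full product set so that the sum of \<open>sv\<close> / W
    factorises over the coordinates; Cauchy-Schwarz with the weights W / \<open>sv\<close> does the
    rest.\<close>
  have sumv2: "(\<Sum>\<tau>\<in>T. cmod (v \<tau> x))^2 \<le> Z ^ CARD('d) * Y" if T: "finite T" for T x
  proof -
   have "\<exists>n. \<forall>\<tau>\<in>T. \<forall>l. snd (\<tau> l) \<le> n"
   proof -
    have "finite (\<Union>\<tau>\<in>T. range (\<lambda>l. snd (\<tau> l)))" using T by auto
    then obtain n where "\<forall>i\<in>(\<Union>\<tau>\<in>T. range (\<lambda>l. snd (\<tau> l))). i \<le> n" using finite_nat_set_iff_bounded_le by auto
    then show ?thesis by blast
   qed
   then obtain n where n: "\<forall>\<tau>\<in>T. \<forall>l. snd (\<tau> l) \<le> n" ..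
   have sub: "T \<subseteq> TT n"
   proof
    fix \<tau> assume "\<tau> \<in> T"
    then have "\<tau> l \<in> levels n" for l using n[rule_format, of \<tau> l] \<open>\<tau> \<in> T\<close> by (cases "\<tau> l") (simp add: levels_def)
    then show "\<tau> \<in> TT n" by (simp add: TT_def PiE_iff)
   qed
   define a where "a \<tau> = complex_of_real (cmod (v \<tau> x))" for \<tau>
   define w where "w \<tau> = W \<tau> / sv \<tau>" for \<tau>
   have Wpos: "0 < W \<tau>" "0 < sv \<tau>" for \<tau> unfolding W_def sv_def by (intro prod_pos zero_less_power ballI \<beta>0 sq0)+
   have w0: "0 < w \<tau>" for \<tau> using Wpos by (simp add: w_def)
   have "(\<Sum>\<tau>\<in>T. cmod (v \<tau> x))^2 \<le> (\<Sum>\<tau>\<in>TT n. cmod (v \<tau> x))^2"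
    using finTT sub by (intro power_mono sum_mono2 sum_nonneg) auto
   also have "\<dots> = (cmod (\<Sum>\<tau>\<in>TT n. a \<tau>))^2"
   proof -
    have "(\<Sum>\<tau>\<in>TT n. a \<tau>) = of_real (\<Sum>\<tau>\<in>TT n. cmod (v \<tau> x))" by (simp add: a_def)
    then show ?thesis by (simp only: norm_of_real power2_abs)
   qed
   also have "\<dots> \<le> (\<Sum>\<tau>\<in>TT n. 1 / w \<tau>) * (\<Sum>\<tau>\<in>TT n. w \<tau> * (cmod (a \<tau>))^2)"
    by (intro weighted_cauchy_schwarz finTT w0)
   also have "\<dots> \<le> Z ^ CARD('d) * Y"
   proof (rule mult_mono)
    have "(\<Sum>\<tau>\<in>TT n. 1 / w \<tau>) = (\<Prod>l\<in>(UNIV :: 'd set). \<Sum>t\<in>levels n. sq t / (\<beta> t)^2)"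
     unfolding TT_def by (subst prod_sum_PiE) (auto simp: finite_levels w_def sv_def W_def prod_dividef)
    also have "\<dots> \<le> (\<Prod>l\<in>(UNIV :: 'd set). Z)"
     by (intro prod_mono conjI ZS sum_nonneg) (simp add: less_imp_le[OF sq0])
    finally show "(\<Sum>\<tau>\<in>TT n. 1 / w \<tau>) \<le> Z ^ CARD('d)" by simp
    have "(\<Sum>\<tau>\<in>TT n. w \<tau> * (cmod (a \<tau>))^2) \<le> (\<Sum>\<tau>\<in>TT n. W \<tau> * U \<tau>)"
    proof (rule sum_mono)
     fix \<tau>
     have "w \<tau> * (cmod (a \<tau>))^2 \<le> w \<tau> * (sv \<tau> * U \<tau>)"
      using vb[of \<tau> x] w0[of \<tau>] by (intro mult_left_mono) (auto simp: a_def)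
     also have "\<dots> = W \<tau> * U \<tau>" using Wpos(2)[of \<tau>] by (simp add: w_def)
     finally show "w \<tau> * (cmod (a \<tau>))^2 \<le> W \<tau> * U \<tau>" .
    qed
    also have "\<dots> \<le> Y" by (rule Y[OF finTT])
    finally show "(\<Sum>\<tau>\<in>TT n. w \<tau> * (cmod (a \<tau>))^2) \<le> Y" .
    show "0 \<le> (\<Sum>\<tau>\<in>TT n. w \<tau> * (cmod (a \<tau>))^2)" using w0 by (intro sum_nonneg mult_nonneg_nonneg) (auto intro: less_imp_le)
   qed (use Z0 in simp)
   finally show ?thesis .
  qed
  define V where "V = sqrt (Z ^ CARD('d) * Y)"
  have sumv: "(\<Sum>\<tau>\<in>T. cmod (v \<tau> x)) \<le> V" if "finite T" for T x
   unfolding V_def using sumv2[OF that, of x] by (rule real_le_rsqrt)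
  define F where "F x = (\<Sum>\<^sub>\<infinity>\<tau>\<in>UNIV. v \<tau> x)" for x
  define Fn where "Fn n x = (\<Sum>\<tau>\<in>TT n. v \<tau> x)" for n x
  have Fnm [measurable]: "Fn n \<in> borel_measurable borel" for n unfolding Fn_def[abs_def] by measurable
  have Fnb: "cmod (Fn n x) \<le> V" for n x
   unfolding Fn_def by (rule order_trans[OF norm_sum sumv[OF finTT]])
  have lim: "(\<lambda>n. Fn n x) \<longlonglongrightarrow> F x" for x
  proof -
   have "(\<lambda>\<tau>. norm (v \<tau> x)) summable_on UNIV"
   proof (rule nonneg_bdd_above_summable_on)
    show "bdd_above (sum (\<lambda>\<tau>. norm (v \<tau> x)) ` {F. F \<subseteq> UNIV \<and> finite F})"
     by (rule bdd_aboveI2[where M = V]) (simp add: sumv)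
   qed simp
   then have "((\<lambda>\<tau>. v \<tau> x) has_sum F x) UNIV"
    unfolding F_def by (rule has_sum_infsum[OF abs_summable_summable])
   then have "(sum (\<lambda>\<tau>. v \<tau> x) \<longlongrightarrow> F x) (finite_subsets_at_top UNIV)" by (simp add: has_sum_def)
   \<comment> \<open>The sets \<open>TT n\<close> exhaust the index set, so the partial sums over
     them converge to the unordered infinite sum.\<close>
   moreover have "filterlim TT (finite_subsets_at_top UNIV) sequentially"
    unfolding filterlim_finite_subsets_at_top
   proof (intro allI impI)
    fix X :: "('d => bool \<times> nat) set" assume "finite X \<and> X \<subseteq> UNIV"
    then have "finite (\<Union>\<tau>\<in>X. range (\<lambda>l. snd (\<tau> l)))" by auto
    then obtain N where N: "\<forall>i\<in>(\<Union>\<tau>\<in>X. range (\<lambda>l. snd (\<tau> l))). i \<le> N" using finite_nat_set_iff_bounded_le by auto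
    have "X \<subseteq> TT n" if "n \<ge> N" for n
    proof
     fix \<tau> assume t: "\<tau> \<in> X"
     have "\<tau> l \<in> levels n" for l
     proof -
      have "snd (\<tau> l) \<le> N" using N t by blast
      then show ?thesis using that by (cases "\<tau> l") (simp add: levels_def)
     qed
     then show "\<tau> \<in> TT n" by (simp add: TT_def PiE_iff)
    qed
    then show "\<forall>\<^sub>F n in sequentially. finite (TT n) \<and> X \<subseteq> TT n \<and> TT n \<subseteq> UNIV"
     using finTT unfolding eventually_sequentially by blast
   qed
   ultimately show ?thesis unfolding Fn_def by (rule filterlim_compose)
  qed
  have Fm [measurable]: "F \<in> borel_measurable borel"
   by (rule borel_measurable_LIMSEQ_metric[OF Fnm lim])
  have Fb: "cmod (F x) \<le> V" for x
   using tendsto_norm[OF lim[of x]] Fnb by (intro Lim_bounded[where M = 0]) auto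
  have AEeq: "AE x in lborel. x \<in> cube --> f x = F x"
  proof (rule AE_eq_of_weak_limit[where Fn = Fn and c = V, OF fi fout Fnm Fm lim Fnb])
   fix a b :: "real^'d" assume ab: "\<And>l. -1 \<le> a $ l \<and> a $ l < b $ l \<and> b $ l \<le> 1"
   define P where "P n x z = (\<Prod>l\<in>UNIV. indicator {a $ l<..<b $ l} (x $ l) * (\<Sum>t\<in>levels n. red t (x $ l) (z $ l)))" for n and x z :: "real^'d"
   define q1 where "q1 n l z = (LBINT x. indicator {a $ l<..<b $ l} x * (\<Sum>t\<in>levels n. red t x z))" for n l z
   have box: "indicator (box a b) x = (\<Prod>l\<in>UNIV. indicator {a $ l<..<b $ l} (x $ l) :: real)" for x
   proof (cases "x \<in> box a b")
    case False
    then obtain l where "x $ l \<notin> {a $ l<..<b $ l}" by (auto simp: mem_box_cart)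
    then have "(\<Prod>l\<in>UNIV. indicator {a $ l<..<b $ l} (x $ l) :: real) = 0" by (intro prod_zero bexI[of _ l]) (auto simp: indicator_def)
    then show ?thesis using False by simp
   qed (simp add: mem_box_cart)
   have boxcube: "\<bar>x $ l\<bar> \<le> 1" if "x \<in> box a b" for x l
    using that ab[of l] by (auto simp: mem_box_cart abs_le_iff) (smt (verit))+
   have redm: "(\<lambda>p. \<Sum>t\<in>levels n. red t (fst p) (snd p)) \<in> borel_measurable (borel \<Otimes>\<^sub>M borel)" for n
    unfolding red_eq by measurable
   have redb: "\<exists>c. \<forall>x z. \<bar>\<Sum>t\<in>levels n. red t x z\<bar> \<le> c" for n by (rule red_sum_bounded)
   then obtain cr where cr: "\<And>n x z. \<bar>\<Sum>t\<in>levels n. red t x z\<bar> \<le> cr n" by metis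
   have cr0: "0 \<le> cr n" for n by (rule order_trans[OF abs_ge_zero cr])
   have Pm: "(\<lambda>p. P n (fst p) (snd p)) \<in> borel_measurable (borel \<Otimes>\<^sub>M borel)" for n
   proof -
    have [measurable]: "(\<lambda>p :: (real^'d) \<times> (real^'d). \<Sum>t\<in>levels n. red t (fst p $ l) (snd p $ l)) \<in> borel_measurable (borel \<Otimes>\<^sub>M borel)" for l
    proof -
     have "(\<lambda>p :: (real^'d) \<times> (real^'d). (fst p $ l, snd p $ l)) \<in> measurable (borel \<Otimes>\<^sub>M borel) (borel \<Otimes>\<^sub>M borel)"
      by (intro measurable_Pair measurable_compose[OF measurable_fst measurable_vec_nth] measurable_compose[OF measurable_snd measurable_vec_nth])
     from measurable_compose[OF this redm] show ?thesis by simp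
    qed
    show ?thesis unfolding P_def by measurable
   qed
   have Pb: "\<bar>P n x z\<bar> \<le> cr n ^ CARD('d) * indicator (box a b) x" for n x z
   proof -
    have "\<bar>P n x z\<bar> \<le> (\<Prod>l\<in>UNIV. cr n * indicator {a $ l<..<b $ l} (x $ l))"
     unfolding P_def abs_prod abs_mult using cr cr0
     by (intro prod_mono conjI) (auto simp: indicator_def)
    then show ?thesis by (simp add: box prod.distrib)
   qed
   have boxi: "integrable lborel (indicator (box a b) :: real^'d => real)"
    by (rule integrable_real_indicator) (auto intro: emeasure_bounded_finite[unfolded infinity_ennreal_def])
   have Pint: "integrable (lborel \<Otimes>\<^sub>M lborel) (\<lambda>(x, z). of_real (P n x z) * f z)" for n
   proof (rule lint_bound[OF integrable_tensor[OF integrable_mult_right[OF boxi, of "cr n ^ CARD('d)"] fi]])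
    show "(\<lambda>(x, z). complex_of_real (P n x z) * f z) \<in> borel_measurable (lborel \<Otimes>\<^sub>M lborel)"
     using Pm[of n] by (simp add: case_prod_unfold)
    show "AE p in lborel \<Otimes>\<^sub>M lborel. norm (case p of (x, z) => complex_of_real (P n x z) * f z)
     \<le> norm (complex_of_real (cr n ^ CARD('d) * indicator (box a b) (fst p)) * f (snd p))"
     using Pb order_trans[OF Pb abs_ge_self]
     by (intro AE_I2) (auto simp: norm_mult split: prod.split simp del: of_real_mult intro!: mult_right_mono)
   qed
   have Pz: "integrable lborel (\<lambda>z. of_real (\<Prod>l\<in>UNIV. red (\<tau> l) (x $ l) (z $ l)) * f z)" for \<tau> x
   proof -
    obtain cb where cb: "\<And>t x z. \<bar>red t x z\<bar> \<le> cb t" using red_bounded by metis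
    have [measurable]: "(\<lambda>z::real^'d. red (\<tau> l) (x $ l) (z $ l)) \<in> borel_measurable borel" for l
     unfolding red_eq by measurable
    show ?thesis
    proof (rule lint_bound)
     show "integrable lborel (\<lambda>z. of_real (\<Prod>l\<in>UNIV. cb (\<tau> l)) * f z)" using fi by (intro integrable_mult_right)
     have "\<bar>\<Prod>l\<in>UNIV. red (\<tau> l) (x $ l) (z $ l)\<bar> \<le> \<bar>\<Prod>l\<in>UNIV. cb (\<tau> l)\<bar>" for z :: "real^'d"
      unfolding abs_prod by (intro prod_mono conjI order_trans[OF cb abs_ge_self]) auto
     then show "AE z in lborel. norm (of_real (\<Prod>l\<in>UNIV. red (\<tau> l) (x $ l) (z $ l)) * f z) \<le> norm (of_real (\<Prod>l\<in>UNIV. cb (\<tau> l)) * f z)"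
      unfolding norm_mult norm_of_real by (intro AE_I2 mult_right_mono) auto
    qed measurable
   qed
   have Fnrep: "indicator (box a b) x *\<^sub>R Fn n x = (LBINT z. of_real (P n x z) * f z)" for n x
   proof (cases "x \<in> box a b")
    case True
    have "Fn n x = (\<Sum>\<tau>\<in>TT n. (LBINT z. of_real (\<Prod>l\<in>UNIV. red (\<tau> l) (x $ l) (z $ l)) * f z))"
     unfolding Fn_def v_def u_def by (intro sum.cong refl avg_diff_representation fi boxcube[OF True])
    also have "\<dots> = (LBINT z. (\<Sum>\<tau>\<in>TT n. of_real (\<Prod>l\<in>UNIV. red (\<tau> l) (x $ l) (z $ l)) * f z))"
     by (intro lint_sum[symmetric] Pz)
    also have "\<dots> = (LBINT z. of_real (P n x z) * f z)"
    proof (rule lint_cong[OF refl])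
     fix z :: "real^'d"
     have "P n x z = (\<Prod>l\<in>UNIV. \<Sum>t\<in>levels n. red t (x $ l) (z $ l))"
      using True unfolding P_def by (intro prod.cong) (auto simp: mem_box_cart)
     also have "\<dots> = (\<Sum>\<tau>\<in>TT n. \<Prod>l\<in>UNIV. red (\<tau> l) (x $ l) (z $ l))"
      unfolding TT_def by (rule prod_sum_PiE) (auto simp: finite_levels)
     finally show "(\<Sum>\<tau>\<in>TT n. of_real (\<Prod>l\<in>UNIV. red (\<tau> l) (x $ l) (z $ l)) * f z) = of_real (P n x z) * f z"
      by (simp only: sum_distrib_right[symmetric] of_real_sum)
    qed
    finally show ?thesis using True by simp
   next
    case False
    then have "P n x z = 0" for z using Pb[of n x z] by simp
    then show ?thesis using False by simp
   qed
   \<comment> \<open>Fubini integrates the reduced kernel over the box first; it factorises into the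
     one-dimensional integrals whose limit is \<open>red_sum_weak_limit\<close>.\<close>
   have swap: "(LBINT x. indicator (box a b) x *\<^sub>R Fn n x) = (LBINT z. of_real (\<Prod>l\<in>UNIV. q1 n l (z $ l)) * f z)" for n
   proof -
    have "(LBINT x. indicator (box a b) x *\<^sub>R Fn n x) = (LBINT z. (LBINT x. of_real (P n x z) * f z))"
     unfolding Fnrep using lborel_pair.Fubini_integral[OF Pint[of n]] by simp
    also have "\<dots> = (LBINT z. of_real (\<Prod>l\<in>UNIV. q1 n l (z $ l)) * f z)"
    proof (rule lint_cong[OF refl])
     fix z :: "real^'d"
     have i1: "integrable lborel (\<lambda>x. indicator {a $ l<..<b $ l} x * (\<Sum>t\<in>levels n. red t x (z $ l)))" for l
     proof (rule lint_bound)
      have "integrable lborel (indicator {a $ l<..<b $ l} :: real => real)" using ab[of l] by auto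
      then show "integrable lborel (\<lambda>x. indicator {a $ l<..<b $ l} x * cr n)" by simp
      have "(\<lambda>x. (x, z $ l)) \<in> measurable borel (borel \<Otimes>\<^sub>M borel)" by measurable
      from measurable_compose[OF this redm[of n]]
      have [measurable]: "(\<lambda>x. \<Sum>t\<in>levels n. red t x (z $ l)) \<in> borel_measurable borel" by simp
      show "(\<lambda>x. indicator {a $ l<..<b $ l} x * (\<Sum>t\<in>levels n. red t x (z $ l))) \<in> borel_measurable lborel" by measurable
      show "AE x in lborel. norm (indicator {a $ l<..<b $ l} x * (\<Sum>t\<in>levels n. red t x (z $ l))) \<le> norm (indicator {a $ l<..<b $ l} x * cr n)"
       using cr cr0 by (intro AE_I2) (auto simp: indicator_def)
     qed
     have "(LBINT x. of_real (P n x z) * f z) = of_real (LBINT x. P n x z) * f z"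
      by (simp only: integral_mult_left_zero integral_complex_of_real)
     also have "(LBINT x. P n x z) = (\<Prod>l\<in>UNIV. q1 n l (z $ l))"
      unfolding P_def q1_def by (rule integral_prod_vec) (rule i1)
     finally show "(LBINT x. of_real (P n x z) * f z) = of_real (\<Prod>l\<in>UNIV. q1 n l (z $ l)) * f z" .
    qed
    finally show ?thesis .
   qed
   define c2 where "c2 = 2 * (LBINT w. \<bar>phi w\<bar>)^2"
   have q1m [measurable]: "q1 n l \<in> borel_measurable borel" for n l
   proof -
    have [measurable]: "(\<lambda>(z, x). \<Sum>t\<in>levels n. red t x z) \<in> borel_measurable (borel \<Otimes>\<^sub>M lborel)"
     unfolding red_eq by measurable
    show ?thesis unfolding q1_def[abs_def] by measurable
   qed
   show "(\<lambda>n. (LBINT x. indicator (box a b) x *\<^sub>R Fn n x)) \<longlonglongrightarrow> (LBINT x. indicator (box a b) x *\<^sub>R f x)"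
    unfolding swap
   proof (rule integral_dominated_convergence[where w = "\<lambda>z. c2 ^ CARD('d) * cmod (f z)"])
    show "AE z in lborel. (\<lambda>n. of_real (\<Prod>l\<in>UNIV. q1 n l (z $ l)) * f z) \<longlonglongrightarrow> indicator (box a b) z *\<^sub>R f z"
     using AE_coordinates_neq[of a b]
    proof eventually_elim
     case (elim z)
     have "(\<lambda>n. \<Prod>l\<in>UNIV. q1 n l (z $ l)) \<longlonglongrightarrow> (\<Prod>l\<in>UNIV. indicator {a $ l<..<b $ l} (z $ l))"
      unfolding q1_def using elim ab by (intro tendsto_prod red_sum_weak_limit(1)) auto
     then have "(\<lambda>n. of_real (\<Prod>l\<in>UNIV. q1 n l (z $ l)) * f z) \<longlonglongrightarrow> of_real (indicator (box a b) z) * f z"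
      unfolding box by (intro tendsto_mult tendsto_of_real tendsto_const)
     then show ?case by (simp only: scaleR_conv_of_real)
    qed
    show "AE z in lborel. norm (of_real (\<Prod>l\<in>UNIV. q1 n l (z $ l)) * f z) \<le> c2 ^ CARD('d) * cmod (f z)" for n
    proof (rule AE_I2)
     fix z :: "real^'d"
     have "\<bar>\<Prod>l\<in>UNIV. q1 n l (z $ l)\<bar> \<le> (\<Prod>l\<in>(UNIV :: 'd set). c2)"
      unfolding abs_prod q1_def c2_def using ab by (intro prod_mono conjI red_sum_weak_limit(2)) auto
     then show "norm (of_real (\<Prod>l\<in>UNIV. q1 n l (z $ l)) * f z) \<le> c2 ^ CARD('d) * cmod (f z)"
      unfolding norm_mult norm_of_real by (intro mult_right_mono) auto
    qed
    show "integrable lborel (\<lambda>z. c2 ^ CARD('d) * cmod (f z))" using fi by simp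
   qed measurable
  qed
  \<comment> \<open>For finite K only finitely many coefficients occur; they converge by dominated
    convergence, so the bound for the partial sums survives in the limit.\<close>
  have fin: "cheb_sum s K F \<le> (S * B) ^ CARD('d) * Y" if K: "finite K" for K
  proof -
   have b: "cheb_sum s K (Fn n) \<le> (S * B) ^ CARD('d) * Y" for n
   proof -
    have "cheb_sum s K (Fn n)
     \<le> (S * B) ^ CARD('d) * (\<Sum>\<tau>\<in>PiE UNIV (\<lambda>_. levels n). (\<Prod>l\<in>UNIV. (\<beta> (\<tau> l))^2) * (LBINT y. (cmod (u \<tau> y))^2))"
     by (rule tensor_chebyshev_bound[where q = q and \<kappa> = kap and C = "\<lambda>t. C * 2 ^ snd t"])
      (use K q0 H1 H2 B0 um u1 u2 kbt kap_measurable in \<open>auto simp: finite_levels Fn_def v_def TT_def\<close>)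
    also have "\<dots> \<le> (S * B) ^ CARD('d) * Y"
     using Y[OF finTT[of n]] S0 B0 unfolding TT_def W_def U_def by (intro mult_left_mono) auto
    finally show ?thesis .
   qed
   have hint: "integrable lborel (\<lambda>x::real^'d. \<Prod>l\<in>UNIV. cheb_fun (k l) (x $ l))" for k
    by (intro integrable_prod_vec integrable_cheb_fun)
   have "(\<lambda>n. (LBINT x. of_real (\<Prod>l\<in>UNIV. cheb_fun (k l) (x $ l)) * Fn n x)) \<longlonglongrightarrow> (LBINT x. of_real (\<Prod>l\<in>UNIV. cheb_fun (k l) (x $ l)) * F x)" for k
   proof (rule integral_dominated_convergence[where w = "\<lambda>x. \<bar>\<Prod>l\<in>UNIV. cheb_fun (k l) (x $ l)\<bar> * V"])
    show "integrable lborel (\<lambda>x::real^'d. \<bar>\<Prod>l\<in>UNIV. cheb_fun (k l) (x $ l)\<bar> * V)"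
     using hint[of k] by (intro integrable_mult_left integrable_abs)
    show "AE x in lborel. (\<lambda>n. of_real (\<Prod>l\<in>UNIV. cheb_fun (k l) (x $ l)) * Fn n x) \<longlonglongrightarrow> of_real (\<Prod>l\<in>UNIV. cheb_fun (k l) (x $ l)) * F x"
     by (intro AE_I2 tendsto_mult tendsto_const lim)
    show "AE x in lborel. norm (of_real (\<Prod>l\<in>UNIV. cheb_fun (k l) (x $ l)) * Fn n x) \<le> \<bar>\<Prod>l\<in>UNIV. cheb_fun (k l) (x $ l)\<bar> * V" for n
     unfolding norm_mult norm_of_real by (intro AE_I2 mult_left_mono Fnb) auto
   qed measurable
   then have "(\<lambda>n. cheb_sum s K (Fn n)) \<longlonglongrightarrow>
    cheb_sum s K F"
    by (intro tendsto_sum tendsto_mult tendsto_const tendsto_power tendsto_norm)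
   then show ?thesis using b by (intro Lim_bounded[where M = 0]) auto
  qed
  show "\<exists>F b. F \<in> borel_measurable borel \<and> (\<forall>x. cmod (F x) \<le> b) \<and> (AE x in lborel. x \<in> cube --> f x = F x) \<and>
   (\<forall>K. finite K --> cheb_sum s K F \<le> (S * B) ^ CARD('d) * Y)"
   using Fm Fb AEeq fin by (intro exI[of _ F] exI[of _ V]) blast
 qed
qed

end

lemma sum_le_infsum_ennreal:
 fixes w :: "'a => ennreal"
 assumes "finite F" "F \<subseteq> A"
 shows "sum w F \<le> (\<Sum>\<^sub>\<infinity>x\<in>A. w x)"
 using assms by (subst nonneg_infsum_complete) (auto intro: SUP_upper)

lemma sum_power2_le_ennreal:
 fixes a :: "'a => ennreal"
 assumes "sum a A \<le> N" "finite A"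
 shows "(\<Sum>x\<in>A. (a x)^2) \<le> N\<^sup>2"
proof -
 have "(\<Sum>x\<in>A. (a x)^2) \<le> (\<Sum>x\<in>A. a x * N)"
  unfolding power2_eq_square using assms order_trans[OF member_le_sum[of _ A a] assms(1)]
  by (intro sum_mono mult_left_mono) auto
 also have "\<dots> \<le> N * N"
  unfolding sum_distrib_right[symmetric] by (intro mult_right_mono assms) auto
 finally show ?thesis by (simp add: power2_eq_square)
qed

lemma L2_representative:
 fixes f :: "real^'d::finite => complex"
 assumes fm: "f \<in> borel_measurable (lebesgue_on cube)" and fin: "L2_norm (lebesgue_on cube) f < \<infinity>"
 obtains g where "g \<in> borel_measurable borel" "\<forall>x. x \<notin> cube --> g x = 0" "AE x in lborel. x \<in> cube --> f x = g x"
  "integrable lborel g" "integrable lborel (\<lambda>x. (cmod (g x))^2)"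
  "ennreal (LBINT x. (cmod (g x))^2) = (L2_norm (lebesgue_on cube) f)^2"
proof -
 obtain g where g: "g \<in> borel_measurable borel" "\<And>x. x \<notin> cube ==> g x = 0" "AE x in lborel. x \<in> cube --> f x = g x"
  using borel_representative[OF fm] by blast
 have n: "(L2_norm (lebesgue_on cube) f)^2 = (\<integral>\<^sup>+x. ennreal ((cmod (g x))^2) \<partial>lborel)"
  unfolding L2_norm_power2 by (rule nn_integral_lebesgue_on_cube[OF g(3,2)])
 then have fin': "(\<integral>\<^sup>+x. ennreal ((cmod (g x))^2) \<partial>lborel) < \<infinity>"
  using fin by (metis power_less_top_ennreal infinity_ennreal_def)
 have m: "g \<in> borel_measurable lborel" using g(1) by simp
 note i = nn_integral_eq_integral_cmod2[OF m fin']
 show ?thesis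
  using g i(1) by (intro that[of g] L2_on_cube_integrable) (simp_all add: n i(2))
qed

text \<open>Reduces the energies required by \<open>fractional_core\<close> to the seminorms: each
  averaged difference is bounded by one term of the series in \<open>R_seminorm\<close>, and each
  term is hit at most once for every choice of sides.\<close>

theorem fractional_case:
 fixes s :: real and M :: nat
 assumes s: "1/2 < s" "s < real M"
 shows "\<exists>C\<ge>0. \<forall>f :: real^'d::finite => complex. f \<in> L2_space (lebesgue_on cube) --> Hmix_norm_fractional s M f < \<infinity> -->
  f \<in> L2_space cheb_measure \<and>
  (\<Sum>\<^sub>\<infinity> k \<in> (UNIV :: (nat^'d) set). ennreal ((cmod (L2_inner cheb_measure f (cheb_eta k)))^2 *
   (\<Prod>l\<in>UNIV. (1 + (real (k $ l))^2) powr s))) \<le> ennreal C * (Hmix_norm_fractional s M f)^2"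
proof -
 have M: "1 \<le> M" using s by linarith
 then have "0 < 1 / (4 * real M)" by simp
 from smooth_bump_exists[OF this] obtain \<nu> where nu: "smooth_real \<nu>" "\<And>x. 0 \<le> \<nu> x" "\<And>x. x \<notin> {0..1 / (4 * real M)} ==> \<nu> x = 0"
  "integrable lborel \<nu>" "(LBINT x. \<nu> x) = 1" by blast
 interpret smoothing M \<nu> using M nu by unfold_locales
 from fractional_core[OF s, where ?'d = 'd] obtain A where A0: "0 \<le> A" and A: "\<forall>(f :: real^'d => complex) Y. integrable lborel f --> f \<in> borel_measurable borel --> (\<forall>x. x \<notin> cube --> f x = 0) -->
  (\<forall>\<tau>. integrable lborel (\<lambda>y. (cmod (avg_diff \<tau> f y))^2)) -->
  (\<forall>T. finite T --> (\<Sum>\<tau>\<in>T. (\<Prod>l\<in>UNIV. (2 powr (s * real (snd (\<tau> l))))^2) * (LBINT y. (cmod (avg_diff \<tau> f y))^2)) \<le> Y) -->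
  (\<exists>F b. F \<in> borel_measurable borel \<and> (\<forall>x. cmod (F x) \<le> b) \<and> (AE x in lborel. x \<in> cube --> f x = F x) \<and>
   (\<forall>K. finite K --> cheb_sum s K F \<le> A * Y))" by (elim exE conjE) (rule that)
 \<comment> \<open>4^d is lost in \<open>avg_diff_norm\<close>; 2 powr (2 s) per coordinate
   compensates the shift from level i to index i - 1.\<close>
 define c where "c = 4 ^ CARD('d) * (2 powr (2 * s)) ^ CARD('d)"
 \<comment> \<open>2^d counts the choices of sides.\<close>
 define c' where "c' = 2 ^ CARD('d) * c"
 have c0: "0 \<le> c" "0 \<le> c'" by (simp_all add: c_def c'_def)
 show ?thesis
 proof (intro exI[of _ "A * c'"] conjI allI impI)
  show "0 \<le> A * c'" using A0 c0 by simp
  fix f :: "real^'d => complex"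
  assume f2: "f \<in> L2_space (lebesgue_on cube)" and Nfin: "Hmix_norm_fractional s M f < \<infinity>"
  define N where "N = Hmix_norm_fractional s M f"
  have fm: "f \<in> borel_measurable (lebesgue_on cube)" and fl: "L2_norm (lebesgue_on cube) f < \<infinity>" using f2 by (auto simp: L2_space_def)
  obtain g where gm: "g \<in> borel_measurable borel" and gout: "\<forall>x. x \<notin> cube --> g x = 0" and fg: "AE x in lborel. x \<in> cube --> f x = g x"
   and gi: "integrable lborel g"
   by (rule L2_representative[OF fm fl]) (rule that, assumption+)
  define D where "D \<tau> = (\<integral>\<^sup>+y. ennreal ((cmod (avg_diff \<tau> g y))^2) \<partial>lborel)" for \<tau> :: "'d => bool \<times> nat"
  define W where "W \<tau> = (\<Prod>l\<in>UNIV. (2 powr (s * real (snd (\<tau> l))))^2)" for \<tau> :: "'d => bool \<times> nat"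
  define j where "j \<tau> = (\<chi> l. snd (\<tau> l) - 1)" for \<tau> :: "'d => bool \<times> nat"
  define w where "w e i = ennreal (2 powr (2 * s * real (\<Sum>l\<in>UNIV. i $ l))) * diff_sup M e i f" for e and i :: "nat^'d"
  define J where "J e = {i :: nat^'d. \<forall>l. l \<notin> e --> i $ l = 0}" for e
  have W0: "0 < W \<tau>" for \<tau> by (auto simp: W_def intro!: prod_pos)
  have trm: "ennreal (W \<tau>) * D \<tau> \<le> ennreal c * w (diff_dirs \<tau>) (j \<tau>)" for \<tau>
  proof -
   have "W \<tau> \<le> (\<Prod>l\<in>(UNIV :: 'd set). 2 powr (2 * s) * 2 powr (2 * s * real (j \<tau> $ l)))"
    unfolding W_def
   proof (intro prod_mono conjI)
    fix l
    have "(2 powr (s * real (snd (\<tau> l))))^2 = 2 powr (2 * s * real (snd (\<tau> l)))"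
     by (simp add: power2_eq_square powr_add[symmetric] mult.assoc)
    also have "\<dots> \<le> 2 powr (2 * s + 2 * s * real (j \<tau> $ l))"
    proof (rule powr_mono)
     have "2 * s * real (snd (\<tau> l)) \<le> 2 * s * (1 + real (j \<tau> $ l))" using s by (intro mult_left_mono) (auto simp: j_def)
     then show "2 * s * real (snd (\<tau> l)) \<le> 2 * s + 2 * s * real (j \<tau> $ l)" by (simp add: algebra_simps)
    qed simp
    finally show "(2 powr (s * real (snd (\<tau> l))))^2 \<le> 2 powr (2 * s) * 2 powr (2 * s * real (j \<tau> $ l))" by (simp add: powr_add)
   qed simp
   also have "\<dots> = (2 powr (2 * s)) ^ CARD('d) * 2 powr (2 * s * real (\<Sum>l\<in>UNIV. j \<tau> $ l))"
    by (simp add: prod.distrib powr_sum sum_distrib_left)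
   finally have Wle: "W \<tau> \<le> (2 powr (2 * s)) ^ CARD('d) * 2 powr (2 * s * real (\<Sum>l\<in>UNIV. j \<tau> $ l))" .
   have Dle: "D \<tau> \<le> ennreal (4 ^ CARD('d)) * diff_sup M (diff_dirs \<tau>) (j \<tau>) f"
    unfolding D_def j_def diff_sup_cong_AE[OF fg] by (rule avg_diff_norm[OF gm])
   have "ennreal (W \<tau>) * D \<tau> \<le> ennreal ((2 powr (2 * s)) ^ CARD('d) * 2 powr (2 * s * real (\<Sum>l\<in>UNIV. j \<tau> $ l))) * (ennreal (4 ^ CARD('d)) * diff_sup M (diff_dirs \<tau>) (j \<tau>) f)"
    by (intro mult_mono ennreal_leI Wle Dle) auto
   also have "\<dots> = ennreal c * w (diff_dirs \<tau>) (j \<tau>)"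
    unfolding c_def w_def by (subst (1 2) ennreal_mult) (auto simp: mult_ac)
   finally show ?thesis .
  qed
  have jJ: "j \<tau> \<in> J (diff_dirs \<tau>)" for \<tau> by (auto simp: J_def j_def diff_dirs_def)
  have sumT: "(\<Sum>\<tau>\<in>T. ennreal (W \<tau>) * D \<tau>) \<le> ennreal c' * N\<^sup>2" if T: "finite T" for T
  proof -
   \<comment> \<open>Truncated subtraction merges the levels 0 and 1; recording the set of
     coordinates with positive level separates them again and makes the map injective.\<close>
   define \<iota> where "\<iota> \<tau> = (fst \<circ> \<tau>, diff_dirs \<tau>, j \<tau>)" for \<tau> :: "'d => bool \<times> nat"
   have inj: "inj \<iota>"
   proof (rule injI, rule ext)
    fix \<sigma> \<tau> l assume e: "\<iota> \<sigma> = \<iota> \<tau>"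
    have a: "fst (\<sigma> l) = fst (\<tau> l)" using e by (auto simp: \<iota>_def fun_eq_iff)
    have b: "snd (\<sigma> l) \<noteq> 0 \<longleftrightarrow> snd (\<tau> l) \<noteq> 0" using e by (auto simp: \<iota>_def diff_dirs_def set_eq_iff)
    have "snd (\<sigma> l) - 1 = snd (\<tau> l) - 1" using e by (auto simp: \<iota>_def j_def vec_eq_iff)
    then show "\<sigma> l = \<tau> l" using a b by (intro prod_eqI) auto
   qed
   have "(\<Sum>\<tau>\<in>T. ennreal (W \<tau>) * D \<tau>) \<le> (\<Sum>\<tau>\<in>T. ennreal c * w (diff_dirs \<tau>) (j \<tau>))"
    by (intro sum_mono trm)
   also have "\<dots> = ennreal c * (\<Sum>p\<in>\<iota> ` T. case p of (\<epsilon>, e, i) => w e i)"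
    by (subst sum.reindex[OF inj_on_subset[OF inj subset_UNIV]]) (simp add: \<iota>_def sum_distrib_left)
   also have "(\<Sum>p\<in>\<iota> ` T. case p of (\<epsilon>, e, i) => w e i) \<le> (\<Sum>p\<in>(UNIV :: ('d => bool) set) \<times> Sigma UNIV (\<lambda>e. j ` T \<inter> J e). case p of (\<epsilon>, e, i) => w e i)"
    using T jJ by (intro sum_mono2) (auto simp: \<iota>_def)
   also have "\<dots> = (\<Sum>\<epsilon>\<in>(UNIV :: ('d => bool) set). \<Sum>e\<in>UNIV. \<Sum>i\<in>j ` T \<inter> J e. w e i)"
    using T by (subst sum.cartesian_product[symmetric], subst sum.Sigma) auto
   also have "\<dots> \<le> (\<Sum>\<epsilon>\<in>(UNIV :: ('d => bool) set). \<Sum>e\<in>UNIV. (R_seminorm s M e f)^2)"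
    unfolding R_seminorm_power2 w_def J_def[symmetric] using T by (intro sum_mono sum_le_infsum_ennreal) auto
   also have "\<dots> \<le> (\<Sum>\<epsilon>\<in>(UNIV :: ('d => bool) set). N\<^sup>2)"
    by (intro sum_mono sum_power2_le_ennreal) (auto simp: N_def Hmix_norm_fractional_def)
   also have "\<dots> = ennreal (2 ^ CARD('d)) * N\<^sup>2"
    by (simp add: card_fun ennreal_of_nat_eq_real_of_nat)
   finally have "(\<Sum>\<tau>\<in>T. ennreal (W \<tau>) * D \<tau>) \<le> ennreal c * (ennreal (2 ^ CARD('d)) * N\<^sup>2)"
    by (simp add: mult_left_mono)
   also have "\<dots> = ennreal c' * N\<^sup>2" using c0 by (simp add: c'_def ennreal_mult mult_ac)
   finally show ?thesis .
  qed
  have N2: "ennreal c' * N\<^sup>2 < \<infinity>"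
   using Nfin by (simp add: N_def ennreal_mult_less_top power_less_top_ennreal)
  define Y where "Y = enn2real (ennreal c' * N\<^sup>2)"
  have Y: "ennreal Y = ennreal c' * N\<^sup>2" using N2 by (simp add: Y_def)
  have Y0: "0 \<le> Y" by (simp add: Y_def)
  have Dfin: "D \<tau> < \<infinity>" for \<tau>
  proof -
   have "ennreal (W \<tau>) * D \<tau> < \<infinity>" using sumT[of "{\<tau>}"] N2 by simp
   then show ?thesis using W0[of \<tau>] by (auto simp: ennreal_mult_less_top)
  qed
  have am: "avg_diff \<tau> g \<in> borel_measurable lborel" for \<tau> using avg_diff_measurable[OF gm] by simp
  note Dint = nn_integral_eq_integral_cmod2[OF am Dfin[unfolded D_def]]
  have sums: "(\<Sum>\<tau>\<in>T. W \<tau> * (LBINT y. (cmod (avg_diff \<tau> g y))^2)) \<le> Y" if T: "finite T" for T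
  proof -
   have "ennreal (\<Sum>\<tau>\<in>T. W \<tau> * (LBINT y. (cmod (avg_diff \<tau> g y))^2)) = (\<Sum>\<tau>\<in>T. ennreal (W \<tau>) * D \<tau>)"
    unfolding D_def Dint(2) using W0 by (subst sum_ennreal[symmetric]) (auto simp: ennreal_mult less_imp_le)
   also have "\<dots> \<le> ennreal Y" unfolding Y by (rule sumT[OF T])
   finally show ?thesis using Y0 by (simp add: ennreal_le_iff)
  qed
  have "\<forall>x. x \<notin> cube --> g x = 0" "\<forall>\<tau>. integrable lborel (\<lambda>y. (cmod (avg_diff \<tau> g y))^2)"
   "\<forall>T. finite T --> (\<Sum>\<tau>\<in>T. (\<Prod>l\<in>UNIV. (2 powr (s * real (snd (\<tau> l))))^2) * (LBINT y. (cmod (avg_diff \<tau> g y))^2)) \<le> Y"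
   using gout Dint(1) sums[unfolded W_def] by simp_all
  from A[THEN spec, THEN spec, THEN mp, OF gi, THEN mp, OF gm, THEN mp, OF this(1), THEN mp, OF this(2), THEN mp, OF this(3)]
  obtain F b where F: "F \<in> borel_measurable borel" "\<forall>x. cmod (F x) \<le> b" "AE x in lborel. x \<in> cube --> g x = F x"
   and fin: "\<forall>K. finite K --> cheb_sum s K F \<le> A * Y" by (elim exE conjE) (rule that)
  have fF: "AE x in lborel. x \<in> cube --> f x = F x" using fg F(3) by eventually_elim simp
  have AY: "ennreal (A * Y) = ennreal (A * c') * (Hmix_norm_fractional s M f)^2"
   using A0 c0 Y0 by (simp add: ennreal_mult Y N_def mult_ac)
  note cc = chebyshev_conclusion[where \<omega> = "\<lambda>k. (1 + (real k)^2) powr s" and E = "A * Y", OF fm F(1) fF F(2)[rule_format] powr_ge_zero]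
  show "f \<in> L2_space cheb_measure" by (rule cc(1)) (use fin in blast)
  show "(\<Sum>\<^sub>\<infinity> k \<in> (UNIV :: (nat^'d) set). ennreal ((cmod (L2_inner cheb_measure f (cheb_eta k)))^2 *
   (\<Prod>l\<in>UNIV. (1 + (real (k $ l))^2) powr s))) \<le> ennreal (A * c') * (Hmix_norm_fractional s M f)^2"
   unfolding AY[symmetric] by (rule cc(2)) (use fin in blast)
 qed
qed

section \<open>A Sobolev representation on the interval\<close>

lemma has_real_derivative_integral_atMost:
 fixes f :: "real => real"
 assumes c: "continuous_on UNIV f" and z: "\<And>x. x \<notin> {-1..1} ==> f x = 0"
 shows "((\<lambda>y. (LBINT t. indicator {..y} t * f t)) has_real_derivative f y) (at y)"
proof -
 define a b where "a = min (-2) (y - 1)" and "b = y + 1"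
 have ab: "a < y" "y < b" by (auto simp: a_def b_def)
 have e: "integral {a..x} f = (LBINT t. indicator {..x} t * f t)" for x
 proof -
  have "indicator {..x} t * f t = indicator {a..x} t *\<^sub>R f t" for t
  proof (cases "a \<le> t")
   case False
   moreover have "a \<le> -2" by (simp add: a_def)
   ultimately show ?thesis using z[of t] by auto
  qed (auto simp: indicator_def)
  then have "(LBINT t. indicator {..x} t * f t) = (LINT t:{a..x}|lborel. f t)"
   by (simp only: set_lebesgue_integral_def)
  also have "\<dots> = integral {a..x} f"
   by (intro set_borel_integral_eq_integral borel_integrable_atLeastAtMost' continuous_on_subset[OF c]) auto
  finally show ?thesis by simp
 qed
 have "((\<lambda>x. integral {a..x} f) has_real_derivative f y) (at y within {a..b})"
  using ab by (intro integral_has_real_derivative continuous_on_subset[OF c]) auto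
 then show ?thesis unfolding e using ab by (simp add: at_within_Icc_at)
qed

text \<open>\<open>wt_chebD_deriv\<close> supplies the primitive, a multiple of the expression of
  order p + 1, and that vanishes outside (-1,1). To the right of 1 the claim is the mean-zero
  property, which needs p < k.\<close>

lemma integral_cheb_atMost:
 assumes pk: "p < k"
 shows "(LBINT t. indicator {..y} t * (wt p t * chebD k p t)) = - (wt (Suc p) y * chebD k (Suc p) y) / ((real k)^2 - (real p)^2)"
proof -
 define f where "f t = wt p t * chebD k p t" for t
 define c where "c = - ((real k)^2 - (real p)^2)"
 define F where "F t = wt (Suc p) t * chebD k (Suc p) t / c" for t
 have c: "c \<noteq> 0" using pk by (simp add: c_def power2_eq_iff_nonneg)
 have F0: "F t = 0" if "\<not> \<bar>t\<bar> < 1" for t using that by (simp add: F_def wt_eq_0)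
 have f0: "f t = 0" if "\<not> \<bar>t\<bar> < 1" for t using that by (simp add: f_def wt_eq_0)
 obtain B where "\<And>x. \<bar>x\<bar> \<le> 1 ==> \<bar>chebD k p x\<bar> \<le> B" using chebD_bounded by blast
 then have fi: "integrable lborel f" unfolding f_def[abs_def] by (intro integrable_wt_times[where B = B]) auto
 have der: "(F has_real_derivative f t) (at t)" if "\<bar>t\<bar> < 1" for t
  using DERIV_cdivide[OF wt_chebD_deriv[OF that, of p k], of c] c by (simp add: F_def[abs_def] f_def c_def)
 consider "y \<le> -1" | "\<bar>y\<bar> < 1" | "1 \<le> y" by linarith
 then have "(LBINT t. indicator {..y} t * f t) = F y"
 proof cases
  case 1
  then have e: "indicator {..y} t * f t = 0" for t using f0[of t] by (auto simp: indicator_def)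
  show ?thesis unfolding e using F0[of y] 1 by simp
 next
  case 3
  then have e: "indicator {..y} t * f t = f t" for t using f0[of t] by (auto simp: indicator_def)
  show ?thesis unfolding e using F0[of y] 3 cheb_integral_eq_0[OF pk] by (simp add: f_def)
 next
  case 2
  \<comment> \<open>The integrand is unbounded near -1 when p = 0, so a version of the fundamental
    theorem with limits at the end points is used.\<close>
  have "(LBINT x=ereal (-1)..ereal y. f x) = F y - 0"
  proof (rule interval_integral_FTC_integrable)
   show "ereal (-1) < ereal y" using 2 by simp
   show "(F has_vector_derivative f x) (at x)" if "ereal (-1) < ereal x" "ereal x < ereal y" for x
    using that 2 der[of x] by (simp add: has_real_derivative_iff_has_vector_derivative)
   show "isCont f x" if x: "ereal (-1) < ereal x" "ereal x < ereal y" for x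
   proof -
    have ax: "\<bar>x\<bar> < 1" using x 2 by simp
    have "continuous (at x) (\<lambda>t. (1 - t\<^sup>2) powr (real p - 1/2) / pi * chebD k p t)"
     using one_minus_sq_pos[OF ax] continuous_chebD[of UNIV k p] by (intro continuous_intros) (auto simp: continuous_on_eq_continuous_at)
    moreover have "\<forall>\<^sub>F t in nhds x. f t = (1 - t\<^sup>2) powr (real p - 1/2) / pi * chebD k p t"
    proof -
     have "\<forall>\<^sub>F t in nhds x. t \<in> {-1<..<1}" using ax by (intro eventually_nhds_in_open) auto
     then show ?thesis by eventually_elim (auto simp: f_def wt_def abs_less_iff)
    qed
    ultimately show ?thesis by (simp add: isCont_cong)
   qed
   show "set_integrable lborel (einterval (ereal (-1)) (ereal y)) f"
    unfolding set_integrable_def using integrable_mult_indicator[OF _ fi] by simp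
   have "continuous_on {-1..1} F" unfolding F_def[abs_def]
    using c by (intro continuous_intros continuous_wt_Suc continuous_chebD) auto
   then have "(F \<longlongrightarrow> F (-1)) (at (-1) within {-1..1})" by (simp add: continuous_on_def)
   then show "((F \<circ> real_of_ereal) \<longlongrightarrow> 0) (at_right (ereal (-1)))"
    using F0[of "-1"] by (simp add: ereal_tendsto_simps at_within_Icc_at_right)
   have "(F \<longlongrightarrow> F y) (at y)" using DERIV_isCont[OF der[OF 2]] by (simp add: isCont_def)
   then show "((F \<circ> real_of_ereal) \<longlongrightarrow> F y) (at_left (ereal y))"
    by (simp add: ereal_tendsto_simps filterlim_at_split)
  qed
  moreover have "(LBINT x=ereal (-1)..ereal y. f x) = (LBINT t. indicator {-1<..<y} t *\<^sub>R f t)"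
   using 2 by (simp add: interval_lebesgue_integral_def set_lebesgue_integral_def)
  moreover have "(LBINT t. indicator {-1<..<y} t *\<^sub>R f t) = (LBINT t. indicator {..y} t * f t)"
  proof (rule integral_cong_AE)
   show "AE t in lborel. indicator {-1<..<y} t *\<^sub>R f t = indicator {..y} t * f t"
    using AE_lborel_singleton[of y] by eventually_elim (use f0 in \<open>auto simp: indicator_def\<close>)
  qed (auto simp: f_def[abs_def])
  ultimately show ?thesis by simp
 qed
 then show ?thesis by (simp only: f_def F_def c_def divide_minus_left divide_minus_right)
qed

lemma higher_deriv_linear:
 assumes "smooth_real f" "smooth_real g"
 shows "(deriv ^^ n) (\<lambda>x. c * f x + g x) = (\<lambda>x. c * (deriv ^^ n) f x + (deriv ^^ n) g x)"
proof (induction n)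
 case (Suc n)
 have "deriv (\<lambda>x. c * (deriv ^^ n) f x + (deriv ^^ n) g x) x = c * deriv ((deriv ^^ n) f) x + deriv ((deriv ^^ n) g) x" for x
  by (intro DERIV_imp_deriv DERIV_add DERIV_cmult smooth_real_deriv smooth_real_higher_deriv assms)
 then show ?case by (simp add: Suc)
qed simp

section \<open>Test functions and the mean-corrected primitive\<close>

text \<open>Smooth functions with compact support in the open interval (-1,1); the radius r < 1
  keeps the support off the end points.\<close>

definition tst :: "(real => real) => bool" where
 "tst \<phi> \<longleftrightarrow> smooth_real \<phi> \<and> (\<exists>r. 0 \<le> r \<and> r < 1 \<and> (\<forall>x. r < \<bar>x\<bar> --> \<phi> x = 0))"

lemma tst_outside: "tst \<phi> ==> x \<notin> {-1..1} ==> \<phi> x = 0"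
 by (force simp: tst_def)

lemma tst_bounded: "tst \<phi> ==> \<exists>B\<ge>0. \<forall>x. \<bar>\<phi> x\<bar> \<le> B"
 using smooth_compact_support_bounded[of \<phi> "-1" 1] tst_outside[of \<phi>] unfolding tst_def by metis

lemma tst_measurable: "tst \<phi> ==> \<phi> \<in> borel_measurable borel"
 by (simp add: tst_def smooth_real_measurable)

lemma tst_integrable: "tst \<phi> ==> integrable lborel \<phi>"
proof -
 assume t: "tst \<phi>"
 then obtain B where B: "\<And>x. \<bar>\<phi> x\<bar> \<le> B" using tst_bounded by blast
 have "integrable lborel (\<lambda>x. indicator {-1..1::real} x * B)" by simp
 then show ?thesis
 proof (rule lint_bound)
  show "AE x in lborel. norm (\<phi> x) \<le> norm (indicator {-1..1::real} x * B)"
   using order_trans[OF B abs_ge_self] tst_outside[OF t] by (intro AE_I2) (auto simp: indicator_def)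
 qed (simp add: tst_measurable[OF t])
qed

lemma tst_cmult: "tst \<phi> ==> tst (\<lambda>x. c * \<phi> x)"
 unfolding tst_def by (auto intro: smooth_real_mult smooth_real_const)

locale averaging =
 fixes \<rho> :: "real => real"
 assumes rho_smooth: "smooth_real \<rho>" and rho_nonneg: "\<And>x. 0 \<le> \<rho> x"
  and rho_supp: "\<And>x. x \<notin> {-1/2..1/2} ==> \<rho> x = 0"
  and rho_int: "integrable lborel \<rho>" and rho_1: "(LBINT x. \<rho> x) = 1"
begin

lemma rho_tst: "tst \<rho>"
 unfolding tst_def using rho_smooth by (intro conjI exI[of _ "1/2"] allI impI rho_supp) auto

lemma rho_measurable [measurable]: "\<rho> \<in> borel_measurable borel"
 by (rule tst_measurable[OF rho_tst])

definition Rho :: "real => real" where "Rho y = (LBINT t. indicator {..y} t * \<rho> t)"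

lemma Rho_deriv: "(Rho has_real_derivative \<rho> y) (at y)"
 unfolding Rho_def[abs_def] using tst_outside[OF rho_tst]
 by (intro has_real_derivative_integral_atMost smooth_real_continuous rho_smooth) auto

lemma Rho_measurable [measurable]: "Rho \<in> borel_measurable borel"
 using Rho_deriv by (intro borel_measurable_continuous_onI continuous_at_imp_continuous_on ballI DERIV_isCont)

lemma Rho_0: "y < -1/2 ==> Rho y = 0" and Rho_1: "1/2 < y ==> Rho y = 1"
proof -
 have e: "indicator {..y} t * \<rho> t = (if y < -1/2 then 0 else \<rho> t)" if "y < -1/2 \<or> 1/2 < y" for t
  using rho_supp[of t] that by (cases "t \<in> {-1/2..1/2}") (auto simp: indicator_def)
 show "Rho y = 0" if "y < -1/2" unfolding Rho_def e[OF disjI1[OF that]] using that by simp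
 show "Rho y = 1" if "1/2 < y" unfolding Rho_def e[OF disjI2[OF that]] using that rho_1 by simp
qed

lemma Rho_range: "0 \<le> Rho y" "Rho y \<le> 1"
proof -
 show "0 \<le> Rho y" unfolding Rho_def by (intro integral_nonneg_AE AE_I2) (simp add: rho_nonneg)
 show "Rho y \<le> 1" unfolding Rho_def rho_1[symmetric]
  by (rule integral_mono_AE'[OF rho_int]) (auto simp: indicator_def rho_nonneg)
qed

text \<open>Kernel of the primitive from the left minus \<open>Rho\<close> times the total integral.
  The plain primitive of a test function is constant to the right of the support; subtracting this
  constant along \<open>Rho\<close> restores compact support.\<close>

definition jk :: "real => real => real" where
 "jk t y = indicator {-1..1} t * ((if t \<le> y then 1 else 0) - Rho y)"

lemma jk_measurable [measurable]: "(\<lambda>p. jk (fst p) (snd p)) \<in> borel_measurable (borel \<Otimes>\<^sub>M borel)"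
 unfolding jk_def by measurable

lemma jk_measurable' [measurable]: "f \<in> borel_measurable N ==> g \<in> borel_measurable N ==> (\<lambda>p. jk (f p) (g p)) \<in> borel_measurable N"
 using measurable_compose[OF _ jk_measurable, of "\<lambda>p. (f p, g p)" N] by simp

lemma jk_le_1: "\<bar>jk t y\<bar> \<le> 1"
 using Rho_range[of y] by (auto simp: jk_def indicator_def)

lemma jk_bound: "\<bar>jk t y\<bar> \<le> indicator {-1..1} t * indicator {-1..1} y"
 using Rho_range[of y] Rho_0[of y] Rho_1[of y] by (auto simp: jk_def indicator_def)

text \<open>Iterated kernels, shifted by one: \<open>io n\<close> belongs to n + 1 applications of
  \<open>Jop\<close>.\<close>

primrec io :: "nat => real => real => real" where
 "io 0 x y = jk x y"
| "io (Suc p) x y = (LBINT t. io p x t * jk t y)"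

lemma io_measurable: "(\<lambda>p. io n (fst p) (snd p)) \<in> borel_measurable (borel \<Otimes>\<^sub>M borel)"
proof (induction n)
 case (Suc n)
 have "(\<lambda>q :: (real \<times> real) \<times> real. (fst (fst q), snd q)) \<in> measurable ((borel \<Otimes>\<^sub>M borel) \<Otimes>\<^sub>M lborel) (borel \<Otimes>\<^sub>M borel)"
  by measurable
 from measurable_compose[OF this Suc]
 have [measurable]: "(\<lambda>q :: (real \<times> real) \<times> real. io n (fst (fst q)) (snd q)) \<in> borel_measurable ((borel \<Otimes>\<^sub>M borel) \<Otimes>\<^sub>M lborel)" by simp
 have "(\<lambda>p. (LBINT t. io n (fst p) t * jk t (snd p))) \<in> borel_measurable (borel \<Otimes>\<^sub>M borel)"
  by (intro lborel.borel_measurable_lebesgue_integral) (simp add: case_prod_unfold)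
 then show ?case by simp
qed simp

lemma io_measurable' [measurable]: "f \<in> borel_measurable N ==> g \<in> borel_measurable N ==> (\<lambda>p. io n (f p) (g p)) \<in> borel_measurable N"
 using measurable_compose[OF _ io_measurable, of "\<lambda>p. (f p, g p)" N] by simp

lemma integral_bound_Icc:
 fixes f :: "real => real"
 assumes "\<And>t. \<bar>f t\<bar> \<le> c * indicator {-1..1} t"
 shows "\<bar>(LBINT t. f t)\<bar> \<le> 2 * c"
proof -
 have "\<bar>(LBINT t. f t)\<bar> \<le> (LBINT t. \<bar>f t\<bar>)" using integral_norm_bound[of lborel f] by simp
 also have "\<dots> \<le> (LBINT t. c * indicator {-1..1::real} t)"
  using assms order_trans[OF abs_ge_zero assms] by (intro integral_mono_AE') auto
 finally show ?thesis by (simp add: content_real)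
qed

lemma io_bound: "\<bar>io n x y\<bar> \<le> 2 ^ n * (indicator {-1..1} x * indicator {-1..1} y)"
proof (induction n arbitrary: y)
 case (Suc n)
 define c :: real where "c = 2 ^ n * (indicator {-1..1} x * indicator {-1..1} y)"
 have "\<bar>io n x t * jk t y\<bar> \<le> c * indicator {-1..1} t" for t
 proof -
  have "\<bar>io n x t * jk t y\<bar> \<le> (2 ^ n * (indicator {-1..1} x * indicator {-1..1} t)) * (indicator {-1..1} t * indicator {-1..1} y)"
   unfolding abs_mult by (intro mult_mono Suc jk_bound) auto
  also have "\<dots> = c * indicator {-1..1} t" by (auto simp: c_def indicator_def)
  finally show ?thesis .
 qed
 from integral_bound_Icc[OF this] show ?case by (simp add: c_def mult_ac)
qed (simp add: jk_bound)

lemma io_bound': "\<bar>io n x y\<bar> \<le> 2 ^ n * indicator {-1..1} y"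
 using io_bound[of n x y] by (cases "x \<in> {-1..1}"; cases "y \<in> {-1..1}") auto

text \<open>The function whose pairing with h is the total integral of the p-th iterate, see
  \<open>integral_Jop_iter\<close>.\<close>

primrec bm :: "nat => real => real" where
 "bm 0 x = 1"
| "bm (Suc p) x = (LBINT y. io p x y)"

lemma bm_measurable [measurable]: "bm p \<in> borel_measurable borel"
proof (cases p)
 case (Suc n)
 have "(\<lambda>x. (LBINT y. io n x y)) \<in> borel_measurable borel"
  by (intro lborel.borel_measurable_lebesgue_integral) (simp add: case_prod_unfold)
 moreover have "bm p = (\<lambda>x. (LBINT y. io n x y))" using Suc by (intro ext) simp
 ultimately show ?thesis by simp
next
 case 0
 then have "bm p = (\<lambda>x. 1)" by (intro ext) simp
 then show ?thesis by simp
qed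

lemma bm_bound: "\<bar>bm p x\<bar> \<le> 2 ^ p"
proof (cases p)
 case (Suc n)
 from integral_bound_Icc[OF io_bound'[of n x]] show ?thesis using Suc by simp
qed simp

definition Jop :: "(real => real) => real => real" where
 "Jop h y = (LBINT t. jk t y * h t)"

lemma io_product_integrable:
 assumes h: "integrable lborel h" and [measurable]: "g \<in> borel_measurable borel" and g: "\<And>t. \<bar>g t\<bar> \<le> (1::real)"
 shows "integrable (lborel \<Otimes>\<^sub>M lborel) (\<lambda>(t, x). g t * (io n x t * h x))"
proof -
 have i: "integrable lborel (\<lambda>t. 2 ^ n * indicator {-1..1::real} t :: real)" by simp
 have hc: "integrable lborel (\<lambda>x. complex_of_real (h x))" using h by simp
 have [measurable]: "h \<in> borel_measurable borel" using h by auto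
 show ?thesis
 proof (rule lint_bound[OF integrable_tensor[OF i hc]])
  have "\<bar>g t * (io n x t * h x)\<bar> \<le> 2 ^ n * indicator {-1..1} t * \<bar>h x\<bar>" for t x
  proof -
   have "\<bar>g t\<bar> * (\<bar>io n x t\<bar> * \<bar>h x\<bar>) \<le> 1 * ((2 ^ n * indicator {-1..1} t) * \<bar>h x\<bar>)"
    by (intro mult_mono g mult_nonneg_nonneg io_bound') auto
   then show ?thesis by (simp add: abs_mult)
  qed
  then show "AE p in lborel \<Otimes>\<^sub>M lborel. norm (case p of (t, x) => g t * (io n x t * h x))
    \<le> norm (complex_of_real (2 ^ n * indicator {-1..1} (fst p)) * complex_of_real (h (snd p)))"
   by (intro AE_I2) (simp add: norm_mult norm_power case_prod_unfold)
 qed (simp add: case_prod_unfold)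
qed

lemma Jop_iter: "integrable lborel h ==> (Jop ^^ Suc n) h y = (LBINT x. io n x y * h x)"
proof (induction n arbitrary: y)
 case (Suc n)
 have "(Jop ^^ Suc (Suc n)) h y = (LBINT t. jk t y * (LBINT x. io n x t * h x))"
  using Suc by (simp add: Jop_def[of "Jop ((Jop ^^ n) h)"])
 also have "\<dots> = (LBINT t. (LBINT x. jk t y * (io n x t * h x)))" by simp
 also have "\<dots> = (LBINT x. (LBINT t. jk t y * (io n x t * h x)))"
  by (rule lborel_pair.Fubini_integral[symmetric]) (rule io_product_integrable, use Suc.prems jk_le_1 in auto)
 also have "\<dots> = (LBINT x. io (Suc n) x y * h x)"
 proof (rule lint_cong[OF refl])
  fix x
  have "(LBINT t. jk t y * (io n x t * h x)) = (LBINT t. (io n x t * jk t y) * h x)" by (simp add: mult_ac)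
  then show "(LBINT t. jk t y * (io n x t * h x)) = io (Suc n) x y * h x" by simp
 qed
 finally show ?case .
qed (simp add: Jop_def)

lemma integral_Jop_iter:
 assumes h: "integrable lborel h"
 shows "(LBINT y. (Jop ^^ p) h y) = (LBINT x. bm p x * h x)"
proof (cases p)
 case (Suc n)
 have "(LBINT y. (Jop ^^ p) h y) = (LBINT y. (LBINT x. 1 * (io n x y * h x)))"
  unfolding Suc Jop_iter[OF h] by simp
 also have "\<dots> = (LBINT x. (LBINT y. 1 * (io n x y * h x)))"
  by (rule lborel_pair.Fubini_integral[symmetric]) (rule io_product_integrable[OF h], auto)
 finally show ?thesis using Suc by simp
qed simp

lemma Jop_eq:
 assumes h: "integrable lborel h" and z: "\<And>x. x \<notin> {-1..1} ==> h x = 0"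
 shows "Jop h y = (LBINT t. indicator {..y} t * h t) - Rho y * (LBINT t. h t)"
proof -
 have [measurable]: "h \<in> borel_measurable borel" using h by auto
 have "jk t y * h t = indicator {..y} t * h t - Rho y * h t" for t
  using z[of t] by (cases "t \<in> {-1..1}") (auto simp: jk_def algebra_simps)
 moreover have "integrable lborel (\<lambda>t. indicator {..y} t * h t)"
  using integrable_mult_indicator[OF _ h, of "{..y}"] by simp
 ultimately show ?thesis using h by (simp add: Jop_def)
qed

lemma Jop_deriv:
 assumes t: "tst \<phi>"
 shows "(Jop \<phi> has_real_derivative (\<phi> y - (LBINT x. \<phi> x) * \<rho> y)) (at y)"
proof -
 have c: "continuous_on UNIV \<phi>" using t by (simp add: tst_def smooth_real_continuous)
 have "((\<lambda>y. (LBINT t. indicator {..y} t * \<phi> t) - Rho y * (LBINT t. \<phi> t)) has_real_derivative (\<phi> y - \<rho> y * (LBINT x. \<phi> x))) (at y)"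
  using tst_outside[OF t] by (intro DERIV_diff has_real_derivative_integral_atMost c DERIV_cmult_right Rho_deriv) auto
 moreover have "Jop \<phi> = (\<lambda>y. (LBINT t. indicator {..y} t * \<phi> t) - Rho y * (LBINT t. \<phi> t))"
  by (intro ext Jop_eq tst_integrable[OF t] tst_outside[OF t])
 ultimately show ?thesis by (simp add: mult.commute)
qed

text \<open>Left of both supports the primitive and \<open>Rho\<close> vanish; right of them the
  primitive is the full integral and \<open>Rho\<close> is 1, so the difference cancels. The
  derivative is again smooth, hence so is \<open>Jop \<phi>\<close>.\<close>

lemma tst_Jop: assumes t: "tst \<phi>" shows "tst (Jop \<phi>)"
 unfolding tst_def
proof
 have s: "smooth_real \<phi>" using t by (simp add: tst_def)
 have "smooth_real (\<lambda>y. \<phi> y + (- (LBINT x. \<phi> x)) * \<rho> y)"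
  by (intro smooth_real_add smooth_real_mult smooth_real_const s rho_smooth)
 then show "smooth_real (Jop \<phi>)" 
  by (rule smooth_realI[rotated]) (use Jop_deriv[OF t] in simp)
 obtain r where r: "0 \<le> r" "r < 1" and z: "\<And>x. r < \<bar>x\<bar> ==> \<phi> x = 0" using t unfolding tst_def by blast
 have J: "Jop \<phi> y = (LBINT t. indicator {..y} t * \<phi> t) - Rho y * (LBINT t. \<phi> t)" for y
  by (intro Jop_eq tst_integrable[OF t] tst_outside[OF t])
 have "Jop \<phi> y = 0" if y: "max r (1/2) < \<bar>y\<bar>" for y
 proof (cases "0 \<le> y")
  case True
  have e: "indicator {..y} x * \<phi> x = \<phi> x" for x using z[of x] y True by (cases "x \<le> y") auto
  then show ?thesis using Rho_1[of y] True y unfolding J e by simp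
 next
  case False
  have e: "indicator {..y} x * \<phi> x = 0" for x using z[of x] y False by (cases "x \<le> y") auto
  then show ?thesis using Rho_0[of y] False y unfolding J e by simp
 qed
 then show "\<exists>r. 0 \<le> r \<and> r < 1 \<and> (\<forall>x. r < \<bar>x\<bar> --> Jop \<phi> x = 0)"
  using r by (intro exI[of _ "max r (1/2)"]) auto
qed

lemma tst_Jop_iter: "tst \<phi> ==> tst ((Jop ^^ n) \<phi>)"
 by (induction n) (auto intro: tst_Jop)

text \<open>Iterates \<open>\<phi> = (\<integral>\<phi>) \<rho> + (Jop \<phi>)'\<close>.\<close>

lemma tst_decomposition:
 assumes t: "tst \<phi>"
 shows "\<phi> = (\<lambda>x. (\<Sum>p<n. (LBINT y. (Jop ^^ p) \<phi> y) * (deriv ^^ p) \<rho> x) + (deriv ^^ n) ((Jop ^^ n) \<phi>) x)"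
proof (induction n)
 case (Suc n)
 define \<psi> where "\<psi> = (Jop ^^ n) \<phi>"
 have psi: "tst \<psi>" unfolding \<psi>_def by (rule tst_Jop_iter[OF t])
 have sJ: "smooth_real (Jop \<psi>)" using tst_Jop[OF psi] by (simp add: tst_def)
 have "\<psi> x = (LBINT y. \<psi> y) * \<rho> x + deriv (Jop \<psi>) x" for x
  using DERIV_imp_deriv[OF Jop_deriv[OF psi, of x]] by simp
 then have e: "\<psi> = (\<lambda>x. (LBINT y. \<psi> y) * \<rho> x + deriv (Jop \<psi>) x)" by (rule ext)
 have "(deriv ^^ n) \<psi> = (deriv ^^ n) (\<lambda>x. (LBINT y. \<psi> y) * \<rho> x + deriv (Jop \<psi>) x)" by (rule arg_cong[OF e])
 also have "\<dots> = (\<lambda>x. (LBINT y. \<psi> y) * (deriv ^^ n) \<rho> x + (deriv ^^ Suc n) (Jop \<psi>) x)"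
  unfolding higher_deriv_linear[OF rho_smooth smooth_real_deriv(2)[OF sJ]] by (simp add: funpow_swap1)
 finally have "(deriv ^^ n) \<psi> x = (LBINT y. \<psi> y) * (deriv ^^ n) \<rho> x + (deriv ^^ Suc n) (Jop \<psi>) x" for x by (rule fun_cong)
 then have "\<phi> x = (\<Sum>p<Suc n. (LBINT y. (Jop ^^ p) \<phi> y) * (deriv ^^ p) \<rho> x) + (deriv ^^ Suc n) ((Jop ^^ Suc n) \<phi>) x" for x
  using fun_cong[OF Suc, of x] by (simp add: \<psi>_def)
 then show ?case by blast
qed simp

section \<open>Kernels of the Sobolev representation\<close>

text \<open>The kernels in f(x) = sum over p <= n + 1 of the integral of \<open>ker n p x y\<close>
  against the p-th derivative of f at y. They transpose the decomposition of test functions, the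
  sign coming from the definition of weak derivatives. Orders p <= n give kernels of rank one; the
  top order has the iterated kernel.\<close>

definition ker :: "nat => nat => real => real => real" where
 "ker n p x y = (-1) ^ p * (if p \<le> n then bm p x * \<rho> y else io n x y)"

text \<open>The transposes acting on test functions: \<open>\<phi>\<close> is the sum of the p-th
  derivatives of \<open>Top n p \<phi>\<close>, which are test functions again.\<close>

definition Top :: "nat => nat => (real => real) => real => real" where
 "Top n p \<phi> = (if p \<le> n then (\<lambda>y. (LBINT x. (Jop ^^ p) \<phi> x) * \<rho> y) else (Jop ^^ Suc n) \<phi>)"

lemma ker_measurable: "(\<lambda>q. ker n p (fst q) (snd q)) \<in> borel_measurable (borel \<Otimes>\<^sub>M borel)"
 unfolding ker_def by measurable

lemma ker_bound: "\<exists>C\<ge>0. \<forall>p x y. \<bar>ker n p x y\<bar> \<le> C * indicator {-1..1} y"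
proof -
 obtain B where B: "0 \<le> B" "\<And>x. \<bar>\<rho> x\<bar> \<le> B" using tst_bounded[OF rho_tst] by blast
 have "\<bar>ker n p x y\<bar> \<le> 2 ^ n * (B + 1) * indicator {-1..1} y" for p x y
 proof (cases "p \<le> n")
  case True
  have "\<bar>\<rho> y\<bar> \<le> B * indicator {-1..1} y" using B tst_outside[OF rho_tst, of y] by (auto simp: indicator_def)
  then have "\<bar>bm p x\<bar> * \<bar>\<rho> y\<bar> \<le> 2 ^ p * (B * indicator {-1..1} y)" by (intro mult_mono bm_bound) auto
  also have "\<dots> \<le> 2 ^ n * ((B + 1) * indicator {-1..1} y)"
   using True B by (intro mult_mono power_increasing) (auto simp: indicator_def)
  finally show ?thesis using True by (simp add: ker_def abs_mult mult.assoc)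
 next
  case False
  note io_bound'[of n x y]
  also have "2 ^ n * indicator {-1..1} y \<le> 2 ^ n * ((B + 1) * indicator {-1..1} y)" using B by (intro mult_left_mono) (auto simp: indicator_def)
  finally show ?thesis using False by (simp add: ker_def abs_mult mult.assoc)
 qed
 then show ?thesis using B by (intro exI[of _ "2 ^ n * (B + 1)"]) auto
qed

lemma integral_ker:
 assumes "integrable lborel h"
 shows "(LBINT x. ker n p x y * h x) = (-1) ^ p * Top n p h y"
proof (cases "p \<le> n")
 case True
 have "(LBINT x. ker n p x y * h x) = (LBINT x. ((-1) ^ p * \<rho> y) * (bm p x * h x))"
  using True by (intro lint_cong) (auto simp: ker_def mult_ac)
 also have "\<dots> = (-1) ^ p * \<rho> y * (LBINT x. bm p x * h x)" by (rule integral_mult_right_zero)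
 finally show ?thesis using True by (simp add: Top_def integral_Jop_iter[OF assms] mult_ac)
next
 case False
 have "(LBINT x. ker n p x y * h x) = (LBINT x. (-1) ^ p * (io n x y * h x))"
  using False by (intro lint_cong) (auto simp: ker_def mult_ac)
 also have "\<dots> = (-1) ^ p * (LBINT x. io n x y * h x)" by (rule integral_mult_right_zero)
 finally show ?thesis using False by (simp only: Top_def Jop_iter[OF assms] if_False)
qed

lemma tst_Top: "tst \<phi> ==> tst (Top n p \<phi>)"
 by (auto simp: Top_def intro: tst_cmult rho_tst tst_Jop_iter simp del: funpow.simps)

lemma Top_decomposition:
 assumes t: "tst \<phi>"
 shows "\<phi> x = (\<Sum>p\<le>Suc n. (deriv ^^ p) (Top n p \<phi>) x)"
proof -
 have "(deriv ^^ p) (Top n p \<phi>) x = (LBINT y. (Jop ^^ p) \<phi> y) * (deriv ^^ p) \<rho> x" if "p \<le> n" for p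
 proof -
  have z: "(deriv ^^ p) (\<lambda>x. 0::real) = (\<lambda>x. 0)" by (induction p) auto
  show ?thesis using that higher_deriv_linear[OF rho_smooth smooth_real_const[of 0], of p "(LBINT y. (Jop ^^ p) \<phi> y)"]
   by (simp add: Top_def z)
 qed
 then have "(\<Sum>p<Suc n. (deriv ^^ p) (Top n p \<phi>) x) = (\<Sum>p<Suc n. (LBINT y. (Jop ^^ p) \<phi> y) * (deriv ^^ p) \<rho> x)"
  by (intro sum.cong) auto
 moreover have "Top n (Suc n) \<phi> = (Jop ^^ Suc n) \<phi>" by (simp add: Top_def del: funpow.simps)
 ultimately have eq: "(\<Sum>p\<le>Suc n. (deriv ^^ p) (Top n p \<phi>) x) = (\<Sum>p<Suc n. (LBINT y. (Jop ^^ p) \<phi> y) * (deriv ^^ p) \<rho> x) + (deriv ^^ Suc n) ((Jop ^^ Suc n) \<phi>) x"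
  by (simp only: lessThan_Suc_atMost[symmetric] sum.lessThan_Suc)
 show ?thesis by (rule trans[OF fun_cong[OF tst_decomposition[OF t, of "Suc n"], of x] sym[OF eq]])
qed

lemma Jop_cmult: "Jop (\<lambda>x. c * h x) = (\<lambda>y. c * Jop h y)"
 unfolding Jop_def by (simp only: mult.left_commute[of _ c] integral_mult_right_zero)

text \<open>\<open>cheb_fun k\<close> is not a test function, yet the kernel applies to it. While p
  < k the mean vanishes, so \<open>Jop\<close> is the plain primitive, and that is given by
  \<open>integral_cheb_atMost\<close>.\<close>

lemma Jop_iter_cheb: "p \<le> k ==> (Jop ^^ p) (cheb_fun k) = (\<lambda>y. (-1) ^ p / lamk k p * (wt p y * chebD k p y))"
proof (induction p)
 case (Suc p)
 then have pk: "p < k" by simp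
 obtain B where "\<And>x. \<bar>x\<bar> \<le> 1 ==> \<bar>chebD k p x\<bar> \<le> B" using chebD_bounded by blast
 then have i: "integrable lborel (\<lambda>x. wt p x * chebD k p x)" by (intro integrable_wt_times[where B = B]) auto
 have z: "wt p x * chebD k p x = 0" if "x \<notin> {-1..1}" for x using that by (auto simp: wt_eq_0)
 have J: "Jop (\<lambda>x. wt p x * chebD k p x) y = (LBINT t. indicator {..y} t * (wt p t * chebD k p t)) - Rho y * (LBINT t. wt p t * chebD k p t)" for y
  by (intro Jop_eq i z)
 have J': "Jop (\<lambda>x. wt p x * chebD k p x) y = - (wt (Suc p) y * chebD k (Suc p) y) / ((real k)^2 - (real p)^2)" for y
  by (simp only: J cheb_integral_eq_0[OF pk] integral_cheb_atMost[OF pk] mult_zero_right diff_zero)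
 have "(Jop ^^ Suc p) (cheb_fun k) = Jop (\<lambda>y. (-1) ^ p / lamk k p * (wt p y * chebD k p y))" using Suc by simp
 also have "\<dots> = (\<lambda>y. (-1) ^ Suc p / lamk k (Suc p) * (wt (Suc p) y * chebD k (Suc p) y))"
  unfolding Jop_cmult J' by (rule ext) (simp add: lamk_Suc mult_ac)
 finally show ?case .
qed (simp add: cheb_fun_def[abs_def])

lemma integral_Jop_iter_cheb: "p < k ==> (LBINT y. (Jop ^^ p) (cheb_fun k) y) = 0"
 by (simp add: Jop_iter_cheb cheb_integral_eq_0)

text \<open>1 + k^2 <= 2 k^2 together with \<open>lamk_lower\<close>.\<close>

lemma weight_le_lamk:
 assumes k: "Suc n \<le> k"
 shows "(1 + (real k)^2) powr real (Suc n) \<le> (2 * real (Suc n)) ^ Suc n * lamk k (Suc n)"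
proof -
 have k1: "1 \<le> real k" using k by simp
 have "(1 + (real k)^2) powr real (Suc n) = (1 + (real k)^2) ^ Suc n" by (rule powr_realpow) (simp add: add_pos_nonneg)
 also have "\<dots> \<le> (2 * (real k)^2) ^ Suc n" using one_le_power[OF k1, of 2] by (intro power_mono) auto
 also have "\<dots> = (2 * real (Suc n)) ^ Suc n * ((real k)^2 / real (Suc n)) ^ Suc n"
  unfolding power_mult_distrib[symmetric] by (rule arg_cong[where f = "\<lambda>x. x ^ Suc n"]) (simp del: of_nat_Suc)
 also have "\<dots> \<le> (2 * real (Suc n)) ^ Suc n * lamk k (Suc n)"
  by (intro mult_left_mono lamk_lower k) auto
 finally show ?thesis .
qed

text \<open>For k > n the rank-one kernels p <= n pair to zero with T_k, because the iterated
  primitives still have mean zero. The top kernel gives a multiple of the orthonormal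
  \<open>chebE\<close> times the square root of a weight bounded by 1, and the factor just
  compensates the weight (1 + k^2)^(n + 1). Orthogonality thus suffices with no dyadic
  summation.\<close>

lemma ker_bessel:
 "\<exists>B\<ge>0. \<forall>K p. finite K --> p \<le> Suc n --> bessel_family K (\<lambda>k y. sqrt ((1 + (real k)^2) powr real (Suc n)) * (LBINT x. ker n p x y * cheb_fun k x)) B"
proof -
 let ?m = "Suc n"
 obtain C where C0: "0 \<le> C" and C: "\<And>p x y. \<bar>ker n p x y\<bar> \<le> C * indicator {-1..1} y" using ker_bound by blast
 define a where "a k = (LBINT x. \<bar>cheb_fun k x\<bar>)" for k
 define \<omega> where "\<omega> k = (1 + (real k)^2) powr real ?m" for k
 define Dk where "Dk k = sqrt (\<omega> k) * (C * a k)" for k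
 define c where "c = (2 * real ?m) ^ ?m"
 \<comment> \<open>c is for k >= n + 1; each of the finitely many smaller k is bounded on its own by
   Cauchy-Schwarz.\<close>
 define B where "B = c + (\<Sum>k<?m. 2 * (Dk k)^2)"
 have c0: "0 \<le> c" by (simp add: c_def)
 have B0: "0 \<le> B" by (auto simp: B_def c0 intro!: add_nonneg_nonneg sum_nonneg)
 show ?thesis
 proof (intro exI[of _ B] conjI allI impI B0)
  fix K :: "nat set" and p assume K: "finite K" and p: "p \<le> ?m"
  define G where "G k y = (LBINT x. ker n p x y * cheb_fun k x)" for k y
  define g where "g k y = sqrt (\<omega> k) * G k y" for k y
  have [measurable]: "g k \<in> borel_measurable borel" for k
  proof -
   have [measurable]: "(\<lambda>q. ker n p (snd q) (fst q)) \<in> borel_measurable (borel \<Otimes>\<^sub>M lborel)"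
    using measurable_compose[OF _ ker_measurable, of "\<lambda>q. (snd q, fst q)" "borel \<Otimes>\<^sub>M lborel"] by simp
   have "(\<lambda>y. (LBINT x. ker n p x y * cheb_fun k x)) \<in> borel_measurable borel"
    by (intro lborel.borel_measurable_lebesgue_integral) (simp add: case_prod_unfold)
   then show ?thesis unfolding g_def[abs_def] G_def by simp
  qed
  have gb: "\<bar>g k y\<bar> \<le> Dk k * indicator {-1..1} y" for k y
  proof -
   have "\<bar>G k y\<bar> \<le> (LBINT x. \<bar>ker n p x y * cheb_fun k x\<bar>)"
    unfolding G_def using integral_norm_bound[of lborel "\<lambda>x. ker n p x y * cheb_fun k x"] by simp
   also have "\<dots> \<le> (LBINT x. C * indicator {-1..1} y * \<bar>cheb_fun k x\<bar>)"
    using integrable_cheb_fun[of k] C C0 by (intro integral_mono_AE') (auto simp: abs_mult intro!: mult_right_mono)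
   finally have "\<bar>G k y\<bar> \<le> C * indicator {-1..1} y * a k" by (simp add: a_def)
   then have "sqrt (\<omega> k) * \<bar>G k y\<bar> \<le> sqrt (\<omega> k) * (C * indicator {-1..1} y * a k)" by (intro mult_left_mono) (auto simp: \<omega>_def)
   then show ?thesis by (simp add: g_def abs_mult Dk_def \<omega>_def mult_ac)
  qed
  have gb2: "(g k y)^2 \<le> (Dk k)^2 * indicator {-1..1} y" for k y
   using power_mono[OF gb[of k y], of 2] by (auto simp: indicator_def)
  have bi: "integrable lborel (\<lambda>y. (Dk k)^2 * indicator {-1..1::real} y)" for k by simp
  have g2: "integrable lborel (\<lambda>y. (g k y)^2)" for k
   by (rule lint_bound[OF bi[of k]]) (use gb2 order_trans[OF gb2 abs_ge_self] in auto)
  have gn: "(LBINT y. (g k y)^2) \<le> 2 * (Dk k)^2" for k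
   using integral_mono[OF g2[of k] bi[of k] gb2] by (simp add: content_real)
  \<comment> \<open>Covers all orders p uniformly: the factor is 0 for p <= n and sqrt (weight /
    \<open>lamk\<close>) at the top order.\<close>
  have gE: "\<exists>\<sigma>. \<sigma>\<^sup>2 \<le> c \<and> (\<forall>y. g k y = \<sigma> * (chebE k ?m y * sqrt (wt ?m y)))" if k: "?m \<le> k" for k
  proof (cases "p \<le> n")
   case True
   then have "G k y = 0" for y
    using k unfolding G_def integral_ker[OF integrable_cheb_fun] by (simp add: Top_def integral_Jop_iter_cheb)
   then show ?thesis using c0 by (intro exI[of _ 0]) (simp add: g_def)
  next
   case False
   then have pm: "p = ?m" using p by simp
   define \<sigma> where "\<sigma> = sqrt (\<omega> k) / sqrt (lamk k ?m)"
   have l0: "0 < lamk k ?m" by (rule lamk_pos[OF k])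
   have "G k y = (-1) ^ ?m * ((-1) ^ ?m / lamk k ?m * (wt ?m y * chebD k ?m y))" for y
    unfolding G_def integral_ker[OF integrable_cheb_fun] pm Top_def using fun_cong[OF Jop_iter_cheb[OF k], of y] by (simp del: funpow.simps)
   then have "G k y = wt ?m y * chebD k ?m y / lamk k ?m" for y
    by (simp add: power_mult_distrib[symmetric] mult.assoc[symmetric] del: power_Suc)
   then have "g k y = \<sigma> * (chebE k ?m y * sqrt (wt ?m y))" for y
    using l0 wt_nonneg[of ?m y] by (simp add: g_def \<sigma>_def chebE_def field_simps)
   moreover have "\<sigma>\<^sup>2 \<le> c"
    using weight_le_lamk[OF k] l0 by (simp add: \<sigma>_def power_divide \<omega>_def c_def divide_le_eq)
   ultimately show ?thesis by blast
  qed
  have "bessel_family K g B"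
   unfolding bessel_family_def
  proof (intro conjI ballI allI impI K B0 g2)
   fix u :: "real => complex" assume um [measurable]: "u \<in> borel_measurable borel" and u2: "integrable lborel (\<lambda>x. (cmod (u x))^2)"
   define U where "U = (LBINT x. (cmod (u x))^2)"
   have U0: "0 \<le> U" by (simp add: U_def)
   define v where "v x = of_real (sqrt (wt ?m x)) * u x" for x
   have [measurable]: "v \<in> borel_measurable borel" unfolding v_def[abs_def] by measurable
   have vb: "(cmod (v x))^2 \<le> (cmod (u x))^2" for x
    using mult_right_mono[OF wt_Suc_le[of n x], of "(cmod (u x))^2"] wt_nonneg[of ?m x] by (simp add: v_def norm_mult power_mult_distrib)
   have v2: "integrable lborel (\<lambda>x. (cmod (v x))^2)"
    by (rule lint_bound[OF u2]) (use vb in auto)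
   have vU: "(LBINT x. (cmod (v x))^2) \<le> U" unfolding U_def by (rule integral_mono[OF v2 u2 vb])
   have hi: "(cmod (LBINT x. of_real (g k x) * u x))^2 \<le> c * (cmod (LBINT x. of_real (chebE k ?m x) * v x))^2" if k: "?m \<le> k" for k
   proof -
    obtain \<sigma> where s: "\<sigma>\<^sup>2 \<le> c" and e: "\<And>y. g k y = \<sigma> * (chebE k ?m y * sqrt (wt ?m y))" using gE[OF k] by blast
    have "(LBINT x. of_real (g k x) * u x) = (LBINT x. of_real \<sigma> * (of_real (chebE k ?m x) * v x))"
     by (intro lint_cong) (auto simp: e v_def)
    then have "(cmod (LBINT x. of_real (g k x) * u x))^2 = \<sigma>\<^sup>2 * (cmod (LBINT x. of_real (chebE k ?m x) * v x))^2"
     by (simp add: norm_mult power_mult_distrib)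
    then show ?thesis using s by (simp add: mult_right_mono)
   qed
   have lo: "(cmod (LBINT x. of_real (g k x) * u x))^2 \<le> 2 * (Dk k)^2 * U" for k
   proof -
    have "(cmod (LBINT x. of_real (g k x) * u x))^2 \<le> (LBINT x. (g k x)^2) * U"
     unfolding U_def by (rule integral_cauchy_schwarz) (use g2 u2 in auto)
    also have "\<dots> \<le> 2 * (Dk k)^2 * U" by (rule mult_right_mono[OF gn U0])
    finally show ?thesis .
   qed
   have "(\<Sum>k\<in>K. (cmod (LBINT x. of_real (g k x) * u x))^2)
     = (\<Sum>k\<in>K \<inter> {..<?m}. (cmod (LBINT x. of_real (g k x) * u x))^2) + (\<Sum>k\<in>K - {..<?m}. (cmod (LBINT x. of_real (g k x) * u x))^2)"
    by (rule sum.Int_Diff[OF K])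
   also have "\<dots> \<le> (\<Sum>k<?m. 2 * (Dk k)^2) * U + c * U"
   proof (rule add_mono)
    have "(\<Sum>k\<in>K \<inter> {..<?m}. (cmod (LBINT x. of_real (g k x) * u x))^2) \<le> (\<Sum>k\<in>K \<inter> {..<?m}. 2 * (Dk k)^2 * U)"
     by (intro sum_mono lo)
    also have "\<dots> \<le> (\<Sum>k<?m. 2 * (Dk k)^2 * U)" using U0 by (intro sum_mono2) auto
    finally show "(\<Sum>k\<in>K \<inter> {..<?m}. (cmod (LBINT x. of_real (g k x) * u x))^2) \<le> (\<Sum>k<?m. 2 * (Dk k)^2) * U"
     by (simp only: sum_distrib_right)
    have "(\<Sum>k\<in>K - {..<?m}. (cmod (LBINT x. of_real (g k x) * u x))^2) \<le> (\<Sum>k\<in>K - {..<?m}. c * (cmod (LBINT x. of_real (chebE k ?m x) * v x))^2)"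
     by (intro sum_mono hi) auto
    also have "\<dots> \<le> c * (LBINT x. (cmod (v x))^2)"
     unfolding sum_distrib_left[symmetric] using K v2 by (intro mult_left_mono cheb_bessel c0) auto
    also have "\<dots> \<le> c * U" by (intro mult_left_mono vU c0)
    finally show "(\<Sum>k\<in>K - {..<?m}. (cmod (LBINT x. of_real (g k x) * u x))^2) \<le> c * U" .
   qed
   also have "\<dots> = B * U" by (simp only: B_def algebra_simps)
   finally show "(\<Sum>k\<in>K. (cmod (LBINT x. of_real (g k x) * u x))^2) \<le> B * (LBINT x. (cmod (u x))^2)" unfolding U_def .
  qed simp
  then show "bessel_family K (\<lambda>k y. sqrt ((1 + (real k)^2) powr real ?m) * (LBINT x. ker n p x y * cheb_fun k x)) B"
   unfolding g_def[abs_def] G_def \<omega>_def .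
 qed
qed

end

section \<open>Weak derivatives\<close>

lemma partial_deriv_prod:
 assumes sm: "\<And>i. smooth_real (\<zeta> i)"
 shows "partial_deriv l (\<lambda>x :: real^'d::finite. \<Prod>i\<in>UNIV. \<zeta> i (x $ i)) = (\<lambda>x. \<Prod>i\<in>UNIV. (\<zeta>(l := deriv (\<zeta> l))) i (x $ i))"
proof
 fix x :: "real^'d"
 define c where "c = (\<Prod>i\<in>UNIV - {l}. \<zeta> i (x $ i))"
 have "(\<Prod>i\<in>UNIV. \<zeta> i ((x + t *\<^sub>R axis l 1) $ i)) = \<zeta> l (t + x $ l) * c" for t
  unfolding c_def by (subst prod.remove[of UNIV l]) (auto simp: axis_def add.commute intro!: prod.cong)
 moreover have "((\<lambda>t. \<zeta> l (t + x $ l)) has_real_derivative deriv (\<zeta> l) (x $ l)) (at 0)"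
  using smooth_real_deriv(1)[OF sm[of l], of "x $ l"] DERIV_shift[of "\<zeta> l" "deriv (\<zeta> l) (x $ l)" 0 "x $ l"] by simp
 ultimately have "partial_deriv l (\<lambda>x. \<Prod>i\<in>UNIV. \<zeta> i (x $ i)) x = deriv (\<zeta> l) (x $ l) * c"
  unfolding partial_deriv_def by (simp only:) (intro DERIV_imp_deriv DERIV_cmult_right)
 also have "\<dots> = (\<Prod>i\<in>UNIV. (\<zeta>(l := deriv (\<zeta> l))) i (x $ i))"
  unfolding c_def by (subst prod.remove[of UNIV l]) (auto intro!: prod.cong)
 finally show "partial_deriv l (\<lambda>x. \<Prod>i\<in>UNIV. \<zeta> i (x $ i)) x = (\<Prod>i\<in>UNIV. (\<zeta>(l := deriv (\<zeta> l))) i (x $ i))" .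
qed

lemma foldr_partial_deriv_prod:
 assumes sm: "\<And>i. smooth_real (\<zeta> i)"
 shows "foldr partial_deriv ls (\<lambda>x :: real^'d::finite. \<Prod>i\<in>UNIV. \<zeta> i (x $ i)) = (\<lambda>x. \<Prod>i\<in>UNIV. (deriv ^^ count_list ls i) (\<zeta> i) (x $ i))"
proof (induction ls)
 case (Cons l ls)
 have "foldr partial_deriv (l # ls) (\<lambda>x :: real^'d. \<Prod>i\<in>UNIV. \<zeta> i (x $ i)) = partial_deriv l (\<lambda>x. \<Prod>i\<in>UNIV. (deriv ^^ count_list ls i) (\<zeta> i) (x $ i))"
  by (simp add: Cons)
 also have "\<dots> = (\<lambda>x. \<Prod>i\<in>UNIV. ((\<lambda>i. (deriv ^^ count_list ls i) (\<zeta> i))(l := deriv ((deriv ^^ count_list ls l) (\<zeta> l)))) i (x $ i))"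
  by (rule partial_deriv_prod) (intro smooth_real_higher_deriv sm)
 also have "\<dots> = (\<lambda>x. \<Prod>i\<in>UNIV. (deriv ^^ count_list (l # ls) i) (\<zeta> i) (x $ i))"
  by (intro ext prod.cong) auto
 finally show ?case .
qed simp

text \<open>Iterated partial derivatives of a product differentiate the factors separately, so
  smoothness is inherited; the support lies in a closed box with half-widths r_i < 1.\<close>

lemma prod_tst_test_function:
 fixes \<zeta> :: "'d::finite => real => real"
 assumes t: "\<And>i. tst (\<zeta> i)"
 shows "(\<lambda>x :: real^'d. \<Prod>i\<in>UNIV. \<zeta> i (x $ i)) \<in> test_functions"
proof -
 have sm: "smooth_real (\<zeta> i)" for i using t[of i] by (simp add: tst_def)
 have "smooth (\<lambda>x :: real^'d. \<Prod>i\<in>UNIV. \<zeta> i (x $ i))"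
  unfolding smooth_def foldr_partial_deriv_prod[OF sm]
 proof (intro allI)
  fix ls :: "'d list"
  define g where "g i = (deriv ^^ count_list ls i) (\<zeta> i)" for i
  have gs: "smooth_real (g i)" for i unfolding g_def by (intro smooth_real_higher_deriv sm)
  have d: "((\<lambda>x :: real^'d. g i (x $ i)) has_derivative (\<lambda>h. deriv (g i) (x $ i) * (h $ i))) (at x)" for i x
   using has_derivative_compose[OF bounded_linear_imp_has_derivative[OF bounded_linear_vec_nth[of i], of "at x"], of "g i" "(*) (deriv (g i) (x $ i))"]
    smooth_real_deriv(1)[OF gs[of i], of "x $ i"] by (simp add: has_field_derivative_def)
  have "(\<lambda>x :: real^'d. \<Prod>i\<in>UNIV. g i (x $ i)) differentiable (at x)" for x
   unfolding differentiable_def by (rule exI, rule has_derivative_prod, rule d)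
  then show "(\<lambda>x :: real^'d. \<Prod>i\<in>UNIV. (deriv ^^ count_list ls i) (\<zeta> i) (x $ i)) differentiable_on UNIV"
   by (simp add: differentiable_on_def g_def)
 qed
 moreover have "closure {x :: real^'d. (\<Prod>i\<in>UNIV. \<zeta> i (x $ i)) \<noteq> 0} \<subseteq> interior cube"
 proof -
  have "\<forall>i. \<exists>r. 0 \<le> r \<and> r < 1 \<and> (\<forall>x. r < \<bar>x\<bar> --> \<zeta> i x = 0)" using t by (simp add: tst_def)
  then obtain r where r: "\<forall>i. 0 \<le> r i \<and> r i < 1 \<and> (\<forall>x. r i < \<bar>x\<bar> --> \<zeta> i x = 0)" by (rule choice[THEN exE])
  have "{x :: real^'d. (\<Prod>i\<in>UNIV. \<zeta> i (x $ i)) \<noteq> 0} \<subseteq> cbox (\<chi> i. - r i) (\<chi> i. r i)"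
  proof
   fix x :: "real^'d" assume "x \<in> {x. (\<Prod>i\<in>UNIV. \<zeta> i (x $ i)) \<noteq> 0}"
   then have "\<zeta> i (x $ i) \<noteq> 0" for i by simp
   then have "\<bar>x $ i\<bar> \<le> r i" for i using r by (meson not_le)
   then show "x \<in> cbox (\<chi> i. - r i) (\<chi> i. r i)" by (simp add: mem_box_cart abs_le_iff minus_le_iff)
  qed
  then have "closure {x :: real^'d. (\<Prod>i\<in>UNIV. \<zeta> i (x $ i)) \<noteq> 0} \<subseteq> cbox (\<chi> i. - r i) (\<chi> i. r i)"
   by (intro closure_minimal) auto
  also have "\<dots> \<subseteq> box (\<chi> i. -1) (\<chi> i. 1)"
   using r by (auto simp: mem_box_cart intro: less_le_trans[rotated] le_less_trans) (smt (verit))+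
  also have "\<dots> = interior cube" unfolding cube_eq_cbox by simp
  finally show ?thesis .
 qed
 ultimately show ?thesis by (simp add: test_functions_def)
qed

lemma integral_lebesgue_on_cube:
 fixes k v :: "real^'d::finite => complex"
 assumes k: "k \<in> borel_measurable (lebesgue_on cube)" and v: "v \<in> borel_measurable borel"
  and eq: "AE x in lborel. x \<in> cube --> k x = v x" and out: "\<And>x. x \<notin> cube ==> v x = 0"
 shows "(LINT x|lebesgue_on cube. k x) = (LBINT x. v x)"
proof -
 have cs: "(cube :: (real^'d) set) \<in> sets lebesgue" using cube_borel by simp
 have v': "v \<in> borel_measurable lborel" using v by simp
 have "(LINT x|lebesgue_on cube. k x) = (\<integral>x. indicator cube x *\<^sub>R k x \<partial>lebesgue)"
  by (rule integral_restrict_space) (use cs in simp)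
 also have "\<dots> = (\<integral>x. v x \<partial>lebesgue)"
 proof (rule integral_cong_AE)
  show "(\<lambda>x. indicator cube x *\<^sub>R k x) \<in> borel_measurable lebesgue"
   using k cs by (simp add: borel_measurable_restrict_space_iff)
  show "v \<in> borel_measurable lebesgue" by (rule measurable_completion[OF v'])
  show "AE x in lebesgue. indicator cube x *\<^sub>R k x = v x"
   using AE_completion[OF eq] by eventually_elim (auto simp: indicator_def out)
 qed
 also have "\<dots> = (LBINT x. v x)" by (rule integral_completion[OF v'])
 finally show ?thesis .
qed

lemma exists_list_with_counts:
 fixes \<alpha> :: "'d::finite => nat"
 shows "\<exists>ls. \<forall>l. count_list ls l = \<alpha> l"
proof -
 have c: "count_list (replicate n a) l = (if l = a then n else 0)" for n and a l :: 'd by (induction n) auto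
 have "\<exists>ls. \<forall>l. count_list ls l = (if l \<in> A then \<alpha> l else 0)" if "finite A" for A
  using that
 proof (induction A rule: finite_induct)
  case (insert a A)
  then obtain ls where "\<forall>l. count_list ls l = (if l \<in> A then \<alpha> l else 0)" by blast
  then show ?case using insert(2) by (intro exI[of _ "replicate (\<alpha> a) a @ ls"]) (auto simp: c)
 qed (auto intro: exI[of _ "[]"])
 from this[of UNIV] show ?thesis by simp
qed

text \<open>A weak derivative is only integrable on compact subsets of the open cube; measurability
  follows by exhausting it with the closed cubes of half-width 1 - 1/(n + 1).\<close>

lemma borel_measurable_interior_cube:
 fixes g :: "real^'d::finite => complex"
 assumes "\<And>K. compact K ==> K \<subseteq> interior cube ==> integrable (lebesgue_on K) g"
 shows "(\<lambda>x. indicator (interior cube) x *\<^sub>R g x) \<in> borel_measurable lebesgue"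
proof -
 define r where "r n = 1 + - inverse (real (Suc n))" for n
 define K :: "nat => (real^'d) set" where "K n = cbox (\<chi> i. - r n) (\<chi> i. r n)" for n
 have ic: "interior (cube :: (real^'d) set) = box (\<chi> i. -1) (\<chi> i. 1)" unfolding cube_eq_cbox by simp
 have r1: "r n < 1" for n by (simp add: r_def)
 have memK: "x \<in> K n \<longleftrightarrow> (\<forall>i. \<bar>x $ i\<bar> \<le> r n)" for x n by (auto simp: K_def mem_box_cart abs_le_iff minus_le_iff)
 have memI: "x \<in> interior cube \<longleftrightarrow> (\<forall>i. \<bar>x $ i\<bar> < 1)" for x :: "real^'d" by (auto simp: ic mem_box_cart abs_less_iff minus_less_iff)
 have sub: "K n \<subseteq> interior cube" for n using r1[of n] unfolding memK memI subset_iff by (meson le_less_trans)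
 have m: "(\<lambda>x. indicator (K n) x *\<^sub>R g x) \<in> borel_measurable lebesgue" for n
 proof -
  have "integrable (lebesgue_on (K n)) g" by (rule assms[OF _ sub]) (simp add: K_def)
  then have "g \<in> borel_measurable (lebesgue_on (K n))" by auto
  then show ?thesis by (simp add: borel_measurable_restrict_space_iff K_def)
 qed
 show ?thesis
 proof (rule borel_measurable_LIMSEQ_metric[OF m])
  fix x :: "real^'d"
  show "(\<lambda>n. indicator (K n) x *\<^sub>R g x) \<longlonglongrightarrow> indicator (interior cube) x *\<^sub>R g x"
  proof (cases "x \<in> interior cube")
   case True
   have "r \<longlonglongrightarrow> 1" unfolding r_def[abs_def] by (rule LIMSEQ_inverse_real_of_nat_add_minus)
   then have "\<forall>\<^sub>F n in sequentially. \<bar>x $ i\<bar> < r n" for i using True memI by (intro order_tendstoD) auto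
   then have "\<forall>\<^sub>F n in sequentially. \<forall>i. \<bar>x $ i\<bar> < r n" by (rule eventually_all_finite)
   then have "\<forall>\<^sub>F n in sequentially. indicator (K n) x *\<^sub>R g x = indicator (interior cube) x *\<^sub>R g x"
    by eventually_elim (use True in \<open>auto simp: memK indicator_def intro: less_imp_le\<close>)
   then show ?thesis by (rule tendsto_eventually)
  next
   case False
   then have "x \<notin> K n" for n using sub by blast
   then show ?thesis using False by simp
  qed
 qed
qed

text \<open>The chosen weak derivative is arbitrary on the boundary of the cube, so it is first cut
  off to the interior, which test functions do not notice, and then replaced by a Borel function. Of
  the defining identity only product test functions are kept.\<close>

lemma weak_deriv_representative:
 fixes f :: "real^'d::finite => complex"
 assumes fin: "weak_deriv_norm \<alpha> f < \<infinity>"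
 obtains u where "u \<in> borel_measurable borel" "\<forall>x. x \<notin> cube --> u x = 0" "integrable lborel u"
  "integrable lborel (\<lambda>x. (cmod (u x))^2)" "ennreal (LBINT x. (cmod (u x))^2) \<le> (weak_deriv_norm \<alpha> f)^2"
  "\<forall>\<zeta>. (\<forall>i. tst (\<zeta> i)) --> (LINT x|lebesgue_on cube. (\<Prod>i\<in>UNIV. (deriv ^^ (\<alpha> $ i)) (\<zeta> i) (x $ i)) *\<^sub>R f x)
   = (- 1) ^ (\<Sum>l\<in>UNIV. \<alpha> $ l) * (LBINT x. of_real (\<Prod>i\<in>UNIV. \<zeta> i (x $ i)) * u x)"
proof -
 have ex: "\<exists>g. has_weak_deriv f \<alpha> g" using fin by (auto simp: weak_deriv_norm_def split: if_splits)
 define g where "g = (SOME g. has_weak_deriv f \<alpha> g)"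
 have wd: "has_weak_deriv f \<alpha> g" unfolding g_def using ex by (rule someI_ex)
 have ng: "weak_deriv_norm \<alpha> f = L2_norm (lebesgue_on cube) g" using ex by (simp add: weak_deriv_norm_def g_def)
 define h where "h x = indicator (interior cube) x *\<^sub>R g x" for x
 have hm: "h \<in> borel_measurable lebesgue"
  unfolding h_def[abs_def] using wd by (intro borel_measurable_interior_cube) (simp add: has_weak_deriv_def)
 have hm': "h \<in> borel_measurable (lebesgue_on cube)" by (rule measurable_restrict_space1[OF hm])
 have le: "(L2_norm (lebesgue_on cube) h)^2 \<le> (L2_norm (lebesgue_on cube) g)^2"
  unfolding L2_norm_power2 by (intro nn_integral_mono) (auto simp: h_def indicator_def)
 have "(L2_norm (lebesgue_on cube) h)^2 < \<infinity>"
  by (rule le_less_trans[OF le]) (use fin in \<open>simp add: ng power_less_top_ennreal\<close>)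
 then have hfin: "L2_norm (lebesgue_on cube) h < \<infinity>" by (simp add: power_less_top_ennreal)
 show ?thesis
 proof (rule L2_representative[OF hm' hfin], rule that, assumption, assumption, assumption, assumption, goal_cases)
  case (1 u)
  then show ?case using le by (simp add: ng)
 next
  case (2 u)
  show ?case
  proof (intro allI impI)
   fix \<zeta> :: "'d => real => real" assume t: "\<forall>i. tst (\<zeta> i)"
   have sm: "smooth_real (\<zeta> i)" for i using t by (simp add: tst_def)
   define \<Phi> where "\<Phi> x = (\<Prod>i\<in>UNIV. \<zeta> i (x $ i))" for x :: "real^'d"
   have \<Phi>t: "\<Phi> \<in> test_functions" unfolding \<Phi>_def[abs_def] by (rule prod_tst_test_function) (use t in simp)
   have [measurable]: "\<zeta> i \<in> borel_measurable borel" for i by (rule smooth_real_measurable[OF sm])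
   have \<Phi>m [measurable]: "\<Phi> \<in> borel_measurable borel" unfolding \<Phi>_def[abs_def] by measurable
   have um [measurable]: "u \<in> borel_measurable borel" using 2 by simp
   obtain ls where ls: "\<forall>l. count_list ls l = \<alpha> $ l" using exists_list_with_counts by blast
   have "(LINT x|lebesgue_on cube. foldr partial_deriv ls \<Phi> x *\<^sub>R f x) = (- 1) ^ (\<Sum>l\<in>UNIV. \<alpha> $ l) * (LINT x|lebesgue_on cube. \<Phi> x *\<^sub>R g x)"
    using wd \<Phi>t ls unfolding has_weak_deriv_def by blast
   also have "foldr partial_deriv ls \<Phi> = (\<lambda>x. \<Prod>i\<in>UNIV. (deriv ^^ (\<alpha> $ i)) (\<zeta> i) (x $ i))"
    unfolding \<Phi>_def[abs_def] foldr_partial_deriv_prod[OF sm] using ls by simp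
   also have "(\<lambda>x. \<Phi> x *\<^sub>R g x) = (\<lambda>x. \<Phi> x *\<^sub>R h x)"
   proof
    fix x
    have "closure {x. \<Phi> x \<noteq> 0} \<subseteq> interior cube" using \<Phi>t by (simp add: test_functions_def)
    then have "\<Phi> x \<noteq> 0 ==> x \<in> interior cube" using closure_subset[of "{x. \<Phi> x \<noteq> 0}"] by blast
    then show "\<Phi> x *\<^sub>R g x = \<Phi> x *\<^sub>R h x" by (cases "\<Phi> x = 0") (simp_all add: h_def)
   qed
   also have "(LINT x|lebesgue_on cube. \<Phi> x *\<^sub>R h x) = (LBINT x. of_real (\<Phi> x) * u x)"
   proof (rule integral_lebesgue_on_cube)
    have "\<Phi> \<in> borel_measurable lborel" by simp
    from measurable_restrict_space1[OF measurable_completion[OF this]]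
    have "\<Phi> \<in> borel_measurable (lebesgue_on cube)" .
    then show "(\<lambda>x. \<Phi> x *\<^sub>R h x) \<in> borel_measurable (lebesgue_on cube)" using hm' by (rule borel_measurable_scaleR)
    have "AE x in lborel. x \<in> cube --> h x = u x" using 2 by simp
    then show "AE x in lborel. x \<in> cube --> \<Phi> x *\<^sub>R h x = of_real (\<Phi> x) * u x"
     by eventually_elim (simp add: scaleR_conv_of_real)
    show "of_real (\<Phi> x) * u x = 0" if "x \<notin> cube" for x using 2 that by simp
   qed measurable
   finally show "(LINT x|lebesgue_on cube. (\<Prod>i\<in>UNIV. (deriv ^^ (\<alpha> $ i)) (\<zeta> i) (x $ i)) *\<^sub>R f x)
   = (- 1) ^ (\<Sum>l\<in>UNIV. \<alpha> $ l) * (LBINT x. of_real (\<Prod>i\<in>UNIV. \<zeta> i (x $ i)) * u x)" unfolding \<Phi>_def .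
  qed
 qed
qed

lemma tst_higher_deriv: "tst \<phi> ==> tst ((deriv ^^ n) \<phi>)"
proof (induction n)
 case (Suc n)
 define \<psi> where "\<psi> = (deriv ^^ n) \<phi>"
 have t: "tst \<psi>" using Suc by (simp add: \<psi>_def)
 then obtain r where r: "0 \<le> r" "r < 1" and z: "\<And>x. r < \<bar>x\<bar> ==> \<psi> x = 0" and sm: "smooth_real \<psi>" unfolding tst_def by blast
 have "deriv \<psi> x = 0" if "r < \<bar>x\<bar>" for x
  using that by (intro deriv_zero_outside[OF smooth_real_deriv(1)[OF sm], of "- r" r] z) auto
 then have "tst (deriv \<psi>)" unfolding tst_def using r smooth_real_deriv(2)[OF sm] by blast
 then show ?case by (simp add: \<psi>_def)
qed simp

section \<open>Smooth cut-offs of boxes and the tensor pairing\<close>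

text \<open>Approximates the indicator of (a, b) from inside: 0 up to distance 1/(k + 1) from the
  end points and 1 from distance 2/(k + 1) on, if the interval is long enough. The margin makes it a
  test function even for a = -1 and b = 1.\<close>

definition cutoff :: "real => real => nat => real => real" where
 "cutoff a b k x = smooth_step (real (Suc k) * x + (- (real (Suc k) * a) - 1)) * smooth_step ((- real (Suc k)) * x + (real (Suc k) * b - 1))"

lemma cutoff_range: "0 \<le> cutoff a b k x" "cutoff a b k x \<le> 1"
 unfolding cutoff_def using smooth_step_range by (auto intro!: mult_le_one)

lemma tst_cutoff:
 assumes "-1 \<le> a" "b \<le> 1"
 shows "tst (cutoff a b k)"
 unfolding tst_def
proof (intro conjI exI[of _ "1 - 1 / real (Suc k)"] allI impI)
 show "smooth_real (cutoff a b k)" unfolding cutoff_def[abs_def]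
  by (intro smooth_real_mult smooth_real_affine smooth_smooth_step)
 fix x :: real assume x: "1 - 1 / real (Suc k) < \<bar>x\<bar>"
 define N where "N = real (Suc k)"
 have N: "0 < N" by (simp add: N_def)
 show "cutoff a b k x = 0"
 proof (cases "0 \<le> x")
  case True
  then have "N * (b - x) \<le> N * (1 / N)" using x assms N by (intro mult_left_mono) (auto simp: N_def)
  then have "(- N) * x + (N * b - 1) \<le> 0" using N by (simp add: algebra_simps)
  then show ?thesis unfolding cutoff_def N_def[symmetric] by (simp only: smooth_step_0 mult_zero_right)
 next
  case False
  then have "N * (x - a) \<le> N * (1 / N)" using x assms N by (intro mult_left_mono) (auto simp: N_def)
  then have "N * x + (- (N * a) - 1) \<le> 0" using N by (simp add: algebra_simps)
  then show ?thesis unfolding cutoff_def N_def[symmetric] by (simp only: smooth_step_0 mult_zero_left)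
 qed
qed (auto simp: divide_le_eq)

lemma cutoff_tendsto: "(\<lambda>k. cutoff a b k x) \<longlonglongrightarrow> indicator {a<..<b} x"
proof (cases "x \<in> {a<..<b}")
 case True
 obtain k0 where k0: "max (2 / (x - a)) (2 / (b - x)) < real k0" using reals_Archimedean2 by blast
 have "cutoff a b k x = 1" if "k0 \<le> k" for k
 proof -
  define N where "N = real (Suc k)"
  have "2 / (x - a) \<le> N" "2 / (b - x) \<le> N" using k0 that by (auto simp: N_def)
  then have "2 \<le> N * (x - a)" "2 \<le> N * (b - x)" using True by (auto simp: divide_le_eq)
  then have "1 \<le> N * x + (- (N * a) - 1)" "1 \<le> (- N) * x + (N * b - 1)" by (simp_all add: algebra_simps)
  then show ?thesis unfolding cutoff_def N_def[symmetric] by (simp only: smooth_step_1 mult_1)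
 qed
 then show ?thesis using True by (intro tendsto_eventually) (auto simp: eventually_sequentially)
next
 case False
 have "cutoff a b k x = 0" for k
 proof (cases "x \<le> a")
  case True
  then have "real (Suc k) * x \<le> real (Suc k) * a" by (intro mult_left_mono) auto
  then have "real (Suc k) * x + (- (real (Suc k) * a) - 1) \<le> 0" by linarith
  then show ?thesis unfolding cutoff_def by (simp only: smooth_step_0 mult_zero_left)
 next
  case 2: False
  then have "real (Suc k) * b \<le> real (Suc k) * x" using False by (intro mult_left_mono) auto
  then have "(- real (Suc k)) * x + (real (Suc k) * b - 1) \<le> 0" unfolding mult_minus_left by linarith
  then show ?thesis unfolding cutoff_def by (simp only: smooth_step_0 mult_zero_right)
 qed
 then show ?thesis using False by simp
qed

lemma cutoff_box_tendsto:
 fixes w :: "real^'d::finite => complex"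
 assumes w: "integrable lborel w" and ab: "\<And>l. -1 \<le> a $ l \<and> a $ l < b $ l \<and> b $ l \<le> 1"
 shows "(\<lambda>k. (LBINT x. of_real (\<Prod>l\<in>UNIV. cutoff (a $ l) (b $ l) k (x $ l)) * w x)) \<longlonglongrightarrow> (LBINT x. indicator (box a b) x *\<^sub>R w x)"
proof (rule integral_dominated_convergence[where w = "\<lambda>x. cmod (w x)"])
 have [measurable]: "cutoff (a $ l) (b $ l) k \<in> borel_measurable borel" for l k
  by (rule tst_measurable[OF tst_cutoff]) (use ab in auto)
 have [measurable]: "w \<in> borel_measurable borel" using w by auto
 show "(\<lambda>x. of_real (\<Prod>l\<in>UNIV. cutoff (a $ l) (b $ l) k (x $ l)) * w x) \<in> borel_measurable lborel" for k by measurable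
 show "AE x in lborel. norm (of_real (\<Prod>l\<in>UNIV. cutoff (a $ l) (b $ l) k (x $ l)) * w x) \<le> cmod (w x)" for k
 proof (rule AE_I2)
  fix x :: "real^'d"
  have "\<bar>\<Prod>l\<in>UNIV. cutoff (a $ l) (b $ l) k (x $ l)\<bar> \<le> (\<Prod>l\<in>(UNIV :: 'd set). 1)"
   unfolding abs_prod using cutoff_range by (intro prod_mono) auto
  then have "\<bar>\<Prod>l\<in>UNIV. cutoff (a $ l) (b $ l) k (x $ l)\<bar> * cmod (w x) \<le> 1 * cmod (w x)" by (intro mult_right_mono) auto
  then show "norm (of_real (\<Prod>l\<in>UNIV. cutoff (a $ l) (b $ l) k (x $ l)) * w x) \<le> cmod (w x)" by (simp only: norm_mult norm_of_real)
 qed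
 have box: "(\<Prod>l\<in>UNIV. indicator {a $ l<..<b $ l} (x $ l)) = (indicator (box a b) x :: real)" for x
 proof (cases "x \<in> box a b")
  case False
  then obtain l where "x $ l \<notin> {a $ l<..<b $ l}" by (auto simp: mem_box_cart)
  then have "(\<Prod>l\<in>UNIV. indicator {a $ l<..<b $ l} (x $ l) :: real) = 0" by (intro prod_zero bexI[of _ l]) (auto simp: indicator_def)
  then show ?thesis using False by simp
 qed (simp add: mem_box_cart)
 show "AE x in lborel. (\<lambda>k. of_real (\<Prod>l\<in>UNIV. cutoff (a $ l) (b $ l) k (x $ l)) * w x) \<longlonglongrightarrow> indicator (box a b) x *\<^sub>R w x"
 proof (rule AE_I2)
  fix x :: "real^'d"
  have "(\<lambda>k. of_real (\<Prod>l\<in>UNIV. cutoff (a $ l) (b $ l) k (x $ l)) * w x) \<longlonglongrightarrow> of_real (\<Prod>l\<in>UNIV. indicator {a $ l<..<b $ l} (x $ l)) * w x"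
   by (intro tendsto_mult tendsto_of_real tendsto_const tendsto_prod cutoff_tendsto)
  then show "(\<lambda>k. of_real (\<Prod>l\<in>UNIV. cutoff (a $ l) (b $ l) k (x $ l)) * w x) \<longlonglongrightarrow> indicator (box a b) x *\<^sub>R w x"
   by (simp only: box scaleR_conv_of_real)
 qed
 show "integrable lborel (\<lambda>x. cmod (w x))" using w by simp
 show "(\<lambda>x. indicator (box a b) x *\<^sub>R w x) \<in> borel_measurable lborel" by measurable
qed

lemma bounded_prod_times_integrable:
 fixes w :: "real^'d::finite => complex" and g :: "'d => real => real"
 assumes w: "integrable lborel w" and gm [measurable]: "\<And>l. g l \<in> borel_measurable borel" and gb: "\<And>l x. \<bar>g l x\<bar> \<le> c l"
 shows "integrable lborel (\<lambda>x. of_real (\<Prod>l\<in>UNIV. g l (x $ l)) * w x)"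
proof (rule lint_bound)
 show "integrable lborel (\<lambda>x. of_real (\<Prod>l\<in>UNIV. c l) * w x)" using w by (intro integrable_mult_right)
 have [measurable]: "w \<in> borel_measurable borel" using w by auto
 show "(\<lambda>x. of_real (\<Prod>l\<in>UNIV. g l (x $ l)) * w x) \<in> borel_measurable lborel" by measurable
 have "\<bar>\<Prod>l\<in>UNIV. g l (x $ l)\<bar> \<le> \<bar>\<Prod>l\<in>UNIV. c l\<bar>" for x :: "real^'d"
  unfolding abs_prod by (intro prod_mono conjI order_trans[OF gb abs_ge_self]) auto
 then show "AE x in lborel. norm (of_real (\<Prod>l\<in>UNIV. g l (x $ l)) * w x) \<le> norm (of_real (\<Prod>l\<in>UNIV. c l) * w x)"
  unfolding norm_mult norm_of_real by (intro AE_I2 mult_right_mono) auto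
qed

lemma (in averaging) ker_measurable' [measurable]:
 assumes "g \<in> borel_measurable N" "h \<in> borel_measurable N"
 shows "(\<lambda>q. ker n p (g q) (h q)) \<in> borel_measurable N"
proof -
 have "(\<lambda>q. (g q, h q)) \<in> measurable N (borel \<Otimes>\<^sub>M borel)" using assms by measurable
 from measurable_compose[OF this ker_measurable] show ?thesis by simp
qed

text \<open>Fubini: integrated against a product test function in x, the tensor kernel factorises,
  and \<open>integral_ker\<close> transposes each factor.\<close>

lemma (in averaging) tensor_ker_pairing:
 fixes w :: "real^'d::finite => complex"
 assumes w: "integrable lborel w" and z: "\<And>l. tst (\<zeta> l)"
 shows "(LBINT y. of_real (\<Prod>l\<in>UNIV. (-1) ^ \<tau> l * Top n (\<tau> l) (\<zeta> l) (y $ l)) * w y)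
  = (\<integral>x. of_real (\<Prod>l\<in>UNIV. \<zeta> l (x $ l)) * (LBINT y. of_real (\<Prod>l\<in>UNIV. ker n (\<tau> l) (x $ l) (y $ l)) * w y) \<partial>(lborel :: (real^'d) measure))"
proof -
 obtain C where C0: "0 \<le> C" and Cx: "\<And>p x y. \<bar>ker n p x y\<bar> \<le> C * indicator {-1..1} y" using ker_bound by blast
 have C: "\<bar>ker n p x y\<bar> \<le> C" for p x y by (rule order_trans[OF Cx]) (use C0 in \<open>auto simp: indicator_def\<close>)
 note [measurable] = tst_measurable[OF z]
 have [measurable]: "w \<in> borel_measurable borel" using w by auto
 define H where "H x y = of_real (\<Prod>l\<in>UNIV. ker n (\<tau> l) (x $ l) (y $ l) * \<zeta> l (x $ l)) * w y" for x y :: "real^'d"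
 have ki: "integrable lborel (\<lambda>x. ker n p x y * \<zeta> l x)" for p l y
 proof (rule lint_bound)
  show "integrable lborel (\<lambda>x. C * \<zeta> l x)" using tst_integrable[OF z] by simp
  show "AE x in lborel. norm (ker n p x y * \<zeta> l x) \<le> norm (C * \<zeta> l x)"
   unfolding real_norm_def abs_mult by (intro AE_I2 mult_right_mono order_trans[OF C abs_ge_self]) auto
 qed measurable
 have zi: "integrable lborel (\<lambda>x :: real^'d. C ^ CARD('d) * \<bar>\<Prod>l\<in>UNIV. \<zeta> l (x $ l)\<bar>)"
  by (intro integrable_mult_right integrable_abs integrable_prod_vec tst_integrable z)
 have Hi: "integrable (lborel \<Otimes>\<^sub>M lborel) (\<lambda>(x, y). H x y)"
 proof (rule lint_bound[OF integrable_tensor[OF zi w]])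
  show "(\<lambda>(x, y). H x y) \<in> borel_measurable (lborel \<Otimes>\<^sub>M lborel)" unfolding H_def by measurable
  have "\<bar>\<Prod>l\<in>UNIV. ker n (\<tau> l) (x $ l) (y $ l) * \<zeta> l (x $ l)\<bar> \<le> C ^ CARD('d) * \<bar>\<Prod>l\<in>UNIV. \<zeta> l (x $ l)\<bar>" for x y :: "real^'d"
  proof -
   have "(\<Prod>l\<in>UNIV. \<bar>ker n (\<tau> l) (x $ l) (y $ l)\<bar>) \<le> (\<Prod>l\<in>(UNIV :: 'd set). C)" by (intro prod_mono conjI C) auto
   then show ?thesis unfolding prod.distrib abs_mult abs_prod by (intro mult_right_mono) (auto intro: prod_nonneg)
  qed
  then have "norm (H x y) \<le> norm (of_real (C ^ CARD('d) * \<bar>\<Prod>l\<in>UNIV. \<zeta> l (x $ l)\<bar>) * w y)" for x y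
   unfolding H_def norm_mult norm_of_real by (intro mult_right_mono order_trans[OF _ abs_ge_self]) auto
  then show "AE p in lborel \<Otimes>\<^sub>M lborel. norm (case p of (x, y) => H x y) \<le> norm (of_real (C ^ CARD('d) * \<bar>\<Prod>l\<in>UNIV. \<zeta> l (fst p $ l)\<bar>) * w (snd p))"
   by (intro AE_I2) (simp only: case_prod_unfold)
 qed
 have "(LBINT y. of_real (\<Prod>l\<in>UNIV. (-1) ^ \<tau> l * Top n (\<tau> l) (\<zeta> l) (y $ l)) * w y) = (LBINT y. (LBINT x. H x y))"
 proof (rule lint_cong[OF refl])
  fix y :: "real^'d"
  have "(LBINT x. H x y) = of_real (LBINT x. (\<Prod>l\<in>UNIV. ker n (\<tau> l) (x $ l) (y $ l) * \<zeta> l (x $ l))) * w y"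
   unfolding H_def by (simp only: integral_mult_left_zero integral_complex_of_real)
  also have "(LBINT x. (\<Prod>l\<in>UNIV. ker n (\<tau> l) (x $ l) (y $ l) * \<zeta> l (x $ l))) = (\<Prod>l\<in>UNIV. (LBINT x. ker n (\<tau> l) x (y $ l) * \<zeta> l x))"
   by (rule integral_prod_vec) (rule ki)
  also have "\<dots> = (\<Prod>l\<in>UNIV. (-1) ^ \<tau> l * Top n (\<tau> l) (\<zeta> l) (y $ l))"
   by (intro prod.cong refl integral_ker tst_integrable z)
  finally show "of_real (\<Prod>l\<in>UNIV. (-1) ^ \<tau> l * Top n (\<tau> l) (\<zeta> l) (y $ l)) * w y = (LBINT x. H x y)" by (rule sym)
 qed
 also have "\<dots> = (LBINT x. (LBINT y. H x y))" by (rule lborel_pair.Fubini_integral[OF Hi])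
 also have "\<dots> = (LBINT x. of_real (\<Prod>l\<in>UNIV. \<zeta> l (x $ l)) * (LBINT y. of_real (\<Prod>l\<in>UNIV. ker n (\<tau> l) (x $ l) (y $ l)) * w y))"
 proof (rule lint_cong[OF refl])
  fix x :: "real^'d"
  have "H x y = of_real (\<Prod>l\<in>UNIV. \<zeta> l (x $ l)) * (of_real (\<Prod>l\<in>UNIV. ker n (\<tau> l) (x $ l) (y $ l)) * w y)" for y
   by (simp add: H_def prod.distrib mult_ac)
  then show "(LBINT y. H x y) = of_real (\<Prod>l\<in>UNIV. \<zeta> l (x $ l)) * (LBINT y. of_real (\<Prod>l\<in>UNIV. ker n (\<tau> l) (x $ l) (y $ l)) * w y)"
   by (simp only: integral_mult_right_zero)
 qed
 finally show ?thesis .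
qed

section \<open>Integer smoothness\<close>

text \<open>By duality. F is defined from the weak derivatives of f with the Sobolev kernels; f and
  F then have the same pairing with every product test function, since decomposing the test function
  by \<open>Top_decomposition\<close> lets the derivatives be moved onto f. Each weak derivative
  enters with its plain L2 norm.\<close>

theorem integer_case:
 "\<exists>C\<ge>0. \<forall>f :: real^'d::finite => complex. f \<in> L2_space (lebesgue_on cube) --> Hmix_norm_integer (Suc n) f < \<infinity> -->
  f \<in> L2_space cheb_measure \<and>
  (\<Sum>\<^sub>\<infinity> k \<in> (UNIV :: (nat^'d) set). ennreal ((cmod (L2_inner cheb_measure f (cheb_eta k)))^2 *
   (\<Prod>l\<in>UNIV. (1 + (real (k $ l))^2) powr real (Suc n)))) \<le> ennreal C * (Hmix_norm_integer (Suc n) f)^2"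
proof -
 let ?m = "Suc n"
 have "(-1/2 :: real) < 1/2" by simp
 from smooth_bump_exists[OF this] obtain \<rho> where rho: "smooth_real \<rho>" "\<And>x. 0 \<le> \<rho> x" "\<And>x. x \<notin> {-1/2..1/2} ==> \<rho> x = 0"
  "integrable lborel \<rho>" "(LBINT x. \<rho> x) = 1" by blast
 interpret averaging \<rho> using rho by unfold_locales
 from ker_bessel[of n] obtain B where B0: "0 \<le> B" and B: "\<And>K p. finite K ==> p \<le> ?m ==> bessel_family K (\<lambda>k y. sqrt ((1 + (real k)^2) powr real ?m) * (LBINT x. ker n p x y * cheb_fun k x)) B" by blast
 obtain C where C0: "0 \<le> C" and Cx: "\<And>p x y. \<bar>ker n p x y\<bar> \<le> C * indicator {-1..1} y" using ker_bound by blast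
 have C: "\<bar>ker n p x y\<bar> \<le> C" for p x y by (rule order_trans[OF Cx]) (use C0 in \<open>auto simp: indicator_def\<close>)
 \<comment> \<open>With all weights q equal to 1 the constant S is the number n + 2 of orders in one
   coordinate.\<close>
 define A where "A = (real (Suc ?m) * B) ^ CARD('d)"
 have A0: "0 \<le> A" using B0 by (simp add: A_def)
 show ?thesis
 proof (intro exI[of _ A] conjI A0 allI impI)
  fix f :: "real^'d => complex"
  assume f2: "f \<in> L2_space (lebesgue_on cube)" and Nfin: "Hmix_norm_integer ?m f < \<infinity>"
  define N where "N = Hmix_norm_integer ?m f"
  have fm: "f \<in> borel_measurable (lebesgue_on cube)" and fl: "L2_norm (lebesgue_on cube) f < \<infinity>" using f2 by (auto simp: L2_space_def)
  obtain g where gm: "g \<in> borel_measurable borel" and gout: "\<forall>x. x \<notin> cube --> g x = 0" and fg: "AE x in lborel. x \<in> cube --> f x = g x"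
   and gi: "integrable lborel g"
   by (rule L2_representative[OF fm fl]) (rule that, assumption+)
  define AA where "AA = {\<alpha> :: nat^'d. \<forall>l. \<alpha> $ l \<le> ?m}"
  define TT where "TT = PiE (UNIV :: 'd set) (\<lambda>_. {..?m})"
  define vl where "vl \<tau> = (\<chi> l. \<tau> l)" for \<tau> :: "'d => nat"
  have finTT: "finite TT" unfolding TT_def by (intro finite_PiE) auto
  have vlAA: "vl \<tau> \<in> AA" if "\<tau> \<in> TT" for \<tau> using that by (auto simp: AA_def TT_def vl_def PiE_iff)
  have AAeq: "AA = vl ` TT"
  proof (intro equalityI subsetI)
   fix \<alpha> assume "\<alpha> \<in> AA"
   then have "\<alpha> = vl (\<lambda>l. \<alpha> $ l)" "(\<lambda>l. \<alpha> $ l) \<in> TT" by (auto simp: AA_def TT_def vl_def PiE_iff)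
   then show "\<alpha> \<in> vl ` TT" by blast
  qed (use vlAA in auto)
  have finAA: "finite AA" unfolding AAeq using finTT by simp
  have inj: "inj_on vl TT" by (rule inj_onI) (simp add: vl_def vec_eq_iff fun_eq_iff)
  have wsum: "(\<Sum>\<alpha>\<in>AA. weak_deriv_norm \<alpha> f) \<le> N" by (simp add: N_def Hmix_norm_integer_def AA_def)
  have wfin: "weak_deriv_norm \<alpha> f < \<infinity>" if "\<alpha> \<in> AA" for \<alpha>
  proof -
   have "weak_deriv_norm \<alpha> f \<le> N" by (rule order_trans[OF member_le_sum[OF that _ finAA] wsum]) simp
   then show ?thesis using Nfin unfolding N_def by (rule le_less_trans)
  qed
  define P where "P \<alpha> u \<longleftrightarrow> u \<in> borel_measurable borel \<and> (\<forall>x. x \<notin> cube --> u x = 0) \<and> integrable lborel u \<and>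
   integrable lborel (\<lambda>x. (cmod (u x))^2) \<and> ennreal (LBINT x. (cmod (u x))^2) \<le> (weak_deriv_norm \<alpha> f)^2 \<and>
   (\<forall>\<zeta>. (\<forall>i. tst (\<zeta> i)) --> (LINT x|lebesgue_on cube. (\<Prod>i\<in>UNIV. (deriv ^^ (\<alpha> $ i)) (\<zeta> i) (x $ i)) *\<^sub>R f x)
   = (- 1) ^ (\<Sum>l\<in>UNIV. \<alpha> $ l) * (LBINT x. of_real (\<Prod>i\<in>UNIV. \<zeta> i (x $ i)) * u x))" for \<alpha> :: "nat^'d" and u
  have "\<exists>u. P \<alpha> u" if "\<alpha> \<in> AA" for \<alpha>
  proof (rule weak_deriv_representative[OF wfin[OF that]], goal_cases)
   case (1 u)
   then show ?case unfolding P_def by (intro exI[of _ u] conjI)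
  qed
  then obtain u where u: "\<forall>\<alpha>\<in>AA. P \<alpha> (u \<alpha>)" using bchoice[of AA P] by blast
  define v where "v \<tau> = u (vl \<tau>)" for \<tau>
  have vP: "P (vl \<tau>) (v \<tau>)" if "\<tau> \<in> TT" for \<tau> using u vlAA[OF that] by (simp add: v_def)
  have vm: "v \<tau> \<in> borel_measurable borel" and vi: "integrable lborel (v \<tau>)" and v2: "integrable lborel (\<lambda>x. (cmod (v \<tau> x))^2)"
   and vn: "ennreal (LBINT x. (cmod (v \<tau> x))^2) \<le> (weak_deriv_norm (vl \<tau>) f)^2"
   and vd: "\<And>\<zeta>. (\<forall>i. tst (\<zeta> i)) ==> (LINT x|lebesgue_on cube. (\<Prod>i\<in>UNIV. (deriv ^^ \<tau> i) (\<zeta> i) (x $ i)) *\<^sub>R f x)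
   = (- 1) ^ (\<Sum>l\<in>UNIV. \<tau> l) * (LBINT x. of_real (\<Prod>i\<in>UNIV. \<zeta> i (x $ i)) * v \<tau> x)"
   if "\<tau> \<in> TT" for \<tau>
   using vP[OF that] by (simp_all add: P_def vl_def)
  define I where "I \<tau> x = (LBINT y. of_real (\<Prod>l\<in>UNIV. ker n (\<tau> l) (x $ l) (y $ l)) * v \<tau> y)" for \<tau> and x :: "real^'d"
  define F where "F x = (\<Sum>\<tau>\<in>TT. I \<tau> x)" for x
  have Im: "I \<tau> \<in> borel_measurable borel" if "\<tau> \<in> TT" for \<tau>
  proof -
   note [measurable] = vm[OF that]
   show ?thesis unfolding I_def[abs_def]
    by (intro lborel.borel_measurable_lebesgue_integral) (simp add: case_prod_unfold)
  qed
  have Ib: "cmod (I \<tau> x) \<le> C ^ CARD('d) * (LBINT y. cmod (v \<tau> y))" if "\<tau> \<in> TT" for \<tau> x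
  proof -
   have b: "cmod (of_real (\<Prod>l\<in>UNIV. ker n (\<tau> l) (x $ l) (y $ l)) * v \<tau> y) \<le> C ^ CARD('d) * cmod (v \<tau> y)" for y
   proof -
    have "\<bar>\<Prod>l\<in>UNIV. ker n (\<tau> l) (x $ l) (y $ l)\<bar> \<le> (\<Prod>l\<in>(UNIV :: 'd set). C)" unfolding abs_prod by (intro prod_mono conjI C) auto
    then show ?thesis unfolding norm_mult norm_of_real by (intro mult_right_mono) auto
   qed
   have "cmod (I \<tau> x) \<le> (LBINT y. cmod (of_real (\<Prod>l\<in>UNIV. ker n (\<tau> l) (x $ l) (y $ l)) * v \<tau> y))"
    unfolding I_def by (rule integral_norm_bound)
   also have "\<dots> \<le> (LBINT y. C ^ CARD('d) * cmod (v \<tau> y))"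
    using vi[OF that] b C0 by (intro integral_mono_AE') auto
   finally show ?thesis by simp
  qed
  have Fm [measurable]: "F \<in> borel_measurable borel" unfolding F_def[abs_def] by (intro borel_measurable_sum Im)
  define b where "b = (\<Sum>\<tau>\<in>TT. C ^ CARD('d) * (LBINT y. cmod (v \<tau> y)))"
  have Fb: "cmod (F x) \<le> b" for x unfolding F_def b_def by (intro order_trans[OF norm_sum] sum_mono Ib)
  \<comment> \<open>The product of the coordinatewise decompositions is multiplied out into one term
    per multi-index; \<open>trm\<close> then uses the weak derivative of that order and transposes
    the kernels.\<close>
  have pairing: "(LBINT x. of_real (\<Prod>l\<in>UNIV. \<zeta> l (x $ l)) * g x) = (LBINT x. of_real (\<Prod>l\<in>UNIV. \<zeta> l (x $ l)) * F x)"
   if z: "\<And>l. tst (\<zeta> l)" for \<zeta>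
  proof -
   define \<eta> where "\<eta> \<tau> l = (deriv ^^ \<tau> l) (Top n (\<tau> l) (\<zeta> l))" for \<tau> :: "'d => nat" and l
   have et: "tst (\<eta> \<tau> l)" for \<tau> l unfolding \<eta>_def by (intro tst_higher_deriv tst_Top z)
   have gint: "integrable lborel (\<lambda>x. of_real (\<Prod>l\<in>UNIV. \<eta> \<tau> l (x $ l)) * g x)" for \<tau>
   proof -
    have "\<forall>l. \<exists>B. \<forall>x. \<bar>\<eta> \<tau> l x\<bar> \<le> B" using tst_bounded[OF et] by blast
    then obtain Bd where "\<forall>l x. \<bar>\<eta> \<tau> l x\<bar> \<le> Bd l" by metis
    then show ?thesis by (intro bounded_prod_times_integrable[where c = Bd] gi tst_measurable et) auto
   qed
   have conv: "(LBINT x. of_real (\<Prod>l\<in>UNIV. \<eta> \<tau> l (x $ l)) * g x) = (LINT x|lebesgue_on cube. (\<Prod>l\<in>UNIV. \<eta> \<tau> l (x $ l)) *\<^sub>R f x)" for \<tau>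
   proof (rule integral_lebesgue_on_cube[symmetric])
    note [measurable] = tst_measurable[OF et] gm
    have "(\<lambda>x :: real^'d. \<Prod>l\<in>UNIV. \<eta> \<tau> l (x $ l)) \<in> borel_measurable lborel" by measurable
    from measurable_restrict_space1[OF measurable_completion[OF this]]
    show "(\<lambda>x. (\<Prod>l\<in>UNIV. \<eta> \<tau> l (x $ l)) *\<^sub>R f x) \<in> borel_measurable (lebesgue_on cube)" using fm by (rule borel_measurable_scaleR)
    show "AE x in lborel. x \<in> cube --> (\<Prod>l\<in>UNIV. \<eta> \<tau> l (x $ l)) *\<^sub>R f x = of_real (\<Prod>l\<in>UNIV. \<eta> \<tau> l (x $ l)) * g x"
     using fg by eventually_elim (simp add: scaleR_conv_of_real)
    show "(\<lambda>x. of_real (\<Prod>l\<in>UNIV. \<eta> \<tau> l (x $ l)) * g x) \<in> borel_measurable borel" by measurable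
   qed (use gout in simp)
   have trm: "(LBINT x. of_real (\<Prod>l\<in>UNIV. \<eta> \<tau> l (x $ l)) * g x) = (LBINT x. of_real (\<Prod>l\<in>UNIV. \<zeta> l (x $ l)) * I \<tau> x)" if t: "\<tau> \<in> TT" for \<tau>
   proof -
    have "(LBINT x. of_real (\<Prod>l\<in>UNIV. \<eta> \<tau> l (x $ l)) * g x)
      = (- 1) ^ (\<Sum>l\<in>UNIV. \<tau> l) * (LBINT x. of_real (\<Prod>l\<in>UNIV. Top n (\<tau> l) (\<zeta> l) (x $ l)) * v \<tau> x)"
     unfolding conv unfolding \<eta>_def by (rule vd[OF t]) (simp add: tst_Top z)
    also have "\<dots> = (LBINT x. (- 1) ^ (\<Sum>l\<in>UNIV. \<tau> l) * (of_real (\<Prod>l\<in>UNIV. Top n (\<tau> l) (\<zeta> l) (x $ l)) * v \<tau> x))"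
     by (simp only: integral_mult_right_zero)
    also have "\<dots> = (LBINT x. of_real (\<Prod>l\<in>UNIV. (-1) ^ \<tau> l * Top n (\<tau> l) (\<zeta> l) (x $ l)) * v \<tau> x)"
     by (simp only: prod.distrib power_sum[symmetric] of_real_mult of_real_power of_real_minus of_real_1 mult.assoc)
    also have "\<dots> = (LBINT x. of_real (\<Prod>l\<in>UNIV. \<zeta> l (x $ l)) * I \<tau> x)"
     unfolding I_def by (rule tensor_ker_pairing[OF vi[OF t] z])
    finally show ?thesis .
   qed
   have zI: "integrable lborel (\<lambda>x. of_real (\<Prod>l\<in>UNIV. \<zeta> l (x $ l)) * I \<tau> x)" if t: "\<tau> \<in> TT" for \<tau>
   proof (rule lint_bound)
    note [measurable] = tst_measurable[OF z] Im[OF t]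
    define c where "c = C ^ CARD('d) * (LBINT y. cmod (v \<tau> y))"
    show "integrable lborel (\<lambda>x :: real^'d. (\<Prod>l\<in>UNIV. \<zeta> l (x $ l)) * c)"
     by (intro integrable_mult_left integrable_prod_vec tst_integrable z)
    show "(\<lambda>x. of_real (\<Prod>l\<in>UNIV. \<zeta> l (x $ l)) * I \<tau> x) \<in> borel_measurable lborel" by measurable
    show "AE x in lborel. norm (of_real (\<Prod>l\<in>UNIV. \<zeta> l (x $ l)) * I \<tau> x) \<le> norm ((\<Prod>l\<in>UNIV. \<zeta> l (x $ l)) * c)"
    proof (rule AE_I2)
     fix x :: "real^'d"
     have "cmod (I \<tau> x) \<le> \<bar>c\<bar>" unfolding c_def by (rule order_trans[OF Ib[OF t] abs_ge_self])
     then show "norm (of_real (\<Prod>l\<in>UNIV. \<zeta> l (x $ l)) * I \<tau> x) \<le> norm ((\<Prod>l\<in>UNIV. \<zeta> l (x $ l)) * c)"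
      unfolding norm_mult norm_of_real real_norm_def abs_mult by (intro mult_left_mono) auto
    qed
   qed
   have "(LBINT x. of_real (\<Prod>l\<in>UNIV. \<zeta> l (x $ l)) * g x) = (LBINT x. (\<Sum>\<tau>\<in>TT. of_real (\<Prod>l\<in>UNIV. \<eta> \<tau> l (x $ l)) * g x))"
   proof (rule lint_cong[OF refl])
    fix x :: "real^'d"
    have "(\<Prod>l\<in>UNIV. \<zeta> l (x $ l)) = (\<Prod>l\<in>UNIV. \<Sum>p\<le>?m. (deriv ^^ p) (Top n p (\<zeta> l)) (x $ l))"
     by (intro prod.cong refl Top_decomposition z)
    also have "\<dots> = (\<Sum>\<tau>\<in>TT. \<Prod>l\<in>UNIV. \<eta> \<tau> l (x $ l))"
     unfolding TT_def \<eta>_def by (rule prod_sum_PiE) auto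
    finally show "of_real (\<Prod>l\<in>UNIV. \<zeta> l (x $ l)) * g x = (\<Sum>\<tau>\<in>TT. of_real (\<Prod>l\<in>UNIV. \<eta> \<tau> l (x $ l)) * g x)"
     by (simp only: sum_distrib_right[symmetric] of_real_sum)
   qed
   also have "\<dots> = (\<Sum>\<tau>\<in>TT. (LBINT x. of_real (\<Prod>l\<in>UNIV. \<eta> \<tau> l (x $ l)) * g x))" by (intro lint_sum gint)
   also have "\<dots> = (\<Sum>\<tau>\<in>TT. (LBINT x. of_real (\<Prod>l\<in>UNIV. \<zeta> l (x $ l)) * I \<tau> x))" by (intro sum.cong refl trm)
   also have "\<dots> = (LBINT x. (\<Sum>\<tau>\<in>TT. of_real (\<Prod>l\<in>UNIV. \<zeta> l (x $ l)) * I \<tau> x))" by (intro lint_sum[symmetric] zI)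
   also have "\<dots> = (LBINT x. of_real (\<Prod>l\<in>UNIV. \<zeta> l (x $ l)) * F x)" by (simp only: F_def sum_distrib_left)
   finally show ?thesis .
  qed
  have gF: "AE x in lborel. x \<in> cube --> g x = F x"
  \<comment> \<open>Used with a constant sequence: the pairing identity already yields equal box
    integrals once product test functions approximate the indicator of the box.\<close>
  proof (rule AE_eq_of_weak_limit[where Fn = "\<lambda>_. F" and c = b, OF gi _ Fm Fm tendsto_const Fb])
   show "g x = 0" if "x \<notin> cube" for x using gout that by blast
   fix p q :: "real^'d" assume pq: "\<And>l. -1 \<le> p $ l \<and> p $ l < q $ l \<and> q $ l \<le> 1"
   define G where "G x = indicator cube x *\<^sub>R F x" for x
   have Gi: "integrable lborel G"
   proof (rule lint_bound)
    show "integrable lborel (\<lambda>x :: real^'d. indicator cube x * b)" using integrable_indicator_cube by (intro integrable_mult_left)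
    show "G \<in> borel_measurable lborel" unfolding G_def[abs_def] by measurable
    show "AE x in lborel. norm (G x) \<le> norm (indicator cube x * b)"
     using order_trans[OF Fb abs_ge_self] by (intro AE_I2) (auto simp: G_def indicator_def)
   qed
   define c where "c k x = (\<Prod>l\<in>UNIV. cutoff (p $ l) (q $ l) k (x $ l))" for k and x :: "real^'d"
   have ct: "tst (cutoff (p $ l) (q $ l) k)" for l k by (rule tst_cutoff) (use pq in auto)
   \<comment> \<open>F is bounded but need not be integrable on the whole space; the cut-offs vanish
     off the cube, so F may be replaced by its integrable restriction G.\<close>
   have cG: "of_real (c k x) * F x = of_real (c k x) * G x" for k x
   proof (cases "x \<in> cube")
    case False
    then obtain l where "\<not> \<bar>x $ l\<bar> \<le> 1" by (auto simp: mem_cube_iff)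
    then have "cutoff (p $ l) (q $ l) k (x $ l) = 0" by (intro tst_outside[OF ct]) auto
    then have "c k x = 0" unfolding c_def by (intro prod_zero bexI[of _ l]) auto
    then show ?thesis by simp
   qed (simp add: G_def)
   have "(\<lambda>k. (LBINT x. of_real (c k x) * g x)) \<longlonglongrightarrow> (LBINT x. indicator (box p q) x *\<^sub>R g x)"
    unfolding c_def by (rule cutoff_box_tendsto[OF gi pq])
   moreover have "(\<lambda>k. (LBINT x. of_real (c k x) * g x)) \<longlonglongrightarrow> (LBINT x. indicator (box p q) x *\<^sub>R G x)"
   proof -
    have "(LBINT x. of_real (c k x) * g x) = (LBINT x. of_real (c k x) * F x)" for k
     unfolding c_def by (rule pairing[OF ct])
    also have "\<dots> k = (LBINT x. of_real (c k x) * G x)" for k unfolding cG ..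
    finally show ?thesis using cutoff_box_tendsto[OF Gi pq] unfolding c_def by simp
   qed
   ultimately have "(LBINT x. indicator (box p q) x *\<^sub>R g x) = (LBINT x. indicator (box p q) x *\<^sub>R G x)" by (rule LIMSEQ_unique)
   also have "(\<lambda>x. indicator (box p q) x *\<^sub>R G x) = (\<lambda>x. indicator (box p q) x *\<^sub>R F x)"
   proof
    fix x
    have "x \<in> cube" if "x \<in> box p q"
     unfolding mem_cube_iff
    proof
     fix l
     have "p $ l < x $ l" "x $ l < q $ l" using that by (auto simp: mem_box_cart)
     then show "\<bar>x $ l\<bar> \<le> 1" using pq[of l] by linarith
    qed
    then show "indicator (box p q) x *\<^sub>R G x = indicator (box p q) x *\<^sub>R F x" by (auto simp: G_def indicator_def)
   qed
   finally show "(\<lambda>n. (LBINT x. indicator (box p q) x *\<^sub>R F x)) \<longlonglongrightarrow> (LBINT x. indicator (box p q) x *\<^sub>R g x)" by simp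
  qed
  have fF: "AE x in lborel. x \<in> cube --> f x = F x" using fg gF by eventually_elim simp
  define Y where "Y = (\<Sum>\<tau>\<in>TT. (LBINT y. (cmod (v \<tau> y))^2))"
  have Y0: "0 \<le> Y" by (auto simp: Y_def intro: sum_nonneg)
  have fin: "cheb_sum (real ?m) K F \<le> A * Y" if K: "finite K" for K
  proof -
   have "cheb_sum (real ?m) K F
    \<le> (real (Suc ?m) * B) ^ CARD('d) * (\<Sum>\<tau>\<in>PiE UNIV (\<lambda>_. {..?m}). (\<Prod>l\<in>(UNIV :: 'd set). ((\<lambda>_. 1 :: real) (\<tau> l))^2) * (LBINT y. (cmod (v \<tau> y))^2))"
   proof (rule tensor_chebyshev_bound[where \<kappa> = "ker n" and q = "\<lambda>_ _. 1" and C = "\<lambda>_. C"])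
    show "bessel_family K (\<lambda>k y. sqrt ((1 + (real k)^2) powr real ?m * 1) * (LBINT x. ker n t x y * cheb_fun k x)) (B * ((\<lambda>_. 1) t)^2)" if "t \<in> {..?m}" for t
     using B[OF K, of t] that by simp
    show "F x = (\<Sum>\<tau>\<in>PiE UNIV (\<lambda>_. {..?m}). (LBINT y. of_real (\<Prod>l\<in>UNIV. ker n (\<tau> l) (x $ l) (y $ l)) * v \<tau> y))" for x
     by (simp add: F_def I_def TT_def)
   qed (use K B0 C vm vi v2 ker_measurable in \<open>simp_all add: TT_def\<close>)
   then show ?thesis by (simp add: A_def Y_def TT_def)
  qed
  have YN: "ennreal Y \<le> N\<^sup>2"
  proof -
   have "ennreal Y = (\<Sum>\<tau>\<in>TT. ennreal (LBINT y. (cmod (v \<tau> y))^2))" unfolding Y_def by (rule sum_ennreal[symmetric]) simp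
   also have "\<dots> \<le> (\<Sum>\<tau>\<in>TT. (weak_deriv_norm (vl \<tau>) f)^2)" by (intro sum_mono vn)
   also have "\<dots> = (\<Sum>\<alpha>\<in>AA. (weak_deriv_norm \<alpha> f)^2)" unfolding AAeq by (simp add: sum.reindex[OF inj])
   also have "\<dots> \<le> N\<^sup>2" by (rule sum_power2_le_ennreal[OF wsum finAA])
   finally show ?thesis .
  qed
  have AY: "ennreal (A * Y) \<le> ennreal A * (Hmix_norm_integer ?m f)^2"
   using mult_left_mono[OF YN, of "ennreal A"] A0 Y0 by (simp add: ennreal_mult N_def)
  note cc = chebyshev_conclusion[where \<omega> = "\<lambda>k. (1 + (real k)^2) powr real ?m" and E = "A * Y", OF fm Fm fF Fb powr_ge_zero]
  show "f \<in> L2_space cheb_measure" by (rule cc(1)) (use fin in blast)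
  show "(\<Sum>\<^sub>\<infinity> k \<in> (UNIV :: (nat^'d) set). ennreal ((cmod (L2_inner cheb_measure f (cheb_eta k)))^2 *
   (\<Prod>l\<in>UNIV. (1 + (real (k $ l))^2) powr real ?m))) \<le> ennreal A * (Hmix_norm_integer ?m f)^2"
   by (rule order_trans[OF cc(2) AY]) (use fin in blast)
 qed
qed

section \<open>Combination of integer and fractional smoothness\<close>

theorem mainTheorem2:
  fixes s :: real and M :: nat
  assumes "s > 1 / 2" and "real M \<ge> s"
  shows "\<exists>C :: real. C > 0 \<and>
    (\<forall>f :: real^'d \<Rightarrow> complex. f \<in> Hmix s M \<longrightarrow>
       f \<in> L2_space cheb_measure \<and>
       (\<Sum>\<^sub>\<infinity> k \<in> (UNIV :: (nat^'d) set).
          ennreal ((cmod (L2_inner cheb_measure f (cheb_eta k)))\<^sup>2 *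
            (\<Prod>l\<in>UNIV. (1 + (real (k $ l))\<^sup>2) powr s)))
         \<le> ennreal C * (Hmix_norm s M f)\<^sup>2 \<and>
       ennreal C * (Hmix_norm s M f)\<^sup>2 < \<infinity>)"
proof -
 have "\<exists>C\<ge>0. \<forall>f :: real^'d => complex. f \<in> L2_space (lebesgue_on cube) --> Hmix_norm s M f < \<infinity> -->
  f \<in> L2_space cheb_measure \<and>
  (\<Sum>\<^sub>\<infinity> k \<in> (UNIV :: (nat^'d) set). ennreal ((cmod (L2_inner cheb_measure f (cheb_eta k)))^2 *
   (\<Prod>l\<in>UNIV. (1 + (real (k $ l))^2) powr s))) \<le> ennreal C * (Hmix_norm s M f)^2"
 proof (cases "s \<in> \<int>")
  case True
  then obtain i where i: "s = of_int i" by (auto elim: Ints_cases)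
  then have "0 < i" using assms(1) by linarith
  then obtain n where n: "i = int (Suc n)" by (metis zero_less_imp_eq_int Suc_pred' of_nat_0_less_iff)
  have s: "s = real (Suc n)" "nat \<lfloor>s\<rfloor> = Suc n" using i n by simp_all
  have "Hmix_norm s M f = Hmix_norm_integer (Suc n) f" for f :: "real^'d => complex" using True s(2) by (simp add: Hmix_norm_def)
  then show ?thesis using integer_case[of n, where ?'d = 'd] s(1) by simp
 next
  case False
  \<comment> \<open>A non-integer s cannot equal M, so s < M is strict, as the dyadic summation
    requires.\<close>
  then have "s \<noteq> real M" by auto
  then have "s < real M" using assms(2) by simp
  from fractional_case[OF assms(1) this, where ?'d = 'd] False show ?thesis by (simp only: Hmix_norm_def if_False)
 qed
 then obtain C where C: "0 \<le> C" and H: "\<forall>f :: real^'d => complex. f \<in> L2_space (lebesgue_on cube) --> Hmix_norm s M f < \<infinity> -->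
  f \<in> L2_space cheb_measure \<and>
  (\<Sum>\<^sub>\<infinity> k \<in> (UNIV :: (nat^'d) set). ennreal ((cmod (L2_inner cheb_measure f (cheb_eta k)))^2 *
   (\<Prod>l\<in>UNIV. (1 + (real (k $ l))^2) powr s))) \<le> ennreal C * (Hmix_norm s M f)^2" by (elim exE conjE) (rule that)
 show ?thesis
 \<comment> \<open>C is only known to be nonnegative; adding 1 makes the constant positive.\<close>
 proof (intro exI[of _ "C + 1"] conjI allI impI)
  show "0 < C + 1" using C by simp
  fix f :: "real^'d => complex" assume "f \<in> Hmix s M"
  then have f: "f \<in> L2_space (lebesgue_on cube)" "Hmix_norm s M f < \<infinity>" by (simp_all add: Hmix_def)
  note h = H[rule_format, OF f]
  show "f \<in> L2_space cheb_measure" using h by blast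
  have "ennreal C * (Hmix_norm s M f)^2 \<le> ennreal (C + 1) * (Hmix_norm s M f)^2" by (intro mult_right_mono ennreal_leI) auto
  then show "(\<Sum>\<^sub>\<infinity> k \<in> (UNIV :: (nat^'d) set). ennreal ((cmod (L2_inner cheb_measure f (cheb_eta k)))^2 *
   (\<Prod>l\<in>UNIV. (1 + (real (k $ l))^2) powr s))) \<le> ennreal (C + 1) * (Hmix_norm s M f)^2"
   using h order_trans by blast
  show "ennreal (C + 1) * (Hmix_norm s M f)^2 < \<infinity>" using f(2) by (simp add: ennreal_mult_less_top power_less_top_ennreal)
 qed
qed

end
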